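(* Let $d=2$, write $x,y$ for the two variables, and let $\varphi=M_\Xi$ be the bivariate $C^1$ piecewise cubic box spline with $\Xi=\begin{bmatrix}1&1&0&0&1\\0&0&1&1&1\end{bmatrix}$, so that $H=2^{-5}(1+x)^2(1+y)^2(1+xy)$. Let $c=2^5\cdot10080$ and write $\overline{cH}\,\Phi=w_{0,0}+w_{1,0}x^{-1}+w_{0,1}y^{-1}+w_{1,1}x^{-1}y^{-1}$ with $w_{s,t}\in\mathcal{L}_\downarrow$. Explicitly, $$w_{0,0}=5x^2y^2+130x^2+130y^2+33x^2y^{-2}+12303+33x^{-2}y^2+12048y^{-2}+12048x^{-2}+215y^{-4}+35193x^{-2}y^{-2}+215x^{-4}+3630x^{-2}y^{-4}+3630x^{-4}y^{-2}+1027x^{-4}y^{-4},$$ $$w_{1,0}=57x^2y^2+3136x^2+110y^2+1677x^2y^{-2}+18425+x^{-2}y^2+2x^2y^{-4}+30692y^{-2}+3134x^{-2}+1677y^{-4}+18425x^{-2}y^{-2}+x^{-4}+3136x^{-2}y^{-4}+110x^{-4}y^{-2}+57x^{-4}y^{-4},$$ $$w_{1,1}=1027x^2y^2+3630x^2+3630y^2+215x^2y^{-2}+35193+215x^{-2}y^2+12048y^{-2}+12048x^{-2}+33y^{-4}+12303x^{-2}y^{-2}+33x^{-4}+130x^{-2}y^{-4}+130x^{-4}y^{-2}+5x^{-4}y^{-4},$$ and $w_{0,1}(x,y)=w_{1,0}(y,x)$. Put $H_{1,0}=w_{1,0}-w_{0,0}x$, $H_{0,1}=w_{0,1}-w_{0,0}y$,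 $H_{1,1}=w_{1,1}-w_{0,0}xy$. Then $\{H,H_{1,0},H_{0,1},H_{1,1}\}$ is a basis of $\mathcal{L}(\ell_1)$ over $\mathcal{L}_\downarrow(\ell_1)$ and $\langle H,H_s\rangle_\Phi=0$ for all $s\in E\setminus\{0\}$; consequently the compactly supported functions $\psi_s$ with masks $H_s$, $s\in E\setminus\{0\}$, are prewavelets for the multiresolution analysis generated by $\varphi$. Moreover $H_{0,1}(x,y)=H_{1,0}(y,x)$, and the numbers of nonzero coefficients of $H_{1,0},H_{0,1},H_{1,1}$ are $29$, $29$ and $28$, in total $86$.
   Context: $E=\{0,1\}^d$; $\mathbb{T}^d=\{\zeta\in\mathbb{C}^d:|\zeta_j|=1\}$. $\mathcal{L}$ is the ring of Laurent polynomials over $\mathbb{C}$; $\mathcal{L}(\ell_1)$ (resp. $\mathcal{L}(\ell_2)$) is the set of Laurent series $\sum_{k\in\mathbb{Z}^d}a_k\zeta^k$ with $a\in\ell_1(\mathbb{Z}^d)$ (resp. $\ell_2$), as functions on $\mathbb{T}^d$; $\mathcal{L}_\downarrow=\{P(\zeta^2):P\in\mathcal{L}\}$ and $\mathcal{L}_\downarrow(\ell_1)=\{F(\zeta^2):F\in\mathcal{L}(\ell_1)\}$, $\zeta^2=(\zeta_1^2,\dots,\zeta_d^2)$. Conjugation: $\overline{\sum a_k\zeta^k}=\sum\overline{a_k}\zeta^{-k}$. Fourier transform: $\hat f(u)=\int f(x)e^{-iu^Tx}dx$. The box spline $M_\Xi$ of a full-rank integer matrix $\Xi=[\xi_1,\dots,\xi_\ell]\in\mathbb{Z}^{d\times\ell}$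 is given by $\widehat{M}_\Xi(u)=\prod_{j=1}^\ell\frac{1-e^{-i\xi_j^Tu}}{i\xi_j^Tu}$, and $\hat\varphi(2u)=H(e^{-iu})\hat\varphi(u)$ for $\varphi=M_\Xi$ with $H(\zeta)=2^{-\ell}\prod_j(1+\zeta^{\xi_j})$. $\Phi(\zeta)=\sum_{k\in\mathbb{Z}^d}\tilde\varphi(k)\zeta^k$, where $\tilde\varphi(u)=\int\varphi(t)\overline{\varphi(t-u)}dt$; here $\Phi=\frac1{10080}\big(3194+31(x^2+x^{-2}+y^2+y^{-2})+5(x^2y^2+x^{-2}y^{-2})+1144(x+x^{-1}+y+y^{-1})+47(xy^2+x^{-1}y^{-2}+x^2y+x^{-2}y^{-1})+(xy^{-2}+x^{-1}y^2+x^{-2}y+x^2y^{-1})+814(xy+x^{-1}y^{-1})+178(xy^{-1}+x^{-1}y)\big)$. $\langle F,G\rangle_\Phi(\zeta)=\sum_{s\in E}\Phi((-1)^s\zeta)F((-1)^s\zeta)\overline{G((-1)^s\zeta)}$ with $(-1)^s\zeta=((-1)^{s_1}\zeta_1,\dots,(-1)^{s_d}\zeta_d)$. $V_0=\{f\in L_2(\mathbb{R}^d):\hat f(u)=F(e^{-iu})\hat\varphi(u),\ F\in\mathcal{L}(\ell_2)\}$; $F$ is called the mask of $f$. $V_{-1}=\{f\in L_2(\mathbb{R}^d):\hat f(u)=\hat g(2u),\ g\in V_0\}\subset V_0$, and $W_0$ is the orthogonal complement of $V_{-1}$ in $V_0$. Functions $\psi_s\in W_0$, $s\in S$ ($S$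 finite), are prewavelets if $\{\psi_s(\cdot-2k):s\in S,k\in\mathbb{Z}^d\}$ is a Riesz basis of $W_0$. *)

theory Defs
  imports "HOL-Analysis.Analysis" "HOL-Library.Poly_Mapping"
begin

text \<open>The group algebra of the free abelian group \<open>int ^ 'd\<close> over the complex numbers
  is the ring of Laurent polynomials in the variables indexed by \<open>'d\<close>.\<close>

type_synonym 'd laurent = "(int ^ 'd) \<Rightarrow>\<^sub>0 complex"

definition torus :: "(complex ^ 'd) set" where
  "torus = {\<zeta>. \<forall>j. cmod (\<zeta> $ j) = 1}"

definition zpow :: "complex ^ 'd \<Rightarrow> int ^ 'd \<Rightarrow> complex" where
  "zpow \<zeta> k = (\<Prod>j\<in>UNIV. (\<zeta> $ j) powi (k $ j))"

definition leval :: "'d::finite laurent \<Rightarrow> complex ^ 'd \<Rightarrow> complex" where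
  "leval P \<zeta> = (\<Sum>k\<in>Poly_Mapping.keys P. Poly_Mapping.lookup P k * zpow \<zeta> k)"

definition lconj :: "'d::finite laurent \<Rightarrow> 'd::finite laurent" where
  "lconj P = Poly_Mapping.map_key uminus (Poly_Mapping.map cnj P)"

definition sq_vec :: "complex ^ 'd \<Rightarrow> complex ^ 'd" where
  "sq_vec \<zeta> = (\<chi> j. (\<zeta> $ j)\<^sup>2)"

definition lsquare :: "'d::finite laurent \<Rightarrow> 'd::finite laurent" where
  "lsquare P = (\<Sum>k\<in>Poly_Mapping.keys P.
                  Poly_Mapping.single (\<chi> j. 2 * k $ j) (Poly_Mapping.lookup P k))"

definition L_down :: "('d::finite laurent) set" where
  "L_down = range lsquare"

text \<open>Elements of the following function spaces matter only through their values on the torus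
  (for \<open>L_l2\<close>, almost everywhere on the torus).\<close>

definition L_l1 :: "(complex ^ 'd \<Rightarrow> complex) set" where
  "L_l1 = {F. \<exists>a :: int ^ 'd \<Rightarrow> complex. (\<lambda>k. cmod (a k)) summable_on UNIV \<and>
                (\<forall>\<zeta>\<in>torus. F \<zeta> = (\<Sum>\<^sub>\<infinity>k. a k * zpow \<zeta> k))}"

definition L_down_l1 :: "(complex ^ 'd \<Rightarrow> complex) set" where
  "L_down_l1 = {G. \<exists>F\<in>L_l1. \<forall>\<zeta>\<in>torus. G \<zeta> = F (sq_vec \<zeta>)}"

definition exp_mi :: "real ^ 'd \<Rightarrow> complex ^ 'd" where
  "exp_mi u = (\<chi> j. exp (- \<i> * of_real (u $ j)))"

text \<open>A square summable Laurent series converges unconditionally in the \<open>L\<^sub>2\<close> norm of the torus.\<close>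

definition L_l2 :: "(complex ^ 'd \<Rightarrow> complex) set" where
  "L_l2 = {F. (\<lambda>u. F (exp_mi u)) \<in> borel_measurable lborel \<and>
     (\<exists>a :: int ^ 'd \<Rightarrow> complex. (\<lambda>k. (cmod (a k))\<^sup>2) summable_on UNIV \<and>
        ((\<lambda>K. \<integral>\<^sup>+u\<in>cbox 0 (\<chi> j. 2 * pi).
                ennreal ((cmod (F (exp_mi u) - (\<Sum>k\<in>K. a k * zpow (exp_mi u) k)))\<^sup>2) \<partial>lborel)
           \<longlongrightarrow> 0) (finite_subsets_at_top UNIV))}"

text \<open>Bases of a module \<open>M\<close> of functions on \<open>X\<close> over a ring \<open>R\<close> of functions on \<open>X\<close>,
  functions on \<open>X\<close> being compared on \<open>X\<close> only.\<close>

definition module_basis_on ::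
  "'x set \<Rightarrow> ('x \<Rightarrow> complex) set \<Rightarrow> ('x \<Rightarrow> complex) set \<Rightarrow> 's set \<Rightarrow> ('s \<Rightarrow> 'x \<Rightarrow> complex) \<Rightarrow> bool" where
  "module_basis_on X R M S B \<longleftrightarrow>
     finite S \<and> (\<forall>s\<in>S. B s \<in> M) \<and>
     (\<forall>F\<in>M. \<exists>G. (\<forall>s\<in>S. G s \<in> R) \<and> (\<forall>z\<in>X. F z = (\<Sum>s\<in>S. G s z * B s z))) \<and>
     (\<forall>G. (\<forall>s\<in>S. G s \<in> R) \<and> (\<forall>z\<in>X. (\<Sum>s\<in>S. G s z * B s z) = 0)
            \<longrightarrow> (\<forall>s\<in>S. \<forall>z\<in>X. G s z = 0))"

definition E01 :: "(int ^ 'd) set" where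
  "E01 = {s. \<forall>j. s $ j \<in> {0, 1}}"

definition flip :: "int ^ 'd \<Rightarrow> complex ^ 'd \<Rightarrow> complex ^ 'd" where
  "flip s \<zeta> = (\<chi> j. (-1) powi (s $ j) * \<zeta> $ j)"

definition bracket ::
  "(complex ^ 'd \<Rightarrow> complex) \<Rightarrow> (complex ^ 'd \<Rightarrow> complex) \<Rightarrow> (complex ^ 'd \<Rightarrow> complex)
     \<Rightarrow> complex ^ 'd \<Rightarrow> complex" where
  "bracket \<Phi> F G \<zeta> = (\<Sum>s\<in>E01. \<Phi> (flip s \<zeta>) * F (flip s \<zeta>) * cnj (G (flip s \<zeta>)))"

definition L2 :: "(real ^ 'd \<Rightarrow> complex) set" where
  "L2 = {f \<in> borel_measurable lborel. integrable lborel (\<lambda>x. (cmod (f x))\<^sup>2)}"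

definition L2_inner :: "(real ^ 'd \<Rightarrow> complex) \<Rightarrow> (real ^ 'd \<Rightarrow> complex) \<Rightarrow> complex" where
  "L2_inner f g = (\<integral>x. f x * cnj (g x) \<partial>lborel)"

definition L2_normsq :: "(real ^ 'd \<Rightarrow> complex) \<Rightarrow> ennreal" where
  "L2_normsq f = (\<integral>\<^sup>+x. ennreal ((cmod (f x))\<^sup>2) \<partial>lborel)"

definition fourier :: "(real ^ 'd \<Rightarrow> complex) \<Rightarrow> real ^ 'd \<Rightarrow> complex" where
  "fourier f u = (\<integral>x. f x * exp (- \<i> * of_real (u \<bullet> x)) \<partial>lborel)"

text \<open>\<open>L2_fourier f g\<close>: (the class of) \<open>g\<close> is the Fourier transform of \<open>f\<close>, where the
  transform is extended by continuity from integrable square integrable functions to \<open>L\<^sub>2\<close>.\<close>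

definition L2_fourier :: "(real ^ 'd \<Rightarrow> complex) \<Rightarrow> (real ^ 'd \<Rightarrow> complex) \<Rightarrow> bool" where
  "L2_fourier f g \<longleftrightarrow> f \<in> L2 \<and> g \<in> L2 \<and>
     (\<exists>h :: nat \<Rightarrow> real ^ 'd \<Rightarrow> complex.
        (\<forall>n. integrable lborel (h n) \<and> h n \<in> L2) \<and>
        (\<lambda>n. L2_normsq (\<lambda>x. h n x - f x)) \<longlonglongrightarrow> 0 \<and>
        (\<lambda>n. L2_normsq (\<lambda>u. fourier (h n) u - g u)) \<longlonglongrightarrow> 0)"

definition compactly_supported :: "(real ^ 'd \<Rightarrow> complex) \<Rightarrow> bool" where
  "compactly_supported f \<longleftrightarrow> (\<exists>K. compact K \<and> (AE x in lborel. x \<notin> K \<longrightarrow> f x = 0))"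

definition real_vec :: "int ^ 'd \<Rightarrow> real ^ 'd" where
  "real_vec k = (\<chi> j. of_int (k $ j))"

text \<open>The integer matrix is given by the list of its columns. Each factor of the Fourier transform
  is extended continuously to the hyperplane where its denominator vanishes.\<close>

definition box_factor :: "real \<Rightarrow> complex" where
  "box_factor t = (if t = 0 then 1 else (1 - exp (- \<i> * of_real t)) / (\<i> * of_real t))"

definition is_box_spline :: "(int ^ 'd) list \<Rightarrow> (real ^ 'd \<Rightarrow> complex) \<Rightarrow> bool" where
  "is_box_spline \<Xi> \<phi> \<longleftrightarrow>
     span (real_vec ` set \<Xi>) = UNIV \<and> integrable lborel \<phi> \<and>
     (\<forall>u. fourier \<phi> u = (\<Prod>\<xi>\<leftarrow>\<Xi>. box_factor (real_vec \<xi> \<bullet> u)))"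

definition box_mask :: "(int ^ 'd) list \<Rightarrow> 'd::finite laurent" where
  "box_mask \<Xi> = Poly_Mapping.single 0 (1 / 2 ^ length \<Xi>)
                  * (\<Prod>\<xi>\<leftarrow>\<Xi>. 1 + Poly_Mapping.single \<xi> 1)"

definition autocorr :: "(real ^ 'd \<Rightarrow> complex) \<Rightarrow> real ^ 'd \<Rightarrow> complex" where
  "autocorr \<phi> u = (\<integral>t. \<phi> t * cnj (\<phi> (t - u)) \<partial>lborel)"

definition Phi :: "(real ^ 'd \<Rightarrow> complex) \<Rightarrow> complex ^ 'd \<Rightarrow> complex" where
  "Phi \<phi> \<zeta> = (\<Sum>\<^sub>\<infinity>k. autocorr \<phi> (real_vec k) * zpow \<zeta> k)"

definition has_mask ::
  "(real ^ 'd \<Rightarrow> complex) \<Rightarrow> (real ^ 'd \<Rightarrow> complex) \<Rightarrow> (complex ^ 'd \<Rightarrow> complex) \<Rightarrow> bool" where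
  "has_mask \<phi> f F \<longleftrightarrow> F \<in> L_l2 \<and> L2_fourier f (\<lambda>u. F (exp_mi u) * fourier \<phi> u)"

definition V0 :: "(real ^ 'd \<Rightarrow> complex) \<Rightarrow> (real ^ 'd \<Rightarrow> complex) set" where
  "V0 \<phi> = {f. \<exists>F. has_mask \<phi> f F}"

definition Vm1 :: "(real ^ 'd \<Rightarrow> complex) \<Rightarrow> (real ^ 'd \<Rightarrow> complex) set" where
  "Vm1 \<phi> = {f. \<exists>g\<in>V0 \<phi>. \<exists>g'. L2_fourier g g' \<and> L2_fourier f (\<lambda>u. g' (2 *\<^sub>R u))}"

definition W0 :: "(real ^ 'd \<Rightarrow> complex) \<Rightarrow> (real ^ 'd \<Rightarrow> complex) set" where
  "W0 \<phi> = {f \<in> V0 \<phi>. \<forall>g\<in>Vm1 \<phi>. L2_inner f g = 0}"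

text \<open>A Riesz basis of a closed subspace \<open>W\<close> of \<open>L\<^sub>2\<close>: a family in \<open>W\<close> with dense linear span
  whose finite linear combinations have norm equivalent to the \<open>\<ell>\<^sub>2\<close> norm of the coefficients.\<close>

definition riesz_basis ::
  "(real ^ 'd \<Rightarrow> complex) set \<Rightarrow> 'j set \<Rightarrow> ('j \<Rightarrow> real ^ 'd \<Rightarrow> complex) \<Rightarrow> bool" where
  "riesz_basis W I g \<longleftrightarrow>
     (\<forall>j\<in>I. g j \<in> W) \<and>
     (\<forall>f\<in>W. \<forall>\<epsilon>>0. \<exists>J c. finite J \<and> J \<subseteq> I \<and>
          L2_normsq (\<lambda>x. f x - (\<Sum>j\<in>J. c j * g j x)) < ennreal \<epsilon>) \<and>
     (\<exists>A B. 0 < A \<and> 0 < B \<and>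
        (\<forall>J c. finite J \<and> J \<subseteq> I \<longrightarrow>
           ennreal (A * (\<Sum>j\<in>J. (cmod (c j))\<^sup>2)) \<le> L2_normsq (\<lambda>x. \<Sum>j\<in>J. c j * g j x) \<and>
           L2_normsq (\<lambda>x. \<Sum>j\<in>J. c j * g j x) \<le> ennreal (B * (\<Sum>j\<in>J. (cmod (c j))\<^sup>2))))"

definition prewavelets ::
  "(real ^ 'd \<Rightarrow> complex) \<Rightarrow> 's set \<Rightarrow> ('s \<Rightarrow> real ^ 'd \<Rightarrow> complex) \<Rightarrow> bool" where
  "prewavelets \<phi> S \<psi> \<longleftrightarrow>
     finite S \<and> (\<forall>s\<in>S. \<psi> s \<in> W0 \<phi>) \<and>
     riesz_basis (W0 \<phi>) (S \<times> (UNIV :: (int ^ 'd) set))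
       (\<lambda>(s, k) x. \<psi> s (x - 2 *\<^sub>R real_vec k))"

text \<open>\<open>mon c i j\<close> is the monomial \<open>c x\<^sup>i y\<^sup>j\<close>.\<close>

abbreviation mon :: "complex \<Rightarrow> int \<Rightarrow> int \<Rightarrow> 2 laurent" where
  "mon c i j \<equiv> Poly_Mapping.single (vector [i, j]) c"

definition lswap :: "2 laurent \<Rightarrow> 2 laurent" where
  "lswap P = Poly_Mapping.map_key (\<lambda>k. vector [k $ 2, k $ 1]) P"

definition Xi :: "(int ^ 2) list" where
  "Xi = [vector [1, 0], vector [1, 0], vector [0, 1], vector [0, 1], vector [1, 1]]"

definition H :: "2 laurent" where
  "H = box_mask Xi"

definition Phi_poly :: "2 laurent" where
  "Phi_poly = mon (1 / 10080) 0 0 *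
     (mon 3194 0 0
      + mon 31 2 0 + mon 31 (-2) 0 + mon 31 0 2 + mon 31 0 (-2)
      + mon 5 2 2 + mon 5 (-2) (-2)
      + mon 1144 1 0 + mon 1144 (-1) 0 + mon 1144 0 1 + mon 1144 0 (-1)
      + mon 47 1 2 + mon 47 (-1) (-2) + mon 47 2 1 + mon 47 (-2) (-1)
      + mon 1 1 (-2) + mon 1 (-1) 2 + mon 1 (-2) 1 + mon 1 2 (-1)
      + mon 814 1 1 + mon 814 (-1) (-1)
      + mon 178 1 (-1) + mon 178 (-1) 1)"

definition w00 :: "2 laurent" where
  "w00 = mon 5 2 2 + mon 130 2 0 + mon 130 0 2 + mon 33 2 (-2) + mon 12303 0 0
       + mon 33 (-2) 2 + mon 12048 0 (-2) + mon 12048 (-2) 0 + mon 215 0 (-4)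
       + mon 35193 (-2) (-2) + mon 215 (-4) 0 + mon 3630 (-2) (-4) + mon 3630 (-4) (-2)
       + mon 1027 (-4) (-4)"

definition w10 :: "2 laurent" where
  "w10 = mon 57 2 2 + mon 3136 2 0 + mon 110 0 2 + mon 1677 2 (-2) + mon 18425 0 0
       + mon 1 (-2) 2 + mon 2 2 (-4) + mon 30692 0 (-2) + mon 3134 (-2) 0 + mon 1677 0 (-4)
       + mon 18425 (-2) (-2) + mon 1 (-4) 0 + mon 3136 (-2) (-4) + mon 110 (-4) (-2)
       + mon 57 (-4) (-4)"

definition w01 :: "2 laurent" where
  "w01 = lswap w10"

definition w11 :: "2 laurent" where
  "w11 = mon 1027 2 2 + mon 3630 2 0 + mon 3630 0 2 + mon 215 2 (-2) + mon 35193 0 0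
       + mon 215 (-2) 2 + mon 12048 0 (-2) + mon 12048 (-2) 0 + mon 33 0 (-4)
       + mon 12303 (-2) (-2) + mon 33 (-4) 0 + mon 130 (-2) (-4) + mon 130 (-4) (-2)
       + mon 5 (-4) (-4)"

definition H10 :: "2 laurent" where
  "H10 = w10 - w00 * mon 1 1 0"

definition H01 :: "2 laurent" where
  "H01 = w01 - w00 * mon 1 0 1"

definition H11 :: "2 laurent" where
  "H11 = w11 - w00 * mon 1 1 1"

definition Hs :: "int ^ 2 \<Rightarrow> 2 laurent" where
  "Hs s = (if s = vector [1, 0] then H10
           else if s = vector [0, 1] then H01
           else if s = vector [1, 1] then H11
           else H)"

end

(* The bracket <H, F> is, up to a factor, the sum over s in E of w_s times the s-th polyphase
   component of F. Its kernel over the even Laurent series is therefore spanned by the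
   vectors w_s e_0 - w_0 e_s, the H_s, as soon as w_0 has no zeros on the torus; a
   determinant computation reduces the basis property to this and to the positivity of
   <H, H>. After multiplication by xy the imaginary part of w_0 is minus a positive
   multiple of sin arg(xy), so zeros could occur only for xy = 1 or xy = -1; and Phi is a
   positive quartic in cosines of half the sum and difference of the two angles. Wiener's lemma inverts Laurent
   polynomials without zeros up to a small error in the l_1 norm, so that Riesz bounds and
   density reduce to the boundedness of the action of Laurent polynomials on l_2 sequences.
   Functions with a mask are identified with series of translates of an explicit version of
   the box spline, by the injectivity of the L_2 Fourier transform. *)

theory Submission
  imports Defs "HOL-Probability.Probability"
begin

section \<open>Laurent polynomials on the torus\<close>

text \<open>The mask of an element of \<open>W0\<close> is in general only square summable, so the
  module basis over absolutely convergent series does not apply to it. Statements about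
  \<open>W0\<close> are therefore made on coefficient sequences, where convolution by a Laurent
  polynomial always makes sense. Plancherel's theorem is nowhere used: upper bounds come from the
  bounded overlap of the translates, lower bounds from duality, and the passage from masks to
  functions from the decay of the transform, summed over the dual lattice. The single computation
  with the large coefficients, \<open>w_decomposition\<close>, serves twice: on the torus it yields
  the module basis, on sequences the orthogonality to \<open>Vm1\<close>. In polyphase components
  the matrix of \<open>H\<close> and the three \<open>Hs\<close> has determinant -w00^2 times the
  sum of w_s H_s over \<open>E01\<close>, H_s denoting the components of \<open>H\<close>, and that
  sum is a positive multiple of <H, H>.\<close>

no_notation Infinite_Set_Sum.abs_summable_on (infix "abs'_summable'_on" 50)

abbreviation "coef \<equiv> Poly_Mapping.lookup"

lemma leval_superset:
  "finite A \<Longrightarrow> Poly_Mapping.keys P \<subseteq> A \<Longrightarrow> leval P \<zeta> = (\<Sum>k\<in>A. coef P k * zpow \<zeta> k)"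
  unfolding leval_def by (rule sum.mono_neutral_left) (auto simp: in_keys_iff)

lemma leval_add: "leval (P + Q) \<zeta> = leval P \<zeta> + leval Q \<zeta>"
proof -
  let ?A = "Poly_Mapping.keys P \<union> Poly_Mapping.keys Q"
  have "leval (P + Q) \<zeta> = (\<Sum>k\<in>?A. coef (P + Q) k * zpow \<zeta> k)"
    using Poly_Mapping.keys_add[of P Q] by (intro leval_superset) auto
  also have "\<dots> = (\<Sum>k\<in>?A. coef P k * zpow \<zeta> k) + (\<Sum>k\<in>?A. coef Q k * zpow \<zeta> k)"
    by (simp add: lookup_add distrib_right sum.distrib)
  also have "\<dots> = leval P \<zeta> + leval Q \<zeta>"
    by (subst (1 2) leval_superset[where A = ?A]) auto
  finally show ?thesis .
qed

lemma leval_single: "leval (Poly_Mapping.single k c) \<zeta> = c * zpow \<zeta> k"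
  by (cases "c = 0") (auto simp: leval_def)

lemma leval_zero: "leval 0 \<zeta> = 0"
  by (simp add: leval_def)

lemma leval_uminus: "leval (- P) \<zeta> = - leval P \<zeta>"
  using leval_add[of P "- P" \<zeta>] by (simp add: leval_zero add_eq_0_iff)

lemma leval_diff: "leval (P - Q) \<zeta> = leval P \<zeta> - leval Q \<zeta>"
  using leval_add[of P "- Q" \<zeta>] by (simp add: leval_uminus)

lemma zpow_0: "zpow \<zeta> 0 = 1"
  by (simp add: zpow_def)

lemma leval_one: "leval 1 \<zeta> = 1"
  using leval_single[of 0 1 \<zeta>] by (simp add: zpow_0)

lemma leval_sum: "leval (\<Sum>i\<in>I. P i) \<zeta> = (\<Sum>i\<in>I. leval (P i) \<zeta>)"
  by (induction I rule: infinite_finite_induct) (auto simp: leval_zero leval_add)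

lemma torus_nonzero: "\<zeta> \<in> torus \<Longrightarrow> \<zeta> $ j \<noteq> 0"
  by (auto simp: torus_def dest: spec[of _ j])

lemma zpow_add: "\<zeta> \<in> torus \<Longrightarrow> zpow \<zeta> (j + k) = zpow \<zeta> j * zpow \<zeta> k"
  by (simp add: zpow_def power_int_add torus_nonzero prod.distrib)

lemma norm_zpow: "\<zeta> \<in> torus \<Longrightarrow> cmod (zpow \<zeta> k) = 1"
  by (simp add: zpow_def prod_norm[symmetric] norm_power_int torus_def)

lemma zpow_minus: "\<zeta> \<in> torus \<Longrightarrow> zpow \<zeta> (- k) = cnj (zpow \<zeta> k)"
proof -
  assume z: "\<zeta> \<in> torus"
  have "zpow \<zeta> k * zpow \<zeta> (- k) = zpow \<zeta> k * cnj (zpow \<zeta> k)"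
    using zpow_add[OF z, of k "- k"] norm_zpow[OF z, of k] complex_norm_square[of "zpow \<zeta> k"]
    by (simp add: zpow_0)
  moreover have "zpow \<zeta> k \<noteq> 0" using norm_zpow[OF z, of k] by auto
  ultimately show ?thesis by simp
qed

text \<open>Evaluation, conjugation and convolution are additive, so identities between them need
  checking on monomials only; products are handled by nesting the induction in the second
  factor.\<close>

lemma laurent_induct [case_names single add]:
  assumes single: "\<And>k c. Q (Poly_Mapping.single k c)" and add: "\<And>f g. Q f \<Longrightarrow> Q g \<Longrightarrow> Q (f + g)"
  shows "Q (P :: 'a \<Rightarrow>\<^sub>0 'b::comm_monoid_add)"
proof (induction P rule: update_induct)
  case const
  show ?case using single[of undefined 0] by simp
next
  case (update f a b)
  have "Poly_Mapping.update a b f = Poly_Mapping.single a b + f"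
    using update(1) by (intro poly_mapping_eqI) (auto simp: Poly_Mapping.lookup_update lookup_add lookup_single in_keys_iff)
  then show ?case using add[OF single update(3)] by simp
qed

lemma leval_mult:
  assumes "\<zeta> \<in> torus"
  shows "leval (P * Q) \<zeta> = leval P \<zeta> * leval Q \<zeta>"
proof (induction P rule: laurent_induct)
  case (single k c)
  show ?case
    by (induction Q rule: laurent_induct)
       (auto simp: mult_single leval_single zpow_add[OF assms] leval_add distrib_left)
qed (simp add: distrib_right leval_add)

lemma leval_power: "\<zeta> \<in> torus \<Longrightarrow> leval (P ^ n) \<zeta> = leval P \<zeta> ^ n"
  by (induction n) (auto simp: leval_one leval_mult)

lemma coef_map_cnj: "coef (Poly_Mapping.map cnj P) k = cnj (coef P k)"
  by (transfer) (auto simp: when_def)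

lemma coef_lconj: "coef (lconj P) k = cnj (coef P (- k))"
proof -
  have [transfer_rule]: "inj (uminus :: int ^ 'a \<Rightarrow> int ^ 'a)" by (auto simp: inj_def)
  have "coef (Poly_Mapping.map_key uminus Q) k = coef Q (- k)" for Q :: "'a laurent"
    by transfer simp
  then show ?thesis by (simp add: lconj_def coef_map_cnj)
qed

lemma lconj_add: "lconj (P + Q) = lconj P + lconj Q"
  by (rule poly_mapping_eqI) (simp add: coef_lconj lookup_add)

lemma lconj_single: "lconj (Poly_Mapping.single k c) = Poly_Mapping.single (- k) (cnj c)"
  by (rule poly_mapping_eqI) (auto simp: coef_lconj lookup_single when_def)

lemma leval_lconj: "\<zeta> \<in> torus \<Longrightarrow> leval (lconj P) \<zeta> = cnj (leval P \<zeta>)"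
  by (induction P rule: laurent_induct) (auto simp: lconj_add lconj_single leval_add leval_single zpow_minus)

subsection \<open>The norm of absolutely summable coefficients\<close>

text \<open>The norm of the Wiener algebra. It is submultiplicative, dominates the supremum on the
  torus and bounds convolution on square summable sequences, so that one smallness statement serves
  both functions and sequences.\<close>

definition lnorm :: "'d laurent \<Rightarrow> real" where
  "lnorm P = (\<Sum>k\<in>Poly_Mapping.keys P. cmod (coef P k))"

lemma lnorm_superset:
  "finite A \<Longrightarrow> Poly_Mapping.keys P \<subseteq> A \<Longrightarrow> lnorm P = (\<Sum>k\<in>A. cmod (coef P k))"
  unfolding lnorm_def by (rule sum.mono_neutral_left) (auto simp: in_keys_iff)

lemma lnorm_nonneg: "lnorm P \<ge> 0"
  by (simp add: lnorm_def sum_nonneg)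

lemma lnorm_add: "lnorm (P + Q) \<le> lnorm P + lnorm Q"
proof -
  let ?A = "Poly_Mapping.keys P \<union> Poly_Mapping.keys Q"
  have "lnorm (P + Q) = (\<Sum>k\<in>?A. cmod (coef (P + Q) k))"
    using Poly_Mapping.keys_add[of P Q] by (intro lnorm_superset) auto
  also have "\<dots> \<le> (\<Sum>k\<in>?A. cmod (coef P k) + cmod (coef Q k))"
    by (intro sum_mono) (simp add: lookup_add norm_triangle_ineq)
  also have "\<dots> = lnorm P + lnorm Q"
    by (subst (1 2) lnorm_superset[where A = ?A]) (auto simp: sum.distrib)
  finally show ?thesis .
qed

lemma lnorm_sum: "lnorm (\<Sum>i\<in>I. P i) \<le> (\<Sum>i\<in>I. lnorm (P i))"
proof (induction I rule: infinite_finite_induct)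
  case (insert i I)
  then show ?case using lnorm_add[of "P i" "\<Sum>i\<in>I. P i"] by simp
qed (auto simp: lnorm_def)

lemma lnorm_single: "lnorm (Poly_Mapping.single k c) = cmod c"
  by (cases "c = 0") (auto simp: lnorm_def)

lemma sum_single_coef: "(P :: 'd laurent) = (\<Sum>k\<in>Poly_Mapping.keys P. Poly_Mapping.single k (coef P k))"
  by (rule poly_mapping_eqI)
     (auto simp: lookup_sum lookup_single when_def in_keys_iff sum.delta split: if_splits)

lemma lnorm_mult: "lnorm (P * Q :: 'd::finite laurent) \<le> lnorm P * lnorm Q"
proof -
  have "P * Q = (\<Sum>j\<in>Poly_Mapping.keys P. \<Sum>k\<in>Poly_Mapping.keys Q. Poly_Mapping.single (j + k) (coef P j * coef Q k))"
    using arg_cong2[where f = "(*)", OF sum_single_coef[of P] sum_single_coef[of Q]]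
    by (simp add: sum_product mult_single)
  also have "lnorm \<dots> \<le> (\<Sum>j\<in>Poly_Mapping.keys P. \<Sum>k\<in>Poly_Mapping.keys Q. cmod (coef P j * coef Q k))"
    by (rule order_trans[OF lnorm_sum sum_mono[OF order_trans[OF lnorm_sum]]])
       (simp add: lnorm_single)
  also have "\<dots> = lnorm P * lnorm Q"
    by (simp add: lnorm_def sum_product norm_mult)
  finally show ?thesis .
qed

lemma norm_leval_le: "\<zeta> \<in> torus \<Longrightarrow> cmod (leval P \<zeta>) \<le> lnorm P"
  unfolding leval_def lnorm_def
  by (rule order_trans[OF norm_sum]) (simp add: norm_mult norm_zpow)

subsection \<open>Coefficients are bounded by the supremum on the torus\<close>

lemma zpow_vec2: "zpow (\<zeta> :: complex ^ 2) k = (\<zeta> $ 1) powi (k $ 1) * (\<zeta> $ 2) powi (k $ 2)"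
  by (simp add: zpow_def UNIV_2)

text \<open>Orthogonality of the characters of a cyclic group; the bound excludes nonzero multiples
  of \<open>N\<close> as values of \<open>j\<close>. It takes the place of the integral formula for
  Fourier coefficients.\<close>

lemma sum_cis_multiples:
  fixes j :: int and N :: nat
  assumes "\<bar>j\<bar> < int N"
  shows "(\<Sum>m<N. cis (2 * pi * real m / real N) powi j) = (if j = 0 then of_nat N else 0)"
proof (cases "j = 0")
  case False
  define z where "z = cis (2 * pi * of_int j / real N)"
  have N: "N > 0" using assms by linarith
  have "z \<noteq> 1"
  proof
    assume "z = 1"
    then have "cos (2 * pi * of_int j / real N) = 1" by (metis Re_complex_of_real cis.sel(1) of_real_1 z_def)
    then obtain n :: int where "2 * pi * of_int j / real N = of_int n * 2 * pi"
      by (auto simp: cos_one_2pi_int)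
    then have "of_int j = of_int n * real N" using N by (simp add: field_simps)
    then have "j = n * int N" by (metis of_int_eq_iff of_int_mult of_int_of_nat_eq)
    then have "\<bar>j\<bar> = \<bar>n\<bar> * int N" by (simp add: abs_mult)
    moreover have "n \<noteq> 0" using False \<open>j = n * int N\<close> by auto
    ultimately have "int N \<le> \<bar>j\<bar>" using mult_right_mono[of 1 "\<bar>n\<bar>" "int N"] by simp
    then show False using assms by simp
  qed
  have "real N * (2 * pi * of_int j / real N) = 2 * pi * of_int j" using N by simp
  then have "z ^ N = cis (2 * pi * of_int j)" by (simp only: z_def Complex.DeMoivre)
  then have zN: "z ^ N = 1" by (simp add: cis_multiple_2pi)
  have "cis (2 * pi * real m / real N) powi j = z ^ m" for m
    by (simp add: z_def cis_power_int Complex.DeMoivre mult_ac)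
  then have "(\<Sum>m<N. cis (2 * pi * real m / real N) powi j) = (\<Sum>m<N. z ^ m)" by simp
  also have "\<dots> = 0" using \<open>z \<noteq> 1\<close> zN by (simp add: geometric_sum)
  finally show ?thesis using False by simp
qed simp

lemma sum_swap3: "(\<Sum>m\<in>A. \<Sum>n\<in>B. \<Sum>a\<in>C. f m n a) = (\<Sum>a\<in>C. \<Sum>m\<in>A. \<Sum>n\<in>B. f m n a)"
proof -
  have "(\<Sum>m\<in>A. \<Sum>n\<in>B. \<Sum>a\<in>C. f m n a) = (\<Sum>m\<in>A. \<Sum>a\<in>C. \<Sum>n\<in>B. f m n a)"
    by (intro sum.cong refl sum.swap)
  also have "\<dots> = (\<Sum>a\<in>C. \<Sum>m\<in>A. \<Sum>n\<in>B. f m n a)" by (rule sum.swap)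
  finally show ?thesis .
qed

text \<open>The coefficient is the mean of P(\<zeta>) \<zeta>^(-k) over a grid of roots of unity,
  once the grid is fine enough to tell all exponents of \<open>P\<close> apart from
  \<open>k\<close>.\<close>

lemma norm_coef_le:
  fixes P :: "2 laurent"
  assumes bnd: "\<And>\<zeta>. \<zeta> \<in> torus \<Longrightarrow> cmod (leval P \<zeta>) \<le> B"
  shows "cmod (coef P k) \<le> B"
proof -
  let ?K = "insert k (Poly_Mapping.keys P)"
  define D where "D = Max ((\<lambda>a. \<bar>a $ 1\<bar> + \<bar>a $ 2\<bar>) ` ?K)"
  have D: "\<bar>a $ 1\<bar> + \<bar>a $ 2\<bar> \<le> D" if "a \<in> ?K" for a
    unfolding D_def using that by (intro Max_ge) auto
  have D0: "D \<ge> 0" using D[of k] by auto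
  \<comment> \<open>All exponents in play have entries of modulus at most \<open>D\<close>, so they
    differ from those of \<open>k\<close> by at most \<open>2 * D\<close>, which is less than the
    order of the roots.\<close>
  define N where "N = nat (2 * D + 1)"
  have N: "int N = 2 * D + 1" using D0 by (simp add: N_def)
  then have N0: "N > 0" using D0 by (cases N) auto
  define G where "G = (\<lambda>m n. vector [cis (2 * pi * real m / real N), cis (2 * pi * real n / real N)] :: complex ^ 2)"
  have G: "G m n \<in> torus" for m n by (auto simp: torus_def G_def forall_2 vector_2)
  have "(\<Sum>m<N. \<Sum>n<N. leval P (G m n) * zpow (G m n) (- k))
     = (\<Sum>m<N. \<Sum>n<N. \<Sum>a\<in>Poly_Mapping.keys P. coef P a * (zpow (G m n) (a - k)))"
    by (simp add: leval_def sum_distrib_right zpow_add[OF G, symmetric] mult.assoc)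
  also have "\<dots> = (\<Sum>a\<in>Poly_Mapping.keys P. coef P a * (\<Sum>m<N. \<Sum>n<N. zpow (G m n) (a - k)))"
    by (subst sum_swap3) (simp add: sum_distrib_left)
  also have "\<dots> = (\<Sum>a\<in>Poly_Mapping.keys P. if a = k then coef P a * of_nat N * of_nat N else 0)"
  proof (rule sum.cong[OF refl])
    fix a assume a: "a \<in> Poly_Mapping.keys P"
    have lt: "\<bar>a $ i - k $ i\<bar> < int N" for i
      using D[of a] D[of k] a exhaust_2[of i] unfolding N by auto
    have "(\<Sum>m<N. \<Sum>n<N. zpow (G m n) (a - k)) =
       (\<Sum>m<N. cis (2 * pi * real m / real N) powi (a $ 1 - k $ 1)) *
       (\<Sum>n<N. cis (2 * pi * real n / real N) powi (a $ 2 - k $ 2))"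
      by (simp add: zpow_vec2 G_def vector_2 sum_product)
    also have "\<dots> = (if a = k then of_nat N * of_nat N else 0)"
      unfolding sum_cis_multiples[OF lt] by (auto simp: vec_eq_iff forall_2)
    finally show "coef P a * (\<Sum>m<N. \<Sum>n<N. zpow (G m n) (a - k)) = (if a = k then coef P a * of_nat N * of_nat N else 0)"
      by simp
  qed
  also have "\<dots> = coef P k * of_nat N * of_nat N"
    by (auto simp: in_keys_iff)
  finally have "cmod (coef P k) * (real N * real N) = cmod (\<Sum>m<N. \<Sum>n<N. leval P (G m n) * zpow (G m n) (- k))"
    by (simp add: norm_mult)
  also have "\<dots> \<le> (\<Sum>m<N. \<Sum>n<N. cmod (leval P (G m n) * zpow (G m n) (- k)))"
    by (rule order_trans[OF norm_sum sum_mono[OF norm_sum]])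
  also have "\<dots> \<le> (\<Sum>m<N. \<Sum>n<N. B)"
    by (intro sum_mono) (simp add: norm_mult norm_zpow[OF G] bnd[OF G])
  also have "\<dots> = B * (real N * real N)" by simp
  finally show ?thesis by (rule mult_right_le_imp_le) (use N0 in simp)
qed

text \<open>Lets identities of Laurent polynomials be proved by evaluation, where conjugates are
  inverses and ring arithmetic is available.\<close>

lemma laurent_eqI:
  fixes P Q :: "2 laurent"
  assumes "\<And>\<zeta>. \<zeta> \<in> torus \<Longrightarrow> leval P \<zeta> = leval Q \<zeta>"
  shows "P = Q"
proof (rule poly_mapping_eqI)
  fix k
  have "cmod (coef (P - Q) k) \<le> 0"
    using assms by (intro norm_coef_le) (simp add: leval_diff)
  then show "coef P k = coef Q k" by (simp add: lookup_minus)
qed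

subsection \<open>Inverses of Laurent polynomials without zeros on the torus\<close>

lemma compact_torus: "compact (torus :: (complex ^ 2) set)"
proof -
  have "closed (torus :: (complex ^ 2) set)"
    unfolding torus_def by (intro closed_Collect_all closed_Collect_eq continuous_intros)
  moreover have "norm \<zeta> \<le> 2" if "\<zeta> \<in> torus" for \<zeta> :: "complex ^ 2"
    using L2_set_le_sum[of UNIV "\<lambda>i. norm (\<zeta> $ i)"] that by (simp add: torus_def UNIV_2 norm_vec_def)
  then have "bounded (torus :: (complex ^ 2) set)" by (auto simp: bounded_iff)
  ultimately show ?thesis by (simp add: compact_eq_bounded_closed)
qed

lemma continuous_on_leval: "continuous_on torus (leval (P :: 2 laurent))"
  unfolding leval_def[abs_def] zpow_vec2
  by (intro continuous_intros) (auto simp: torus_nonzero)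

lemma torus_nonempty: "(torus :: (complex ^ 'd) set) \<noteq> {}"
proof -
  have "(\<chi> j. 1) \<in> (torus :: (complex ^ 'd) set)" by (simp add: torus_def)
  then show ?thesis by blast
qed

lemma keys_power_le:
  fixes R :: "2 laurent"
  assumes "\<And>a i. a \<in> Poly_Mapping.keys R \<Longrightarrow> \<bar>a $ i\<bar> \<le> D"
  shows "a \<in> Poly_Mapping.keys (R ^ n) \<Longrightarrow> \<bar>a $ i\<bar> \<le> int n * D"
proof (induction n arbitrary: a)
  case 0
  then show ?case by (auto split: if_splits)
next
  case (Suc n)
  then obtain b c where "b \<in> Poly_Mapping.keys R" "c \<in> Poly_Mapping.keys (R ^ n)" "a = b + c"
    using keys_mult[of R "R ^ n"] by auto
  then show ?case using assms[of b i] Suc.IH[of c] by (auto simp: distrib_right)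
qed

lemma lnorm_le_card:
  fixes P :: "2 laurent"
  assumes keys: "\<And>a i. a \<in> Poly_Mapping.keys P \<Longrightarrow> \<bar>a $ i\<bar> \<le> int m" and B: "\<And>k. cmod (coef P k) \<le> B"
  shows "lnorm P \<le> (2 * real m + 1)\<^sup>2 * B"
proof -
  let ?S = "(\<lambda>(i, j). vector [i, j] :: int ^ 2) ` ({- int m..int m} \<times> {- int m..int m})"
  have sub: "Poly_Mapping.keys P \<subseteq> ?S"
  proof
    fix a assume a: "a \<in> Poly_Mapping.keys P"
    have "a = vector [a $ 1, a $ 2]" by (simp add: vec_eq_iff forall_2 vector_2)
    then show "a \<in> ?S" using keys[OF a, of 1] keys[OF a, of 2] by (intro image_eqI[of _ _ "(a $ 1, a $ 2)"]) auto
  qed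
  have "card ?S \<le> card ({- int m..int m} \<times> {- int m..int m})" by (rule card_image_le) auto
  also have "\<dots> = (2 * m + 1)\<^sup>2" by (simp add: power2_eq_square nat_add_distrib nat_mult_distrib)
  finally have "real (card ?S) \<le> real ((2 * m + 1)\<^sup>2)" by (rule of_nat_mono)
  then have c: "real (card ?S) \<le> (2 * real m + 1)\<^sup>2" by (simp add: algebra_simps)
  have B0: "B \<ge> 0" using order_trans[OF norm_ge_zero B] .
  have "lnorm P = (\<Sum>k\<in>?S. cmod (coef P k))" by (rule lnorm_superset[OF _ sub]) auto
  also have "\<dots> \<le> real (card ?S) * B" using B by (intro sum_bounded_above) 
  also have "\<dots> \<le> (2 * real m + 1)\<^sup>2 * B" by (rule mult_right_mono[OF c B0])
  finally show ?thesis .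
qed

text \<open>Wiener's lemma for Laurent polynomials. With \<open>R = 1 - |P|\<^sup>2 / M\<^sup>2\<close> one has \<open>0 \<le> R \<le> q < 1\<close> on the torus, and
  \<open>R\<^sup>n\<close> has \<open>O(n\<^sup>2)\<close> coefficients, none of which exceeds \<open>q\<^sup>n\<close>.\<close>
theorem laurent_approx_inverse:
  fixes P :: "2 laurent"
  assumes nz: "\<And>\<zeta>. \<zeta> \<in> torus \<Longrightarrow> leval P \<zeta> \<noteq> 0" and e: "\<epsilon> > 0"
  obtains Q where "lnorm (1 - Q * P) < \<epsilon>"
proof -
  \<comment> \<open>On the torus |P| is at most \<open>lnorm P\<close>, so |P| / M stays below 1 and
    \<open>R\<close> is nonnegative there.\<close>
  define M where "M = lnorm P + 1"
  have M: "M > 0" using lnorm_nonneg[of P] by (simp add: M_def)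
  define T where "T = Poly_Mapping.single 0 (1 / of_real (M\<^sup>2)) * lconj P"
  define R where "R = 1 - T * P"
  have levR: "leval R \<zeta> = of_real (1 - (cmod (leval P \<zeta>) / M)\<^sup>2)" if z: "\<zeta> \<in> torus" for \<zeta>
  proof -
    have "leval R \<zeta> = 1 - (1 / of_real (M\<^sup>2)) * (cnj (leval P \<zeta>) * leval P \<zeta>)"
      by (simp add: R_def T_def leval_diff leval_one leval_mult[OF z] leval_single zpow_0 leval_lconj[OF z])
    also have "cnj (leval P \<zeta>) * leval P \<zeta> = of_real ((cmod (leval P \<zeta>))\<^sup>2)"
      by (simp add: complex_norm_square[symmetric] mult.commute)
    finally show ?thesis by (simp add: power_divide)
  qed
  have "continuous_on torus (\<lambda>\<zeta>. cmod (leval R \<zeta>))"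
    by (intro continuous_on_norm continuous_on_leval)
  from continuous_attains_sup[OF compact_torus torus_nonempty this]
  obtain z0 where z0: "z0 \<in> torus" and max: "\<And>\<zeta>. \<zeta> \<in> torus \<Longrightarrow> cmod (leval R \<zeta>) \<le> cmod (leval R z0)"
    by blast
  define q where "q = cmod (leval R z0)"
  have "cmod (leval P z0) / M \<le> 1" "cmod (leval P z0) / M > 0"
    using norm_leval_le[OF z0, of P] nz[OF z0] M by (auto simp: M_def)
  then have "0 \<le> 1 - (cmod (leval P z0) / M)\<^sup>2" "1 - (cmod (leval P z0) / M)\<^sup>2 < 1"
    by (auto simp: power_le_one)
  then have q: "0 \<le> q" "q < 1"
    unfolding q_def levR[OF z0] norm_of_real by auto
  have "finite (Poly_Mapping.keys R)" by simp
  then obtain D :: nat where D: "\<And>a i. a \<in> Poly_Mapping.keys R \<Longrightarrow> \<bar>a $ i\<bar> \<le> int D"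
  proof -
    define d where "d = (\<Sum>a\<in>Poly_Mapping.keys R. nat (\<bar>a $ 1\<bar> + \<bar>a $ 2\<bar>))"
    have "\<bar>a $ i\<bar> \<le> int d" if "a \<in> Poly_Mapping.keys R" for a i
    proof -
      have "nat (\<bar>a $ 1\<bar> + \<bar>a $ 2\<bar>) \<le> d" unfolding d_def using that by (intro member_le_sum) auto
      then show ?thesis using exhaust_2[of i] by auto
    qed
    then show ?thesis using that by blast
  qed
  have Rn: "lnorm (R ^ n) \<le> (2 * real (n * D) + 1)\<^sup>2 * q ^ n" for n
  proof (rule lnorm_le_card)
    show "\<bar>a $ i\<bar> \<le> int (n * D)" if "a \<in> Poly_Mapping.keys (R ^ n)" for a i
      using keys_power_le[of R "int D" a n i, OF D that] by simp
    show "cmod (coef (R ^ n) k) \<le> q ^ n" for k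
      using max by (intro norm_coef_le) (simp add: leval_power norm_power power_mono q_def)
  qed
  \<comment> \<open>Writing \<open>q ^ n\<close> as the square of \<open>r ^ n\<close> absorbs the
    quadratic factor into the square of \<open>n * r ^ n\<close>, which tends to 0.\<close>
  define r where "r = sqrt q"
  have r: "0 \<le> r" "r < 1" using q by (auto simp: r_def)
  have "(\<lambda>n. (2 * real D * (real n * r ^ n) + r ^ n)\<^sup>2) \<longlonglongrightarrow> (2 * real D * 0 + 0)\<^sup>2"
    using r by (intro tendsto_intros powser_times_n_limit_0 LIMSEQ_power_zero) auto
  moreover have "(2 * real (n * D) + 1)\<^sup>2 * q ^ n = (2 * real D * (real n * r ^ n) + r ^ n)\<^sup>2" for n
  proof -
    have "(r ^ n)\<^sup>2 = (r\<^sup>2) ^ n" by (simp only: power_mult[symmetric] mult.commute)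
    then have "q ^ n = (r ^ n)\<^sup>2" using q by (simp add: r_def)
    then show ?thesis by (simp add: algebra_simps flip: power_mult_distrib)
  qed
  ultimately have "(\<lambda>n. (2 * real (n * D) + 1)\<^sup>2 * q ^ n) \<longlonglongrightarrow> 0" by simp
  from order_tendstoD(2)[OF this e] obtain n where "(2 * real (n * D) + 1)\<^sup>2 * q ^ n < \<epsilon>"
    by (auto simp: eventually_sequentially)
  with Rn[of n] have small: "lnorm (R ^ n) < \<epsilon>" by simp
  \<comment> \<open>Telescoping shows the power to be a residual:
    \<open>Q = (\<Sum>i<n. R ^ i) * T\<close> has \<open>1 - Q * P = R ^ n\<close> exactly.\<close>
  have "1 - R ^ n = (1 - R) * (\<Sum>i<n. R ^ i)" by (rule one_diff_power_eq)
  then have "R ^ n = 1 - ((\<Sum>i<n. R ^ i) * T) * P" by (simp add: R_def algebra_simps)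
  with small that show ?thesis by metis
qed

subsection \<open>The algebra of absolutely convergent Laurent series\<close>

lemma infsum_finite_support:
  fixes f :: "'a \<Rightarrow> 'b::{comm_monoid_add, t2_space}"
  assumes "finite A" "\<And>x. x \<notin> A \<Longrightarrow> f x = 0"
  shows "f summable_on UNIV" "infsum f UNIV = sum f A"
proof -
  have "f summable_on A" using assms(1) by (rule summable_on_finite)
  then show "f summable_on UNIV"
    by (subst summable_on_cong_neutral[of A UNIV f f]) (use assms(2) in auto)
  have "infsum f UNIV = infsum f A" by (rule infsum_cong_neutral) (use assms(2) in auto)
  then show "infsum f UNIV = sum f A" using assms(1) by simp
qed

lemma leval_infsum: "leval P \<zeta> = (\<Sum>\<^sub>\<infinity>k. coef P k * zpow \<zeta> k)"
  unfolding leval_def by (rule infsum_finite_support(2)[symmetric]) (auto simp: in_keys_iff)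

lemma lnorm_infsum: "(\<lambda>k. cmod (coef P k)) summable_on UNIV" "lnorm P = (\<Sum>\<^sub>\<infinity>k. cmod (coef P k))"
  unfolding lnorm_def using infsum_finite_support[of "Poly_Mapping.keys P" "\<lambda>k. cmod (coef P k)"]
  by (auto simp: in_keys_iff)

lemma L_l1I:
  assumes "(\<lambda>k. cmod (a k)) summable_on UNIV" "\<And>\<zeta>. \<zeta> \<in> torus \<Longrightarrow> F \<zeta> = (\<Sum>\<^sub>\<infinity>k. a k * zpow \<zeta> k)"
  shows "F \<in> L_l1"
  using assms by (auto simp: L_l1_def)

lemma L_l1E:
  assumes "F \<in> L_l1"
  obtains a where "(\<lambda>k. cmod (a k)) summable_on UNIV" "\<And>\<zeta>. \<zeta> \<in> torus \<Longrightarrow> F \<zeta> = (\<Sum>\<^sub>\<infinity>k. a k * zpow \<zeta> k)"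
  using assms by (auto simp: L_l1_def)

lemma L_l1_cong: "F \<in> L_l1 \<Longrightarrow> (\<And>\<zeta>. \<zeta> \<in> torus \<Longrightarrow> F \<zeta> = G \<zeta>) \<Longrightarrow> G \<in> L_l1"
  by (auto simp: L_l1_def)

lemma L_l1_leval: "leval P \<in> L_l1"
  by (rule L_l1I[OF lnorm_infsum(1)]) (rule leval_infsum)

lemma summable_torus:
  assumes "(\<lambda>k. cmod (a k)) summable_on UNIV" "\<zeta> \<in> torus"
  shows "(\<lambda>k. a k * zpow \<zeta> k) summable_on UNIV"
  by (rule abs_summable_summable) (use assms in \<open>simp add: norm_mult norm_zpow\<close>)

lemma L_l1_add:
  fixes F :: "complex ^ 'd::finite \<Rightarrow> complex"
  shows "F \<in> L_l1 \<Longrightarrow> G \<in> L_l1 \<Longrightarrow> (\<lambda>\<zeta>. F \<zeta> + G \<zeta>) \<in> L_l1"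
proof (elim L_l1E)
  fix a b :: "int ^ 'd \<Rightarrow> complex"
  assume a: "(\<lambda>k. cmod (a k)) summable_on UNIV" "\<And>\<zeta>. \<zeta> \<in> torus \<Longrightarrow> F \<zeta> = (\<Sum>\<^sub>\<infinity>k. a k * zpow \<zeta> k)"
    and b: "(\<lambda>k. cmod (b k)) summable_on UNIV" "\<And>\<zeta>. \<zeta> \<in> torus \<Longrightarrow> G \<zeta> = (\<Sum>\<^sub>\<infinity>k. b k * zpow \<zeta> k)"
  show ?thesis
  proof (rule L_l1I)
    show "(\<lambda>k. cmod (a k + b k)) summable_on UNIV"
      by (rule summable_on_comparison_test[OF summable_on_add[OF a(1) b(1)]]) (auto simp: norm_triangle_ineq)
    show "F \<zeta> + G \<zeta> = (\<Sum>\<^sub>\<infinity>k. (a k + b k) * zpow \<zeta> k)" if z: "\<zeta> \<in> torus" for \<zeta>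
      unfolding a(2)[OF z] b(2)[OF z] distrib_right
      by (rule infsum_add[symmetric]; rule summable_torus[OF _ z]) (rule a b)+
  qed
qed

text \<open>The Cauchy product: the family \<open>a j * b (m - j)\<close> is absolutely summable
  over pairs, because shifting \<open>b\<close> does not change its sum, and may be summed along
  either index first.\<close>

lemma L_l1_mult:
  fixes F :: "complex ^ 'd::finite \<Rightarrow> complex"
  shows "F \<in> L_l1 \<Longrightarrow> G \<in> L_l1 \<Longrightarrow> (\<lambda>\<zeta>. F \<zeta> * G \<zeta>) \<in> L_l1"
proof (elim L_l1E)
  fix a b :: "int ^ 'd \<Rightarrow> complex"
  assume a: "(\<lambda>k. cmod (a k)) summable_on UNIV" "\<And>\<zeta>. \<zeta> \<in> torus \<Longrightarrow> F \<zeta> = (\<Sum>\<^sub>\<infinity>k. a k * zpow \<zeta> k)"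
    and b: "(\<lambda>k. cmod (b k)) summable_on UNIV" "\<And>\<zeta>. \<zeta> \<in> torus \<Longrightarrow> G \<zeta> = (\<Sum>\<^sub>\<infinity>k. b k * zpow \<zeta> k)"
  have shift: "bij_betw (\<lambda>m. m - j) UNIV UNIV" for j :: "int ^ 'd"
    by (rule bij_betw_byWitness[of _ "\<lambda>m. m + j"]) auto
  have prod: "(\<lambda>(j, m). cmod (a j * b (m - j))) summable_on UNIV \<times> UNIV"
  proof -
    have "(\<lambda>(j, m). a j * b (m - j)) abs_summable_on Sigma UNIV (\<lambda>_. UNIV)"
      unfolding Infinite_Sum.abs_summable_on_Sigma_iff
    proof (intro conjI ballI)
      show "(\<lambda>m. case (j, m) of (j, m) \<Rightarrow> a j * b (m - j)) abs_summable_on UNIV" for j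
        using summable_on_reindex_bij_betw[OF shift, of "\<lambda>k. cmod (b k)" j] b(1)
        by (simp add: norm_mult summable_on_cmult_right)
      have "(\<Sum>\<^sub>\<infinity>m. cmod (b (m - j))) = (\<Sum>\<^sub>\<infinity>m. cmod (b m))" for j
        by (rule infsum_reindex_bij_betw[OF shift])
      then show "(\<lambda>j. \<Sum>\<^sub>\<infinity>m. cmod (case (j, m) of (j, m) \<Rightarrow> a j * b (m - j))) abs_summable_on UNIV"
        using a(1) by (simp add: norm_mult infsum_cmult_right' abs_mult infsum_nonneg summable_on_cmult_left)
    qed
    then show ?thesis by (simp add: case_prod_unfold)
  qed
  define c where "c = (\<lambda>m. \<Sum>\<^sub>\<infinity>j. a j * b (m - j))"
  show ?thesis
  proof (rule L_l1I)
    have "prod.swap ` (UNIV \<times> UNIV) = (UNIV :: ((int ^ 'd) \<times> (int ^ 'd)) set)" by auto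
    then have prod': "(\<lambda>(m, j). cmod (a j * b (m - j))) summable_on UNIV \<times> UNIV"
      using prod summable_on_reindex[of prod.swap "UNIV \<times> UNIV" "\<lambda>(m, j). cmod (a j * b (m - j))"]
      by (simp add: comp_def case_prod_unfold)
    have "(\<lambda>m. \<Sum>\<^sub>\<infinity>j. cmod (a j * b (m - j))) summable_on UNIV"
      by (rule summable_on_Sigma_banach) (use prod' in simp)
    then show "(\<lambda>k. cmod (c k)) summable_on UNIV"
    proof (rule summable_on_comparison_test)
      fix m
      have "(\<lambda>(m, j). a j * b (m - j)) abs_summable_on Sigma UNIV (\<lambda>_. UNIV)"
        using prod' by (simp add: case_prod_unfold)
      then have "(\<lambda>j. a j * b (m - j)) abs_summable_on UNIV"
        unfolding Infinite_Sum.abs_summable_on_Sigma_iff by simp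
      then show "cmod (c m) \<le> (\<Sum>\<^sub>\<infinity>j. cmod (a j * b (m - j)))"
        unfolding c_def by (rule norm_infsum_bound)
    qed auto
    fix \<zeta> :: "complex ^ 'd" assume z: "\<zeta> \<in> torus"
    have zz: "zpow \<zeta> j * zpow \<zeta> (m - j) = zpow \<zeta> m" for j m
      using zpow_add[OF z, of j "m - j"] by simp
    have "F \<zeta> * G \<zeta> = (\<Sum>\<^sub>\<infinity>j. a j * zpow \<zeta> j * G \<zeta>)"
      unfolding a(2)[OF z] by (rule infsum_cmult_left'[symmetric])
    also have "\<dots> = (\<Sum>\<^sub>\<infinity>j. \<Sum>\<^sub>\<infinity>m. a j * b (m - j) * zpow \<zeta> m)"
    proof (rule infsum_cong)
      fix j
      have "G \<zeta> = (\<Sum>\<^sub>\<infinity>m. b (m - j) * zpow \<zeta> (m - j))"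
        unfolding b(2)[OF z] by (rule infsum_reindex_bij_betw[OF shift, symmetric])
      then have "a j * zpow \<zeta> j * G \<zeta> = (\<Sum>\<^sub>\<infinity>m. a j * zpow \<zeta> j * (b (m - j) * zpow \<zeta> (m - j)))"
        by (simp add: infsum_cmult_right')
      also have "\<dots> = (\<Sum>\<^sub>\<infinity>m. a j * b (m - j) * zpow \<zeta> m)"
      proof (rule infsum_cong)
        fix m
        show "a j * zpow \<zeta> j * (b (m - j) * zpow \<zeta> (m - j)) = a j * b (m - j) * zpow \<zeta> m"
          using arg_cong[OF zz[of j m], of "\<lambda>t. a j * b (m - j) * t"] by (simp only: mult_ac)
      qed
      finally show "a j * zpow \<zeta> j * G \<zeta> = (\<Sum>\<^sub>\<infinity>m. a j * b (m - j) * zpow \<zeta> m)" .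
    qed
    also have "\<dots> = (\<Sum>\<^sub>\<infinity>m. \<Sum>\<^sub>\<infinity>j. a j * b (m - j) * zpow \<zeta> m)"
    proof (rule infsum_swap_banach, rule abs_summable_summable)
      show "(\<lambda>(j, m). a j * b (m - j) * zpow \<zeta> m) abs_summable_on UNIV \<times> UNIV"
        using prod by (simp add: case_prod_unfold norm_mult norm_zpow[OF z])
    qed
    also have "\<dots> = (\<Sum>\<^sub>\<infinity>m. c m * zpow \<zeta> m)"
      unfolding c_def by (simp add: infsum_cmult_left')
    finally show "F \<zeta> * G \<zeta> = (\<Sum>\<^sub>\<infinity>m. c m * zpow \<zeta> m)" .
  qed
qed

lemma L_l1_const: "(\<lambda>\<zeta>. c) \<in> L_l1"
  using L_l1_leval[of "Poly_Mapping.single 0 c"] by (rule L_l1_cong) (simp add: leval_single zpow_0)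

lemma L_l1_cmult: "F \<in> L_l1 \<Longrightarrow> (\<lambda>\<zeta>. c * F \<zeta>) \<in> L_l1"
  by (rule L_l1_mult[OF L_l1_const])

lemma L_l1_diff: "F \<in> L_l1 \<Longrightarrow> G \<in> L_l1 \<Longrightarrow> (\<lambda>\<zeta>. F \<zeta> - G \<zeta>) \<in> L_l1"
  using L_l1_add[of F "\<lambda>\<zeta>. (-1) * G \<zeta>"] L_l1_cmult[of G "-1"] by simp

lemma L_l1_sum: "(\<And>i. i \<in> I \<Longrightarrow> F i \<in> L_l1) \<Longrightarrow> (\<lambda>\<zeta>. \<Sum>i\<in>I. F i \<zeta>) \<in> L_l1"
  by (induction I rule: infinite_finite_induct) (auto intro: L_l1_const L_l1_add)

lemma lnorm_power: "lnorm ((R :: 'd::finite laurent) ^ n) \<le> lnorm R ^ n"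
proof (induction n)
  case 0
  then show ?case using lnorm_single[of "0 :: int ^ 'd" 1] by simp
next
  case (Suc n)
  then show ?case using lnorm_mult[of R "R ^ n"] mult_left_mono[OF Suc lnorm_nonneg[of R]] by simp
qed

text \<open>Neumann series: submultiplicativity of \<open>lnorm\<close> makes the coefficients of
  all powers \<open>R ^ n\<close> jointly absolutely summable, and summing them over
  \<open>n\<close> at a fixed exponent gives the coefficients of the quotient.\<close>

lemma L_l1_geometric:
  fixes R :: "'d::finite laurent"
  assumes R: "lnorm R < 1"
  shows "(\<lambda>\<zeta>. 1 / (1 - leval R \<zeta>)) \<in> L_l1"
proof (rule L_l1I)
  let ?f = "\<lambda>n k. coef (R ^ n) k"
  have sl: "summable (\<lambda>n. lnorm (R ^ n))"
    by (rule summable_comparison_test'[OF summable_geometric[of "lnorm R"]])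
       (use R in \<open>auto simp: lnorm_nonneg lnorm_power\<close>)
  have "(\<lambda>(n, k). ?f n k) abs_summable_on Sigma UNIV (\<lambda>_. UNIV)"
    unfolding Infinite_Sum.abs_summable_on_Sigma_iff
  proof (intro conjI ballI)
    show "(\<lambda>k. case (n, k) of (n, k) \<Rightarrow> ?f n k) abs_summable_on UNIV" for n
      using lnorm_infsum(1)[of "R ^ n"] by simp
    show "(\<lambda>n. \<Sum>\<^sub>\<infinity>k. cmod (case (n, k) of (n, k) \<Rightarrow> ?f n k)) abs_summable_on UNIV"
      using norm_summable_imp_summable_on[of "\<lambda>n. lnorm (R ^ n)"] sl
      by (simp flip: lnorm_infsum(2) add: lnorm_nonneg)
  qed
  then have prod: "(\<lambda>(n, k). cmod (?f n k)) summable_on UNIV \<times> UNIV" by (simp add: case_prod_unfold)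
  have "prod.swap ` (UNIV \<times> UNIV) = (UNIV :: ((int ^ 'd) \<times> nat) set)" by auto
  then have prod': "(\<lambda>(k, n). cmod (?f n k)) summable_on UNIV \<times> UNIV"
    using prod summable_on_reindex[of prod.swap "UNIV \<times> UNIV" "\<lambda>(k, n). cmod (?f n k)"]
    by (simp add: comp_def case_prod_unfold)
  have "(\<lambda>k. \<Sum>\<^sub>\<infinity>n. cmod (?f n k)) summable_on UNIV"
    by (rule summable_on_Sigma_banach) (use prod' in simp)
  then show "(\<lambda>k. cmod (\<Sum>\<^sub>\<infinity>n. ?f n k)) summable_on UNIV"
  proof (rule summable_on_comparison_test)
    fix k
    have "(\<lambda>(k, n). ?f n k) abs_summable_on Sigma UNIV (\<lambda>_. UNIV)"
      using prod' by (simp add: case_prod_unfold)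
    then have "(\<lambda>n. ?f n k) abs_summable_on UNIV"
      unfolding Infinite_Sum.abs_summable_on_Sigma_iff by simp
    then show "cmod (\<Sum>\<^sub>\<infinity>n. ?f n k) \<le> (\<Sum>\<^sub>\<infinity>n. cmod (?f n k))"
      by (rule norm_infsum_bound)
  qed auto
  fix \<zeta> :: "complex ^ 'd" assume z: "\<zeta> \<in> torus"
  have lt: "cmod (leval R \<zeta>) < 1" using norm_leval_le[OF z, of R] R by simp
  have "((\<lambda>n. leval R \<zeta> ^ n) has_sum (1 / (1 - leval R \<zeta>))) UNIV"
    by (rule norm_summable_imp_has_sum) (use lt in \<open>auto simp: norm_power intro: geometric_sums\<close>)
  then have "1 / (1 - leval R \<zeta>) = (\<Sum>\<^sub>\<infinity>n. leval R \<zeta> ^ n)" by (simp add: infsumI)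
  also have "\<dots> = (\<Sum>\<^sub>\<infinity>n. \<Sum>\<^sub>\<infinity>k. ?f n k * zpow \<zeta> k)"
    by (rule infsum_cong, subst leval_power[OF z, symmetric]) (rule leval_infsum)
  also have "\<dots> = (\<Sum>\<^sub>\<infinity>k. \<Sum>\<^sub>\<infinity>n. ?f n k * zpow \<zeta> k)"
  proof (rule infsum_swap_banach, rule abs_summable_summable)
    show "(\<lambda>(n, k). ?f n k * zpow \<zeta> k) abs_summable_on UNIV \<times> UNIV"
      using prod by (simp add: case_prod_unfold norm_mult norm_zpow[OF z])
  qed
  also have "\<dots> = (\<Sum>\<^sub>\<infinity>k. (\<Sum>\<^sub>\<infinity>n. ?f n k) * zpow \<zeta> k)"
    by (simp add: infsum_cmult_left')
  finally show "1 / (1 - leval R \<zeta>) = (\<Sum>\<^sub>\<infinity>k. (\<Sum>\<^sub>\<infinity>n. ?f n k) * zpow \<zeta> k)" .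
qed

text \<open>For \<open>Q\<close> with \<open>lnorm (1 - Q * P) < 1\<close> the identity 1 / P = Q /
  (1 - (1 - Q P)) reduces the claim to the geometric series.\<close>

theorem L_l1_inverse:
  fixes P :: "2 laurent"
  assumes nz: "\<And>\<zeta>. \<zeta> \<in> torus \<Longrightarrow> leval P \<zeta> \<noteq> 0"
  shows "(\<lambda>\<zeta>. 1 / leval P \<zeta>) \<in> L_l1"
proof -
  obtain Q where Q: "lnorm (1 - Q * P) < 1"
    using laurent_approx_inverse[OF nz, of 1] by auto
  have "(\<lambda>\<zeta>. leval Q \<zeta> * (1 / (1 - leval (1 - Q * P) \<zeta>))) \<in> L_l1"
    by (intro L_l1_mult L_l1_leval L_l1_geometric Q)
  then show ?thesis
  proof (rule L_l1_cong)
    fix \<zeta> :: "complex ^ 2" assume z: "\<zeta> \<in> torus"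
    have e: "1 - leval (1 - Q * P) \<zeta> = leval Q \<zeta> * leval P \<zeta>"
      by (simp add: leval_diff leval_one leval_mult[OF z])
    have "cmod (leval (1 - Q * P) \<zeta>) < 1" using norm_leval_le[OF z, of "1 - Q * P"] Q by simp
    then have "leval Q \<zeta> * leval P \<zeta> \<noteq> 0" using e by auto
    then show "leval Q \<zeta> * (1 / (1 - leval (1 - Q * P) \<zeta>)) = 1 / leval P \<zeta>"
      unfolding e by simp
  qed
qed

subsection \<open>Sign changes and even Laurent series\<close>

lemma norm_power_int_minus1: "cmod ((-1) powi n) = 1"
  by (simp add: norm_power_int)

lemma flip_torus: "\<zeta> \<in> torus \<Longrightarrow> flip s \<zeta> \<in> torus"
  by (simp add: torus_def flip_def norm_mult norm_power_int_minus1)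

text \<open>The sign belonging to the exponent \<open>k\<close> is written as the value of the
  monomial at the flipped point with all coordinates 1.\<close>

lemma zpow_flip: "zpow (flip s \<zeta>) k = zpow (flip s (\<chi> j. 1)) k * zpow \<zeta> k"
  by (simp add: zpow_def flip_def power_int_mult_distrib prod.distrib)

lemma L_l1_flip:
  fixes F :: "complex ^ 'd::finite \<Rightarrow> complex"
  shows "F \<in> L_l1 \<Longrightarrow> (\<lambda>\<zeta>. F (flip s \<zeta>)) \<in> L_l1"
proof (elim L_l1E)
  fix a :: "int ^ 'd \<Rightarrow> complex"
  assume a: "(\<lambda>k. cmod (a k)) summable_on UNIV" "\<And>\<zeta>. \<zeta> \<in> torus \<Longrightarrow> F \<zeta> = (\<Sum>\<^sub>\<infinity>k. a k * zpow \<zeta> k)"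
  have one: "(\<chi> j. 1) \<in> (torus :: (complex ^ 'd) set)" by (simp add: torus_def)
  show ?thesis
  proof (rule L_l1I)
    show "(\<lambda>k. cmod (a k * zpow (flip s (\<chi> j. 1)) k)) summable_on UNIV"
      using a(1) by (simp add: norm_mult norm_zpow[OF flip_torus[OF one]])
    show "F (flip s \<zeta>) = (\<Sum>\<^sub>\<infinity>k. a k * zpow (flip s (\<chi> j. 1)) k * zpow \<zeta> k)" if "\<zeta> \<in> torus" for \<zeta>
      unfolding a(2)[OF flip_torus[OF that]] by (simp add: zpow_flip[of s \<zeta>] mult.assoc)
  qed
qed

lemma E01_2: "(E01 :: (int ^ 2) set) = {vector [0, 0], vector [1, 0], vector [0, 1], vector [1, 1]}"
  unfolding E01_def by (auto simp: vec_eq_iff forall_2 vector_2)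

lemma vec2_eq_iff: "(vector [a, b] :: 'a::zero ^ 2) = vector [c, d] \<longleftrightarrow> a = c \<and> b = d"
  by (auto simp: vec_eq_iff forall_2 vector_2)

lemma vec2_zero: "(0 :: 'a::zero ^ 2) = vector [0, 0]"
  by (simp add: vec_eq_iff forall_2 vector_2)

lemma E01_2_nonzero: "(E01 :: (int ^ 2) set) - {0} = {vector [1, 0], vector [0, 1], vector [1, 1]}"
  unfolding E01_2 vec2_zero by (auto simp: vec2_eq_iff)

lemma sum_E01_2:
  "(\<Sum>s\<in>(E01 :: (int ^ 2) set). f s) = f (vector [0, 0]) + f (vector [1, 0]) + f (vector [0, 1]) + (f (vector [1, 1]) :: 'a :: comm_monoid_add)"
  unfolding E01_2 by (simp add: vec2_eq_iff add.assoc)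

lemma sq_vec_flip: "sq_vec (flip s \<zeta>) = sq_vec \<zeta>"
proof -
  have "((-1) powi n * z)\<^sup>2 = (z::complex)\<^sup>2" for n :: int and z
    by (cases "even n") auto
  then show ?thesis by (simp add: sq_vec_def flip_def vec_eq_iff)
qed

lemma L_down_l1_flip: "G \<in> L_down_l1 \<Longrightarrow> \<zeta> \<in> torus \<Longrightarrow> G (flip s \<zeta>) = G \<zeta>"
  by (auto simp: L_down_l1_def flip_torus sq_vec_flip)

definition even_vec :: "int ^ 2 \<Rightarrow> bool" where
  "even_vec k \<longleftrightarrow> even (k $ 1) \<and> even (k $ 2)"

text \<open>A character sum over the group of sign changes: the four signs cancel unless both
  exponents are even.\<close>

lemma sum_zpow_flip:
  "(\<Sum>s\<in>E01. zpow (flip s \<zeta>) k) = (if even_vec k then 4 else 0) * zpow \<zeta> (k :: int ^ 2)"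
  by (subst zpow_flip) (auto simp: sum_E01_2 zpow_vec2 flip_def vector_2 even_vec_def algebra_simps)

lemma zpow_double: "zpow \<zeta> (\<chi> j. 2 * k $ j) = zpow (sq_vec \<zeta>) k"
  by (simp add: zpow_def sq_vec_def power_int_mult)

lemma even_vec_iff: "even_vec k \<longleftrightarrow> (\<exists>m. k = (\<chi> j. 2 * m $ j))"
proof
  assume "even_vec k"
  then obtain a b where "k $ 1 = 2 * a" "k $ 2 = 2 * b" by (auto simp: even_vec_def elim!: evenE)
  then have "k = (\<chi> j. 2 * (vector [a, b] :: int ^ 2) $ j)" by (simp add: vec_eq_iff forall_2 vector_2)
  then show "\<exists>m. k = (\<chi> j. 2 * m $ j)" by blast
qed (auto simp: even_vec_def)

lemma inj_double: "inj (\<lambda>m :: int ^ 'd. \<chi> j. 2 * m $ j)"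
  by (auto simp: inj_def vec_eq_iff)

text \<open>Averaging the series over the four sign changes removes all coefficients at exponents
  that are not even, while invariance leaves the function unchanged.\<close>

lemma flip_invariant_L_down_l1:
  fixes F :: "complex ^ 2 \<Rightarrow> complex"
  assumes F: "F \<in> L_l1" and inv: "\<And>s \<zeta>. s \<in> E01 \<Longrightarrow> \<zeta> \<in> torus \<Longrightarrow> F (flip s \<zeta>) = F \<zeta>"
  shows "F \<in> L_down_l1"
proof -
  from F obtain a where a: "(\<lambda>k. cmod (a k)) summable_on UNIV"
    "\<And>\<zeta>. \<zeta> \<in> torus \<Longrightarrow> F \<zeta> = (\<Sum>\<^sub>\<infinity>k. a k * zpow \<zeta> k)" by (rule L_l1E) blast
  let ?d = "\<lambda>m :: int ^ 2. \<chi> j. 2 * m $ j"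
  define G where "G = (\<lambda>\<zeta>. \<Sum>\<^sub>\<infinity>m. a (?d m) * zpow \<zeta> m)"
  have "(\<lambda>m. cmod (a (?d m))) summable_on UNIV"
    using summable_on_reindex[OF inj_double, of "\<lambda>k. cmod (a k)"] summable_on_subset_banach[OF a(1)]
    by (simp add: comp_def)
  then have G: "G \<in> L_l1" by (rule L_l1I) (simp add: G_def)
  have "F \<zeta> = G (sq_vec \<zeta>)" if z: "\<zeta> \<in> torus" for \<zeta>
  proof -
    have "4 * F \<zeta> = (\<Sum>s\<in>E01. F (flip s \<zeta>))" using inv[OF _ z] by (subst sum_E01_2) (simp add: E01_2)
    also have "\<dots> = (\<Sum>s\<in>E01. \<Sum>\<^sub>\<infinity>k. a k * zpow (flip s \<zeta>) k)"
      by (simp add: a(2) flip_torus z)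
    also have "\<dots> = (\<Sum>\<^sub>\<infinity>k. \<Sum>s\<in>E01. a k * zpow (flip s \<zeta>) k)"
      unfolding sum_E01_2 by (subst infsum_add | intro summable_on_add summable_torus a(1) flip_torus z refl)+
    also have "\<dots> = (\<Sum>\<^sub>\<infinity>k. 4 * (if even_vec k then a k * zpow \<zeta> k else 0))"
      by (intro infsum_cong) (simp add: sum_distrib_left[symmetric] sum_zpow_flip)
    also have "\<dots> = 4 * (\<Sum>\<^sub>\<infinity>k. (if even_vec k then a k * zpow \<zeta> k else 0))"
      by (rule infsum_cmult_right')
    also have "(\<Sum>\<^sub>\<infinity>k. (if even_vec k then a k * zpow \<zeta> k else 0)) = (\<Sum>\<^sub>\<infinity>k\<in>range ?d. a k * zpow \<zeta> k)"
      by (rule infsum_cong_neutral) (auto simp: even_vec_iff)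
    also have "\<dots> = (\<Sum>\<^sub>\<infinity>m. a (?d m) * zpow \<zeta> (?d m))"
      by (subst infsum_reindex[OF inj_double]) (simp add: comp_def)
    finally show ?thesis by (simp add: G_def zpow_double)
  qed
  with G show ?thesis by (auto simp: L_down_l1_def)
qed

section \<open>The Laurent polynomials of the box spline\<close>

lemma vec2_add: "(vector [a, b] :: int ^ 2) + vector [c, d] = vector [a + c, b + d]"
  and vec2_uminus: "- (vector [a, b] :: int ^ 2) = vector [- a, - b]"
  by (simp_all add: vec_eq_iff forall_2 vector_2)

lemma mon_mult: "mon a i j * mon b k l = mon (a * b) (i + k) (j + l)"
  by (simp add: mult_single vec2_add)

lemma H_eq: "H = mon (1 / 2 ^ 5) 0 0 * (1 + mon 1 1 0) ^ 2 * (1 + mon 1 0 1) ^ 2 * (1 + mon 1 1 1)"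
  by (simp add: H_def box_mask_def Xi_def power2_eq_square vec2_zero mult_ac)

lemma leval_mon: "leval (mon c i j) \<zeta> = c * ((\<zeta> $ 1) powi i * (\<zeta> $ 2) powi j)"
  by (simp add: leval_single zpow_vec2 vector_2)

lemma cnj_torus: "\<zeta> \<in> torus \<Longrightarrow> \<zeta> $ j * cnj (\<zeta> $ j) = 1"
  by (simp add: torus_def complex_norm_square[symmetric])

text \<open>No exponent in \<open>Phi_poly\<close> or in the \<open>w\<close> polynomials exceeds 2,
  so extracting the square of each variable leaves nonnegative powers of its inverse. The identities
  then concern ordinary polynomials and fall to ring arithmetic.\<close>

lemma powi_as_powers:
  fixes x X :: complex
  assumes "x * X = 1"
  shows "x powi 2 = x ^ 2" "x powi 1 = x ^ 2 * X" "x powi 0 = x ^ 2 * X ^ 2" "x powi (- 1) = x ^ 2 * X ^ 3"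
    "x powi (- 2) = x ^ 2 * X ^ 4" "x powi (- 4) = x ^ 2 * X ^ 6"
proof -
  have x: "x \<noteq> 0" using assms by auto
  then have X: "X = inverse x" using assms by (simp add: field_simps)
  show "x powi 2 = x ^ 2" "x powi 1 = x ^ 2 * X" "x powi 0 = x ^ 2 * X ^ 2" "x powi (- 1) = x ^ 2 * X ^ 3"
    "x powi (- 2) = x ^ 2 * X ^ 4" "x powi (- 4) = x ^ 2 * X ^ 6"
    using x by (simp_all add: X power_int_minus field_simps eval_nat_numeral)
qed

text \<open>The common factor taken out by \<open>powi_as_powers\<close>. The polynomials below are
  the cofactors in the conjugate variables, \<open>pPhi\<close> without the constant 1 /
  10080.\<close>

definition sq2 :: "complex \<Rightarrow> complex \<Rightarrow> complex" where "sq2 x y = x ^ 2 * y ^ 2"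

definition pPhi :: "complex \<Rightarrow> complex \<Rightarrow> complex" where
  "pPhi X Y = 3194 * X ^ 2 * Y ^ 2 + 31 * (Y ^ 2 + X ^ 4 * Y ^ 2 + X ^ 2 + X ^ 2 * Y ^ 4)
    + 5 * (1 + X ^ 4 * Y ^ 4) + 1144 * (X * Y ^ 2 + X ^ 3 * Y ^ 2 + X ^ 2 * Y + X ^ 2 * Y ^ 3)
    + 47 * (X + X ^ 3 * Y ^ 4 + Y + X ^ 4 * Y ^ 3) + (X * Y ^ 4 + X ^ 3 + X ^ 4 * Y + Y ^ 3)
    + 814 * (X * Y + X ^ 3 * Y ^ 3) + 178 * (X * Y ^ 3 + X ^ 3 * Y)"

definition p00 :: "complex \<Rightarrow> complex \<Rightarrow> complex" where
  "p00 X Y = 5 + 130 * Y ^ 2 + 130 * X ^ 2 + 33 * Y ^ 4 + 12303 * X ^ 2 * Y ^ 2 + 33 * X ^ 4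
    + 12048 * X ^ 2 * Y ^ 4 + 12048 * X ^ 4 * Y ^ 2 + 215 * X ^ 2 * Y ^ 6 + 35193 * X ^ 4 * Y ^ 4
    + 215 * X ^ 6 * Y ^ 2 + 3630 * X ^ 4 * Y ^ 6 + 3630 * X ^ 6 * Y ^ 4 + 1027 * X ^ 6 * Y ^ 6"

definition p10 :: "complex \<Rightarrow> complex \<Rightarrow> complex" where
  "p10 X Y = 57 + 3136 * Y ^ 2 + 110 * X ^ 2 + 1677 * Y ^ 4 + 18425 * X ^ 2 * Y ^ 2 + X ^ 4
    + 2 * Y ^ 6 + 30692 * X ^ 2 * Y ^ 4 + 3134 * X ^ 4 * Y ^ 2 + 1677 * X ^ 2 * Y ^ 6
    + 18425 * X ^ 4 * Y ^ 4 + X ^ 6 * Y ^ 2 + 3136 * X ^ 4 * Y ^ 6 + 110 * X ^ 6 * Y ^ 4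
    + 57 * X ^ 6 * Y ^ 6"

definition p11 :: "complex \<Rightarrow> complex \<Rightarrow> complex" where
  "p11 X Y = 1027 + 3630 * Y ^ 2 + 3630 * X ^ 2 + 215 * Y ^ 4 + 35193 * X ^ 2 * Y ^ 2 + 215 * X ^ 4
    + 12048 * X ^ 2 * Y ^ 4 + 12048 * X ^ 4 * Y ^ 2 + 33 * X ^ 2 * Y ^ 6 + 12303 * X ^ 4 * Y ^ 4
    + 33 * X ^ 6 * Y ^ 2 + 130 * X ^ 4 * Y ^ 6 + 130 * X ^ 6 * Y ^ 4 + 5 * X ^ 6 * Y ^ 6"

context
  fixes \<zeta> :: "complex ^ 2" and x y X Y :: complex
  assumes z: "\<zeta> \<in> torus"
  defines "x \<equiv> \<zeta> $ 1" and "y \<equiv> \<zeta> $ 2" and "X \<equiv> cnj (\<zeta> $ 1)" and "Y \<equiv> cnj (\<zeta> $ 2)"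
begin

lemma xX: "x * X = 1" and yY: "y * Y = 1"
  using cnj_torus[OF z] by (auto simp: x_def X_def y_def Y_def)

lemma leval_H: "leval H \<zeta> = (1 + x)\<^sup>2 * (1 + y)\<^sup>2 * (1 + x * y) / 32"
  by (simp add: H_eq leval_mult[OF z] leval_add leval_one leval_power[OF z] leval_mon x_def y_def)

lemmas powi_xy = powi_as_powers[OF xX, unfolded x_def] powi_as_powers[OF yY, unfolded y_def]

lemma leval_Phi_poly: "leval Phi_poly \<zeta> = sq2 x y * pPhi X Y / 10080"
proof -
  have "leval Phi_poly \<zeta> = leval (mon (1 / 10080) 0 0) \<zeta> * (sq2 x y * pPhi X Y)"
    unfolding Phi_poly_def leval_mult[OF z] leval_add
    by (simp only: leval_mon powi_xy) (simp add: sq2_def pPhi_def x_def y_def algebra_simps)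
  then show ?thesis by (simp add: leval_mon)
qed

lemma leval_w00: "leval w00 \<zeta> = sq2 x y * p00 X Y"
  unfolding w00_def leval_add
  by (simp only: leval_mon powi_xy) (simp add: sq2_def p00_def x_def y_def algebra_simps)

lemma leval_w10: "leval w10 \<zeta> = sq2 x y * p10 X Y"
  unfolding w10_def leval_add
  by (simp only: leval_mon powi_xy) (simp add: sq2_def p10_def x_def y_def algebra_simps)

lemma leval_w11: "leval w11 \<zeta> = sq2 x y * p11 X Y"
  unfolding w11_def leval_add
  by (simp only: leval_mon powi_xy) (simp add: sq2_def p11_def x_def y_def algebra_simps)

end

definition swap_vec :: "'a::zero ^ 2 \<Rightarrow> 'a ^ 2" where "swap_vec k = vector [k $ 2, k $ 1]"

lemma swap_swap: "swap_vec (swap_vec k) = k"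
  by (simp add: swap_vec_def vec_eq_iff forall_2 vector_2)

lemma inj_swap: "inj swap_vec"
  by (metis injI swap_swap)

lemma lswap_add: "lswap (P + Q) = lswap P + lswap Q"
  unfolding lswap_def swap_vec_def[symmetric, abs_def] by (rule map_key_plus[OF inj_swap])

lemma lswap_single: "lswap (Poly_Mapping.single k c) = Poly_Mapping.single (swap_vec k) c"
  unfolding lswap_def swap_vec_def[symmetric, abs_def]
  using map_key_single[OF inj_swap, of "swap_vec k" c] by (simp add: swap_swap)

lemma leval_lswap: "leval (lswap P) \<zeta> = leval P (swap_vec \<zeta>)"
  by (induction P rule: laurent_induct)
     (auto simp: lswap_add lswap_single leval_add leval_single zpow_vec2 swap_vec_def vector_2 mult.commute)

lemma swap_torus: "\<zeta> \<in> torus \<Longrightarrow> swap_vec \<zeta> \<in> torus"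
  by (auto simp: torus_def swap_vec_def forall_2 vector_2)

lemma leval_w01:
  assumes z: "\<zeta> \<in> torus"
  shows "leval w01 \<zeta> = sq2 (\<zeta> $ 1) (\<zeta> $ 2) * p10 (cnj (\<zeta> $ 2)) (cnj (\<zeta> $ 1))"
  unfolding w01_def leval_lswap leval_w10[OF swap_torus[OF z]]
  by (simp add: swap_vec_def vector_2 sq2_def mult.commute)

text \<open>\<open>w00\<close> is symmetric in the two variables, so exchanging them turns w10 - w00
  x into w01 - w00 y.\<close>

lemma H01_eq_lswap: "H01 = lswap H10"
proof (rule laurent_eqI)
  fix \<zeta> :: "complex ^ 2" assume z: "\<zeta> \<in> torus"
  show "leval H01 \<zeta> = leval (lswap H10) \<zeta>"
    unfolding H01_def H10_def leval_lswap leval_diff leval_mult[OF z] leval_mult[OF swap_torus[OF z]] w01_def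
      leval_mon leval_w00[OF z] leval_w00[OF swap_torus[OF z]]
    by (simp add: swap_vec_def vector_2 sq2_def p00_def)
qed

text \<open>The factor \<open>sq2\<close> occurs on both sides, and what remains is an identity of
  polynomials in two independent variables \<open>X\<close> and \<open>Y\<close>.\<close>

lemma w_decomposition:
  assumes z: "\<zeta> \<in> torus"
  shows "2 ^ 5 * 10080 * cnj (leval H \<zeta>) * leval Phi_poly \<zeta>
    = leval w00 \<zeta> + leval w10 \<zeta> * cnj (\<zeta> $ 1) + leval w01 \<zeta> * cnj (\<zeta> $ 2) + leval w11 \<zeta> * (cnj (\<zeta> $ 1) * cnj (\<zeta> $ 2))"
proof -
  define X Y where "X = cnj (\<zeta> $ 1)" and "Y = cnj (\<zeta> $ 2)"
  have "(1 + X)\<^sup>2 * (1 + Y)\<^sup>2 * (1 + X * Y) * pPhi X Y = p00 X Y + p10 X Y * X + p10 Y X * Y + p11 X Y * (X * Y)"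
    unfolding pPhi_def p00_def p10_def p11_def by algebra
  moreover have "2 ^ 5 * 10080 * (h / 32) * (s * p / 10080) = s * (h * p)" for h s p :: complex by simp
  moreover have "cnj (leval H \<zeta>) = (1 + X)\<^sup>2 * (1 + Y)\<^sup>2 * (1 + X * Y) / 32"
    unfolding leval_H[OF z] X_def Y_def by simp
  ultimately have "2 ^ 5 * 10080 * cnj (leval H \<zeta>) * leval Phi_poly \<zeta>
     = sq2 (\<zeta> $ 1) (\<zeta> $ 2) * (p00 X Y + p10 X Y * X + p10 Y X * Y + p11 X Y * (X * Y))"
    unfolding leval_Phi_poly[OF z] X_def[symmetric] Y_def[symmetric] by (simp only:)
  then show ?thesis
    unfolding leval_w00[OF z] leval_w10[OF z] leval_w01[OF z] leval_w11[OF z] X_def[symmetric] Y_def[symmetric]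
    by (simp add: distrib_left mult.assoc)
qed

subsection \<open>Zeros on the torus\<close>

text \<open>Raising the coefficient of \<open>p ^ 4\<close> from 80 to 286 makes the part of degree
  four that is divisible by p^2 nonnegative; as p^4 <= p^2, this costs at most 206 p^2. The other
  mixed terms cost at most 4016 |p q|, hence at most 2704 p^2 + 1506 q^2. What is left is 1344 + 18
  p^2 - 1042 q^2, which is positive for q^2 <= 1.\<close>

lemma quartic_pos:
  fixes p q :: real
  assumes p: "\<bar>p\<bar> \<le> 1" and q: "\<bar>q\<bar> \<le> 1"
  shows "1344 + 2928 * p\<^sup>2 + 464 * q\<^sup>2 + 4000 * (p * q) + 496 * (p\<^sup>2 * q\<^sup>2) + 80 * p ^ 4 + 752 * (p ^ 3 * q) + 16 * (p * q ^ 3) > 0"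
proof -
  have p2: "p\<^sup>2 \<le> 1" and q2: "q\<^sup>2 \<le> 1" using p q by (simp_all add: abs_square_le_1)
  \<comment> \<open>Completing the square: 47 / 62 is 752 / (2 * 496).\<close>
  have "0 \<le> 496 * (q + 47 / 62 * p)\<^sup>2 + (286 - 496 * (47 / 62)\<^sup>2) * p\<^sup>2"
    by (intro add_nonneg_nonneg mult_nonneg_nonneg) (auto simp: power2_eq_square)
  then have "0 \<le> 496 * q\<^sup>2 + 752 * (p * q) + 286 * p\<^sup>2"
    by (simp add: power2_eq_square algebra_simps)
  then have "0 \<le> p\<^sup>2 * (496 * q\<^sup>2 + 752 * (p * q) + 286 * p\<^sup>2)" by simp
  then have a: "496 * (p\<^sup>2 * q\<^sup>2) + 752 * (p ^ 3 * q) + 286 * p ^ 4 \<ge> 0"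
    by (simp add: power2_eq_square power3_eq_cube power4_eq_xxxx algebra_simps)
  have b: "p ^ 4 \<le> p\<^sup>2"
    using mult_left_mono[OF p2, of "p\<^sup>2"] by (simp add: power2_eq_square power4_eq_xxxx mult.assoc)
  have m: "\<bar>p * q ^ 3\<bar> \<le> \<bar>p * q\<bar>"
    using mult_left_mono[OF q2, of "\<bar>p * q\<bar>"] by (simp add: power2_eq_square power3_eq_cube abs_mult mult_ac)
  \<comment> \<open>One hundredth of the expanded square reads 4035.2 |p q| <= 2704 p^2 + 1505.44
    q^2, slightly more than is required.\<close>
  have "0 \<le> (520 * \<bar>p\<bar> - 388 * \<bar>q\<bar>)\<^sup>2" by simp
  have c: "4016 * \<bar>p * q\<bar> \<le> 2704 * p\<^sup>2 + 1506 * q\<^sup>2"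
  proof -
    have "403520 * \<bar>p * q\<bar> \<le> 270400 * p\<^sup>2 + 150544 * q\<^sup>2"
      using \<open>0 \<le> (520 * \<bar>p\<bar> - 388 * \<bar>q\<bar>)\<^sup>2\<close> by (simp add: power2_diff abs_mult power_mult_distrib)
    then show ?thesis using zero_le_power2[of p] zero_le_power2[of q] abs_ge_zero[of "p * q"] by linarith
  qed
  show ?thesis using a b c m q2 by linarith
qed

text \<open>For P = cis t and p = cos t the right-hand sides are twice the Chebyshev polynomials of
  degrees 2, 3 and 4.\<close>

lemma sum_powers_unit:
  fixes P Pi p :: complex
  assumes "P * Pi = 1" "P + Pi = 2 * p"
  shows "P ^ 2 + Pi ^ 2 = 4 * p ^ 2 - 2" "P ^ 3 + Pi ^ 3 = 8 * p ^ 3 - 6 * p"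
    "P ^ 4 + Pi ^ 4 = 16 * p ^ 4 - 16 * p ^ 2 + 2"
  using assms by algebra+

lemma unit_cis: "cmod z = 1 \<Longrightarrow> \<exists>t. z = cis t"
  by (metis cis_Arg_unique complex_norm_eq_1_exp cis_conv_exp mult.commute)

text \<open>With the half angles \<open>\<sigma> = (\<alpha> + \<beta>) / 2\<close> and \<open>\<delta> = (\<alpha> - \<beta>) / 2\<close> of \<open>x = cis \<alpha>\<close>, \<open>y = cis \<beta>\<close>, \<open>\<Phi>\<close> is a quartic in
  \<open>cos \<sigma>\<close> and \<open>cos \<delta>\<close>.\<close>
lemma leval_Phi_poly_pos:
  assumes z: "\<zeta> \<in> torus"
  shows "\<exists>r>0. leval Phi_poly \<zeta> = of_real r"
proof -
  obtain \<alpha> \<beta> where ab: "\<zeta> $ 1 = cis \<alpha>" "\<zeta> $ 2 = cis \<beta>"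
    using unit_cis[of "\<zeta> $ 1"] unit_cis[of "\<zeta> $ 2"] z by (auto simp: torus_def)
  define P Pi Q Qi where "P = cis ((\<alpha> + \<beta>) / 2)" and "Pi = cis (- (\<alpha> + \<beta>) / 2)"
    and "Q = cis ((\<alpha> - \<beta>) / 2)" and "Qi = cis (- (\<alpha> - \<beta>) / 2)"
  define p q where "p = cos ((\<alpha> + \<beta>) / 2)" and "q = cos ((\<alpha> - \<beta>) / 2)"
  have PP: "P * Pi = 1" "P + Pi = 2 * complex_of_real p" and QQ: "Q * Qi = 1" "Q + Qi = 2 * complex_of_real q"
    by (simp_all add: P_def Pi_def Q_def Qi_def p_def q_def cis_mult complex_eq_iff minus_divide_left[symmetric] del: minus_diff_eq minus_add_distrib)
  have xy: "\<zeta> $ 1 = P * Q" "\<zeta> $ 2 = P * Qi" "cnj (\<zeta> $ 1) = Pi * Qi" "cnj (\<zeta> $ 2) = Pi * Q"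
    unfolding ab P_def Q_def Pi_def Qi_def cis_cnj cis_mult by (auto intro!: arg_cong[of _ _ cis] simp: field_simps)
  define F where "F = 1344 + 2928 * p\<^sup>2 + 464 * q\<^sup>2 + 4000 * (p * q) + 496 * (p\<^sup>2 * q\<^sup>2) + 80 * p ^ 4 + 752 * (p ^ 3 * q) + 16 * (p * q ^ 3)"
  have "F > 0" unfolding F_def by (rule quartic_pos) (auto simp: p_def q_def)
  \<comment> \<open>The monomial x^i y^j becomes P^(i+j) Q^(i-j), and the symmetries of
    \<open>Phi_poly\<close> under exchange and inversion of the variables group these into products
    of power sums.\<close>
  have "sq2 (P * Q) (P * Qi) * pPhi (Pi * Qi) (Pi * Q)
      = 3194 + 31 * ((P ^ 2 + Pi ^ 2) * (Q ^ 2 + Qi ^ 2)) + 5 * (P ^ 4 + Pi ^ 4)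
       + 1144 * ((P + Pi) * (Q + Qi)) + 47 * ((P ^ 3 + Pi ^ 3) * (Q + Qi)) + (P + Pi) * (Q ^ 3 + Qi ^ 3)
       + 814 * (P ^ 2 + Pi ^ 2) + 178 * (Q ^ 2 + Qi ^ 2)"
    unfolding sq2_def pPhi_def using PP(1) QQ(1) by algebra
  also have "\<dots> = of_real F"
    unfolding sum_powers_unit[OF PP] sum_powers_unit[OF QQ] PP(2) QQ(2) F_def
    by (simp add: algebra_simps power2_eq_square)
  finally have "leval Phi_poly \<zeta> = of_real (F / 10080)"
    unfolding leval_Phi_poly[OF z] xy(3,4) unfolding xy(1,2) by simp
  then show ?thesis using \<open>F > 0\<close> by (intro exI[of _ "F / 10080"]) auto
qed

text \<open>Up to the unimodular factor \<open>P = x y\<close>, the imaginary part of \<open>w\<^sub>0\<^sub>0\<close> is \<open>- Im P\<close> times a positive number.\<close>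
lemma leval_w00_nonzero:
  assumes z: "\<zeta> \<in> torus"
  shows "leval w00 \<zeta> \<noteq> 0"
proof
  assume 0: "leval w00 \<zeta> = 0"
  define x y X Y where "x = \<zeta> $ 1" and "y = \<zeta> $ 2" and "X = cnj (\<zeta> $ 1)" and "Y = cnj (\<zeta> $ 2)"
  have xX: "x * X = 1" "y * Y = 1" using cnj_torus[OF z] by (auto simp: x_def X_def y_def Y_def)
  define P Q where "P = x * y" and "Q = x * Y"
  have cP: "cnj P = X * Y" and cQ: "cnj Q = X * y" by (auto simp: P_def Q_def x_def y_def X_def Y_def)
  define p u r where "p = Re P" and "u = Im P" and "r = 2 * Re Q"
  have P: "P = Complex p u" "cnj P = Complex p (- u)" by (simp_all add: p_def u_def complex_eq_iff)
  have rQ: "Q + cnj Q = of_real r" by (simp add: r_def complex_eq_iff)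
  have PP: "P * cnj P = 1" "Q * cnj Q = 1"
  proof -
    have "x * y * (X * Y) = 1" "x * Y * (X * y) = 1" using xX by algebra+
    then show "P * cnj P = 1" "Q * cnj Q = 1" unfolding cP cQ by (simp_all add: P_def Q_def)
  qed
  have "cmod v = 1" if "v * cnj v = 1" for v
  proof -
    have "(cmod v)\<^sup>2 = 1" using that by (simp only: complex_norm_square[symmetric] of_real_eq_1_iff)
    then show ?thesis using norm_ge_zero[of v] by (auto simp: power2_eq_1_iff)
  qed
  with PP have nP: "cmod P = 1" "cmod Q = 1" by auto
  have pu: "p\<^sup>2 + u\<^sup>2 = 1" using nP(1) by (simp add: P cmod_def)
  have r2: "\<bar>r\<bar> \<le> 2" using abs_Re_le_cmod[of Q] nP by (simp add: r_def)
  have p1: "\<bar>p\<bar> \<le> 1" using abs_Re_le_cmod[of P] nP by (simp add: p_def)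
  have Q2: "Q ^ 2 + cnj Q ^ 2 = (of_real r) ^ 2 - 2"
    unfolding rQ[symmetric] using PP(2) by algebra
  \<comment> \<open>The exponents of \<open>w00\<close> range from (2, 2) down to (-4, -4);
    multiplication by \<open>P\<close> centres them, which pairs the powers of \<open>P\<close> with
    those of its conjugate.\<close>
  have eq: "P * (sq2 x y * p00 X Y) = 5 * P ^ 3 + 130 * P ^ 2 * (Q + cnj Q) + 33 * P * (Q ^ 2 + cnj Q ^ 2) + 12303 * P
      + 12048 * (Q + cnj Q) + 215 * cnj P * (Q ^ 2 + cnj Q ^ 2) + 35193 * cnj P + 3630 * cnj P ^ 2 * (Q + cnj Q)
      + 1027 * cnj P ^ 3"
    unfolding cP cQ unfolding P_def Q_def sq2_def p00_def using xX by algebra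
  have e0: "P * (sq2 x y * p00 X Y) = 0"
    using 0 unfolding leval_w00[OF z] by (simp add: x_def y_def X_def Y_def)
  have Z: "5 * P ^ 3 + 130 * P ^ 2 * of_real r + 33 * P * ((of_real r) ^ 2 - 2) + 12303 * P
      + 12048 * of_real r + 215 * cnj P * ((of_real r) ^ 2 - 2) + 35193 * cnj P + 3630 * cnj P ^ 2 * of_real r
      + 1027 * cnj P ^ 3 = 0"
    using eq e0 unfolding rQ Q2 by (simp only:)
  \<comment> \<open>In the imaginary part only differences of paired coefficients survive: 1022 =
    1027 - 5, 7000 = 2 (3630 - 130), 182 = 215 - 33, 22890 = 35193 - 12303.\<close>
  have im: "u * (1022 * (4 * p\<^sup>2 - 1) + 7000 * (p * r) + 182 * (r\<^sup>2 - 2) + 22890) = 0"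
  proof -
    have "- (u * (1022 * (3 * p\<^sup>2 - u\<^sup>2) + 7000 * (p * r) + 182 * (r\<^sup>2 - 2) + 22890)) = 0"
      using arg_cong[OF Z, of Im] unfolding P
      by (simp add: power2_eq_square power3_eq_cube algebra_simps)
    moreover have "3 * p\<^sup>2 - u\<^sup>2 = 4 * p\<^sup>2 - 1" using pu by simp
    ultimately show ?thesis by simp
  qed
  have "\<bar>p * r\<bar> \<le> 1 * 2" unfolding abs_mult using p1 r2 by (intro mult_mono) auto
  then have "- 2 \<le> p * r" by linarith
  then have "4088 * p\<^sup>2 + 7000 * (p * r) + 182 * r\<^sup>2 + 21504 > 0"
    using zero_le_power2[of p] zero_le_power2[of r] by linarith
  then have "1022 * (4 * p\<^sup>2 - 1) + 7000 * (p * r) + 182 * (r\<^sup>2 - 2) + 22890 > 0" by simp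
  then have u: "u = 0" using im by simp
  then have "p = 1 \<or> p = - 1" using pu by (simp add: power2_eq_1_iff)
  \<comment> \<open>In the real part the paired coefficients add up. At p = 1 and p = -1 the
    resulting quadratic in \<open>r\<close> has no zero with |r| <= 2.\<close>
  moreover have "1032 * p ^ 3 + 3760 * p\<^sup>2 * r + 248 * (r\<^sup>2 - 2) * p + 47496 * p + 12048 * r = 0"
    using arg_cong[OF Z, of Re] unfolding P u
    by (simp add: power2_eq_square power3_eq_cube algebra_simps)
  ultimately have "48032 + 15808 * r + 248 * r\<^sup>2 = 0 \<or> - 48032 + 15808 * r - 248 * r\<^sup>2 = 0"
    by (auto simp: algebra_simps)
  moreover have "- 2 \<le> r" "r \<le> 2" using r2 by auto
  moreover have "0 \<le> r\<^sup>2" by simp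
  ultimately show False by linarith
qed

subsection \<open>Polyphase components\<close>

text \<open>The even function F_s in the splitting of F into the sum of \<zeta>^s F_s over
  \<open>E01\<close>, obtained by averaging over the sign changes. It is kept as a function of
  \<zeta> rather than of its square, so that even factors simply pass through.\<close>

definition polyphase :: "int ^ 2 \<Rightarrow> (complex ^ 2 \<Rightarrow> complex) \<Rightarrow> complex ^ 2 \<Rightarrow> complex" where
  "polyphase s F \<zeta> = (\<Sum>t\<in>E01. zpow (flip t \<zeta>) (- s) * F (flip t \<zeta>)) / 4"

lemma flip_vec2: "flip (vector [i, j]) (\<zeta> :: complex ^ 2) = vector [(-1) powi i * \<zeta> $ 1, (-1) powi j * \<zeta> $ 2]"
  by (simp add: flip_def vec_eq_iff forall_2 vector_2)

lemma sum_flip_invariant: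
  assumes "s \<in> E01"
  shows "(\<Sum>t\<in>E01. f (flip t (flip s \<zeta>))) = (\<Sum>t\<in>E01. (f (flip t (\<zeta> :: complex ^ 2)) :: complex))"
  using assms unfolding sum_E01_2 unfolding E01_2
  by (auto simp: flip_vec2 vector_2 add_ac)

lemma polyphase_flip: "s \<in> E01 \<Longrightarrow> polyphase t F (flip s \<zeta>) = polyphase t F \<zeta>"
  unfolding polyphase_def using sum_flip_invariant[of s "\<lambda>\<zeta>. zpow \<zeta> (- t) * F \<zeta>" \<zeta>] by simp

lemma L_l1_zpow: "(\<lambda>\<zeta>. zpow \<zeta> k) \<in> L_l1"
  using L_l1_leval[of "Poly_Mapping.single k 1"] by (rule L_l1_cong) (simp add: leval_single)

lemma polyphase_L_l1: "F \<in> L_l1 \<Longrightarrow> polyphase s F \<in> L_l1"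
proof -
  assume F: "F \<in> L_l1"
  have "(\<lambda>\<zeta>. (1 / 4) * (\<Sum>t\<in>E01. zpow (flip t \<zeta>) (- s) * F (flip t \<zeta>))) \<in> L_l1"
    by (intro L_l1_cmult L_l1_sum L_l1_mult L_l1_flip[OF F] L_l1_flip[OF L_l1_zpow])
  then show ?thesis by (rule L_l1_cong) (simp add: polyphase_def)
qed

lemma polyphase_cmult:
  assumes "\<And>t. t \<in> E01 \<Longrightarrow> G (flip t \<zeta>) = G \<zeta>"
  shows "polyphase s (\<lambda>\<zeta>. G \<zeta> * F \<zeta>) \<zeta> = G \<zeta> * polyphase s F \<zeta>"
  using assms by (simp add: polyphase_def sum_distrib_left mult_ac)

lemma polyphase_diff: "polyphase s (\<lambda>\<zeta>. F \<zeta> - G \<zeta>) \<zeta> = polyphase s F \<zeta> - polyphase s G \<zeta>"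
  by (simp add: polyphase_def sum_subtractf right_diff_distrib diff_divide_distrib)

lemma polyphase_sum: "polyphase s (\<lambda>\<zeta>. \<Sum>i\<in>I. F i \<zeta>) \<zeta> = (\<Sum>i\<in>I. polyphase s (F i) \<zeta>)"
  unfolding polyphase_def sum_distrib_left sum_divide_distrib[symmetric] by (subst sum.swap) (rule refl)

lemma polyphase_cong: "\<zeta> \<in> torus \<Longrightarrow> (\<And>\<zeta>. \<zeta> \<in> torus \<Longrightarrow> F \<zeta> = G \<zeta>) \<Longrightarrow> polyphase s F \<zeta> = polyphase s G \<zeta>"
  by (simp add: polyphase_def flip_torus)

lemma polyphase_zpow:
  assumes s: "s \<in> E01" and t: "t \<in> E01" and z: "\<zeta> \<in> torus"
  shows "polyphase t (\<lambda>\<zeta>. zpow \<zeta> s) \<zeta> = (if s = t then 1 else 0)"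
proof -
  have "polyphase t (\<lambda>\<zeta>. zpow \<zeta> s) \<zeta> = (\<Sum>u\<in>E01. zpow (flip u \<zeta>) (s - t)) / 4"
    unfolding polyphase_def
    by (simp add: flip_torus[OF z] zpow_add[symmetric])
  also have "\<dots> = (if s = t then 1 else 0)"
    using s t unfolding sum_zpow_flip unfolding E01_2
    by (auto simp: even_vec_def vector_2 vec2_eq_iff zpow_0)
  finally show ?thesis .
qed

lemma sum_polyphase:
  assumes z: "\<zeta> \<in> torus"
  shows "(\<Sum>s\<in>E01. zpow \<zeta> s * polyphase s F \<zeta>) = F \<zeta>"
proof -
  have nz: "\<zeta> $ 1 \<noteq> 0" "\<zeta> $ 2 \<noteq> 0" using torus_nonzero[OF z] by auto
  have z0: "vector [\<zeta> $ 1, \<zeta> $ 2] = \<zeta>" by (simp add: vec_eq_iff forall_2 vector_2)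
  show ?thesis
    unfolding polyphase_def sum_E01_2
    using nz by (simp add: flip_vec2 vec2_uminus zpow_vec2 vector_2 power_int_minus field_simps z0)
qed

definition w :: "int ^ 2 \<Rightarrow> 2 laurent" where
  "w s = (if s = vector [1, 0] then w10 else if s = vector [0, 1] then w01
          else if s = vector [1, 1] then w11 else w00)"

lemma leval_lsquare: "leval (lsquare P) \<zeta> = leval P (sq_vec \<zeta>)"
  unfolding lsquare_def leval_sum leval_single zpow_double by (simp add: leval_def)

lemma powi_square: "(z ^ 2) powi n = (z :: complex) powi (2 * n)"
  by (simp add: power_int_mult)

lemma w00_L_down: "w00 \<in> L_down"
proof -
  have "w00 = lsquare (mon 5 1 1 + mon 130 1 0 + mon 130 0 1 + mon 33 1 (-1) + mon 12303 0 0
       + mon 33 (-1) 1 + mon 12048 0 (-1) + mon 12048 (-1) 0 + mon 215 0 (-2)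
       + mon 35193 (-1) (-1) + mon 215 (-2) 0 + mon 3630 (-1) (-2) + mon 3630 (-2) (-1)
       + mon 1027 (-2) (-2))"
    by (rule laurent_eqI, unfold w00_def leval_lsquare leval_add leval_mon sq_vec_def vec_lambda_beta powi_square) simp
  then show ?thesis by (simp add: L_down_def)
qed

lemma w10_L_down: "w10 \<in> L_down"
proof -
  have "w10 = lsquare (mon 57 1 1 + mon 3136 1 0 + mon 110 0 1 + mon 1677 1 (-1) + mon 18425 0 0
       + mon 1 (-1) 1 + mon 2 1 (-2) + mon 30692 0 (-1) + mon 3134 (-1) 0 + mon 1677 0 (-2)
       + mon 18425 (-1) (-1) + mon 1 (-2) 0 + mon 3136 (-1) (-2) + mon 110 (-2) (-1)
       + mon 57 (-2) (-2))"
    by (rule laurent_eqI, unfold w10_def leval_lsquare leval_add leval_mon sq_vec_def vec_lambda_beta powi_square) simp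
  then show ?thesis by (simp add: L_down_def)
qed

lemma w01_L_down: "w01 \<in> L_down"
proof -
  obtain P where P: "w10 = lsquare P" using w10_L_down by (auto simp: L_down_def)
  have "w01 = lsquare (lswap P)"
    by (rule laurent_eqI) (simp add: w01_def P leval_lsquare leval_lswap sq_vec_def swap_vec_def vec_eq_iff[symmetric],
       rule arg_cong[of _ _ "leval P"], simp add: vec_eq_iff forall_2 vector_2)
  then show ?thesis by (simp add: L_down_def)
qed

lemma w11_L_down: "w11 \<in> L_down"
proof -
  have "w11 = lsquare (mon 1027 1 1 + mon 3630 1 0 + mon 3630 0 1 + mon 215 1 (-1) + mon 35193 0 0
       + mon 215 (-1) 1 + mon 12048 0 (-1) + mon 12048 (-1) 0 + mon 33 0 (-2)
       + mon 12303 (-1) (-1) + mon 33 (-2) 0 + mon 130 (-1) (-2) + mon 130 (-2) (-1)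
       + mon 5 (-2) (-2))"
    by (rule laurent_eqI, unfold w11_def leval_lsquare leval_add leval_mon sq_vec_def vec_lambda_beta powi_square) simp
  then show ?thesis by (simp add: L_down_def)
qed

lemma leval_L_down_flip: "P \<in> L_down \<Longrightarrow> leval P (flip s \<zeta>) = leval P \<zeta>"
  by (auto simp: L_down_def leval_lsquare sq_vec_flip)

lemma w_L_down: "w s \<in> L_down"
  by (simp add: w_def w00_L_down w10_L_down w01_L_down w11_L_down)

lemma w_0: "w 0 = w00"
  by (simp add: w_def vec2_zero vec2_eq_iff)

lemma Hs_0: "Hs 0 = H"
  by (simp add: Hs_def vec2_zero vec2_eq_iff)

lemma Hs_eq: "s \<in> E01 - {0} \<Longrightarrow> Hs s = w s - w00 * Poly_Mapping.single s 1"
  unfolding E01_2_nonzero by (auto simp: Hs_def w_def vec2_eq_iff H10_def H01_def H11_def)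

lemma w_decomposition_sum:
  assumes z: "\<zeta> \<in> torus"
  shows "2 ^ 5 * 10080 * cnj (leval H \<zeta>) * leval Phi_poly \<zeta> = (\<Sum>s\<in>E01. leval (w s) \<zeta> * zpow \<zeta> (- s))"
  unfolding w_decomposition[OF z] zpow_minus[OF z] sum_E01_2
  by (simp add: w_def vec2_eq_iff zpow_vec2 vector_2)

text \<open>The \<open>w s\<close> are invariant under sign changes and come out of the sum over the
  flips; what stays behind is four times a polyphase component.\<close>

lemma sum_H_Phi:
  assumes z: "\<zeta> \<in> torus"
  shows "2 ^ 5 * 10080 * (\<Sum>t\<in>E01. leval Phi_poly (flip t \<zeta>) * F (flip t \<zeta>) * cnj (leval H (flip t \<zeta>)))
     = 4 * (\<Sum>s\<in>E01. leval (w s) \<zeta> * polyphase s F \<zeta>)"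
proof -
  have "2 ^ 5 * 10080 * (\<Sum>t\<in>E01. leval Phi_poly (flip t \<zeta>) * F (flip t \<zeta>) * cnj (leval H (flip t \<zeta>)))
     = (\<Sum>t\<in>E01. (2 ^ 5 * 10080 * cnj (leval H (flip t \<zeta>)) * leval Phi_poly (flip t \<zeta>)) * F (flip t \<zeta>))"
    unfolding sum_distrib_left by (simp add: mult_ac)
  also have "\<dots> = (\<Sum>t\<in>E01. (\<Sum>s\<in>E01. leval (w s) \<zeta> * zpow (flip t \<zeta>) (- s)) * F (flip t \<zeta>))"
    by (simp only: w_decomposition_sum flip_torus[OF z] leval_L_down_flip[OF w_L_down])
  also have "\<dots> = (\<Sum>s\<in>E01. \<Sum>t\<in>E01. leval (w s) \<zeta> * zpow (flip t \<zeta>) (- s) * F (flip t \<zeta>))"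
    unfolding sum_distrib_right by (rule sum.swap)
  also have "\<dots> = 4 * (\<Sum>s\<in>E01. leval (w s) \<zeta> * polyphase s F \<zeta>)"
  proof -
    have "4 * polyphase s F \<zeta> = (\<Sum>t\<in>E01. zpow (flip t \<zeta>) (- s) * F (flip t \<zeta>))" for s
      by (simp add: polyphase_def)
    then have "4 * (leval (w s) \<zeta> * polyphase s F \<zeta>) = leval (w s) \<zeta> * (\<Sum>t\<in>E01. zpow (flip t \<zeta>) (- s) * F (flip t \<zeta>))" for s
      by (metis mult.left_commute)
    then show ?thesis by (simp only: sum_distrib_left mult.assoc)
  qed
  finally show ?thesis .
qed

lemma zero_in_E01: "(0 :: int ^ 2) \<in> E01"
  by (simp add: E01_def)

lemma finite_E01: "finite (E01 :: (int ^ 2) set)"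
  by (simp add: E01_2)

lemma sum_E01_split: "(\<Sum>s\<in>E01. f s) = f 0 + (\<Sum>s\<in>(E01 :: (int ^ 2) set) - {0}. (f s :: complex))"
  by (rule sum.remove[OF finite_E01 zero_in_E01])

text \<open>\<open>w s\<close> and \<open>w00\<close> are even, so the polyphase vector of
  \<open>Hs s\<close> can be read off from its definition and has at most two nonzero
  entries.\<close>

lemma polyphase_Hs:
  assumes s: "s \<in> E01 - {0}" and t: "t \<in> E01" and z: "\<zeta> \<in> torus"
  shows "polyphase t (leval (Hs s)) \<zeta> = (if t = 0 then leval (w s) \<zeta> else 0) - (if t = s then leval w00 \<zeta> else 0)"
proof -
  have "polyphase t (leval (Hs s)) \<zeta> = polyphase t (\<lambda>\<zeta>. leval (w s) \<zeta> * zpow \<zeta> 0 - leval w00 \<zeta> * zpow \<zeta> s) \<zeta>"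
    by (rule polyphase_cong[OF z]) (simp add: Hs_eq[OF s] leval_diff leval_mult leval_single zpow_0)
  also have "\<dots> = leval (w s) \<zeta> * polyphase t (\<lambda>\<zeta>. zpow \<zeta> 0) \<zeta> - leval w00 \<zeta> * polyphase t (\<lambda>\<zeta>. zpow \<zeta> s) \<zeta>"
    unfolding polyphase_diff by (simp add: polyphase_cmult leval_L_down_flip w_L_down w00_L_down)
  also have "\<dots> = (if t = 0 then leval (w s) \<zeta> else 0) - (if t = s then leval w00 \<zeta> else 0)"
    using s t z zero_in_E01 by (auto simp: polyphase_zpow)
  finally show ?thesis .
qed

text \<open>The two entries of the polyphase vector meet \<open>w00\<close> and \<open>w s\<close>
  in the pairing and cancel.\<close>

lemma bracket_H_Hs_zero:
  assumes s: "s \<in> E01 - {0}" and z: "\<zeta> \<in> torus"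
  shows "(\<Sum>t\<in>E01. leval Phi_poly (flip t \<zeta>) * leval (Hs s) (flip t \<zeta>) * cnj (leval H (flip t \<zeta>))) = 0"
proof -
  have "(\<Sum>t\<in>E01. leval (w t) \<zeta> * polyphase t (leval (Hs s)) \<zeta>)
      = (\<Sum>t\<in>E01. (if t = 0 then leval (w t) \<zeta> * leval (w s) \<zeta> else 0) - (if t = s then leval (w t) \<zeta> * leval w00 \<zeta> else 0))"
    by (intro sum.cong refl) (simp add: polyphase_Hs[OF s _ z] right_diff_distrib)
  also have "\<dots> = 0"
    using s zero_in_E01 by (simp add: sum_subtractf sum.delta finite_E01 w_0 mult.commute)
  finally show ?thesis using sum_H_Phi[OF z, of "leval (Hs s)"] by simp
qed

text \<open>Up to a constant this is <H, H>, a sum of squared moduli of \<open>H\<close> at the four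
  sign changes with positive weights. It could vanish only if \<open>H\<close> vanished at all four
  points, which its linear factors exclude.\<close>

lemma sum_w_polyphase_H_nonzero:
  assumes z: "\<zeta> \<in> torus"
  shows "(\<Sum>s\<in>E01. leval (w s) \<zeta> * polyphase s (leval H) \<zeta>) \<noteq> 0"
proof
  assume 0: "(\<Sum>s\<in>E01. leval (w s) \<zeta> * polyphase s (leval H) \<zeta>) = 0"
  obtain r where r: "\<And>t. r t > 0" "\<And>t. leval Phi_poly (flip t \<zeta>) = of_real (r t)"
    using leval_Phi_poly_pos[OF flip_torus[OF z]] by metis
  have "(\<Sum>t\<in>E01. leval Phi_poly (flip t \<zeta>) * leval H (flip t \<zeta>) * cnj (leval H (flip t \<zeta>))) = 0"
    using sum_H_Phi[OF z, of "leval H"] 0 by simp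
  also have "(\<Sum>t\<in>E01. leval Phi_poly (flip t \<zeta>) * leval H (flip t \<zeta>) * cnj (leval H (flip t \<zeta>)))
      = of_real (\<Sum>t\<in>E01. r t * (cmod (leval H (flip t \<zeta>)))\<^sup>2)"
  proof -
    have "v * cnj v = (complex_of_real (cmod v))\<^sup>2" for v by (metis complex_norm_square of_real_power)
    then show ?thesis by (simp add: r mult.assoc)
  qed
  finally have "(\<Sum>t\<in>E01. r t * (cmod (leval H (flip t \<zeta>)))\<^sup>2) = 0"
    using of_real_eq_0_iff by blast
  then have "\<forall>t\<in>E01. r t * (cmod (leval H (flip t \<zeta>)))\<^sup>2 = 0"
    by (subst (asm) sum_nonneg_eq_0_iff) (use r(1) finite_E01 in \<open>auto simp: less_imp_le\<close>)
  then have H0: "leval H (flip t \<zeta>) = 0" if "t \<in> E01" for t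
    using that r(1)[of t] by auto
  define x y where "x = \<zeta> $ 1" and "y = \<zeta> $ 2"
  have nz: "x \<noteq> 0" "y \<noteq> 0" using torus_nonzero[OF z] by (auto simp: x_def y_def)
  have e: "(1 + a * x) = 0 \<or> (1 + b * y) = 0 \<or> 1 + a * x * (b * y) = 0"
    if "t = vector [i, j]" "t \<in> E01" "a = (-1) powi i" "b = (-1) powi j" for t :: "int ^ 2" and i j a b
  proof -
    have "(1 + flip t \<zeta> $ 1)\<^sup>2 * (1 + flip t \<zeta> $ 2)\<^sup>2 * (1 + flip t \<zeta> $ 1 * flip t \<zeta> $ 2) / 32 = 0"
      using H0[OF that(2)] leval_H[OF flip_torus[OF z, of t]] by (simp only:)
    then show ?thesis by (simp add: that flip_vec2 vector_2 x_def y_def)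
  qed
  \<comment> \<open>Each zero of \<open>H\<close> forces \<open>x\<close>, \<open>y\<close> or
    \<open>x * y\<close> to be a sign that depends on the flip, and the four requirements are
    incompatible.\<close>
  have c: "1 + x = 0 \<or> 1 + y = 0 \<or> 1 + x * y = 0" "1 - x = 0 \<or> 1 + y = 0 \<or> 1 - x * y = 0"
    "1 + x = 0 \<or> 1 - y = 0 \<or> 1 - x * y = 0" "1 - x = 0 \<or> 1 - y = 0 \<or> 1 + x * y = 0"
    using e[of "vector [0, 0]" 0 0 1 1] e[of "vector [1, 0]" 1 0 "-1" 1] e[of "vector [0, 1]" 0 1 1 "-1"]
      e[of "vector [1, 1]" 1 1 "-1" "-1"] by (simp_all add: E01_2)
  have eqs: "(1 + x = 0) = (x = -1)" "(1 - x = 0) = (x = 1)" "(1 + y = 0) = (y = -1)" "(1 - y = 0) = (y = 1)"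
    "(1 + x * y = 0) = (x * y = -1)" "(1 - x * y = 0) = (x * y = 1)"
    by (simp_all add: add_eq_0_iff eq_commute[of 1])
  show False using c unfolding eqs by (elim disjE) (simp_all, (simp add: minus_equation_iff)?)
qed

text \<open>The pullback under a sign change as a polynomial again, so that it can enter
  \<open>L_l1_inverse\<close> and comparisons of coefficients.\<close>

definition flip_poly :: "int ^ 'd \<Rightarrow> 'd::finite laurent \<Rightarrow> 'd laurent" where
  "flip_poly s P = (\<Sum>k\<in>Poly_Mapping.keys P. Poly_Mapping.single k (coef P k * zpow (flip s (\<chi> j. 1)) k))"

lemma leval_flip_poly: "leval (flip_poly s P) \<zeta> = leval P (flip s \<zeta>)"
  unfolding flip_poly_def leval_sum leval_single
  by (simp add: leval_def[of P] zpow_flip[of s \<zeta>] mult.assoc)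

lemma L_l1_inverse_flip_sum:
  assumes "\<And>\<zeta>. \<zeta> \<in> torus \<Longrightarrow> (\<Sum>s\<in>E01. leval (w s) \<zeta> * polyphase s (leval H) \<zeta>) \<noteq> 0"
  shows "(\<lambda>\<zeta>. 1 / (\<Sum>s\<in>E01. leval (w s) \<zeta> * polyphase s (leval H) \<zeta>)) \<in> L_l1"
proof -
  define N where "N = Poly_Mapping.single 0 (1 / 4) *
    (\<Sum>s\<in>E01. w s * (\<Sum>t\<in>E01. flip_poly t (Poly_Mapping.single (- s) 1) * flip_poly t H))"
  have N: "leval N \<zeta> = (\<Sum>s\<in>E01. leval (w s) \<zeta> * polyphase s (leval H) \<zeta>)" if z: "\<zeta> \<in> torus" for \<zeta>
    by (simp add: N_def leval_mult[OF z] leval_sum leval_flip_poly leval_single zpow_0 polyphase_def sum_distrib_left sum_divide_distrib mult_ac)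
  have "(\<lambda>\<zeta>. 1 / leval N \<zeta>) \<in> L_l1" by (rule L_l1_inverse) (simp add: N assms)
  then show ?thesis by (rule L_l1_cong) (simp add: N)
qed

text \<open>Spanning is an orthogonal decomposition: subtracting the projection \<open>G0\<close>
  onto \<open>H\<close> leaves a remainder orthogonal to \<open>H\<close>, whose coefficients are
  its polyphase components at nonzero \<open>s\<close>, divided by \<open>- w00\<close>.
  Independence follows the same elimination: pairing with the \<open>w s\<close> isolates the
  coefficient of \<open>H\<close>.\<close>

theorem module_basis_Hs: "module_basis_on torus L_down_l1 L_l1 E01 (\<lambda>s. leval (Hs s))"
  unfolding module_basis_on_def
proof (intro conjI ballI allI impI)
  show "finite (E01 :: (int ^ 2) set)" by (rule finite_E01)
  show "leval (Hs s) \<in> L_l1" for s by (rule L_l1_leval)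
next
  fix F :: "complex ^ 2 \<Rightarrow> complex" assume F: "F \<in> L_l1"
  define N where "N = (\<lambda>\<zeta>. \<Sum>s\<in>E01. leval (w s) \<zeta> * polyphase s (leval H) \<zeta>)"
  define G0 where "G0 = (\<lambda>\<zeta>. (\<Sum>s\<in>E01. leval (w s) \<zeta> * polyphase s F \<zeta>) * (1 / N \<zeta>))"
  define R where "R = (\<lambda>\<zeta>. F \<zeta> - G0 \<zeta> * leval H \<zeta>)"
  define G where "G = (\<lambda>s \<zeta>. if s = 0 then G0 \<zeta> else (-1) * (polyphase s R \<zeta> * (1 / leval w00 \<zeta>)))"
  have N0: "N \<zeta> \<noteq> 0" if "\<zeta> \<in> torus" for \<zeta> unfolding N_def by (rule sum_w_polyphase_H_nonzero[OF that])
  have G0f: "G0 (flip t \<zeta>) = G0 \<zeta>" if "t \<in> E01" for t \<zeta>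
    unfolding G0_def N_def by (simp add: polyphase_flip that leval_L_down_flip w_L_down)
  have G0: "G0 \<in> L_l1"
    unfolding G0_def N_def
    by (intro L_l1_mult L_l1_sum polyphase_L_l1 F L_l1_leval L_l1_inverse_flip_sum sum_w_polyphase_H_nonzero)
  have R: "R \<in> L_l1" unfolding R_def by (intro L_l1_diff F L_l1_mult G0 L_l1_leval)
  have GR: "G s \<in> L_down_l1" if s: "s \<in> E01" for s
  proof (rule flip_invariant_L_down_l1)
    show "G s \<in> L_l1"
      using G0 L_l1_cmult[OF L_l1_mult[OF polyphase_L_l1[OF R] L_l1_inverse[OF leval_w00_nonzero]], of "-1" s]
      by (cases "s = 0") (simp_all add: G_def)
    show "G s (flip t \<zeta>) = G s \<zeta>" if "t \<in> E01" for t \<zeta>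
      using that by (simp add: G_def G0f polyphase_flip leval_L_down_flip w00_L_down)
  qed
  have "F \<zeta> = (\<Sum>s\<in>E01. G s \<zeta> * leval (Hs s) \<zeta>)" if z: "\<zeta> \<in> torus" for \<zeta>
  proof -
    have ppR: "polyphase s R \<zeta> = polyphase s F \<zeta> - G0 \<zeta> * polyphase s (leval H) \<zeta>" for s
      unfolding R_def polyphase_diff by (simp add: polyphase_cmult G0f)
    have "(\<Sum>s\<in>E01. leval (w s) \<zeta> * polyphase s R \<zeta>) = (\<Sum>s\<in>E01. leval (w s) \<zeta> * polyphase s F \<zeta>) - G0 \<zeta> * N \<zeta>"
      by (simp add: ppR N_def right_diff_distrib sum_subtractf sum_distrib_left mult_ac)
    also have "\<dots> = 0" using N0[OF z] by (simp add: G0_def)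
    \<comment> \<open>Orthogonality of the remainder determines its component at 0 from the others,
      so matching the components at nonzero \<open>s\<close> is enough.\<close>
    finally have W: "leval w00 \<zeta> * polyphase 0 R \<zeta> = - (\<Sum>s\<in>E01 - {0}. leval (w s) \<zeta> * polyphase s R \<zeta>)"
      unfolding sum_E01_split by (simp add: w_0 add_eq_0_iff2)
    note nz = leval_w00_nonzero[OF z]
    have "(\<Sum>s\<in>E01. G s \<zeta> * leval (Hs s) \<zeta>) = G0 \<zeta> * leval H \<zeta>
        + (\<Sum>s\<in>E01 - {0}. - (polyphase s R \<zeta> / leval w00 \<zeta>) * (leval (w s) \<zeta> - leval w00 \<zeta> * zpow \<zeta> s))"
      unfolding sum_E01_split
      by (simp add: G_def Hs_0 Hs_eq leval_diff leval_mult[OF z] leval_single)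
    also have "(\<Sum>s\<in>E01 - {0}. - (polyphase s R \<zeta> / leval w00 \<zeta>) * (leval (w s) \<zeta> - leval w00 \<zeta> * zpow \<zeta> s))
        = (\<Sum>s\<in>E01 - {0}. zpow \<zeta> s * polyphase s R \<zeta> - (leval (w s) \<zeta> * polyphase s R \<zeta>) / leval w00 \<zeta>)"
      using nz by (intro sum.cong refl) (simp add: field_simps)
    also have "\<dots> = (\<Sum>s\<in>E01 - {0}. zpow \<zeta> s * polyphase s R \<zeta>) + polyphase 0 R \<zeta>"
    proof -
      have "(\<Sum>s\<in>E01 - {0}. leval (w s) \<zeta> * polyphase s R \<zeta>) = - (leval w00 \<zeta> * polyphase 0 R \<zeta>)"
        using W by simp
      then show ?thesis using nz by (simp add: sum_subtractf flip: sum_divide_distrib)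
    qed
    also have "\<dots> = R \<zeta>"
      using sum_polyphase[OF z, of R] unfolding sum_E01_split by (simp add: zpow_0 add_ac)
    finally show ?thesis by (simp add: R_def)
  qed
  with GR show "\<exists>G. (\<forall>s\<in>E01. G s \<in> L_down_l1) \<and> (\<forall>z\<in>torus. F z = (\<Sum>s\<in>E01. G s z * leval (Hs s) z))"
    by blast
next
  fix G :: "int ^ 2 \<Rightarrow> complex ^ 2 \<Rightarrow> complex" and s :: "int ^ 2" and \<zeta> :: "complex ^ 2"
  assume A: "(\<forall>s\<in>E01. G s \<in> L_down_l1) \<and> (\<forall>z\<in>torus. (\<Sum>s\<in>E01. G s z * leval (Hs s) z) = 0)"
    and s: "s \<in> E01" and z: "\<zeta> \<in> torus"
  have Gf: "G s (flip t \<zeta>) = G s \<zeta>" if "s \<in> E01" for s t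
    using L_down_l1_flip[OF _ z] A that by auto
  have pp: "(\<Sum>s\<in>E01. G s \<zeta> * polyphase t (leval (Hs s)) \<zeta>) = 0" for t
  proof -
    have "polyphase t (\<lambda>\<zeta>. \<Sum>s\<in>E01. G s \<zeta> * leval (Hs s) \<zeta>) \<zeta> = polyphase t (\<lambda>\<zeta>. 0) \<zeta>"
      using A by (intro polyphase_cong[OF z]) auto
    then show ?thesis unfolding polyphase_sum by (simp add: polyphase_cmult Gf) (simp add: polyphase_def)
  qed
  have pt: "G 0 \<zeta> * polyphase t (leval H) \<zeta> + (if t = 0 then (\<Sum>s\<in>E01 - {0}. G s \<zeta> * leval (w s) \<zeta>) else - (G t \<zeta> * leval w00 \<zeta>)) = 0"
    if t: "t \<in> E01" for t
  proof -
    have "(\<Sum>s\<in>E01 - {0}. G s \<zeta> * polyphase t (leval (Hs s)) \<zeta>)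
       = (\<Sum>s\<in>E01 - {0}. (if t = 0 then G s \<zeta> * leval (w s) \<zeta> else 0) - (if t = s then G s \<zeta> * leval w00 \<zeta> else 0))"
      by (intro sum.cong refl) (simp add: polyphase_Hs[OF _ t z] right_diff_distrib)
    also have "\<dots> = (if t = 0 then (\<Sum>s\<in>E01 - {0}. G s \<zeta> * leval (w s) \<zeta>) else - (G t \<zeta> * leval w00 \<zeta>))"
      using t by (auto simp: sum_subtractf sum.delta finite_E01)
    finally show ?thesis using pp[of t] unfolding sum_E01_split by (simp add: Hs_0)
  qed
  \<comment> \<open>In this combination the contributions of the three \<open>Hs\<close> cancel,
    which leaves the coefficient of \<open>H\<close> times a function without zeros.\<close>
  have "0 = (\<Sum>t\<in>E01. leval (w t) \<zeta> * (G 0 \<zeta> * polyphase t (leval H) \<zeta> + (if t = 0 then (\<Sum>s\<in>E01 - {0}. G s \<zeta> * leval (w s) \<zeta>) else - (G t \<zeta> * leval w00 \<zeta>))))"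
    by (simp add: pt)
  also have "\<dots> = G 0 \<zeta> * (\<Sum>t\<in>E01. leval (w t) \<zeta> * polyphase t (leval H) \<zeta>)"
    unfolding sum_E01_split
    by (simp add: w_0 distrib_left sum.distrib sum_distrib_left sum_negf right_diff_distrib sum_subtractf mult_ac)
  finally have G0: "G 0 \<zeta> = 0" using sum_w_polyphase_H_nonzero[OF z] by simp
  show "G s \<zeta> = 0"
    using pt[OF s] G0 leval_w00_nonzero[OF z] by (cases "s = 0") auto
qed

subsection \<open>Counting coefficients\<close>

text \<open>A list keeps coefficients and exponents as numerals, so that distinctness of the
  exponents and nonvanishing of the coefficients are decided by evaluation.\<close>

definition sum_mon :: "(complex \<times> int \<times> int) list \<Rightarrow> 2 laurent" where
  "sum_mon xs = (\<Sum>(c, i, j)\<leftarrow>xs. mon c i j)"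

lemma keys_sum_mon:
  assumes "distinct (map snd xs)" "\<forall>c\<in>set (map fst xs). c \<noteq> 0"
  shows "Poly_Mapping.keys (sum_mon xs) = (\<lambda>(i, j). vector [i, j]) ` set (map snd xs)"
  using assms
proof (induction xs)
  case Nil
  then show ?case by (simp add: sum_mon_def)
next
  case (Cons a xs)
  obtain c i j where a: "a = (c, i, j)" by (cases a)
  have IH: "Poly_Mapping.keys (sum_mon xs) = (\<lambda>(i, j). vector [i, j]) ` set (map snd xs)"
    using Cons by simp
  have s: "sum_mon (a # xs) = mon c i j + sum_mon xs" by (simp add: sum_mon_def a)
  have nin: "vector [i, j] \<notin> Poly_Mapping.keys (sum_mon xs)"
    using Cons.prems(1) unfolding IH a by (force simp: vec2_eq_iff)
  have "coef (sum_mon (a # xs)) k \<noteq> 0 \<longleftrightarrow> k = vector [i, j] \<or> k \<in> Poly_Mapping.keys (sum_mon xs)" for k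
    using nin Cons.prems(2) unfolding s by (auto simp: a lookup_add lookup_single when_def in_keys_iff)
  then have "Poly_Mapping.keys (sum_mon (a # xs)) = insert (vector [i, j]) (Poly_Mapping.keys (sum_mon xs))"
    by (auto simp: in_keys_iff)
  then show ?case by (simp add: IH a)
qed

lemma card_keys_sum_mon:
  assumes "distinct (map snd xs)" "\<forall>c\<in>set (map fst xs). c \<noteq> 0"
  shows "card (Poly_Mapping.keys (sum_mon xs)) = length xs"
proof -
  have "inj_on (\<lambda>(i, j). vector [i, j] :: int ^ 2) A" for A by (auto simp: inj_on_def vec2_eq_iff)
  then have "card (Poly_Mapping.keys (sum_mon xs)) = card (set (map snd xs))"
    unfolding keys_sum_mon[OF assms] by (rule card_image)
  also have "\<dots> = length xs" using distinct_card[OF assms(1)] by simp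
  finally show ?thesis .
qed

text \<open>15 monomials come from \<open>w10\<close> and 14 from \<open>w00\<close>. They cannot
  collide: the first exponents are even in one group and odd in the other.\<close>

lemma card_H10: "card (Poly_Mapping.keys H10) = 29"
proof -
  have eq: "H10 = sum_mon [(57,2,2), (3136,2,0), (110,0,2), (1677,2,-2), (18425,0,0), (1,-2,2), (2,2,-4),
    (30692,0,-2), (3134,-2,0), (1677,0,-4), (18425,-2,-2), (1,-4,0), (3136,-2,-4), (110,-4,-2), (57,-4,-4),
    (-5,3,2), (-130,3,0), (-130,1,2), (-33,3,-2), (-12303,1,0), (-33,-1,2), (-12048,1,-2), (-12048,-1,0),
    (-215,1,-4), (-35193,-1,-2), (-215,-3,0), (-3630,-1,-4), (-3630,-3,-2), (-1027,-3,-4)]"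
    unfolding H10_def w10_def w00_def sum_mon_def
    by (simp add: distrib_right mon_mult single_uminus algebra_simps)
  show ?thesis unfolding eq by (subst card_keys_sum_mon) simp_all
qed

lemma card_H11: "card (Poly_Mapping.keys H11) = 28"
proof -
  have eq: "H11 = sum_mon [(1027,2,2), (3630,2,0), (3630,0,2), (215,2,-2), (35193,0,0), (215,-2,2),
    (12048,0,-2), (12048,-2,0), (33,0,-4), (12303,-2,-2), (33,-4,0), (130,-2,-4), (130,-4,-2), (5,-4,-4),
    (-5,3,3), (-130,3,1), (-130,1,3), (-33,3,-1), (-12303,1,1), (-33,-1,3), (-12048,1,-1), (-12048,-1,1),
    (-215,1,-3), (-35193,-1,-1), (-215,-3,1), (-3630,-1,-3), (-3630,-3,-1), (-1027,-3,-3)]"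
    unfolding H11_def w11_def w00_def sum_mon_def
    by (simp add: distrib_right mon_mult single_uminus algebra_simps)
  show ?thesis unfolding eq by (subst card_keys_sum_mon) simp_all
qed

lemma card_H01: "card (Poly_Mapping.keys H01) = 29"
proof -
  have "Poly_Mapping.keys H01 = swap_vec -` Poly_Mapping.keys H10"
    unfolding H01_eq_lswap lswap_def swap_vec_def[symmetric, abs_def] by (rule keys_map_key[OF inj_swap])
  also have "\<dots> = swap_vec ` Poly_Mapping.keys H10"
    by (auto simp: swap_swap) (metis image_eqI swap_swap)
  finally show ?thesis using card_image[OF inj_on_subset[OF inj_swap], of "Poly_Mapping.keys H10"] by (simp add: card_H10)
qed

section \<open>Lebesgue measure on the plane as a product measure\<close>

lemma vector_eq_axis: "(vector [a, b] :: real ^ 2) = a *\<^sub>R axis 1 1 + b *\<^sub>R axis 2 1"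
  by (simp add: vec_eq_iff forall_2 axis_def vector_2)

lemma measurable_vec2 [measurable]:
  assumes [measurable]: "f \<in> borel_measurable M" "g \<in> borel_measurable M"
  shows "(\<lambda>x. vector [f x, g x] :: real ^ 2) \<in> borel_measurable M"
  unfolding vector_eq_axis by measurable

lemma borel_measurable_vec_nth2 [measurable]:
  assumes [measurable]: "f \<in> borel_measurable M"
  shows "(\<lambda>x. (f x :: real ^ 2) $ i) \<in> borel_measurable M"
proof -
  have "(\<lambda>x. f x \<bullet> axis i 1) \<in> borel_measurable M" by measurable
  then show ?thesis by (simp add: inner_axis)
qed

lemma Basis_real2: "Basis = {axis 1 1, axis 2 (1::real) :: real ^ 2}"
  by (auto simp: Basis_vec_def UNIV_2)

lemma axis_1_neq_2: "axis 1 (1::real) \<noteq> (axis 2 1 :: real ^ 2)"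
  by (simp add: axis_eq_axis)

lemma prod_Basis2: "(\<Prod>b\<in>(Basis :: (real ^ 2) set). F (x \<bullet> b)) = F (x $ 1) * F (x $ 2)"
  for F :: "real \<Rightarrow> 'a :: comm_monoid_mult"
  unfolding Basis_real2 using axis_1_neq_2 by (simp add: inner_axis)

text \<open>Makes Fubini's theorem and product integrals available for vectors of length two; it
  suffices to compare the volumes of open boxes.\<close>

lemma lborel_eq_vec2:
  "(lborel :: (real ^ 2) measure) = distr (lborel \<Otimes>\<^sub>M lborel) borel (\<lambda>p. vector [fst p, snd p])"
proof (rule lborel_eqI)
  fix l u :: "real ^ 2"
  assume le: "\<And>b. b \<in> Basis \<Longrightarrow> l \<bullet> b \<le> u \<bullet> b"
  have le1: "l $ 1 \<le> u $ 1" "l $ 2 \<le> u $ 2"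
    using le[of "axis 1 1"] le[of "axis 2 1"] by (auto simp: Basis_real2 inner_axis)
  have "(\<lambda>p. vector [fst p, snd p] :: real ^ 2) -` box l u \<inter> space (lborel \<Otimes>\<^sub>M lborel)
      = {l $ 1 <..< u $ 1} \<times> {l $ 2 <..< u $ 2}"
    by (auto simp: mem_box_cart forall_2 vector_2 space_pair_measure)
  then have "emeasure (distr (lborel \<Otimes>\<^sub>M lborel) borel (\<lambda>p. vector [fst p, snd p])) (box l u)
     = emeasure (lborel \<Otimes>\<^sub>M lborel) ({l $ 1 <..< u $ 1} \<times> {l $ 2 <..< u $ 2})"
    by (subst emeasure_distr) auto
  also have "\<dots> = (u $ 1 - l $ 1) * (u $ 2 - l $ 2)"
    using le1 by (subst lborel.emeasure_pair_measure_Times) (auto simp: ennreal_mult')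
  also have "\<dots> = (\<Prod>b\<in>Basis. (u - l) \<bullet> b)"
    using prod_Basis2[of "\<lambda>x. x" "u - l"] by simp
  finally show "emeasure (distr (lborel \<Otimes>\<^sub>M lborel) borel (\<lambda>p. vector [fst p, snd p])) (box l u)
     = (\<Prod>b\<in>Basis. (u - l) \<bullet> b)" .
qed simp

lemma nn_integral_vec2:
  assumes [measurable]: "f \<in> borel_measurable borel"
  shows "(\<integral>\<^sup>+x. f x \<partial>(lborel :: (real ^ 2) measure)) = (\<integral>\<^sup>+a. \<integral>\<^sup>+b. f (vector [a, b]) \<partial>lborel \<partial>lborel)"
  by (subst lborel_eq_vec2, subst nn_integral_distr) (auto simp: lborel.nn_integral_fst[symmetric])

lemma integrable_vec2_iff:
  fixes f :: "real ^ 2 \<Rightarrow> 'a :: {banach, second_countable_topology}"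
  assumes [measurable]: "f \<in> borel_measurable borel"
  shows "integrable lborel f \<longleftrightarrow> integrable (lborel \<Otimes>\<^sub>M lborel) (\<lambda>p. f (vector [fst p, snd p]))"
  by (subst lborel_eq_vec2, subst integrable_distr_eq) auto

lemma integral_vec2:
  fixes f :: "real ^ 2 \<Rightarrow> 'a :: {banach, second_countable_topology}"
  assumes "integrable lborel f"
  shows "(\<integral>x. f x \<partial>lborel) = (\<integral>a. \<integral>b. f (vector [a, b]) \<partial>lborel \<partial>lborel)"
proof -
  have [measurable]: "f \<in> borel_measurable borel" using borel_measurable_integrable[OF assms] by simp
  have i: "integrable (lborel \<Otimes>\<^sub>M lborel) (\<lambda>p. f (vector [fst p, snd p]))"
    using assms by (simp add: integrable_vec2_iff)
  have "(\<integral>x. f x \<partial>lborel) = (\<integral>p. f (vector [fst p, snd p]) \<partial>(lborel \<Otimes>\<^sub>M lborel))"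
    by (subst lborel_eq_vec2, subst integral_distr) auto
  also have "\<dots> = (\<integral>a. \<integral>b. f (vector [a, b]) \<partial>lborel \<partial>lborel)"
    using lborel_pair.integral_fst'[OF i] by simp
  finally show ?thesis .
qed

lemma
  fixes f g :: "real \<Rightarrow> 'a :: {real_normed_field, banach, second_countable_topology}"
  assumes f: "integrable lborel f" and g: "integrable lborel g"
  shows integrable_prod2: "integrable lborel (\<lambda>x::real^2. f (x $ 1) * g (x $ 2))"
    and integral_prod2: "(\<integral>x. f (x $ 1) * g (x $ 2) \<partial>(lborel :: (real ^ 2) measure)) = (\<integral>x. f x \<partial>lborel) * (\<integral>x. g x \<partial>lborel)"
proof -
  have [measurable]: "f \<in> borel_measurable borel" "g \<in> borel_measurable borel"
    using borel_measurable_integrable[OF f] borel_measurable_integrable[OF g] by simp_all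
  have "integrable (lborel \<Otimes>\<^sub>M lborel) (\<lambda>(a, b). f a * g b)"
    by (rule lborel_pair.Fubini_integrable) (use f g in \<open>auto simp: norm_mult\<close>)
  then show i: "integrable lborel (\<lambda>x::real^2. f (x $ 1) * g (x $ 2))"
    by (subst integrable_vec2_iff) (auto simp: vector_2 split_beta')
  show "(\<integral>x. f (x $ 1) * g (x $ 2) \<partial>(lborel :: (real ^ 2) measure)) = (\<integral>x. f x \<partial>lborel) * (\<integral>x. g x \<partial>lborel)"
    by (subst integral_vec2[OF i]) (auto simp: vector_2)
qed

section \<open>The Fourier transform of integrable functions\<close>

lemma inner_vec2: "(u::real^2) \<bullet> x = u $ 1 * x $ 1 + u $ 2 * x $ 2"
  by (simp add: inner_vec_def sum_2)

lemma integrable_times_bounded: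
  fixes f g :: "'a \<Rightarrow> complex"
  assumes f: "integrable M f" and [measurable]: "g \<in> borel_measurable M" and b: "\<And>x. cmod (g x) \<le> C"
  shows "integrable M (\<lambda>x. f x * g x)"
proof (rule Bochner_Integration.integrable_bound)
  show "integrable M (\<lambda>x. C * norm (f x))" using f by simp
  have "f \<in> borel_measurable M" using f by simp
  then show "(\<lambda>x. f x * g x) \<in> borel_measurable M" by measurable
  have "norm (f x * g x) \<le> norm (C * norm (f x))" for x
    using mult_left_mono[OF b[of x], of "cmod (f x)"] order_trans[OF norm_ge_zero b[of x]]
    by (simp add: norm_mult abs_mult mult.commute)
  then show "AE x in M. norm (f x * g x) \<le> norm (C * norm (f x))" by simp
qed

lemma cmod_exp_neg_i [simp]: "cmod (exp (- \<i> * complex_of_real t)) = 1"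
  using norm_exp_i_times[of "-t"] by (simp add: mult.commute)

lemma borel_measurable_exp_inner [measurable]:
  "(\<lambda>x. exp (- \<i> * complex_of_real (u \<bullet> (x::real^2)))) \<in> borel_measurable borel"
  by (intro borel_measurable_continuous_onI continuous_intros)

lemma integrable_fourier:
  fixes f :: "real ^ 2 \<Rightarrow> complex"
  assumes "integrable lborel f"
  shows "integrable lborel (\<lambda>x. f x * exp (- \<i> * of_real (u \<bullet> x)))"
  by (rule integrable_times_bounded[OF assms, where C = 1]) auto

lemma fourier_diff:
  fixes f g :: "real ^ 2 \<Rightarrow> complex"
  assumes "integrable lborel f" "integrable lborel g"
  shows "fourier (\<lambda>x. f x - g x) u = fourier f u - fourier g u"
  unfolding fourier_def left_diff_distrib
  by (intro Bochner_Integration.integral_diff integrable_fourier assms)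

lemma fourier_sum:
  fixes f :: "'i \<Rightarrow> real ^ 2 \<Rightarrow> complex"
  assumes "\<And>i. i \<in> I \<Longrightarrow> integrable lborel (f i)"
  shows "fourier (\<lambda>x. \<Sum>i\<in>I. c i * f i x) u = (\<Sum>i\<in>I. c i * fourier (f i) u)"
proof -
  have "(\<lambda>x. (\<Sum>i\<in>I. c i * f i x) * exp (- \<i> * of_real (u \<bullet> x)))
      = (\<lambda>x. \<Sum>i\<in>I. c i * (f i x * exp (- \<i> * of_real (u \<bullet> x))))"
    by (simp add: sum_distrib_right mult.assoc)
  then show ?thesis
    unfolding fourier_def using integrable_fourier[OF assms, of _ u]
    by (simp add: Bochner_Integration.integral_sum)
qed

lemma integrable_pair_mult:
  fixes f g :: "real ^ 2 \<Rightarrow> complex"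
  assumes f: "integrable lborel f" and g: "integrable lborel g"
  shows "integrable (lborel \<Otimes>\<^sub>M lborel) (\<lambda>p. f (fst p) * g (snd p))"
proof -
  have [measurable]: "f \<in> borel_measurable borel" "g \<in> borel_measurable borel"
    using borel_measurable_integrable[OF f] borel_measurable_integrable[OF g] by simp_all
  show ?thesis
    by (rule lborel_pair.Fubini_integrable) (use f g in \<open>auto simp: norm_mult\<close>)
qed

text \<open>Fubini's theorem for the double integrand, whose kernel is symmetric and of modulus 1.
  With Gaussians as \<open>g\<close> this does duty for Fourier inversion.\<close>

lemma fourier_multiplication_formula:
  fixes f g :: "real ^ 2 \<Rightarrow> complex"
  assumes f: "integrable lborel f" and g: "integrable lborel g"
  shows "(\<integral>x. f x * fourier g x \<partial>lborel) = (\<integral>u. fourier f u * g u \<partial>lborel)"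
proof -
  have [measurable]: "(\<lambda>p. exp (- \<i> * complex_of_real (snd p \<bullet> (fst p::real^2)))) \<in> borel_measurable (lborel \<Otimes>\<^sub>M lborel)"
    by (simp add: lborel_prod del: minus_mult_minus) (intro borel_measurable_continuous_onI continuous_intros)
  have i: "integrable (lborel \<Otimes>\<^sub>M lborel) (\<lambda>p. f (fst p) * g (snd p) * exp (- \<i> * of_real (snd p \<bullet> fst p)))"
    by (rule integrable_times_bounded[OF integrable_pair_mult[OF f g], where C = 1]) auto
  have "(\<integral>u. fourier f u * g u \<partial>lborel)
      = (\<integral>u. \<integral>x. f x * g u * exp (- \<i> * of_real (u \<bullet> x)) \<partial>lborel \<partial>lborel)"
    unfolding fourier_def
    by (intro Bochner_Integration.integral_cong refl, subst integral_mult_left_zero[symmetric])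
       (simp add: mult_ac)
  also have "\<dots> = (\<integral>x. \<integral>u. f x * g u * exp (- \<i> * of_real (u \<bullet> x)) \<partial>lborel \<partial>lborel)"
    using lborel_pair.Fubini_integral[of "\<lambda>x u. f x * g u * exp (- \<i> * of_real (u \<bullet> x))"] i
    by (simp add: split_beta')
  also have "\<dots> = (\<integral>x. f x * fourier g x \<partial>lborel)"
    unfolding fourier_def
    by (intro Bochner_Integration.integral_cong refl, subst integral_mult_right_zero[symmetric])
       (simp add: mult_ac inner_commute)
  finally show ?thesis by simp
qed

section \<open>Gaussians and injectivity of the Fourier transform on integrable functions\<close>

definition gauss :: "real \<Rightarrow> real" where "gauss t = exp (- t\<^sup>2 / 2)"

lemma gauss_pos: "gauss t > 0" and gauss_le_1: "gauss t \<le> 1" and gauss_minus: "gauss (- t) = gauss t"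
  by (auto simp: gauss_def)

lemma gauss_measurable [measurable]: "gauss \<in> borel_measurable borel"
  unfolding gauss_def[abs_def] by measurable

lemma gauss_std_normal: "gauss t = sqrt (2 * pi) * std_normal_density t"
  by (simp add: gauss_def std_normal_density_def)

lemma integrable_gauss: "integrable lborel gauss"
  unfolding gauss_std_normal[abs_def] using integrable_normal_density[of 1 0] by simp

lemma integral_gauss: "(\<integral>t. gauss t \<partial>lborel) = sqrt (2 * pi)"
  unfolding gauss_std_normal[abs_def] using integral_normal_density[of 1 0] by simp

text \<open>Read off from the characteristic function of the standard normal distribution.\<close>

lemma gauss_fourier:
  "(\<integral>t. of_real (gauss t) * exp (- \<i> * of_real (x * t)) \<partial>lborel) = of_real (sqrt (2 * pi) * gauss x)"
proof -
  have "char std_normal_distribution (- x) = (\<integral>t. std_normal_density t *\<^sub>R iexp (- x * t) \<partial>lborel)"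
    unfolding char_def by (subst integral_density) (auto simp: normal_density_nonneg)
  then have "(\<integral>t. std_normal_density t *\<^sub>R iexp (- x * t) \<partial>lborel) = of_real (gauss x)"
    by (simp add: char_std_normal_distribution gauss_def)
  then have "of_real (sqrt (2 * pi)) * (\<integral>t. std_normal_density t *\<^sub>R iexp (- x * t) \<partial>lborel)
     = of_real (sqrt (2 * pi) * gauss x)" by simp
  also have "of_real (sqrt (2 * pi)) * (\<integral>t. std_normal_density t *\<^sub>R iexp (- x * t) \<partial>lborel)
     = (\<integral>t. of_real (gauss t) * exp (- \<i> * of_real (x * t)) \<partial>lborel)"
    by (subst integral_mult_right_zero[symmetric]) (simp add: gauss_std_normal scaleR_conv_of_real mult_ac)
  finally show ?thesis .
qed

lemma gauss_fourier_affine: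
  assumes "s > 0"
  shows "integrable lborel (\<lambda>t. complex_of_real (gauss (s * t)))"
    and "(\<integral>t. of_real (gauss (s * t)) * exp (- \<i> * of_real (x * t)) \<partial>lborel)
           = of_real (sqrt (2 * pi) / s * gauss (x / s))"
proof -
  have "integrable lborel (\<lambda>t. gauss (s * t))"
    using lborel_integrable_real_affine[OF integrable_gauss, of s 0] assms by simp
  then show "integrable lborel (\<lambda>t. complex_of_real (gauss (s * t)))" by simp
  have "of_real (sqrt (2 * pi) * gauss (x / s)) =
     s *\<^sub>R (\<integral>t. of_real (gauss (s * t)) * exp (- \<i> * of_real (x / s * (s * t))) \<partial>lborel)"
    unfolding gauss_fourier[symmetric]
    using assms by (subst lborel_integral_real_affine[where c = s and t = 0]) auto
  then show "(\<integral>t. of_real (gauss (s * t)) * exp (- \<i> * of_real (x * t)) \<partial>lborel)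
           = of_real (sqrt (2 * pi) / s * gauss (x / s))"
    using assms by (simp add: scaleR_conv_of_real field_simps)
qed

text \<open>For small \<open>s\<close> this is a wide Gaussian modulated by \<open>y\<close>; its
  transform is a narrow Gaussian centred at \<open>y\<close>.\<close>

lemma fourier_gauss2:
  fixes y :: "real ^ 2"
  assumes s: "s > 0"
  defines "g \<equiv> (\<lambda>u::real^2. of_real (gauss (s * u $ 1) * gauss (s * u $ 2)) * exp (\<i> * of_real (u \<bullet> y)))"
  shows "integrable lborel g"
    and "fourier g x = of_real (2 * pi / s\<^sup>2 * (gauss ((x $ 1 - y $ 1) / s) * gauss ((x $ 2 - y $ 2) / s)))"
proof -
  have exp_split: "exp (\<i> * complex_of_real (u \<bullet> y)) = exp (- \<i> * of_real (- (y $ 1) * u $ 1)) * exp (- \<i> * of_real (- (y $ 2) * u $ 2))" for u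
    by (simp add: inner_vec2 exp_add[symmetric] algebra_simps)
  have gi: "g = (\<lambda>u. (of_real (gauss (s * u $ 1)) * exp (- \<i> * of_real (- (y $ 1) * u $ 1))) *
       (of_real (gauss (s * u $ 2)) * exp (- \<i> * of_real (- (y $ 2) * u $ 2))))"
    unfolding g_def exp_split by (simp add: mult_ac)
  have i1: "integrable lborel (\<lambda>t. of_real (gauss (s * t)) * exp (- \<i> * of_real (c * t)))" for c
    by (rule integrable_times_bounded[OF gauss_fourier_affine(1)[OF s], where C = 1]) auto
  show "integrable lborel g"
    unfolding gi by (intro integrable_prod2 i1)
  have e: "g u * exp (- \<i> * of_real (x \<bullet> u)) = 
     (of_real (gauss (s * u $ 1)) * exp (- \<i> * of_real ((x $ 1 - y $ 1) * u $ 1))) *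
     (of_real (gauss (s * u $ 2)) * exp (- \<i> * of_real ((x $ 2 - y $ 2) * u $ 2)))" for u
    unfolding g_def
    by (simp add: inner_vec2 exp_add[symmetric] algebra_simps)
  show "fourier g x = of_real (2 * pi / s\<^sup>2 * (gauss ((x $ 1 - y $ 1) / s) * gauss ((x $ 2 - y $ 2) / s)))"
    unfolding fourier_def e
    by (subst integral_prod2[OF i1 i1], unfold gauss_fourier_affine(2)[OF s])
       (simp add: power2_eq_square field_simps flip: of_real_mult)
qed

text \<open>The substitution z = (n + 1) (x - y) moves the dependence on \<open>n\<close> into the
  indicator, with one fixed Gaussian as majorant. At an endpoint of a proper interval the limit
  would be half the inner value, hence the strict inequalities.\<close>

lemma integral_gauss_interval_tendsto:
  fixes a b x :: real
  defines "K \<equiv> (\<lambda>n. \<integral>y. indicator {a..b} y * gauss (real (Suc n) * (x - y)) \<partial>lborel)"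
  shows "a < x \<Longrightarrow> x < b \<Longrightarrow> (\<lambda>n. real (Suc n) * K n) \<longlonglongrightarrow> sqrt (2 * pi)"
    and "x < a \<or> b < x \<Longrightarrow> (\<lambda>n. real (Suc n) * K n) \<longlonglongrightarrow> 0"
    and "\<bar>real (Suc n) * K n\<bar> \<le> sqrt (2 * pi)"
proof -
  have K: "real (Suc n) * K n = (\<integral>z. indicator {a..b} (x - z / real (Suc n)) * gauss z \<partial>lborel)" for n
  proof -
    have "K n = (1 / real (Suc n)) * (\<integral>z. indicator {a..b} (x + (- 1 / real (Suc n)) * z)
         * gauss (real (Suc n) * (x - (x + (- 1 / real (Suc n)) * z))) \<partial>lborel)"
      unfolding K_def by (subst lborel_integral_real_affine[where c = "- 1 / real (Suc n)" and t = x]) auto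
    moreover have "real (Suc n) * (x - (x + (- 1 / real (Suc n)) * z)) = z" for z by simp
    ultimately show ?thesis by (simp del: of_nat_Suc)
  qed
  have lim: "(\<lambda>n. x - z / real (Suc n)) \<longlonglongrightarrow> x - z * 0" for z :: real
    unfolding divide_inverse by (intro tendsto_intros LIMSEQ_inverse_real_of_nat)
  { fix L :: real
    assume ev: "\<And>z. \<forall>\<^sub>F n in sequentially. indicator {a..b} (x - z / real (Suc n)) = L"
    have "(\<lambda>n. (\<integral>z. indicator {a..b} (x - z / real (Suc n)) * gauss z \<partial>lborel)) \<longlonglongrightarrow> (\<integral>z. L * gauss z \<partial>lborel)"
    proof (rule integral_dominated_convergence[where w = gauss])
      show "AE z in lborel. (\<lambda>n. indicator {a..b} (x - z / real (Suc n)) * gauss z) \<longlonglongrightarrow> L * gauss z"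
        by (intro AE_I2 tendsto_mult tendsto_const tendsto_eventually ev)
      show "AE z in lborel. norm (indicator {a..b} (x - z / real (Suc n)) * gauss z) \<le> gauss z" for n
        using gauss_pos by (auto simp: indicator_def less_imp_le)
    qed (auto simp: integrable_gauss)
    then have "(\<lambda>n. real (Suc n) * K n) \<longlonglongrightarrow> L * sqrt (2 * pi)"
      unfolding K by (simp add: integral_gauss)
  } note main = this
  show "(\<lambda>n. real (Suc n) * K n) \<longlonglongrightarrow> sqrt (2 * pi)" if "a < x" "x < b"
  proof -
    have "\<forall>\<^sub>F n in sequentially. indicator {a..b} (x - z / real (Suc n)) = (1::real)" for z
      using order_tendstoD(1)[OF lim[of z, simplified], of a] order_tendstoD(2)[OF lim[of z, simplified], of b] that
      by (simp, elim eventually_elim2) (auto simp: indicator_def)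
    from main[OF this] show ?thesis by simp
  qed
  show "(\<lambda>n. real (Suc n) * K n) \<longlonglongrightarrow> 0" if "x < a \<or> b < x"
  proof -
    have "\<forall>\<^sub>F n in sequentially. indicator {a..b} (x - z / real (Suc n)) = (0::real)" for z
      using that
    proof
      assume "x < a"
      with order_tendstoD(2)[OF lim[of z, simplified], of a] show ?thesis
        by (simp, elim eventually_mono) (auto simp: indicator_def)
    next
      assume "b < x"
      with order_tendstoD(1)[OF lim[of z, simplified], of b] show ?thesis
        by (simp, elim eventually_mono) (auto simp: indicator_def)
    qed
    from main[OF this] show ?thesis by simp
  qed
  have "\<bar>\<integral>z. indicator {a..b} (x - z / real (Suc n)) * gauss z \<partial>lborel\<bar> \<le> (\<integral>z. gauss z \<partial>lborel)"
  proof (rule order_trans[OF integral_abs_bound], rule integral_mono)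
    show "integrable lborel (\<lambda>z. \<bar>indicator {a..b} (x - z / real (Suc n)) * gauss z\<bar>)"
      by (rule Bochner_Integration.integrable_bound[OF integrable_gauss])
         (use gauss_pos in \<open>auto simp: indicator_def less_imp_le\<close>)
  qed (use gauss_pos in \<open>auto simp: indicator_def less_imp_le integrable_gauss\<close>)
  then show "\<bar>real (Suc n) * K n\<bar> \<le> sqrt (2 * pi)"
    unfolding K integral_gauss .
qed

lemma tendsto_indicator_box2:
  fixes a b x :: "real ^ 2"
  assumes x: "x \<notin> cbox a b - box a b"
  defines "K \<equiv> (\<lambda>n i. real (Suc n) * (\<integral>y. indicator {a $ i..b $ i} y * gauss (real (Suc n) * (x $ i - y)) \<partial>lborel))"
  shows "(\<lambda>n. K n 1 * K n 2) \<longlonglongrightarrow> 2 * pi * indicator (box a b) x"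
proof -
  note T = integral_gauss_interval_tendsto
  have bnd: "norm (K n i) \<le> sqrt (2 * pi)" for n i
    unfolding K_def real_norm_def by (rule T(3))
  have z: "(\<lambda>n. K n 1 * K n 2) \<longlonglongrightarrow> 0" if "(\<lambda>n. K n i) \<longlonglongrightarrow> 0" for i
  proof (rule tendsto_0_le[OF that])
    have "norm (K n 1 * K n 2) \<le> norm (K n i) * sqrt (2 * pi)" for n
      using exhaust_2[of i] mult_left_mono[OF bnd[of n 2], of "norm (K n 1)"] mult_left_mono[OF bnd[of n 1], of "norm (K n 2)"]
      by (auto simp: abs_mult mult.commute)
    then show "\<forall>\<^sub>F n in sequentially. norm (K n 1 * K n 2) \<le> norm (K n i) * sqrt (2 * pi)" by simp
  qed
  show ?thesis
  proof (cases "x \<in> box a b")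
    case True
    then have "(\<lambda>n. K n i) \<longlonglongrightarrow> sqrt (2 * pi)" for i
      unfolding K_def by (intro T(1)) (auto simp: mem_box_cart)
    from tendsto_mult[OF this[of 1] this[of 2]] True show ?thesis by simp
  next
    case False
    then obtain i where "x $ i < a $ i \<or> b $ i < x $ i"
      using x by (auto simp: mem_box_cart not_le)
    then have "(\<lambda>n. K n i) \<longlonglongrightarrow> 0" unfolding K_def by (intro T(2))
    from z[OF this] False show ?thesis by simp
  qed
qed

text \<open>Dynkin's argument: boxes are stable under intersection and generate the Borel sets, and
  the sets over which \<open>h\<close> integrates to 0 are closed under disjoint unions and, by the
  vanishing total integral, under complements.\<close>

lemma set_integral_zero_imp_AE_zero:
  fixes h :: "real ^ 2 \<Rightarrow> complex"
  assumes h: "integrable lborel h" and 0: "(\<integral>x. h x \<partial>lborel) = 0"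
    and box: "\<And>a b. (\<integral>x. h x * indicator (box a b) x \<partial>lborel) = 0"
  shows "AE x in lborel. h x = 0"
proof -
  have hs: "set_integrable lborel A h" if "A \<in> sets borel" for A
    using that h by (auto simp: set_integrable_def intro: integrable_mult_indicator)
  have "set_lebesgue_integral lborel A h = 0" if "A \<in> sets borel" for A
  proof -
    have 1: "A \<in> sigma_sets UNIV (range (\<lambda>(a, b). box a b :: (real ^ 2) set))"
      using that by (simp add: borel_eq_box)
    have 2: "Int_stable (range (\<lambda>(a, b). box a b :: (real ^ 2) set))"
      by (auto simp: Int_stable_def box_Int_box)
    have 3: "range (\<lambda>(a, b). box a b :: (real ^ 2) set) \<subseteq> Pow UNIV" by simp
    from 2 3 1 show ?thesis
    proof (induction rule: sigma_sets_induct_disjoint)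
      case (basic A)
      then show ?case using box
        by (auto simp: set_lebesgue_integral_def scaleR_conv_of_real mult.commute of_real_indicator)
    next
      case empty
      then show ?case by (simp add: set_lebesgue_integral_def)
    next
      case (compl A)
      then have "A \<in> sets borel" by (simp add: borel_eq_box)
      then have "set_lebesgue_integral lborel (A \<union> (UNIV - A)) h
          = set_lebesgue_integral lborel A h + set_lebesgue_integral lborel (UNIV - A) h"
        by (intro set_integral_Un hs) auto
      then show ?case using compl 0 by (simp add: set_lebesgue_integral_def)
    next
      case (union A)
      then have A: "range A \<subseteq> sets borel" by (simp add: borel_eq_box)
      have "set_lebesgue_integral lborel (\<Union>i. A i) h = suminf (\<lambda>i. set_lebesgue_integral lborel (A i) h)"
        using A union by (intro lebesgue_integral_countable_add hs) (auto simp: disjoint_family_on_def)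
      then show ?case using union by simp
    qed
  qed
  then show ?thesis
    using sigma_finite_measure.density_unique_banach[OF sigma_finite_lborel h, of "\<lambda>_. 0"] by (simp add: set_lebesgue_integral_def)
qed

text \<open>By the multiplication formula a vanishing transform means orthogonality to every
  translated Gaussian. Averaging the translates over a box and narrowing them recovers the indicator
  of the box almost everywhere.\<close>

theorem fourier_zero_imp_AE_zero:
  fixes h :: "real ^ 2 \<Rightarrow> complex"
  assumes h: "integrable lborel h" and z: "\<And>u. fourier h u = 0"
  shows "AE x in lborel. h x = 0"
proof (rule set_integral_zero_imp_AE_zero[OF h])
  show "(\<integral>x. h x \<partial>lborel) = 0" using z[of 0] by (simp add: fourier_def)
  have [measurable]: "h \<in> borel_measurable borel" using borel_measurable_integrable[OF h] by simp
  have gauss0: "(\<integral>x. h x * of_real (gauss (c * (x $ 1 - y $ 1)) * gauss (c * (x $ 2 - y $ 2))) \<partial>lborel) = 0"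
    if c: "c > 0" for c and y :: "real ^ 2"
  proof -
    define s where "s = 1 / c"
    have s: "s > 0" "c = 1 / s" using c by (auto simp: s_def)
    define g where "g = (\<lambda>u::real^2. of_real (gauss (s * u $ 1) * gauss (s * u $ 2)) * exp (\<i> * of_real (u \<bullet> y)))"
    have g: "integrable lborel g" unfolding g_def by (rule fourier_gauss2(1)[OF s(1)])
    have fg: "fourier g x = of_real (2 * pi / s\<^sup>2) * of_real (gauss (c * (x $ 1 - y $ 1)) * gauss (c * (x $ 2 - y $ 2)))" for x
      unfolding g_def fourier_gauss2(2)[OF s(1)] s(2) by simp
    have "0 = (\<integral>x. h x * fourier g x \<partial>lborel)"
      unfolding fourier_multiplication_formula[OF h g] z by simp
    also have "\<dots> = of_real (2 * pi / s\<^sup>2) * (\<integral>x. h x * of_real (gauss (c * (x $ 1 - y $ 1)) * gauss (c * (x $ 2 - y $ 2))) \<partial>lborel)"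
      unfolding fg by (subst integral_mult_right_zero[symmetric]) (simp add: mult_ac)
    finally show ?thesis using s(1) by simp
  qed
  fix a b :: "real ^ 2"
  define K where "K = (\<lambda>n (i::2) t. real (Suc n) * (\<integral>y. indicator {a $ i..b $ i} y * gauss (real (Suc n) * (t - y)) \<partial>lborel))"
  have Kb: "\<bar>K n i t\<bar> \<le> sqrt (2 * pi)" for n i t
    unfolding K_def by (rule integral_gauss_interval_tendsto(3))
  have [measurable]: "K n i \<in> borel_measurable borel" for n i
    unfolding K_def by measurable
  \<comment> \<open>After exchanging the integrals, the inner one over \<open>x\<close> is 0 for
    each centre \<open>y\<close> by \<open>gauss0\<close>.\<close>
  have K0: "(\<integral>x. h x * of_real (K n 1 (x $ 1) * K n 2 (x $ 2)) \<partial>lborel) = 0" for n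
  proof -
    define c where "c = real (Suc n)"
    have c: "c > 0" by (simp add: c_def)
    define I where "I = (\<lambda>y::real^2. complex_of_real (indicator {a $ 1..b $ 1} (y $ 1)) * of_real (indicator {a $ 2..b $ 2} (y $ 2)))"
    define G where "G = (\<lambda>(x::real^2) (y::real^2). complex_of_real (gauss (c * (x $ 1 - y $ 1)) * gauss (c * (x $ 2 - y $ 2))))"
    have I: "integrable lborel I" unfolding I_def
      by (intro integrable_prod2 integrable_of_real integrable_real_indicator) (auto simp: emeasure_lborel_Icc_eq)
    have i: "integrable (lborel \<Otimes>\<^sub>M lborel) (\<lambda>p. h (fst p) * I (snd p) * G (fst p) (snd p))"
    proof (rule integrable_times_bounded[OF integrable_pair_mult[OF h I], where C = 1])
      show "(\<lambda>p. G (fst p) (snd p)) \<in> borel_measurable (lborel \<Otimes>\<^sub>M lborel)" unfolding G_def by measurable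
      show "cmod (G (fst p) (snd p)) \<le> 1" for p
        unfolding G_def norm_of_real abs_mult
        by (intro mult_le_one) (simp_all add: gauss_le_1 less_imp_le gauss_pos)
    qed
    have inner: "(\<integral>y. h x * I y * G x y \<partial>lborel) = h x * of_real (K n 1 (x $ 1) * K n 2 (x $ 2)) / c\<^sup>2" for x
    proof -
      have i1: "integrable lborel (\<lambda>t. complex_of_real (indicator {l..u} t * gauss (c * (w - t))))" for l u w :: real
      proof (rule integrable_of_real, rule Bochner_Integration.integrable_bound)
        show "integrable lborel (indicator {l..u} :: real \<Rightarrow> real)"
          by (simp add: integrable_real_indicator emeasure_lborel_Icc_eq)
        show "AE t in lborel. norm (indicator {l..u} t * gauss (c * (w - t))) \<le> norm (indicator {l..u} t :: real)"
          using gauss_le_1 by (auto simp: indicator_def less_imp_le[OF gauss_pos])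
      qed auto
      have "(\<integral>y. h x * I y * G x y \<partial>lborel) = h x * (\<integral>y. of_real (indicator {a $ 1..b $ 1} (y $ 1) * gauss (c * (x $ 1 - y $ 1)))
             * of_real (indicator {a $ 2..b $ 2} (y $ 2) * gauss (c * (x $ 2 - y $ 2))) \<partial>(lborel :: (real ^ 2) measure))"
        unfolding I_def G_def by (subst integral_mult_right_zero[symmetric]) (simp add: mult_ac)
      also have "\<dots> = h x * (of_real (K n 1 (x $ 1)) / c * (of_real (K n 2 (x $ 2)) / c))"
        unfolding K_def c_def[symmetric] using c by (subst integral_prod2[OF i1 i1], unfold integral_complex_of_real) simp
      finally show ?thesis by (simp add: power2_eq_square)
    qed
    have "(\<integral>x. \<integral>y. h x * I y * G x y \<partial>lborel \<partial>lborel) = (\<integral>y. \<integral>x. h x * I y * G x y \<partial>lborel \<partial>lborel)"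
      using lborel_pair.Fubini_integral[of "\<lambda>x y. h x * I y * G x y"] i by (simp add: split_beta')
    also have "(\<lambda>y. \<integral>x. h x * I y * G x y \<partial>lborel) = (\<lambda>y. I y * (\<integral>x. h x * G x y \<partial>lborel))"
      by (subst integral_mult_right_zero[symmetric]) (simp add: mult_ac)
    also have "(\<integral>y. I y * (\<integral>x. h x * G x y \<partial>lborel) \<partial>lborel) = 0"
      unfolding G_def using gauss0[OF c] by simp
    finally show ?thesis unfolding inner using c by simp
  qed
  have "(\<lambda>n. (\<integral>x. h x * of_real (K n 1 (x $ 1) * K n 2 (x $ 2)) \<partial>lborel))
     \<longlonglongrightarrow> (\<integral>x. h x * of_real (2 * pi * indicator (box a b) x) \<partial>lborel)"
  proof (rule integral_dominated_convergence[where w = "\<lambda>x. 2 * pi * cmod (h x)"])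
    show "integrable lborel (\<lambda>x. 2 * pi * cmod (h x))" using h by simp
    have "AE x in lborel. x \<notin> cbox a b - box a b" by (rule AE_not_in[OF null_sets_cbox_Diff_box])
    then show "AE x in lborel. (\<lambda>n. h x * of_real (K n 1 (x $ 1) * K n 2 (x $ 2)))
       \<longlonglongrightarrow> h x * of_real (2 * pi * indicator (box a b) x)"
    proof (eventually_elim)
      case (elim x)
      from tendsto_indicator_box2[OF this] show ?case
        unfolding K_def by (rule tendsto_mult[OF tendsto_const tendsto_of_real])
    qed
    have "\<bar>K n 1 s * K n 2 t\<bar> \<le> 2 * pi" for n s t
      using mult_mono[OF Kb[of n 1 s] Kb[of n 2 t]] by (simp add: abs_mult)
    then show "AE x in lborel. norm (h x * of_real (K n 1 (x $ 1) * K n 2 (x $ 2))) \<le> 2 * pi * cmod (h x)" for n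
      unfolding norm_mult norm_of_real by (auto simp: mult.commute intro!: mult_left_mono)
  qed auto
  then have "(\<integral>x. h x * of_real (2 * pi * indicator (box a b) x) \<partial>lborel) = 0"
    unfolding K0 by (simp add: LIMSEQ_const_iff)
  also have "(\<integral>x. h x * of_real (2 * pi * indicator (box a b) x) \<partial>lborel)
      = 2 * pi * (\<integral>x. h x * indicator (box a b) x \<partial>lborel)"
    by (subst integral_mult_right_zero[symmetric]) (simp add: mult_ac of_real_indicator)
  finally show "(\<integral>x. h x * indicator (box a b) x \<partial>lborel) = 0" by simp
qed

subsection \<open>Square integrable functions\<close>

lemma L2_measurable: "f \<in> L2 \<Longrightarrow> f \<in> borel_measurable borel"
  by (simp add: L2_def)

lemma L2_iff_normsq: "f \<in> L2 \<longleftrightarrow> f \<in> borel_measurable borel \<and> L2_normsq f < \<infinity>"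
  unfolding L2_def L2_normsq_def by (auto simp: integrable_iff_bounded)

lemma L2_normsq_add_le:
  assumes "f \<in> borel_measurable borel" "g \<in> borel_measurable borel"
  shows "L2_normsq (\<lambda>x. f x + g x) \<le> 2 * L2_normsq f + 2 * L2_normsq g"
proof -
  note [measurable] = assms
  have "(cmod (f x + g x))\<^sup>2 \<le> 2 * (cmod (f x))\<^sup>2 + 2 * (cmod (g x))\<^sup>2" for x
  proof -
    have "(cmod (f x + g x))\<^sup>2 \<le> (cmod (f x) + cmod (g x))\<^sup>2"
      by (intro power_mono norm_triangle_ineq) auto
    also have "\<dots> \<le> 2 * (cmod (f x))\<^sup>2 + 2 * (cmod (g x))\<^sup>2"
      using sum_squares_bound[of "cmod (f x)" "cmod (g x)"] by (simp add: power2_sum)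
    finally show ?thesis .
  qed
  then have "L2_normsq (\<lambda>x. f x + g x) \<le> (\<integral>\<^sup>+x. ennreal (2 * (cmod (f x))\<^sup>2 + 2 * (cmod (g x))\<^sup>2) \<partial>lborel)"
    unfolding L2_normsq_def by (intro nn_integral_mono ennreal_leI)
  also have "\<dots> = 2 * L2_normsq f + 2 * L2_normsq g"
    unfolding L2_normsq_def
    by (simp add: ennreal_plus ennreal_mult' nn_integral_add nn_integral_cmult del: ennreal_plus[symmetric])
  finally show ?thesis .
qed

lemma L2_normsq_minus: "L2_normsq (\<lambda>x. - f x) = L2_normsq f"
  by (simp add: L2_normsq_def)

lemma L2_normsq_diff_le:
  assumes "f \<in> borel_measurable borel" "g \<in> borel_measurable borel"
  shows "L2_normsq (\<lambda>x. f x - g x) \<le> 2 * L2_normsq f + 2 * L2_normsq g"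
  using L2_normsq_add_le[of f "\<lambda>x. - g x"] assms by (simp add: L2_normsq_minus)

lemma L2_diff: "f \<in> L2 \<Longrightarrow> g \<in> L2 \<Longrightarrow> (\<lambda>x. f x - g x) \<in> L2"
  unfolding L2_iff_normsq
  by (intro conjI le_less_trans[OF L2_normsq_diff_le]) (auto simp: ennreal_mult_less_top)

lemma nn_integral_mult_le_L2:
  assumes "f \<in> borel_measurable borel" "g \<in> borel_measurable borel"
  shows "(\<integral>\<^sup>+x. ennreal (cmod (f x * g x)) \<partial>lborel)\<^sup>2 \<le> L2_normsq f * L2_normsq g"
proof -
  note [measurable] = assms
  show ?thesis
    using Cauchy_Schwarz_nn_integral[of "\<lambda>x. ennreal (cmod (f x))" lborel "\<lambda>x. ennreal (cmod (g x))"]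
    by (simp add: L2_normsq_def norm_mult ennreal_mult ennreal_power)
qed

lemma L2_mult_integrable:
  assumes f: "f \<in> L2" and g: "g \<in> L2"
  shows "integrable lborel (\<lambda>x. f x * g x)"
proof -
  have [measurable]: "f \<in> borel_measurable borel" "g \<in> borel_measurable borel"
    using f g by (auto simp: L2_measurable)
  have "(\<integral>\<^sup>+x. ennreal (cmod (f x * g x)) \<partial>lborel)\<^sup>2 < \<infinity>"
    using f g by (intro le_less_trans[OF nn_integral_mult_le_L2]) (auto simp: L2_iff_normsq ennreal_mult_less_top)
  then show ?thesis
    by (auto simp: integrable_iff_bounded power2_eq_square ennreal_mult_less_top less_top)
qed

lemma ennreal_tendsto_0_le:
  fixes f g :: "'i \<Rightarrow> ennreal"
  assumes "\<And>n. f n \<le> g n" "(g \<longlongrightarrow> 0) F"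
  shows "(f \<longlongrightarrow> 0) F"
  by (rule tendsto_sandwich[OF _ _ tendsto_const assms(2)]) (simp_all add: assms(1))

lemma integral_mult_tendsto_0:
  assumes f: "\<And>n. f n \<in> L2" and g: "g \<in> L2" and lim: "(\<lambda>n. L2_normsq (f n)) \<longlonglongrightarrow> 0"
  shows "(\<lambda>n. (\<integral>x. f n x * g x \<partial>lborel)) \<longlonglongrightarrow> 0"
proof -
  have [measurable]: "f n \<in> borel_measurable borel" "g \<in> borel_measurable borel" for n
    using f g by (auto simp: L2_measurable)
  obtain C where C: "L2_normsq g = ennreal C" "C \<ge> 0"
    using g by (cases "L2_normsq g") (auto simp: L2_iff_normsq)
  have "(\<lambda>n. L2_normsq (f n) * ennreal C) \<longlonglongrightarrow> 0 * ennreal C"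
    by (intro tendsto_mult_ennreal lim tendsto_const) auto
  then have "(\<lambda>n. L2_normsq (f n) * ennreal C) \<longlonglongrightarrow> 0" by simp
  moreover have "ennreal ((cmod (\<integral>x. f n x * g x \<partial>lborel))\<^sup>2) \<le> L2_normsq (f n) * ennreal C" for n
  proof -
    have "ennreal (cmod (\<integral>x. f n x * g x \<partial>lborel)) \<le> (\<integral>\<^sup>+x. ennreal (cmod (f n x * g x)) \<partial>lborel)"
      by (rule integral_norm_bound_ennreal[OF L2_mult_integrable[OF f g]])
    then have "(ennreal (cmod (\<integral>x. f n x * g x \<partial>lborel)))\<^sup>2 \<le> (\<integral>\<^sup>+x. ennreal (cmod (f n x * g x)) \<partial>lborel)\<^sup>2"
      by (intro power_mono) auto
    also have "\<dots> \<le> L2_normsq (f n) * ennreal C"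
      using nn_integral_mult_le_L2[of "f n" g] C by simp
    finally show ?thesis by (simp add: ennreal_power)
  qed
  ultimately have "(\<lambda>n. ennreal ((cmod (\<integral>x. f n x * g x \<partial>lborel))\<^sup>2)) \<longlonglongrightarrow> 0"
    by (rule ennreal_tendsto_0_le[rotated])
  then have "(\<lambda>n. (cmod (\<integral>x. f n x * g x \<partial>lborel))\<^sup>2) \<longlonglongrightarrow> 0"
    by (subst (asm) tendsto_ennreal_iff[where x = 0, simplified]) auto
  then have "(\<lambda>n. sqrt ((cmod (\<integral>x. f n x * g x \<partial>lborel))\<^sup>2)) \<longlonglongrightarrow> sqrt 0"
    by (rule tendsto_real_sqrt)
  then show ?thesis by (simp add: tendsto_norm_zero_iff)
qed

lemma L2_normsq_tendsto_0_diff: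
  assumes "\<And>n. f n \<in> L2" "\<And>n. g n \<in> L2"
    and "(\<lambda>n. L2_normsq (f n)) \<longlonglongrightarrow> 0" "(\<lambda>n. L2_normsq (g n)) \<longlonglongrightarrow> 0"
  shows "(\<lambda>n. L2_normsq (\<lambda>x. f n x - g n x)) \<longlonglongrightarrow> 0"
proof (rule tendsto_sandwich[OF _ _ tendsto_const])
  have "(\<lambda>n. 2 * L2_normsq (f n) + 2 * L2_normsq (g n)) \<longlonglongrightarrow> 2 * 0 + 2 * 0"
    by (intro tendsto_add tendsto_mult_ennreal tendsto_const assms) auto
  then show "(\<lambda>n. 2 * L2_normsq (f n) + 2 * L2_normsq (g n)) \<longlonglongrightarrow> 0" by simp
qed (use assms in \<open>auto intro!: always_eventually L2_normsq_diff_le L2_measurable\<close>)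

lemma L2_normsq_cong_AE: "(AE x in lborel. f x = g x) \<Longrightarrow> L2_normsq f = L2_normsq g"
  unfolding L2_normsq_def by (rule nn_integral_cong_AE) auto

section \<open>Injectivity of the L_2 Fourier transform\<close>

lemma fourier_measurable:
  fixes f :: "real ^ 2 \<Rightarrow> complex"
  assumes "f \<in> borel_measurable borel"
  shows "fourier f \<in> borel_measurable borel"
proof -
  note [measurable] = assms
  have [measurable]: "(\<lambda>p. exp (- \<i> * complex_of_real (fst p \<bullet> (snd p::real^2)))) \<in> borel_measurable (lborel \<Otimes>\<^sub>M lborel)"
    by (simp add: lborel_prod del: minus_mult_minus) (intro borel_measurable_continuous_onI continuous_intros)
  have "(\<lambda>u. \<integral>x. f x * exp (- \<i> * complex_of_real (u \<bullet> x)) \<partial>lborel) \<in> borel_measurable lborel"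
    by (rule lborel.borel_measurable_lebesgue_integral) (simp add: split_beta', measurable)
  then show ?thesis by (simp add: fourier_def[abs_def])
qed

text \<open>Testing \<open>f - f'\<close> against modulated Gaussians shows that its product with a Gaussian, which
  is integrable, has vanishing Fourier transform.\<close>
theorem L2_fourier_inject:
  fixes f f' :: "real ^ 2 \<Rightarrow> complex"
  assumes "L2_fourier f g" "L2_fourier f' g"
  shows "AE x in lborel. f x = f' x"
proof -
  from assms(1) obtain h where f: "f \<in> L2" and g: "g \<in> L2"
    and h: "\<And>n. integrable lborel (h n)" "\<And>n. h n \<in> L2"
      "(\<lambda>n. L2_normsq (\<lambda>x. h n x - f x)) \<longlonglongrightarrow> 0" "(\<lambda>n. L2_normsq (\<lambda>u. fourier (h n) u - g u)) \<longlonglongrightarrow> 0"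
    by (auto simp: L2_fourier_def)
  from assms(2) obtain h' where f': "f' \<in> L2"
    and h': "\<And>n. integrable lborel (h' n)" "\<And>n. h' n \<in> L2"
      "(\<lambda>n. L2_normsq (\<lambda>x. h' n x - f' x)) \<longlonglongrightarrow> 0" "(\<lambda>n. L2_normsq (\<lambda>u. fourier (h' n) u - g u)) \<longlonglongrightarrow> 0"
    by (auto simp: L2_fourier_def)
  define D where "D = (\<lambda>x. f x - f' x)"
  \<comment> \<open>Both approximating sequences have the limit \<open>g\<close> on the Fourier
    side, so the transforms of their differences tend to 0 while the differences tend to
    \<open>D\<close>.\<close>
  define p where "p = (\<lambda>n x. h n x - h' n x)"
  have D: "D \<in> L2" unfolding D_def by (intro L2_diff f f')
  have pi: "integrable lborel (p n)" and pL2: "p n \<in> L2" for n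
    unfolding p_def by (intro Bochner_Integration.integrable_diff L2_diff h h')+
  have pD: "(\<lambda>n. L2_normsq (\<lambda>x. p n x - D x)) \<longlonglongrightarrow> 0"
    using L2_normsq_tendsto_0_diff[of "\<lambda>n x. h n x - f x" "\<lambda>n x. h' n x - f' x"]
    by (simp add: h h' f f' L2_diff p_def D_def algebra_simps)
  define N where "N = (\<lambda>n. L2_normsq (fourier (p n)))"
  have ev: "\<forall>\<^sub>F n in sequentially. N n \<le> 2 * L2_normsq (\<lambda>u. fourier (h n) u - g u) + 2 * L2_normsq (\<lambda>u. fourier (h' n) u - g u)"
  proof (intro always_eventually allI)
    fix n
    have eq: "fourier (p n) = (\<lambda>u. (fourier (h n) u - g u) - (fourier (h' n) u - g u))"
      unfolding p_def by (auto simp: fourier_diff h h')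
    show "N n \<le> 2 * L2_normsq (\<lambda>u. fourier (h n) u - g u) + 2 * L2_normsq (\<lambda>u. fourier (h' n) u - g u)"
      unfolding N_def eq using L2_measurable[OF g] L2_measurable[OF h(2)] L2_measurable[OF h'(2)]
      by (intro L2_normsq_diff_le borel_measurable_diff fourier_measurable)
  qed
  have lim: "(\<lambda>n. 2 * L2_normsq (\<lambda>u. fourier (h n) u - g u) + 2 * L2_normsq (\<lambda>u. fourier (h' n) u - g u)) \<longlonglongrightarrow> 2 * 0 + 2 * 0"
    by (intro tendsto_add tendsto_mult_ennreal tendsto_const h h') auto
  have N0: "N \<longlonglongrightarrow> 0"
  proof (rule tendsto_sandwich[OF _ ev tendsto_const])
    show "\<forall>\<^sub>F n in sequentially. 0 \<le> N n" by simp
    show "(\<lambda>n. 2 * L2_normsq (\<lambda>u. fourier (h n) u - g u) + 2 * L2_normsq (\<lambda>u. fourier (h' n) u - g u)) \<longlonglongrightarrow> 0"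
      using lim by simp
  qed
  \<comment> \<open>Convergence to 0 makes the norms finite from some index on only; earlier
    transforms may fail to be square integrable and are skipped.\<close>
  obtain n0 where n0: "\<And>n. n \<ge> n0 \<Longrightarrow> N n < \<infinity>"
    using order_tendstoD(2)[OF N0, of \<infinity>] unfolding eventually_sequentially by auto
  define E where "E = (\<lambda>x::real^2. complex_of_real (gauss (x $ 1) * gauss (x $ 2)))"
  have [measurable]: "E \<in> borel_measurable borel" "D \<in> borel_measurable borel"
    using D by (auto simp: E_def L2_measurable)
  have E_le: "cmod (E x) \<le> 1" for x
    unfolding E_def norm_of_real abs_mult
    by (intro mult_le_one) (simp_all add: gauss_le_1 less_imp_le gauss_pos)
  have L2E: "(\<lambda>x. E x * w x) \<in> L2" if [measurable]: "w \<in> borel_measurable borel" and w: "\<And>x. cmod (w x) = 1" for w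
  proof -
    have iE: "integrable lborel E"
      using integrable_prod2[of "\<lambda>x. complex_of_real (gauss x)" "\<lambda>x. complex_of_real (gauss x)"] integrable_gauss
      by (simp add: E_def)
    have "integrable lborel (\<lambda>x. (cmod (E x * w x))\<^sup>2)"
    proof (rule Bochner_Integration.integrable_bound[of _ "\<lambda>x. cmod (E x)"])
      show "AE x in lborel. norm ((cmod (E x * w x))\<^sup>2) \<le> norm (cmod (E x))"
        using E_le by (auto simp: norm_mult w power2_eq_square intro!: mult_left_le)
    qed (use iE in auto)
    then show ?thesis by (simp add: L2_def)
  qed
  have "AE x in lborel. D x * E x = 0"
  proof (rule fourier_zero_imp_AE_zero)
    show "integrable lborel (\<lambda>x. D x * E x)"
      using L2_mult_integrable[OF D L2E[of "\<lambda>_. 1"]] by simp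
    fix v :: "real ^ 2"
    define e where "e = (\<lambda>u::real^2. complex_of_real (gauss (1 * u $ 1) * gauss (1 * u $ 2)) * exp (\<i> * of_real (u \<bullet> (0::real^2))))"
    \<comment> \<open>At scale 1 the Gaussian reproduces itself up to a factor, so its translate by
      \<open>v\<close> has a multiple of the modulated Gaussian \<open>W\<close> as its
      transform.\<close>
    define ev where "ev = (\<lambda>u. e (u - v))"
    define W where "W = (\<lambda>x::real^2. E x * exp (- \<i> * of_real (v \<bullet> x)))"
    have eE: "e = E" by (simp add: e_def E_def)
    have W: "W \<in> L2" unfolding W_def by (rule L2E) auto
    have ei: "integrable lborel E"
      using fourier_gauss2(1)[of 1 0] unfolding e_def[symmetric] eE by simp
    have shift: "integrable lborel (\<lambda>u. k (u - v))" "(\<integral>u. k (u - v) \<partial>lborel) = (\<integral>u. k u \<partial>lborel)"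
      if k: "integrable lborel k" for k :: "real ^ 2 \<Rightarrow> complex"
    proof -
      have [measurable]: "k \<in> borel_measurable borel" using borel_measurable_integrable[OF k] by simp
      have "integrable (distr lborel borel ((+) (-v))) k" "integral\<^sup>L (distr lborel borel ((+) (-v))) k = (\<integral>u. k u \<partial>lborel)"
        using k by (auto simp: lborel_distr_plus)
      then show "integrable lborel (\<lambda>u. k (u - v))" "(\<integral>u. k (u - v) \<partial>lborel) = (\<integral>u. k u \<partial>lborel)"
        by (auto simp: integrable_distr_eq integral_distr)
    qed
    have evi: "integrable lborel ev" unfolding ev_def eE by (rule shift(1)[OF ei])
    have "(\<lambda>x. E x * 1) \<in> L2" by (rule L2E) auto
    then have "integrable lborel (\<lambda>u. complex_of_real ((cmod (E u))\<^sup>2))"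
      by (subst complex_of_real_integrable_eq) (simp add: L2_def)
    from shift(1)[OF this] have "integrable lborel (\<lambda>u. (cmod (E (u - v)))\<^sup>2)"
      by (subst (asm) complex_of_real_integrable_eq)
    moreover have "ev \<in> borel_measurable borel" using borel_measurable_integrable[OF evi] by simp
    ultimately have evL2: "ev \<in> L2"
      by (simp add: L2_def ev_def eE)
    have fev: "fourier ev x = 2 * pi * W x" for x
    proof -
      have "fourier ev x = (\<integral>u. (\<lambda>u. exp (- \<i> * of_real (v \<bullet> x)) * (E u * exp (- \<i> * of_real (x \<bullet> u)))) (u - v) \<partial>lborel)"
        unfolding fourier_def ev_def eE
        by (intro Bochner_Integration.integral_cong refl)
           (simp add: inner_diff_right exp_diff exp_minus field_simps inner_commute algebra_simps)
      also have "\<dots> = exp (- \<i> * of_real (v \<bullet> x)) * fourier E x"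
        unfolding fourier_def
        using shift(2)[OF integrable_mult_right[OF integrable_fourier[OF ei, of x]], of "exp (- \<i> * of_real (v \<bullet> x))"]
      by simp
      also have "fourier E x = of_real (2 * pi) * E x"
        using fourier_gauss2(2)[of 1 0 x] unfolding e_def[symmetric] eE by (simp add: E_def)
      finally show ?thesis by (simp add: W_def mult_ac)
    qed
    have "(\<lambda>n. (\<integral>x. (p n x - D x) * W x \<partial>lborel)) \<longlonglongrightarrow> 0"
      by (intro integral_mult_tendsto_0 L2_diff pL2 D W pD)
    then have "(\<lambda>n. (\<integral>x. p n x * W x \<partial>lborel) - (\<integral>x. D x * W x \<partial>lborel)) \<longlonglongrightarrow> 0"
      by (simp add: left_diff_distrib Bochner_Integration.integral_diff L2_mult_integrable pL2 D W)
    then have l1: "(\<lambda>n. (\<integral>x. p n x * W x \<partial>lborel)) \<longlonglongrightarrow> (\<integral>x. D x * W x \<partial>lborel)"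
      by (simp add: LIM_zero_iff)
    have "(\<lambda>n. (\<integral>u. fourier (p (n + n0)) u * ev u \<partial>lborel)) \<longlonglongrightarrow> 0"
    proof (rule integral_mult_tendsto_0)
      show "fourier (p (n + n0)) \<in> L2" for n
        using n0[of "n + n0"] L2_measurable[OF pL2] by (auto simp: L2_iff_normsq N_def intro: fourier_measurable)
      show "(\<lambda>n. L2_normsq (fourier (p (n + n0)))) \<longlonglongrightarrow> 0"
        using LIMSEQ_ignore_initial_segment[OF N0, of n0] by (simp add: N_def)
    qed (rule evL2)
    then have "(\<lambda>n. (\<integral>x. p (n + n0) x * (2 * pi * W x) \<partial>lborel)) \<longlonglongrightarrow> 0"
      unfolding fourier_multiplication_formula[OF pi evi, symmetric] fev .
    then have "(\<lambda>n. (2 * pi) * (\<integral>x. p (n + n0) x * W x \<partial>lborel)) \<longlonglongrightarrow> 0"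
      by (subst integral_mult_right_zero[symmetric]) (simp add: mult.left_commute)
    then have "(\<lambda>n. (\<integral>x. p (n + n0) x * W x \<partial>lborel)) \<longlonglongrightarrow> 0"
      by (subst (asm) tendsto_mult_left_iff[where l = 0, simplified]) auto
    with LIMSEQ_ignore_initial_segment[OF l1, of n0] have "(\<integral>x. D x * W x \<partial>lborel) = 0"
      by (rule LIMSEQ_unique)
    then show "fourier (\<lambda>x. D x * E x) v = 0"
      by (simp add: fourier_def W_def mult_ac)
  qed
  then show ?thesis
    by eventually_elim (auto simp: E_def D_def gauss_def)
qed

section \<open>The box spline as an integral of products of hat functions\<close>

abbreviation uind :: "real \<Rightarrow> real" where "uind \<equiv> indicator {0..1}"

definition hat :: "real \<Rightarrow> real" where "hat t = max 0 (1 - \<bar>t - 1\<bar>)"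

lemma hat_nonneg: "0 \<le> hat t" and hat_le_1: "hat t \<le> 1"
  by (auto simp: hat_def)

lemma hat_nonzero: "hat t \<noteq> 0 \<Longrightarrow> 0 < t \<and> t < 2"
  by (auto simp: hat_def max_def split: if_splits)

lemma hat_zero: "t \<le> 0 \<or> 2 \<le> t \<Longrightarrow> hat t = 0"
  by (auto simp: hat_def)

lemma hat_measurable [measurable]: "hat \<in> borel_measurable borel"
  unfolding hat_def[abs_def] by measurable

text \<open>The doubled columns (1,0) and (0,1) give the tensor product of two hats, each the
  convolution of two unit intervals; the column (1,1) averages this product along the
  diagonal.\<close>

definition bspl :: "real ^ 2 \<Rightarrow> real" where
  "bspl x = (\<integral>t. uind t * (hat (x $ 1 - t) * hat (x $ 2 - t)) \<partial>lborel)"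

lemma integrable_box:
  fixes f :: "'a::euclidean_space \<Rightarrow> real"
  assumes [measurable]: "f \<in> borel_measurable borel"
    and B: "\<And>x. \<bar>f x\<bar> \<le> B" and supp: "\<And>x. f x \<noteq> 0 \<Longrightarrow> x \<in> cbox a b"
  shows "integrable lborel f"
proof (rule Bochner_Integration.integrable_bound)
  show "integrable lborel (\<lambda>x. B * indicator (cbox a b) x)"
    by (intro integrable_mult_right integrable_real_indicator) (auto simp: emeasure_lborel_cbox_finite[unfolded infinity_ennreal_def])
  show "AE x in lborel. norm (f x) \<le> norm (B * indicator (cbox a b) x)"
    using B supp by (intro AE_I2) (auto simp: indicator_def split: if_splits intro: order_trans[OF B abs_ge_self])
qed simp

text \<open>A bounded measurable function that vanishes off a box is integrable, which leaves only
  pointwise conditions and measurability to check at each exchange of integrals.\<close>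

lemma Fubini_box:
  fixes f :: "'a::euclidean_space \<Rightarrow> 'b::euclidean_space \<Rightarrow> real"
  assumes m: "(\<lambda>p. f (fst p) (snd p)) \<in> borel_measurable (borel \<Otimes>\<^sub>M borel)"
    and B: "\<And>x y. \<bar>f x y\<bar> \<le> B" and supp: "\<And>x y. f x y \<noteq> 0 \<Longrightarrow> x \<in> cbox a b \<and> y \<in> cbox c d"
  shows "(\<integral>x. \<integral>y. f x y \<partial>lborel \<partial>lborel) = (\<integral>y. \<integral>x. f x y \<partial>lborel \<partial>lborel)"
proof -
  have "integrable lborel (\<lambda>p. f (fst p) (snd p))"
  proof (rule integrable_box)
    show "(\<lambda>p. f (fst p) (snd p)) \<in> borel_measurable borel" using m by (simp add: borel_prod)
    show "p \<in> cbox (a, c) (b, d)" if "f (fst p) (snd p) \<noteq> 0" for p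
      using supp[OF that] by (cases p) (auto simp: cbox_Pair_eq)
  qed (rule B)
  then have "integrable (lborel \<Otimes>\<^sub>M lborel) (\<lambda>(x, y). f x y)"
    by (simp add: lborel_prod split_beta')
  from lborel_pair.Fubini_integral[OF this] show ?thesis by simp
qed

lemma integral_real_shift: "(\<integral>x. f (x - c) \<partial>lborel) = (\<integral>x. f x \<partial>lborel)"
  for f :: "real \<Rightarrow> 'a::{banach, second_countable_topology}"
  using lborel_integral_real_affine[of 1 f "-c"] by simp

lemma hat_eq_convolution: "(\<integral>s. uind s * uind (x - s) \<partial>lborel) = hat x"
proof -
  have "(\<lambda>s. uind s * uind (x - s)) = indicator {max 0 (x - 1)..min 1 x}"
    by (auto simp: indicator_def fun_eq_iff)
  then show ?thesis by (auto simp: hat_def measure_def emeasure_lborel_Icc_eq max_def min_def)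
qed

lemma bspl_nonneg: "bspl x \<ge> 0"
  unfolding bspl_def by (intro integral_nonneg_AE AE_I2) (auto simp: hat_nonneg)

lemma integrable_uind: "integrable lborel uind"
  by (simp add: integrable_real_indicator emeasure_lborel_Icc_eq)

lemma bspl_le_1: "bspl x \<le> 1"
proof -
  have le: "uind t * (hat (x $ 1 - t) * hat (x $ 2 - t)) \<le> uind t" for t
    using hat_nonneg hat_le_1 by (auto simp: indicator_def intro!: mult_le_one)
  have "bspl x \<le> (\<integral>t. uind t \<partial>lborel)"
    unfolding bspl_def
  proof (rule integral_mono[OF _ integrable_uind le])
    show "integrable lborel (\<lambda>t. uind t * (hat (x $ 1 - t) * hat (x $ 2 - t)))"
      by (rule Bochner_Integration.integrable_bound[OF integrable_uind])
         (use le hat_nonneg in \<open>auto simp: abs_of_nonneg\<close>)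
  qed
  then show ?thesis by simp
qed

lemma bspl_nonzero:
  assumes "bspl x \<noteq> 0"
  shows "0 < x $ i \<and> x $ i < 3"
proof (rule ccontr)
  assume "\<not> (0 < x $ i \<and> x $ i < 3)"
  then have z: "uind t * (hat (x $ 1 - t) * hat (x $ 2 - t)) = 0" for t
    using hat_zero[of "x $ i - t"] exhaust_2[of i] by (auto simp: indicator_def)
  have "bspl x = 0" unfolding bspl_def z by simp
  with assms show False by simp
qed

lemma bspl_support: "bspl x \<noteq> 0 \<Longrightarrow> x \<in> cbox 0 (\<chi> j. 3)"
  using bspl_nonzero[of x] by (auto simp: mem_box_cart less_imp_le)

lemma bspl_measurable [measurable]: "bspl \<in> borel_measurable borel"
proof -
  have "(\<lambda>x :: real ^ 2. \<integral>t. uind t * (hat (x $ 1 - t) * hat (x $ 2 - t)) \<partial>lborel) \<in> borel_measurable borel"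
    by (rule lborel.borel_measurable_lebesgue_integral) (simp add: split_beta', measurable)
  then show ?thesis by (simp add: bspl_def[abs_def])
qed

lemma integrable_bspl: "integrable lborel (\<lambda>x. complex_of_real (bspl x))"
  by (intro integrable_of_real integrable_box[OF _ _ bspl_support, where B = 1])
     (auto simp: abs_of_nonneg bspl_nonneg bspl_le_1)

subsection \<open>Its Fourier transform\<close>

abbreviation expn :: "real \<Rightarrow> complex" where "expn t \<equiv> exp (- \<i> * of_real t)"

lemma uind_fourier: "(\<integral>t. of_real (uind t) * expn (u * t) \<partial>lborel) = box_factor u"
proof (cases "u = 0")
  case True
  then show ?thesis by (simp add: box_factor_def integral_complex_of_real)
next
  case False
  define F where "F = (\<lambda>t. - expn (u * t) / (\<i> * of_real u))"
  have "(\<integral>t. indicator {0..1} t *\<^sub>R expn (u * t) \<partial>lborel) = F 1 - F 0"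
  proof (rule integral_FTC_Icc)
    show "(F has_vector_derivative expn (u * t)) (at t within {0..1})" for t
      unfolding F_def using False
      by (auto intro!: derivative_eq_intros has_vector_derivative_real_field simp: field_simps)
    show "continuous_on {0..1} (\<lambda>t. expn (u * t))" by (intro continuous_intros)
  qed simp
  then show ?thesis using False by (simp add: F_def box_factor_def scaleR_conv_of_real diff_divide_distrib)
qed

lemma Fubini_box_complex:
  fixes f :: "'a::euclidean_space \<Rightarrow> 'b::euclidean_space \<Rightarrow> real" and g :: "'a \<Rightarrow> complex"
  assumes m: "(\<lambda>p. f (fst p) (snd p)) \<in> borel_measurable (borel \<Otimes>\<^sub>M borel)"
    and g [measurable]: "g \<in> borel_measurable borel" and g1: "\<And>x. cmod (g x) \<le> 1"
    and B: "\<And>x y. \<bar>f x y\<bar> \<le> B" and supp: "\<And>x y. f x y \<noteq> 0 \<Longrightarrow> x \<in> cbox a b \<and> y \<in> cbox c d"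
  shows "(\<integral>x. of_real (\<integral>y. f x y \<partial>lborel) * g x \<partial>lborel) = (\<integral>y. \<integral>x. of_real (f x y) * g x \<partial>lborel \<partial>lborel)"
proof -
  have "integrable lborel (\<lambda>p. f (fst p) (snd p))"
  proof (rule integrable_box)
    show "(\<lambda>p. f (fst p) (snd p)) \<in> borel_measurable borel" using m by (simp add: borel_prod)
    show "p \<in> cbox (a, c) (b, d)" if "f (fst p) (snd p) \<noteq> 0" for p
      using supp[OF that] by (cases p) (auto simp: cbox_Pair_eq)
  qed (rule B)
  then have "integrable lborel (\<lambda>p. complex_of_real (f (fst p) (snd p)) * g (fst p))"
  proof (intro integrable_times_bounded[OF integrable_of_real, where C = 1] g1)
    have "(\<lambda>p :: 'a \<times> 'b. g (fst p)) \<in> borel_measurable borel"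
      unfolding borel_prod[symmetric] by measurable
    then show "(\<lambda>p :: 'a \<times> 'b. g (fst p)) \<in> borel_measurable lborel" by simp
  qed
  then have "integrable (lborel \<Otimes>\<^sub>M lborel) (\<lambda>(x, y). complex_of_real (f x y) * g x)"
    by (simp add: lborel_prod split_beta')
  from lborel_pair.Fubini_integral[OF this]
  have "(\<integral>y. \<integral>x. of_real (f x y) * g x \<partial>lborel \<partial>lborel) = (\<integral>x. \<integral>y. of_real (f x y) * g x \<partial>lborel \<partial>lborel)" .
  also have "\<dots> = (\<integral>x. of_real (\<integral>y. f x y \<partial>lborel) * g x \<partial>lborel)"
    by (intro Bochner_Integration.integral_cong refl, subst integral_complex_of_real[symmetric])
       (rule integral_mult_left_zero)
  finally show ?thesis ..
qed

lemma expn_add: "expn (a + b) = expn a * expn b"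
  by (simp add: exp_add[symmetric] algebra_simps)

lemma expn_shift: "expn (u * x) = expn (u * s) * expn (u * (x - s))"
  by (simp add: exp_add[symmetric] algebra_simps)

lemma borel_measurable_expn [measurable]: "(\<lambda>t. expn (u * t)) \<in> borel_measurable borel"
  by (intro borel_measurable_continuous_onI continuous_intros)

lemma hat_fourier: "(\<integral>x. of_real (hat x) * expn (u * x) \<partial>lborel) = (box_factor u)\<^sup>2"
proof -
  have "(\<integral>x. of_real (hat x) * expn (u * x) \<partial>lborel)
      = (\<integral>x. of_real (\<integral>s. uind s * uind (x - s) \<partial>lborel) * expn (u * x) \<partial>lborel)"
    by (simp add: hat_eq_convolution)
  also have "\<dots> = (\<integral>s. \<integral>x. of_real (uind s * uind (x - s)) * expn (u * x) \<partial>lborel \<partial>lborel)"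
  proof (rule Fubini_box_complex[where B = 1])
    show "x \<in> cbox 0 2 \<and> s \<in> cbox 0 1" if "uind s * uind (x - s) \<noteq> 0" for x s :: real
      using that by (auto simp: indicator_def split: if_splits)
    show "\<bar>uind s * uind (x - s)\<bar> \<le> 1" for x s :: real by (auto simp: indicator_def)
    show "(\<lambda>p. uind (snd p) * uind (fst p - snd p)) \<in> borel_measurable (borel \<Otimes>\<^sub>M borel)" by measurable
  qed simp_all
  also have "\<dots> = (\<integral>s. of_real (uind s) * expn (u * s) * box_factor u \<partial>lborel)"
  proof (intro Bochner_Integration.integral_cong refl)
    fix s
    have "(\<integral>x. of_real (uind s * uind (x - s)) * expn (u * x) \<partial>lborel)
       = (\<integral>x. (\<lambda>x. of_real (uind s) * expn (u * s) * (of_real (uind x) * expn (u * x))) (x - s) \<partial>lborel)"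
      by (intro Bochner_Integration.integral_cong refl, subst expn_shift[of _ _ s]) (simp add: mult_ac)
    also have "\<dots> = of_real (uind s) * expn (u * s) * box_factor u"
      by (subst integral_real_shift[where f = "\<lambda>x. of_real (uind s) * expn (u * s) * (of_real (uind x) * expn (u * x))"])
         (simp only: integral_mult_right_zero uind_fourier)
    finally show "(\<integral>x. of_real (uind s * uind (x - s)) * expn (u * x) \<partial>lborel) = of_real (uind s) * expn (u * s) * box_factor u" .
  qed
  also have "\<dots> = (box_factor u)\<^sup>2"
    unfolding integral_mult_left_zero uind_fourier by (simp add: power2_eq_square)
  finally show ?thesis .
qed

lemma integrable_hat: "integrable lborel hat"
  by (rule integrable_box[where B = 1 and a = 0 and b = 2])
     (use hat_nonneg hat_le_1 in \<open>auto dest!: hat_nonzero simp: abs_of_nonneg\<close>)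

text \<open>For fixed \<open>t\<close> the integrand is a product of functions of one coordinate
  each, and the two shifts by \<open>t\<close> combine to the frequency u_1 + u_2, which the outer
  integral turns into the last factor.\<close>

lemma fourier_bspl: "fourier (\<lambda>x. of_real (bspl x)) u = (box_factor (u $ 1))\<^sup>2 * (box_factor (u $ 2))\<^sup>2 * box_factor (u $ 1 + u $ 2)"
proof -
  let ?f = "\<lambda>(x::real^2) t. uind t * (hat (x $ 1 - t) * hat (x $ 2 - t))"
  have "fourier (\<lambda>x. of_real (bspl x)) u = (\<integral>t. \<integral>x. of_real (?f x t) * expn (u \<bullet> x) \<partial>lborel \<partial>lborel)"
    unfolding fourier_def bspl_def
  proof (rule Fubini_box_complex[where B = 1])
    show "x \<in> cbox 0 (\<chi> j. 3) \<and> t \<in> cbox 0 1" if "?f x t \<noteq> 0" for x t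
      using that hat_nonzero[of "x $ 1 - t"] hat_nonzero[of "x $ 2 - t"]
      by (auto simp: mem_box_cart forall_2 indicator_def split: if_splits)
    show "\<bar>?f x t\<bar> \<le> 1" for x t
      using hat_nonneg hat_le_1 by (auto simp: indicator_def abs_mult intro!: mult_le_one)
    show "(\<lambda>p. ?f (fst p) (snd p)) \<in> borel_measurable (borel \<Otimes>\<^sub>M borel)" by measurable
  qed simp_all
  also have "\<dots> = (\<integral>t. of_real (uind t) * expn ((u $ 1 + u $ 2) * t) * ((box_factor (u $ 1))\<^sup>2 * (box_factor (u $ 2))\<^sup>2) \<partial>lborel)"
  proof (intro Bochner_Integration.integral_cong refl)
    fix t
    have i: "integrable lborel (\<lambda>x. of_real (hat (x - t)) * expn (v * x))" for v
    proof (rule integrable_times_bounded[where C = 1])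
      show "integrable lborel (\<lambda>x. complex_of_real (hat (x - t)))"
        using lborel_integrable_real_affine[OF integrable_hat, of 1 "-t"] by simp
    qed auto
    have h: "(\<integral>x. of_real (hat (x - t)) * expn (v * x) \<partial>lborel) = expn (v * t) * (box_factor v)\<^sup>2" for v
    proof -
      have "(\<integral>x. of_real (hat (x - t)) * expn (v * x) \<partial>lborel) = (\<integral>x. (\<lambda>x. expn (v * t) * (of_real (hat x) * expn (v * x))) (x - t) \<partial>lborel)"
        by (intro Bochner_Integration.integral_cong refl, subst expn_shift[of _ _ t]) (simp add: mult_ac)
      also have "\<dots> = expn (v * t) * (box_factor v)\<^sup>2"
        by (subst integral_real_shift[where f = "\<lambda>x. expn (v * t) * (of_real (hat x) * expn (v * x))"])
           (simp only: integral_mult_right_zero hat_fourier)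
      finally show ?thesis .
    qed
    have "(\<integral>x. of_real (?f x t) * expn (u \<bullet> x) \<partial>lborel)
       = (\<integral>x. of_real (uind t) * ((of_real (hat (x $ 1 - t)) * expn (u $ 1 * x $ 1)) * (of_real (hat (x $ 2 - t)) * expn (u $ 2 * x $ 2))) \<partial>(lborel :: (real ^ 2) measure))"
      unfolding inner_vec2 expn_add by (intro Bochner_Integration.integral_cong refl) (simp add: mult_ac)
    also have "\<dots> = of_real (uind t) * ((expn (u $ 1 * t) * (box_factor (u $ 1))\<^sup>2) * (expn (u $ 2 * t) * (box_factor (u $ 2))\<^sup>2))"
      unfolding integral_mult_right_zero integral_prod2[OF i i] h ..
    also have "\<dots> = of_real (uind t) * expn ((u $ 1 + u $ 2) * t) * ((box_factor (u $ 1))\<^sup>2 * (box_factor (u $ 2))\<^sup>2)"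
      unfolding distrib_right expn_add by (simp only: mult_ac)
    finally show "(\<integral>x. of_real (?f x t) * expn (u \<bullet> x) \<partial>lborel) = of_real (uind t) * expn ((u $ 1 + u $ 2) * t) * ((box_factor (u $ 1))\<^sup>2 * (box_factor (u $ 2))\<^sup>2)" .
  qed
  also have "\<dots> = (box_factor (u $ 1))\<^sup>2 * (box_factor (u $ 2))\<^sup>2 * box_factor (u $ 1 + u $ 2)"
    unfolding integral_mult_left_zero uind_fourier by simp
  finally show ?thesis .
qed

lemma box_spline_fourier:
  assumes "is_box_spline Xi \<phi>"
  shows "fourier \<phi> u = fourier (\<lambda>x. of_real (bspl x)) u"
proof -
  have "fourier \<phi> u = (\<Prod>\<xi>\<leftarrow>Xi. box_factor (real_vec \<xi> \<bullet> u))"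
    using assms by (simp add: is_box_spline_def)
  also have "\<dots> = fourier (\<lambda>x. of_real (bspl x)) u"
    by (simp add: fourier_bspl Xi_def real_vec_def inner_vec2 vector_2 power2_eq_square mult_ac)
  finally show ?thesis .
qed

text \<open>A box spline is specified by its transform alone and hence up to null sets; this is the
  passage to the explicit version.\<close>

lemma box_spline_AE:
  assumes \<phi>: "is_box_spline Xi \<phi>"
  shows "AE x in lborel. \<phi> x = of_real (bspl x)"
proof -
  have i: "integrable lborel \<phi>" using \<phi> by (simp add: is_box_spline_def)
  have "AE x in lborel. \<phi> x - of_real (bspl x) = 0"
    using i integrable_bspl
    by (intro fourier_zero_imp_AE_zero) (auto simp: fourier_diff box_spline_fourier[OF \<phi>])
  then show ?thesis by simp
qed

subsection \<open>Its autocorrelation at the integer points\<close>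

text \<open>The autocorrelation of the hat, that is, the cubic B-spline centred at 0.\<close>

definition cubic :: "real \<Rightarrow> real" where "cubic v = (\<integral>z. hat z * hat (z - v) \<partial>lborel)"

definition bcorr :: "real ^ 2 \<Rightarrow> real" where "bcorr v = (\<integral>x. bspl x * bspl (x - v) \<partial>lborel)"

lemma cubic_measurable [measurable]: "cubic \<in> borel_measurable borel"
proof -
  have "(\<lambda>v. \<integral>z. hat z * hat (z - v) \<partial>lborel) \<in> borel_measurable borel"
    by (rule lborel.borel_measurable_lebesgue_integral) (simp add: split_beta', measurable)
  then show ?thesis by (simp add: cubic_def[abs_def])
qed

lemma cubic_minus: "cubic (- v) = cubic v"
proof -
  have "cubic (- v) = (\<integral>z. (\<lambda>z. hat (z - v) * hat z) (z - (- v)) \<partial>lborel)" by (simp add: cubic_def)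
  also have "\<dots> = (\<integral>z. hat (z - v) * hat z \<partial>lborel)" by (rule integral_real_shift)
  finally show ?thesis by (simp add: cubic_def mult.commute)
qed

lemma integrable_hat_prod: "integrable lborel (\<lambda>z. hat (z - a) * hat (z - b))"
proof (rule integrable_box[where B = 1 and a = a and b = "a + 2"])
  show "z \<in> cbox a (a + 2)" if "hat (z - a) * hat (z - b) \<noteq> 0" for z
    using that hat_nonzero[of "z - a"] by auto
  show "\<bar>hat (z - a) * hat (z - b)\<bar> \<le> 1" for z
    using hat_nonneg hat_le_1 by (auto simp: abs_mult intro!: mult_le_one)
qed simp

lemma integral_hat_prod: "(\<integral>z. hat (z - a) * hat (z - b) \<partial>lborel) = cubic (b - a)"
proof -
  have "(\<integral>z. (\<lambda>z. hat z * hat (z - (b - a))) (z - a) \<partial>lborel) = cubic (b - a)"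
    unfolding cubic_def by (rule integral_real_shift)
  then show ?thesis by (simp add: algebra_simps)
qed

lemma cubic_bound: "0 \<le> cubic v" "cubic v \<le> 2" 
proof -
  show "0 \<le> cubic v" unfolding cubic_def by (intro integral_nonneg_AE AE_I2) (auto simp: hat_nonneg)
  have "cubic v \<le> (\<integral>z. indicator {0..2::real} z \<partial>lborel)"
    unfolding cubic_def
  proof (rule integral_mono)
    show "integrable lborel (\<lambda>z. hat z * hat (z - v))" using integrable_hat_prod[of 0 v] by simp
    show "integrable lborel (indicator {0..2::real} :: real \<Rightarrow> real)"
      by (simp add: integrable_real_indicator emeasure_lborel_Icc_eq)
    show "hat z * hat (z - v) \<le> indicator {0..2} z" for z
      using hat_nonneg hat_le_1 hat_nonzero[of z] by (cases "hat z = 0") (auto simp: indicator_def intro!: mult_le_one)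
  qed
  then show "cubic v \<le> 2" by simp
qed

lemma cubic_nonzero: "cubic v \<noteq> 0 \<Longrightarrow> \<bar>v\<bar> < 2"
proof (rule ccontr)
  assume c: "cubic v \<noteq> 0" "\<not> \<bar>v\<bar> < 2"
  have z: "hat z * hat (z - v) = 0" for z
  proof -
    have "z \<le> 0 \<or> 2 \<le> z \<or> z - v \<le> 0 \<or> 2 \<le> z - v" using c(2) by linarith
    then show ?thesis using hat_zero[of z] hat_zero[of "z - v"] by auto
  qed
  have "cubic v = 0" unfolding cubic_def z by simp
  with c show False by simp
qed

text \<open>With both factors written as averages along the diagonal, with parameters
  \<open>t\<close> and \<open>s\<close>, the plane integral splits into two autocorrelations of the
  hat that depend on r = s - t only. The weight of \<open>r\<close> is the autocorrelation of the
  unit interval, a hat centred at 0.\<close>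

lemma bcorr_eq_cubic: "bcorr v = (\<integral>r. hat (1 - r) * (cubic (v $ 1 + r) * cubic (v $ 2 + r)) \<partial>lborel)"
proof -
  let ?h = "\<lambda>(x::real^2) t. hat (x $ 1 - t) * hat (x $ 2 - t)"
  have hb: "\<bar>?h x t\<bar> \<le> 1" for x t
    using hat_nonneg hat_le_1 by (auto simp: abs_mult intro!: mult_le_one)
  have hs: "x \<in> cbox 0 (\<chi> j. 3)" if "uind t * ?h x t \<noteq> 0" for x t
    using that hat_nonzero[of "x $ 1 - t"] hat_nonzero[of "x $ 2 - t"]
    by (auto simp: mem_box_cart forall_2 indicator_def split: if_splits)
  have bb: "\<bar>bspl x\<bar> \<le> 1" for x using bspl_nonneg bspl_le_1 by (simp add: abs_of_nonneg)
  have "bcorr v = (\<integral>x. \<integral>t. uind t * ?h x t * bspl (x - v) \<partial>lborel \<partial>lborel)"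
    unfolding bcorr_def by (subst bspl_def) simp
  also have "\<dots> = (\<integral>t. \<integral>x. uind t * ?h x t * bspl (x - v) \<partial>lborel \<partial>lborel)"
  proof (rule Fubini_box[where B = 1])
    show "(\<lambda>p. uind (snd p) * ?h (fst p) (snd p) * bspl (fst p - v)) \<in> borel_measurable (borel \<Otimes>\<^sub>M borel)" by measurable
    show "\<bar>uind t * ?h x t * bspl (x - v)\<bar> \<le> 1" for x t
      unfolding abs_mult[of "uind t * ?h x t"] abs_mult[of "uind t"]
      by (intro mult_le_one hb bb) (auto simp: indicator_def)
    show "x \<in> cbox 0 (\<chi> j. 3) \<and> t \<in> cbox 0 1" if "uind t * ?h x t * bspl (x - v) \<noteq> 0" for x t
      using hs[of t x] that by (auto simp: indicator_def split: if_splits)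
  qed
  also have "\<dots> = (\<integral>t. uind t * (\<integral>x. ?h x t * bspl (x - v) \<partial>lborel) \<partial>lborel)"
    by (simp add: mult.assoc)
  also have "(\<lambda>t. \<integral>x. ?h x t * bspl (x - v) \<partial>lborel) = (\<lambda>t. \<integral>s. uind s * (cubic (v $ 1 + (s - t)) * cubic (v $ 2 + (s - t))) \<partial>lborel)"
  proof
    fix t
    have "(\<integral>x. ?h x t * bspl (x - v) \<partial>lborel) = (\<integral>x. \<integral>s. ?h x t * (uind s * ?h (x - v) s) \<partial>lborel \<partial>lborel)"
      by (subst bspl_def) simp
    also have "\<dots> = (\<integral>s. \<integral>x. ?h x t * (uind s * ?h (x - v) s) \<partial>lborel \<partial>lborel)"
    proof (rule Fubini_box[where B = 1])
      show "(\<lambda>p. ?h (fst p) t * (uind (snd p) * ?h (fst p - v) (snd p))) \<in> borel_measurable (borel \<Otimes>\<^sub>M borel)" by measurable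
      show "\<bar>?h x t * (uind s * ?h (x - v) s)\<bar> \<le> 1" for x s
        unfolding abs_mult[of "?h x t"] abs_mult[of "uind s"]
        by (intro mult_le_one hb) (auto simp: indicator_def)
      show "x \<in> cbox v (v + (\<chi> j. 3)) \<and> s \<in> cbox 0 1" if "?h x t * (uind s * ?h (x - v) s) \<noteq> 0" for x s
        using hs[of s "x - v"] that by (auto simp: mem_box_cart indicator_def algebra_simps split: if_splits)
    qed
    also have "\<dots> = (\<integral>s. uind s * (cubic (v $ 1 + (s - t)) * cubic (v $ 2 + (s - t))) \<partial>lborel)"
    proof (intro Bochner_Integration.integral_cong refl)
      fix s
      have "(\<integral>x. ?h x t * (uind s * ?h (x - v) s) \<partial>lborel)
         = (\<integral>x. uind s * ((hat (x $ 1 - t) * hat (x $ 1 - (v $ 1 + s))) * (hat (x $ 2 - t) * hat (x $ 2 - (v $ 2 + s)))) \<partial>(lborel :: (real ^ 2) measure))"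
        by (intro Bochner_Integration.integral_cong refl) (simp add: mult_ac diff_diff_eq)
      also have "\<dots> = uind s * (cubic (v $ 1 + s - t) * cubic (v $ 2 + s - t))"
        unfolding integral_mult_right_zero integral_prod2[OF integrable_hat_prod integrable_hat_prod] integral_hat_prod ..
      finally show "(\<integral>x. ?h x t * (uind s * ?h (x - v) s) \<partial>lborel) = uind s * (cubic (v $ 1 + (s - t)) * cubic (v $ 2 + (s - t)))"
        by (simp add: add_diff_eq)
    qed
    finally show "(\<integral>x. ?h x t * bspl (x - v) \<partial>lborel) = (\<integral>s. uind s * (cubic (v $ 1 + (s - t)) * cubic (v $ 2 + (s - t))) \<partial>lborel)" .
  qed
  also have "(\<integral>t. uind t * (\<integral>s. uind s * (cubic (v $ 1 + (s - t)) * cubic (v $ 2 + (s - t))) \<partial>lborel) \<partial>lborel)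
     = (\<integral>t. \<integral>r. uind t * (uind (r + t) * (cubic (v $ 1 + r) * cubic (v $ 2 + r))) \<partial>lborel \<partial>lborel)"
  proof (intro Bochner_Integration.integral_cong refl)
    fix t
    have "(\<integral>s. uind s * (cubic (v $ 1 + (s - t)) * cubic (v $ 2 + (s - t))) \<partial>lborel)
        = (\<integral>s. (\<lambda>r. uind (r + t) * (cubic (v $ 1 + r) * cubic (v $ 2 + r))) (s - t) \<partial>lborel)" by simp
    also have "\<dots> = (\<integral>r. uind (r + t) * (cubic (v $ 1 + r) * cubic (v $ 2 + r)) \<partial>lborel)"
      by (rule integral_real_shift)
    finally show "uind t * (\<integral>s. uind s * (cubic (v $ 1 + (s - t)) * cubic (v $ 2 + (s - t))) \<partial>lborel)
       = (\<integral>r. uind t * (uind (r + t) * (cubic (v $ 1 + r) * cubic (v $ 2 + r))) \<partial>lborel)" by simp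
  qed
  also have "\<dots> = (\<integral>r. \<integral>t. uind t * (uind (r + t) * (cubic (v $ 1 + r) * cubic (v $ 2 + r))) \<partial>lborel \<partial>lborel)"
  proof (rule Fubini_box[where B = 4])
    show "(\<lambda>p. uind (fst p) * (uind (snd p + fst p) * (cubic (v $ 1 + snd p) * cubic (v $ 2 + snd p)))) \<in> borel_measurable (borel \<Otimes>\<^sub>M borel)"
      by measurable
    have "cubic a * cubic b \<le> 2 * 2" for a b by (intro mult_mono cubic_bound) auto
    then show "\<bar>uind t * (uind (r + t) * (cubic (v $ 1 + r) * cubic (v $ 2 + r)))\<bar> \<le> 4" for t r
      using cubic_bound by (auto simp: indicator_def abs_mult)
    show "t \<in> cbox 0 1 \<and> r \<in> cbox (-1) 1" if "uind t * (uind (r + t) * (cubic (v $ 1 + r) * cubic (v $ 2 + r))) \<noteq> 0" for t r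
      using that by (auto simp: indicator_def split: if_splits)
  qed
  also have "\<dots> = (\<integral>r. (\<integral>t. uind t * uind (r + t) \<partial>lborel) * (cubic (v $ 1 + r) * cubic (v $ 2 + r)) \<partial>lborel)"
    by (simp add: mult.assoc[symmetric])
  also have "(\<lambda>r. \<integral>t. uind t * uind (r + t) \<partial>lborel) = (\<lambda>r. hat (1 - r))"
  proof
    fix r :: real
    \<comment> \<open>The unit interval is symmetric about 1 / 2, which turns the correlation into a
      convolution.\<close>
    have "(\<lambda>t. uind t * uind (r + t)) = (\<lambda>t. uind t * uind (1 - r - t))" by (auto simp: indicator_def fun_eq_iff)
    then show "(\<integral>t. uind t * uind (r + t) \<partial>lborel) = hat (1 - r)" by (simp add: hat_eq_convolution)
  qed
  finally show ?thesis .
qed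

section \<open>Polynomial pieces of the cubic B-spline and integrals of their products\<close>

lemma cubic_0_1:
  assumes r: "0 \<le> r" "r \<le> 1"
  shows "cubic r = (4 - 6 * r ^ 2 + 3 * r ^ 3) / 6"
proof -
  let ?f = "\<lambda>z. hat z * hat (z - r)"
  \<comment> \<open>\<open>F\<close>, \<open>G\<close> and \<open>K\<close> are antiderivatives of
    the product on [r, 1], [1, 1 + r] and [1 + r, 2], where both hats are linear.\<close>
  define F where "F = (\<lambda>z. z ^ 3 / 3 - r * z ^ 2 / 2)"
  have 1: "(?f has_integral (F 1 - F r)) {r..1}"
  proof (rule has_integral_eq)
    show "((\<lambda>z. z * (z - r)) has_integral (F 1 - F r)) {r..1}"
      unfolding F_def using r
      by (intro fundamental_theorem_of_calculus)
         (auto intro!: derivative_eq_intros simp: has_real_derivative_iff_has_vector_derivative[symmetric] power2_eq_square algebra_simps)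
  qed (use r in \<open>auto simp: hat_def\<close>)
  define G where "G = (\<lambda>z. (2 + r) * z ^ 2 / 2 - 2 * r * z - z ^ 3 / 3)"
  have 2: "(?f has_integral (G (1 + r) - G 1)) {1..1 + r}"
  proof (rule has_integral_eq)
    show "((\<lambda>z. (2 - z) * (z - r)) has_integral (G (1 + r) - G 1)) {1..1 + r}"
      unfolding G_def using r
      by (intro fundamental_theorem_of_calculus)
         (auto intro!: derivative_eq_intros simp: has_real_derivative_iff_has_vector_derivative[symmetric] power2_eq_square algebra_simps)
  qed (use r in \<open>auto simp: hat_def\<close>)
  define K where "K = (\<lambda>z. (4 + 2 * r) * z - (4 + r) * z ^ 2 / 2 + z ^ 3 / 3)"
  have 3: "(?f has_integral (K 2 - K (1 + r))) {1 + r..2}"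
  proof (rule has_integral_eq)
    show "((\<lambda>z. (2 - z) * (2 - z + r)) has_integral (K 2 - K (1 + r))) {1 + r..2}"
      unfolding K_def using r
      by (intro fundamental_theorem_of_calculus)
         (auto intro!: derivative_eq_intros simp: has_real_derivative_iff_has_vector_derivative[symmetric] power2_eq_square algebra_simps)
  qed (use r in \<open>auto simp: hat_def\<close>)
  have "(?f has_integral ((F 1 - F r) + (G (1 + r) - G 1) + (K 2 - K (1 + r)))) {r..2}"
    using r by (intro has_integral_combine[OF _ _ has_integral_combine[OF _ _ 1 2] 3]) auto
  then have "(?f has_integral ((F 1 - F r) + (G (1 + r) - G 1) + (K 2 - K (1 + r)))) UNIV"
    by (rule has_integral_on_superset) (use hat_zero in auto)
  moreover have "integrable lborel ?f" using integrable_hat_prod[of 0 r] by simp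
  then have "(?f has_integral cubic r) UNIV"
    unfolding cubic_def by (rule has_integral_integral_lborel)
  ultimately have "cubic r = (F 1 - F r) + (G (1 + r) - G 1) + (K 2 - K (1 + r))"
    by (rule has_integral_unique[symmetric])
  then show ?thesis unfolding F_def G_def K_def by (simp add: power2_eq_square power3_eq_cube field_simps)
qed

lemma cubic_1_2:
  assumes r: "0 \<le> r" "r \<le> 1"
  shows "cubic (1 + r) = (1 - r) ^ 3 / 6"
proof -
  let ?f = "\<lambda>z. hat z * hat (z - (1 + r))"
  define G where "G = (\<lambda>z. (3 + r) * z ^ 2 / 2 - 2 * (1 + r) * z - z ^ 3 / 3)"
  have "(?f has_integral (G 2 - G (1 + r))) {1 + r..2}"
  proof (rule has_integral_eq)
    show "((\<lambda>z. (2 - z) * (z - (1 + r))) has_integral (G 2 - G (1 + r))) {1 + r..2}"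
      unfolding G_def using r
      by (intro fundamental_theorem_of_calculus)
         (auto intro!: derivative_eq_intros simp: has_real_derivative_iff_has_vector_derivative[symmetric] power2_eq_square algebra_simps)
  qed (use r in \<open>auto simp: hat_def\<close>)
  then have "(?f has_integral (G 2 - G (1 + r))) UNIV"
    by (rule has_integral_on_superset) (use hat_zero in auto)
  moreover have "integrable lborel ?f" using integrable_hat_prod[of 0 "1 + r"] by simp
  then have "(?f has_integral cubic (1 + r)) UNIV"
    unfolding cubic_def by (rule has_integral_integral_lborel)
  ultimately have "cubic (1 + r) = G 2 - G (1 + r)"
    by (rule has_integral_unique[symmetric])
  then show ?thesis unfolding G_def by (simp add: power2_eq_square power3_eq_cube field_simps)
qed

text \<open>Six times the piece of \<open>cubic\<close> on [k, k + 1] in the local variable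
  \<open>t\<close>; only k = -2, ..., 1 meet the support.\<close>

definition cubP :: "int \<Rightarrow> real \<Rightarrow> real" where
  "cubP k t = (if k = 0 then 4 - 6 * t ^ 2 + 3 * t ^ 3 else if k = 1 then (1 - t) ^ 3
     else if k = - 1 then 1 + 3 * t + 3 * t ^ 2 - 3 * t ^ 3 else if k = - 2 then t ^ 3 else 0)"

lemma cubic_eq_cubP:
  assumes t: "0 \<le> t" "t \<le> 1"
  shows "cubic (of_int k + t) = cubP k t / 6"
proof -
  consider "k = 0" | "k = 1" | "k = -1" | "k = -2" | "k \<ge> 2" | "k \<le> -3" by linarith
  then show ?thesis
  proof cases
    case 3
    have "cubic (-1 + t) = cubic (1 - t)" using cubic_minus[of "1 - t"] by (simp add: algebra_simps)
    also have "\<dots> = (4 - 6 * (1 - t) ^ 2 + 3 * (1 - t) ^ 3) / 6" using t by (intro cubic_0_1) auto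
    finally show ?thesis using 3 by (simp add: cubP_def power2_eq_square power3_eq_cube algebra_simps)
  next
    case 4
    have "cubic (-2 + t) = cubic (1 + (1 - t))" using cubic_minus[of "2 - t"] by (simp add: algebra_simps)
    also have "\<dots> = (1 - (1 - t)) ^ 3 / 6" using t by (intro cubic_1_2) auto
    finally show ?thesis using 4 by (simp add: cubP_def)
  next
    case 5
    then have "2 \<le> real_of_int k + t" using t by linarith
    then have "cubic (of_int k + t) = 0" using cubic_nonzero[of "of_int k + t"] by linarith
    then show ?thesis using 5 by (simp add: cubP_def)
  next
    case 6
    then have "real_of_int k + t \<le> -2" using t by linarith
    then have "cubic (of_int k + t) = 0" using cubic_nonzero[of "of_int k + t"] by linarith
    then show ?thesis using 6 by (simp add: cubP_def)
  qed (use t cubic_0_1[of t] cubic_1_2[of t] in \<open>auto simp: cubP_def\<close>)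
qed

text \<open>The part of \<open>bcorr\<close> over 0 <= r <= 1, where the weight is 1 - r; the
  denominator 36 stems from the two factors 1 / 6 in \<open>cubic_eq_cubP\<close>.\<close>

definition cubJ :: "int \<Rightarrow> int \<Rightarrow> real" where
  "cubJ i j = integral {0..1} (\<lambda>t. (1 - t) * (cubP i t * cubP j t) / 36)"

lemma has_integral_poly7:
  "((\<lambda>t::real. (c0 + c1 * t + c2 * t ^ 2 + c3 * t ^ 3 + c4 * t ^ 4 + c5 * t ^ 5 + c6 * t ^ 6 + c7 * t ^ 7) / 36)
     has_integral (c0 + c1 / 2 + c2 / 3 + c3 / 4 + c4 / 5 + c5 / 6 + c6 / 7 + c7 / 8) / 36) {0..1}"
proof -
  let ?F = "\<lambda>t. (c0 * t + c1 * t ^ 2 / 2 + c2 * t ^ 3 / 3 + c3 * t ^ 4 / 4 + c4 * t ^ 5 / 5 + c5 * t ^ 6 / 6 + c6 * t ^ 7 / 7 + c7 * t ^ 8 / 8) / 36"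
  have "((\<lambda>t::real. (c0 + c1 * t + c2 * t ^ 2 + c3 * t ^ 3 + c4 * t ^ 4 + c5 * t ^ 5 + c6 * t ^ 6 + c7 * t ^ 7) / 36)
     has_integral (?F 1 - ?F 0)) {0..1}"
    by (intro fundamental_theorem_of_calculus)
       (auto intro!: derivative_eq_intros simp: has_real_derivative_iff_has_vector_derivative[symmetric])
  then show ?thesis by simp
qed

text \<open>The integrand has degree 1 + 3 + 3 = 7; once its eight coefficients are supplied, each
  value is rational arithmetic.\<close>

lemma cubJ_eqI:
  assumes "\<And>t. (1 - t) * (cubP i t * cubP j t) = c0 + c1 * t + c2 * t ^ 2 + c3 * t ^ 3 + c4 * t ^ 4 + c5 * t ^ 5 + c6 * t ^ 6 + c7 * t ^ 7"
    and "(c0 + c1 / 2 + c2 / 3 + c3 / 4 + c4 / 5 + c5 / 6 + c6 / 7 + c7 / 8) / 36 = v"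
  shows "cubJ i j = v"
  using has_integral_poly7[of c0 c1 c2 c3 c4 c5 c6 c7] unfolding cubJ_def assms by (rule integral_unique)

lemma cubJ_commute: "cubJ i j = cubJ j i"
  by (simp add: cubJ_def mult_ac)

lemma cubJ_0: "i \<notin> {-2, -1, 0, 1} \<Longrightarrow> cubJ i j = 0" "i \<notin> {-2, -1, 0, 1} \<Longrightarrow> cubJ j i = 0"
  by (simp_all add: cubJ_def cubP_def)

lemma cubJ_values:
  shows "cubJ (- 2) (- 2) = 1 / 2016" "cubJ (- 2) (- 1) = 47 / 10080" "cubJ (- 2) 0 = 31 / 10080" "cubJ (- 2) 1 = 1 / 10080" "cubJ (- 1) (- 1) = 779 / 10080" "cubJ (- 1) 0 = 311 / 3360" "cubJ (- 1) 1 = 89 / 10080" "cubJ 0 0 = 1597 / 10080" "cubJ 0 1 = 211 / 10080" "cubJ 1 1 = 1 / 288"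
proof -
  show "cubJ (- 2) (- 2) = 1 / 2016"
    by (rule cubJ_eqI[of "- 2" "- 2" "0" "0" "0" "0" "0" "0" "1" "- 1"]; (simp add: cubP_def)?, (algebra)?)
  show "cubJ (- 2) (- 1) = 47 / 10080"
    by (rule cubJ_eqI[of "- 2" "- 1" "0" "0" "0" "1" "2" "0" "- 6" "3"]; (simp add: cubP_def)?, (algebra)?)
  show "cubJ (- 2) 0 = 31 / 10080"
    by (rule cubJ_eqI[of "- 2" 0 "0" "0" "0" "4" "- 4" "- 6" "9" "- 3"]; (simp add: cubP_def)?, (algebra)?)
  show "cubJ (- 2) 1 = 1 / 10080"
    by (rule cubJ_eqI[of "- 2" 1 "0" "0" "0" "1" "- 4" "6" "- 4" "1"]; (simp add: cubP_def)?, (algebra)?)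
  show "cubJ (- 1) (- 1) = 779 / 10080"
    by (rule cubJ_eqI[of "- 1" "- 1" "1" "5" "9" "- 3" "- 21" "- 9" "27" "- 9"]; (simp add: cubP_def)?, (algebra)?)
  show "cubJ (- 1) 0 = 311 / 3360"
    by (rule cubJ_eqI[of "- 1" 0 "4" "8" "- 6" "- 33" "18" "36" "- 36" "9"]; (simp add: cubP_def)?, (algebra)?)
  show "cubJ (- 1) 1 = 89 / 10080"
    by (rule cubJ_eqI[of "- 1" 1 "1" "- 1" "- 3" "- 1" "19" "- 27" "15" "- 3"]; (simp add: cubP_def)?, (algebra)?)
  show "cubJ 0 0 = 1597 / 10080"
    by (rule cubJ_eqI[of 0 0 "16" "- 16" "- 48" "72" "12" "- 72" "45" "- 9"]; (simp add: cubP_def)?, (algebra)?)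
  show "cubJ 0 1 = 211 / 10080"
    by (rule cubJ_eqI[of 0 1 "4" "- 16" "18" "11" "- 44" "42" "- 18" "3"]; (simp add: cubP_def)?, (algebra)?)
  show "cubJ 1 1 = 1 / 288"
    by (rule cubJ_eqI[of 1 1 "1" "- 7" "21" "- 35" "35" "- 21" "7" "- 1"]; (simp add: cubP_def)?, (algebra)?)
qed

lemma cubJ_values_swap:
  shows "cubJ (- 1) (- 2) = 47 / 10080" "cubJ 0 (- 2) = 31 / 10080" "cubJ 1 (- 2) = 1 / 10080" "cubJ 0 (- 1) = 311 / 3360" "cubJ 1 (- 1) = 89 / 10080" "cubJ 1 0 = 211 / 10080"
  by (subst cubJ_commute, simp only: cubJ_values)+

lemma continuous_on_cubP: "continuous_on S (cubP k)"
proof -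
  consider "k = 0" | "k = 1" | "k = -1" | "k = -2" | "k \<notin> {0, 1, -1, -2}" by auto
  then show ?thesis by cases (auto simp: cubP_def[abs_def] intro!: continuous_intros)
qed

lemma cubic_continuous_pieces:
  "((\<lambda>r. hat (1 - r) * (cubic (of_int i + r) * cubic (of_int j + r))) has_integral cubJ i j) {0..1}"
proof -
  have "continuous_on {0..1} (\<lambda>t. (1 - t) * (cubP i t * cubP j t) / 36)"
    by (intro continuous_intros continuous_on_cubP) simp
  then have "((\<lambda>t. (1 - t) * (cubP i t * cubP j t) / 36) has_integral cubJ i j) {0..1}"
    unfolding cubJ_def by (intro integrable_integral integrable_continuous_real)
  then show ?thesis
    by (rule has_integral_eq[rotated]) (simp add: cubic_eq_cubP hat_def)
qed

text \<open>The half over -1 <= r <= 0 is reflected to the other side; as \<open>cubic\<close> and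
  the weight are even, this reverses the signs of \<open>i\<close> and \<open>j\<close>.\<close>

lemma bcorr_int: "bcorr (real_vec (vector [i, j])) = cubJ i j + cubJ (- i) (- j)"
proof -
  let ?q = "\<lambda>i j r. hat (1 - r) * (cubic (of_int i + r) * cubic (of_int j + r))"
  have "((\<lambda>r. ?q (-i) (-j) (-r)) has_integral cubJ (-i) (-j)) {-1..-0}"
    by (subst has_integral_reflect_real) (rule cubic_continuous_pieces)
  then have "(?q i j has_integral cubJ (-i) (-j)) {-1..0}"
  proof (subst (asm) has_integral_cong)
    fix r :: real
    have "cubic (of_int (- k) + (- r)) = cubic (of_int k + r)" for k
      using cubic_minus[of "of_int k + r"] by (simp add: algebra_simps)
    moreover have "hat (1 - (- r)) = hat (1 - r)" by (simp add: hat_def)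
    ultimately show "?q (-i) (-j) (-r) = ?q i j r" by (simp only:)
  qed simp
  then have "(?q i j has_integral (cubJ (-i) (-j) + cubJ i j)) {-1..1}"
    by (intro has_integral_combine[OF _ _ _ cubic_continuous_pieces]) auto
  then have 1: "(?q i j has_integral (cubJ (-i) (-j) + cubJ i j)) UNIV"
    by (rule has_integral_on_superset) (use hat_zero in auto)
  have "integrable lborel (?q i j)"
  proof (rule integrable_box[where B = 4])
    have "cubic a * cubic b \<le> 2 * 2" for a b by (intro mult_mono cubic_bound) auto
    then have "hat c * (cubic a * cubic b) \<le> 1 * 4" for a b c
      by (intro mult_mono hat_le_1) (auto simp: hat_nonneg cubic_bound)
    then show "\<bar>?q i j r\<bar> \<le> 4" for r
      using cubic_bound hat_nonneg by (simp add: abs_mult)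
    show "r \<in> cbox (-1) 1" if "?q i j r \<noteq> 0" for r
      using that hat_nonzero[of "1 - r"] by auto
  qed measurable
  then have "(?q i j has_integral (\<integral>r. ?q i j r \<partial>lborel)) UNIV"
    by (rule has_integral_integral_lborel)
  then have "(\<integral>r. ?q i j r \<partial>lborel) = cubJ (-i) (-j) + cubJ i j"
    using 1 by (rule has_integral_unique)
  then show ?thesis by (simp add: bcorr_eq_cubic real_vec_def vector_2)
qed

lemma coef_const_mult: "coef (Poly_Mapping.single 0 c * P) k = c * coef (P :: 'd::finite laurent) k"
  by (induction P rule: laurent_induct) (auto simp: distrib_left mult_single lookup_add lookup_single when_def)

text \<open>Each coefficient is a sum of two values of \<open>cubJ\<close>; for instance 814 / 10080
  at (1,1) is 35 / 10080 from \<open>cubJ 1 1\<close> plus 779 / 10080 from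
  \<open>cubJ (- 1) (- 1)\<close>.\<close>

lemma coef_Phi_poly: "coef Phi_poly k = of_real (bcorr (real_vec k))"
proof -
  define i j where "i = k $ 1" and "j = k $ 2"
  have k: "k = vector [i, j]" by (simp add: i_def j_def vec_eq_iff forall_2 vector_2)
  have e: "Phi_poly = Poly_Mapping.single 0 (1 / 10080) *
     (mon 3194 0 0
      + mon 31 2 0 + mon 31 (-2) 0 + mon 31 0 2 + mon 31 0 (-2)
      + mon 5 2 2 + mon 5 (-2) (-2)
      + mon 1144 1 0 + mon 1144 (-1) 0 + mon 1144 0 1 + mon 1144 0 (-1)
      + mon 47 1 2 + mon 47 (-1) (-2) + mon 47 2 1 + mon 47 (-2) (-1)
      + mon 1 1 (-2) + mon 1 (-1) 2 + mon 1 (-2) 1 + mon 1 2 (-1)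
      + mon 814 1 1 + mon 814 (-1) (-1)
      + mon 178 1 (-1) + mon 178 (-1) 1)"
    by (simp only: Phi_poly_def vec2_zero)
  note J = cubJ_values cubJ_values_swap
  show ?thesis
  \<comment> \<open>If an entry exceeds 2 in modulus, both values of \<open>cubJ\<close> vanish; 25
    exponents remain.\<close>
  proof (cases "i \<in> {-2, -1, 0, 1, 2} \<and> j \<in> {-2, -1, 0, 1, 2}")
    case False
    then have "i \<notin> {-2, -1, 0, 1, 2} \<or> j \<notin> {-2, -1, 0, 1, 2}" by simp
    then have "cubJ i j = 0" "cubJ (-i) (-j) = 0"
      using cubJ_0(1)[of i j] cubJ_0(2)[of j i] cubJ_0(1)[of "-i" "-j"] cubJ_0(2)[of "-j" "-i"]
      by (simp_all add: minus_equation_iff[of i] minus_equation_iff[of j]) fastforce+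
    moreover have "coef Phi_poly k = 0"
      unfolding e coef_const_mult lookup_add lookup_single k vec2_eq_iff using False by auto
    ultimately show ?thesis by (simp add: k bcorr_int)
  next
    case True
    then have "i = -2 \<or> i = -1 \<or> i = 0 \<or> i = 1 \<or> i = 2" "j = -2 \<or> j = -1 \<or> j = 0 \<or> j = 1 \<or> j = 2" by auto
    then show ?thesis
      unfolding e coef_const_mult lookup_add lookup_single k vec2_eq_iff bcorr_int
      by (elim disjE) (simp_all add: J cubJ_0)
  qed
qed

lemma AE_lborel_shift:
  fixes c :: "'a::euclidean_space"
  assumes "AE x in lborel. P x"
  shows "AE x in lborel. P (x - c)"
proof -
  have "AE x in distr lborel borel ((+) (- c)). P x" unfolding lborel_distr_plus by (rule assms)
  from AE_distrD[OF _ this] show ?thesis by simp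
qed

lemma borel_measurable_cnj [measurable]: "cnj \<in> borel_measurable borel"
  by (intro borel_measurable_continuous_onI continuous_intros)

lemma autocorr_box_spline:
  assumes \<phi>: "is_box_spline Xi \<phi>"
  shows "autocorr \<phi> v = of_real (bcorr v)"
proof -
  have [measurable]: "\<phi> \<in> borel_measurable borel"
    using \<phi> borel_measurable_integrable[of lborel \<phi>] by (simp add: is_box_spline_def)
  have "autocorr \<phi> v = (\<integral>t. of_real (bspl t * bspl (t - v)) \<partial>lborel)"
    unfolding autocorr_def
  proof (rule integral_cong_AE)
    show "(\<lambda>t. \<phi> t * cnj (\<phi> (t - v))) \<in> borel_measurable lborel" by measurable
    show "AE t in lborel. \<phi> t * cnj (\<phi> (t - v)) = of_real (bspl t * bspl (t - v))"
      using box_spline_AE[OF \<phi>] AE_lborel_shift[OF box_spline_AE[OF \<phi>], of v]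
      by eventually_elim simp
  qed measurable
  then show ?thesis unfolding bcorr_def by (simp only: integral_complex_of_real)
qed

theorem Phi_box_spline:
  assumes "is_box_spline Xi \<phi>"
  shows "Phi \<phi> \<zeta> = leval Phi_poly \<zeta>"
  unfolding Phi_def leval_infsum by (simp add: autocorr_box_spline[OF assms] coef_Phi_poly)

subsection \<open>Refinement and decay of the Fourier transform\<close>

lemma exp_mi_torus: "exp_mi u \<in> torus"
  by (simp add: torus_def exp_mi_def)

lemma expn_powi: "expn t powi n = expn (of_int n * t)"
proof -
  have e: "expn t = cis (- t)" for t by (simp add: cis_conv_exp)
  show ?thesis unfolding e cis_power_int by simp
qed

lemma zpow_exp_mi: "zpow (exp_mi u) k = expn (real_vec k \<bullet> (u :: real ^ 2))"
  unfolding zpow_vec2 exp_mi_def real_vec_def inner_vec2 vec_lambda_beta expn_powi expn_add ..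

lemma fourier_shift:
  fixes f :: "real ^ 2 \<Rightarrow> complex"
  assumes f: "integrable lborel f"
  shows "integrable lborel (\<lambda>x. f (x - c))" "fourier (\<lambda>x. f (x - c)) u = expn (c \<bullet> u) * fourier f u"
proof -
  have sh: "integrable lborel (\<lambda>u. k (u - c))" "(\<integral>u. k (u - c) \<partial>lborel) = (\<integral>u. k u \<partial>lborel)"
    if k: "integrable lborel k" for k :: "real ^ 2 \<Rightarrow> complex"
  proof -
    have [measurable]: "k \<in> borel_measurable borel" using borel_measurable_integrable[OF k] by simp
    have "integrable (distr lborel borel ((+) (-c))) k" "integral\<^sup>L (distr lborel borel ((+) (-c))) k = (\<integral>u. k u \<partial>lborel)"
      using k by (auto simp: lborel_distr_plus)
    then show "integrable lborel (\<lambda>u. k (u - c))" "(\<integral>u. k (u - c) \<partial>lborel) = (\<integral>u. k u \<partial>lborel)"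
      by (auto simp: integrable_distr_eq integral_distr)
  qed
  show "integrable lborel (\<lambda>x. f (x - c))" by (rule sh(1)[OF f])
  have "fourier (\<lambda>x. f (x - c)) u = (\<integral>x. expn (c \<bullet> u) * (f (x - c) * expn (u \<bullet> (x - c))) \<partial>lborel)"
    unfolding fourier_def
    by (intro Bochner_Integration.integral_cong refl)
       (simp add: inner_diff_right exp_add[symmetric] inner_commute algebra_simps)
  also have "\<dots> = expn (c \<bullet> u) * fourier f u"
    unfolding integral_mult_right_zero fourier_def by (subst sh(2)[OF integrable_fourier[OF f]]) simp
  finally show "fourier (\<lambda>x. f (x - c)) u = expn (c \<bullet> u) * fourier f u" .
qed

lemma lborel_scale2: "(lborel :: (real ^ 2) measure) = density (distr lborel borel (\<lambda>x. 2 *\<^sub>R x)) (\<lambda>_. 4)"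
  using lborel_affine[of 2 "0 :: real ^ 2"] by (simp add: DIM_cart)

lemma nn_integral_scale2:
  assumes [measurable]: "f \<in> borel_measurable borel"
  shows "(\<integral>\<^sup>+x. f x \<partial>(lborel :: (real ^ 2) measure)) = 4 * (\<integral>\<^sup>+x. f (2 *\<^sub>R x) \<partial>lborel)"
  by (subst lborel_scale2) (simp add: nn_integral_density nn_integral_distr nn_integral_cmult)

lemma integral_scale2:
  fixes f :: "real ^ 2 \<Rightarrow> complex"
  assumes [measurable]: "f \<in> borel_measurable borel"
  shows "integrable lborel (\<lambda>x. f (2 *\<^sub>R x)) \<longleftrightarrow> integrable lborel f"
    and "(\<integral>x. f x \<partial>lborel) = 4 * (\<integral>x. f (2 *\<^sub>R x) \<partial>lborel)"
proof -
  have "integrable lborel f \<longleftrightarrow> integrable (density (distr lborel borel (\<lambda>x. 2 *\<^sub>R x)) (\<lambda>_. ennreal 4)) f"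
    using lborel_scale2 by simp
  also have "\<dots> \<longleftrightarrow> integrable lborel (\<lambda>x. f (2 *\<^sub>R x))"
  proof (subst integrable_density)
    have "integrable lborel (\<lambda>x. (1 / 4) *\<^sub>R (4 *\<^sub>R f (2 *\<^sub>R x)))" if "integrable lborel (\<lambda>x. 4 *\<^sub>R f (2 *\<^sub>R x))"
      using that by (rule integrable_scaleR_right)
    then show "integrable (distr lborel borel (\<lambda>x. 2 *\<^sub>R x)) (\<lambda>x. 4 *\<^sub>R f x) \<longleftrightarrow> integrable lborel (\<lambda>x. f (2 *\<^sub>R x))"
      by (subst integrable_distr_eq) auto
  qed simp_all
  finally show "integrable lborel (\<lambda>x. f (2 *\<^sub>R x)) \<longleftrightarrow> integrable lborel f" by simp
  have "(\<integral>x. f x \<partial>lborel) = (\<integral>x. f x \<partial>(density (distr lborel borel (\<lambda>x. 2 *\<^sub>R x)) (\<lambda>_. ennreal 4)))"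
    using lborel_scale2 by simp
  also have "\<dots> = 4 * (\<integral>x. f (2 *\<^sub>R x) \<partial>lborel)"
    by (subst integral_density) (simp_all add: integral_distr scaleR_conv_of_real)
  finally show "(\<integral>x. f x \<partial>lborel) = 4 * (\<integral>x. f (2 *\<^sub>R x) \<partial>lborel)" .
qed

lemma fourier_half:
  fixes f :: "real ^ 2 \<Rightarrow> complex"
  assumes f: "integrable lborel f"
  shows "integrable lborel (\<lambda>x. f ((1 / 2) *\<^sub>R x))" "fourier (\<lambda>x. f ((1 / 2) *\<^sub>R x)) u = 4 * fourier f (2 *\<^sub>R u)"
proof -
  have [measurable]: "f \<in> borel_measurable borel" using borel_measurable_integrable[OF f] by simp
  have [measurable]: "(\<lambda>x. f ((1 / 2) *\<^sub>R x)) \<in> borel_measurable borel" by measurable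
  show "integrable lborel (\<lambda>x. f ((1 / 2) *\<^sub>R x))"
    using integral_scale2(1)[of "\<lambda>x. f ((1 / 2) *\<^sub>R x)"] f by simp
  show "fourier (\<lambda>x. f ((1 / 2) *\<^sub>R x)) u = 4 * fourier f (2 *\<^sub>R u)"
    unfolding fourier_def by (subst integral_scale2(2)) simp_all
qed

text \<open>From 1 - e^(-2it) = (1 - e^(-it)) (1 + e^(-it)). Each column of the matrix thereby
  contributes one factor of \<open>H\<close> to the refinement equation.\<close>

lemma box_factor_double: "box_factor (2 * t) = (1 + expn t) / 2 * box_factor t"
proof (cases "t = 0")
  case False
  have "expn (2 * t) = expn t * expn t" by (simp add: exp_add[symmetric] algebra_simps)
  then show ?thesis using False by (simp add: box_factor_def field_simps)
qed (simp add: box_factor_def)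

lemma fourier_bspl_double:
  "fourier (\<lambda>x. of_real (bspl x)) (2 *\<^sub>R u) = leval H (exp_mi u) * fourier (\<lambda>x. of_real (bspl x)) u"
proof -
  have b: "box_factor (2 * u $ 1 + 2 * u $ 2) = (1 + expn (u $ 1) * expn (u $ 2)) / 2 * box_factor (u $ 1 + u $ 2)"
    using box_factor_double[of "u $ 1 + u $ 2"] by (simp only: expn_add distrib_left)
  show ?thesis
    unfolding fourier_bspl leval_H[OF exp_mi_torus]
    by (simp add: box_factor_double b exp_mi_def power_mult_distrib power_divide)
qed

text \<open>Adding the squares of |b| <= 1 and |t| |b| <= 2, with b the box factor, gives the
  constant 5 = 1 + 4.\<close>

lemma norm_box_factor_le: "(cmod (box_factor t))\<^sup>2 \<le> 5 / (1 + t\<^sup>2)"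
proof -
  have a: "cmod (box_factor t) \<le> 1"
  proof -
    have "cmod (box_factor t) \<le> (\<integral>s. cmod (of_real (uind s) * expn (t * s)) \<partial>lborel)"
      unfolding uind_fourier[symmetric] by (rule integral_norm_bound)
    also have "\<dots> = 1" by (simp add: norm_mult)
    finally show ?thesis .
  qed
  have b: "\<bar>t\<bar> * cmod (box_factor t) \<le> 2"
  proof (cases "t = 0")
    case False
    have "cmod (1 - expn t) \<le> 2" using norm_triangle_ineq4[of 1 "expn t"] by simp
    then show ?thesis using False by (simp add: box_factor_def norm_divide norm_mult)
  qed simp
  have "(cmod (box_factor t))\<^sup>2 \<le> 1" using a by (simp add: power_le_one)
  moreover have "(\<bar>t\<bar> * cmod (box_factor t))\<^sup>2 \<le> 2\<^sup>2" using b by (intro power_mono) auto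
  ultimately have "(1 + t\<^sup>2) * (cmod (box_factor t))\<^sup>2 \<le> 5" by (simp add: power_mult_distrib distrib_right)
  moreover have "1 + t\<^sup>2 > 0" by (simp add: add_pos_nonneg)
  ultimately show ?thesis by (simp add: field_simps)
qed

lemma norm_box_factor_le_1: "cmod (box_factor t) \<le> 1"
proof -
  have "cmod (box_factor t) \<le> (\<integral>s. cmod (of_real (uind s) * expn (t * s)) \<partial>lborel)"
    unfolding uind_fourier[symmetric] by (rule integral_norm_bound)
  also have "\<dots> = 1" by (simp add: norm_mult)
  finally show ?thesis .
qed

text \<open>One box factor per coordinate already makes the square decay like an integrable product;
  the remaining three are bounded by 1.\<close>

lemma fourier_bspl_decay:
  "(cmod (fourier (\<lambda>x. of_real (bspl x)) u))\<^sup>2 \<le> 25 / ((1 + (u $ 1)\<^sup>2) * (1 + (u $ 2)\<^sup>2))"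
proof -
  have "cmod (fourier (\<lambda>x. of_real (bspl x)) u) = (cmod (box_factor (u $ 1)))\<^sup>2 * (cmod (box_factor (u $ 2)))\<^sup>2 * cmod (box_factor (u $ 1 + u $ 2))"
    by (simp add: fourier_bspl norm_mult norm_power)
  also have "\<dots> \<le> (cmod (box_factor (u $ 1)))\<^sup>2 * (cmod (box_factor (u $ 2)))\<^sup>2 * 1"
    by (intro mult_left_mono norm_box_factor_le_1) auto
  also have "\<dots> \<le> (cmod (box_factor (u $ 1)) * 1) * (cmod (box_factor (u $ 2)) * 1) * 1"
    unfolding power2_eq_square by (intro mult_mono norm_box_factor_le_1 mult_nonneg_nonneg) auto
  finally have "(cmod (fourier (\<lambda>x. of_real (bspl x)) u))\<^sup>2 \<le> (cmod (box_factor (u $ 1)) * cmod (box_factor (u $ 2)))\<^sup>2"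
    by (intro power_mono) auto
  also have "\<dots> = (cmod (box_factor (u $ 1)))\<^sup>2 * (cmod (box_factor (u $ 2)))\<^sup>2" by (rule power_mult_distrib)
  also have "\<dots> \<le> 5 / (1 + (u $ 1)\<^sup>2) * (5 / (1 + (u $ 2)\<^sup>2))"
    by (intro mult_mono norm_box_factor_le) (auto simp: add_nonneg_nonneg)
  finally show ?thesis by simp
qed

lemma sum_coef_fourier:
  "fourier (\<lambda>x. \<Sum>k\<in>K. c k * of_real (bspl (x - real_vec k))) u
     = (\<Sum>k\<in>K. c k * zpow (exp_mi u) k) * fourier (\<lambda>x. of_real (bspl x)) u"
proof -
  have "fourier (\<lambda>x. \<Sum>k\<in>K. c k * of_real (bspl (x - real_vec k))) u
     = (\<Sum>k\<in>K. c k * fourier (\<lambda>x. of_real (bspl (x - real_vec k))) u)"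
    by (rule fourier_sum) (rule fourier_shift(1)[OF integrable_bspl])
  then show ?thesis
    by (simp add: fourier_shift(2)[OF integrable_bspl] zpow_exp_mi sum_distrib_right mult.assoc)
qed

text \<open>Both sides have the same transform, by the doubling relation for \<open>H\<close>; the 4
  is the determinant of the dilation.\<close>

theorem bspl_refinement:
  "AE x in lborel. complex_of_real (bspl ((1 / 2) *\<^sub>R x))
     = (\<Sum>k\<in>Poly_Mapping.keys H. 4 * coef H k * of_real (bspl (x - real_vec k)))"
proof -
  let ?S = "\<lambda>x. \<Sum>k\<in>Poly_Mapping.keys H. 4 * coef H k * of_real (bspl (x - real_vec k))"
  have i: "integrable lborel ?S"
    by (intro Bochner_Integration.integrable_sum integrable_mult_right fourier_shift(1)[OF integrable_bspl])
  have "AE x in lborel. complex_of_real (bspl ((1 / 2) *\<^sub>R x)) - ?S x = 0"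
  proof (rule fourier_zero_imp_AE_zero)
    show "integrable lborel (\<lambda>x. complex_of_real (bspl ((1 / 2) *\<^sub>R x)) - ?S x)"
      by (intro Bochner_Integration.integrable_diff i fourier_half(1)[OF integrable_bspl])
    fix u
    have "fourier ?S u = 4 * leval H (exp_mi u) * fourier (\<lambda>x. of_real (bspl x)) u"
      unfolding sum_coef_fourier[of "\<lambda>k. 4 * coef H k"] by (simp add: leval_def sum_distrib_left mult.assoc)
    then show "fourier (\<lambda>x. complex_of_real (bspl ((1 / 2) *\<^sub>R x)) - ?S x) u = 0"
      unfolding fourier_diff[OF fourier_half(1)[OF integrable_bspl] i] fourier_half(2)[OF integrable_bspl]
      by (simp add: fourier_bspl_double)
  qed
  then show ?thesis by simp
qed

section \<open>Square summable combinations of the translates\<close>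

definition vfloor :: "real ^ 2 \<Rightarrow> int ^ 2" where "vfloor x = (\<chi> j. \<lfloor>x $ j\<rfloor>)"

definition box3 :: "(int ^ 2) set" where "box3 = (\<lambda>(i, j). vector [i, j]) ` ({0..2} \<times> {0..2})"

text \<open>The sum runs over the nine translates of the box spline that can be nonzero at \<open>x\<close>, so that it
  represents the whole series for an arbitrary coefficient sequence \<open>a\<close>.\<close>
definition spl :: "(int ^ 2 \<Rightarrow> complex) \<Rightarrow> real ^ 2 \<Rightarrow> complex" where
  "spl a x = (\<Sum>m\<in>box3. a (vfloor x - m) * of_real (bspl (x - real_vec (vfloor x - m))))"

text \<open>The square of the usual norm, valued in \<open>ennreal\<close> so that it is defined for
  every sequence.\<close>

definition l2norm :: "(int ^ 2 \<Rightarrow> complex) \<Rightarrow> ennreal" where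
  "l2norm a = (\<integral>\<^sup>+k. ennreal ((cmod (a k))\<^sup>2) \<partial>count_space UNIV)"

lemma finite_box3: "finite box3" and card_box3: "card box3 = 9"
proof -
  have "inj_on (\<lambda>(i, j). vector [i, j] :: int ^ 2) ({0..2} \<times> {0..2})" by (auto simp: inj_on_def vec2_eq_iff)
  from card_image[OF this] show "card box3 = 9" by (simp add: box3_def)
qed (simp add: box3_def)

lemma box3_iff: "m \<in> box3 \<longleftrightarrow> (\<forall>j. 0 \<le> m $ j \<and> m $ j \<le> 2)"
proof
  assume "\<forall>j. 0 \<le> m $ j \<and> m $ j \<le> 2"
  then have "(m $ 1, m $ 2) \<in> {0..2} \<times> {0..2}" by auto
  moreover have "m = (\<lambda>(i, j). vector [i, j]) (m $ 1, m $ 2)" by (simp add: vec_eq_iff forall_2 vector_2)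
  ultimately show "m \<in> box3" unfolding box3_def by (rule rev_image_eqI)
qed (auto simp: box3_def forall_2 vector_2)

lemma bspl_translate_nonzero:
  assumes "bspl (x - real_vec k) \<noteq> 0"
  shows "vfloor x - k \<in> box3"
  unfolding box3_iff
proof
  fix j
  have "0 < x $ j - of_int (k $ j)" "x $ j - of_int (k $ j) < 3"
    using bspl_nonzero[OF assms, of j] by (simp_all add: real_vec_def)
  then have "0 \<le> \<lfloor>x $ j\<rfloor> - k $ j" "\<lfloor>x $ j\<rfloor> - k $ j \<le> 2" by linarith+
  then show "0 \<le> (vfloor x - k) $ j \<and> (vfloor x - k) $ j \<le> 2" by (simp add: vfloor_def)
qed

text \<open>Frees \<open>spl\<close> from its index set, which moves with \<open>x\<close>: at a
  given point, every finite set outside which the terms vanish gives the same sum.\<close>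

lemma spl_eq:
  assumes K: "finite K" "\<And>k. k \<notin> K \<Longrightarrow> a k * of_real (bspl (x - real_vec k)) = 0"
  shows "spl a x = (\<Sum>k\<in>K. a k * of_real (bspl (x - real_vec k)))"
proof -
  let ?f = "\<lambda>k. a k * complex_of_real (bspl (x - real_vec k))"
  let ?B = "(\<lambda>m. vfloor x - m) ` box3"
  have "spl a x = (\<Sum>k\<in>?B. ?f k)"
    unfolding spl_def by (subst sum.reindex) (auto simp: inj_on_def)
  also have "\<dots> = (\<Sum>k\<in>?B \<union> K. ?f k)"
  proof (rule sum.mono_neutral_left)
    show "\<forall>k\<in>?B \<union> K - ?B. ?f k = 0"
    proof
      fix k assume "k \<in> ?B \<union> K - ?B"
      then have "vfloor x - k \<notin> box3" by (auto simp: image_iff)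
      then show "?f k = 0" using bspl_translate_nonzero[of x k] by auto
    qed
  qed (use finite_box3 K in auto)
  also have "\<dots> = (\<Sum>k\<in>K. ?f k)"
    using finite_box3 K by (intro sum.mono_neutral_right) auto
  finally show ?thesis .
qed

lemma spl_coef: "spl (coef P) x = (\<Sum>k\<in>Poly_Mapping.keys P. coef P k * of_real (bspl (x - real_vec k)))"
  by (rule spl_eq) (auto simp: in_keys_iff)

lemma spl_diff: "spl (\<lambda>k. a k - b k) x = spl a x - spl b x"
  by (simp add: spl_def left_diff_distrib sum_subtractf)

lemma spl_cmult: "spl (\<lambda>k. c * a k) x = c * spl a x"
  by (simp add: spl_def sum_distrib_left mult.assoc)

lemma spl_sum: "spl (\<lambda>k. \<Sum>i\<in>I. a i k) x = (\<Sum>i\<in>I. spl (a i) x)"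
  by (simp add: spl_def sum_distrib_right sum.swap[of _ box3])

lemma vfloor_shift: "vfloor (x - real_vec m) = vfloor x - m"
  by (simp add: vfloor_def real_vec_def vec_eq_iff)

lemma real_vec_diff: "real_vec (k - m) = real_vec k - real_vec m"
  and real_vec_add: "real_vec (k + m) = real_vec k + real_vec m"
  by (simp_all add: real_vec_def vec_eq_iff)

lemma spl_shift: "spl a (x - real_vec m) = spl (\<lambda>k. a (k - m)) x"
  unfolding spl_def by (intro sum.cong refl) (simp add: vfloor_shift real_vec_diff real_vec_add algebra_simps)

lemma measurable_vfloor [measurable]: "vfloor \<in> borel \<rightarrow>\<^sub>M count_space UNIV"
proof (rule measurable_count_space_eq_countable[THEN iffD2, OF countableI_type], intro conjI ballI)
  fix k :: "int ^ 2"
  have "vfloor -` {k} \<inter> space borel = {x. \<lfloor>x $ 1\<rfloor> = k $ 1 \<and> \<lfloor>x $ 2\<rfloor> = k $ 2}"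
    by (auto simp: vfloor_def vec_eq_iff forall_2)
  also have "\<dots> = {x \<in> space borel. real_of_int \<lfloor>x $ 1\<rfloor> = of_int (k $ 1) \<and> real_of_int \<lfloor>x $ 2\<rfloor> = of_int (k $ 2)}" by simp
  also have "\<dots> \<in> sets borel" by measurable
  finally show "vfloor -` {k} \<inter> space borel \<in> sets borel" .
qed simp

lemma spl_measurable [measurable]: "spl a \<in> borel_measurable borel"
  unfolding spl_def[abs_def]
proof (rule borel_measurable_sum)
  fix m
  have "(\<lambda>x. (\<lambda>k. a (k - m)) (vfloor x)) \<in> borel_measurable borel"
    by (rule measurable_compose[OF measurable_vfloor]) simp
  moreover have "(\<lambda>x. (\<lambda>k. real_vec (k - m)) (vfloor x)) \<in> borel_measurable borel"
    by (rule measurable_compose[OF measurable_vfloor]) simp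
  ultimately show "(\<lambda>x. a (vfloor x - m) * of_real (bspl (x - real_vec (vfloor x - m)))) \<in> borel_measurable borel"
    by measurable
qed

text \<open>The half-open lattice cells have measure 1, squeezed between the open and the closed
  unit box; integrals of functions of \<open>vfloor x\<close> thus become sums.\<close>

lemma distr_vfloor: "distr lborel (count_space UNIV) vfloor = count_space UNIV"
proof (rule measure_eqI_countable[where A = UNIV])
  fix k :: "int ^ 2"
  let ?C = "vfloor -` {k}"
  have C: "?C \<in> sets lborel" using measurable_sets[OF measurable_vfloor, of "{k}"] by simp
  have sub: "box (real_vec k) (real_vec k + 1) \<subseteq> ?C" "?C \<subseteq> cbox (real_vec k) (real_vec k + 1)"
    by (auto simp: vfloor_def vec_eq_iff mem_box_cart real_vec_def forall_2 floor_eq_iff less_imp_le)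
  have v: "(\<Prod>b\<in>Basis. ((real_vec k + 1) - real_vec k) \<bullet> b) = 1"
    using prod_Basis2[of "\<lambda>t. t" "1 :: real ^ 2"] by simp
  have le: "real_vec k \<bullet> b \<le> (real_vec k + 1) \<bullet> b" if "b \<in> Basis" for b
    using that by (auto simp: Basis_real2 inner_axis real_vec_def)
  have "emeasure lborel (box (real_vec k) (real_vec k + 1)) = 1" "emeasure lborel (cbox (real_vec k) (real_vec k + 1)) = 1"
    using le v by (simp_all add: emeasure_lborel_box emeasure_lborel_cbox)
  then have "emeasure lborel ?C = 1"
    using emeasure_mono[OF sub(1) C] emeasure_mono[OF sub(2), of lborel] by simp
  then show "emeasure (distr lborel (count_space UNIV) vfloor) {k} = emeasure (count_space UNIV) {k}"
    by (simp add: emeasure_distr)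
qed auto

lemma nn_integral_vfloor: "(\<integral>\<^sup>+x. g (vfloor x) \<partial>lborel) = (\<integral>\<^sup>+k. g k \<partial>count_space UNIV)"
proof -
  have "(\<integral>\<^sup>+k. g k \<partial>count_space UNIV) = (\<integral>\<^sup>+k. g k \<partial>distr lborel (count_space UNIV) vfloor)"
    by (simp add: distr_vfloor)
  also have "\<dots> = (\<integral>\<^sup>+x. g (vfloor x) \<partial>lborel)" by (rule nn_integral_distr) auto
  finally show ?thesis by simp
qed

lemma l2norm_shift: "l2norm (\<lambda>k. a (k - m)) = l2norm a"
proof -
  have "bij_betw (\<lambda>k :: int ^ 2. k - m) UNIV UNIV"
    by (rule bij_betw_byWitness[of _ "\<lambda>k. k + m"]) auto
  from nn_integral_bij_count_space[OF this, of "\<lambda>k. ennreal ((cmod (a k))\<^sup>2)"] show ?thesis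
    by (simp add: l2norm_def)
qed

lemma norm_sum_squared_le: "(cmod (\<Sum>i\<in>I. z i))\<^sup>2 \<le> real (card I) * (\<Sum>i\<in>I. (cmod (z i))\<^sup>2)"
proof -
  have "(cmod (\<Sum>i\<in>I. z i))\<^sup>2 \<le> (\<Sum>i\<in>I. cmod (z i))\<^sup>2" by (intro power_mono norm_sum) auto
  also have "\<dots> \<le> (\<Sum>i\<in>I. (cmod (z i))\<^sup>2) * card I" by (rule sum_squared_le_sum_of_squares)
  finally show ?thesis by (simp add: mult.commute)
qed

text \<open>81 = 9 * 9: one factor from Cauchy-Schwarz for the nine terms at a point, the other from
  the nine shifted copies of the sequence.\<close>

theorem L2_normsq_spl_le: "L2_normsq (spl a) \<le> 81 * l2norm a"
proof -
  have "ennreal ((cmod (spl a x))\<^sup>2) \<le> 9 * (\<Sum>m\<in>box3. ennreal ((cmod (a (vfloor x - m)))\<^sup>2))" for x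
  proof -
    have "(cmod (spl a x))\<^sup>2 \<le> 9 * (\<Sum>m\<in>box3. (cmod (a (vfloor x - m) * of_real (bspl (x - real_vec (vfloor x - m)))))\<^sup>2)"
      unfolding spl_def using norm_sum_squared_le[where I = box3] by (simp add: card_box3)
    also have "\<dots> \<le> 9 * (\<Sum>m\<in>box3. (cmod (a (vfloor x - m)))\<^sup>2)"
    proof (intro mult_left_mono sum_mono power_mono)
      show "cmod (a (vfloor x - m) * of_real (bspl (x - real_vec (vfloor x - m)))) \<le> cmod (a (vfloor x - m))" for m
        using bspl_nonneg bspl_le_1 by (simp add: norm_mult mult_left_le)
    qed auto
    finally have "ennreal ((cmod (spl a x))\<^sup>2) \<le> ennreal (9 * (\<Sum>m\<in>box3. (cmod (a (vfloor x - m)))\<^sup>2))"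
      by (rule ennreal_leI)
    then show ?thesis by (simp add: ennreal_mult' sum_ennreal)
  qed
  then have "L2_normsq (spl a) \<le> (\<integral>\<^sup>+x. 9 * (\<Sum>m\<in>box3. ennreal ((cmod (a (vfloor x - m)))\<^sup>2)) \<partial>lborel)"
    unfolding L2_normsq_def by (intro nn_integral_mono)
  also have "\<dots> = (\<integral>\<^sup>+k. 9 * (\<Sum>m\<in>box3. ennreal ((cmod (a (k - m)))\<^sup>2)) \<partial>count_space UNIV)"
    by (rule nn_integral_vfloor)
  also have "\<dots> = 9 * (\<Sum>m\<in>box3. l2norm (\<lambda>k. a (k - m)))"
    by (simp add: nn_integral_cmult nn_integral_sum l2norm_def del: sum_ennreal)
  also have "\<dots> = 81 * l2norm a"
    unfolding l2norm_shift by (simp add: card_box3 mult.assoc[symmetric])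
  finally show ?thesis .
qed

lemma spl_L2: "l2norm a < \<infinity> \<Longrightarrow> spl a \<in> L2"
  unfolding L2_iff_normsq using le_less_trans[OF L2_normsq_spl_le[of a]] by (simp add: ennreal_mult_less_top)

lemma l2norm_finite:
  assumes "finite K" "\<And>k. k \<notin> K \<Longrightarrow> a k = 0"
  shows "l2norm a = ennreal (\<Sum>k\<in>K. (cmod (a k))\<^sup>2)"
proof -
  have "l2norm a = (\<integral>\<^sup>+k. ennreal ((cmod (a k))\<^sup>2) * indicator K k \<partial>count_space UNIV)"
    unfolding l2norm_def by (intro nn_integral_cong) (use assms in \<open>auto simp: indicator_def\<close>)
  also have "\<dots> = (\<integral>\<^sup>+k. ennreal ((cmod (a k))\<^sup>2) \<partial>count_space K)"
    by (rule nn_integral_count_space_indicator[symmetric]) simp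
  also have "\<dots> = ennreal (\<Sum>k\<in>K. (cmod (a k))\<^sup>2)"
    using assms(1) by (simp add: nn_integral_count_space_finite sum_ennreal)
  finally show ?thesis .
qed

lemma l2norm_coef_finite: "l2norm (coef P) < \<infinity>"
  by (subst l2norm_finite[of "Poly_Mapping.keys P"]) (auto simp: in_keys_iff)

lemma l2norm_summable:
  assumes "(\<lambda>k. (cmod (a k))\<^sup>2) summable_on UNIV"
  shows "l2norm a < \<infinity>"
proof -
  have "Infinite_Set_Sum.abs_summable_on (\<lambda>k. (cmod (a k))\<^sup>2) UNIV"
    using assms by (subst abs_summable_equivalent[symmetric]) simp
  then have "integrable (count_space UNIV) (\<lambda>k. (cmod (a k))\<^sup>2)"
    by (simp add: Infinite_Set_Sum.abs_summable_on_def)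
  then show ?thesis by (simp add: integrable_iff_bounded l2norm_def)
qed

lemma l2norm_add_le: "l2norm (\<lambda>k. a k + b k) \<le> 2 * l2norm a + 2 * l2norm b"
proof -
  have "(cmod (a k + b k))\<^sup>2 \<le> 2 * (cmod (a k))\<^sup>2 + 2 * (cmod (b k))\<^sup>2" for k
    using norm_sum_squared_le[where z = "\<lambda>i. if i then a k else b k" and I = UNIV] by (simp add: UNIV_bool add.commute)
  then have "l2norm (\<lambda>k. a k + b k) \<le> (\<integral>\<^sup>+k. ennreal (2 * (cmod (a k))\<^sup>2 + 2 * (cmod (b k))\<^sup>2) \<partial>count_space UNIV)"
    unfolding l2norm_def by (intro nn_integral_mono ennreal_leI)
  also have "\<dots> = 2 * l2norm a + 2 * l2norm b"
    unfolding l2norm_def by (simp add: ennreal_plus ennreal_mult' nn_integral_add nn_integral_cmult)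
  finally show ?thesis .
qed

lemma l2norm_mono: "(\<And>k. cmod (a k) \<le> cmod (b k)) \<Longrightarrow> l2norm a \<le> l2norm b"
  unfolding l2norm_def by (intro nn_integral_mono ennreal_leI power_mono) auto

definition boxn :: "nat \<Rightarrow> (int ^ 2) set" where
  "boxn n = (\<lambda>(i, j). vector [i, j]) ` ({- int n..int n} \<times> {- int n..int n})"

lemma finite_boxn: "finite (boxn n)"
  by (simp add: boxn_def)

lemma boxn_iff: "m \<in> boxn n \<longleftrightarrow> (\<forall>j. \<bar>m $ j\<bar> \<le> int n)"
proof
  assume "\<forall>j. \<bar>m $ j\<bar> \<le> int n"
  then have "\<bar>m $ 1\<bar> \<le> int n" "\<bar>m $ 2\<bar> \<le> int n" by auto
  then have "(m $ 1, m $ 2) \<in> {- int n..int n} \<times> {- int n..int n}" by auto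
  moreover have "m = (\<lambda>(i, j). vector [i, j]) (m $ 1, m $ 2)" by (simp add: vec_eq_iff forall_2 vector_2)
  ultimately show "m \<in> boxn n" unfolding boxn_def by (rule rev_image_eqI)
qed (auto simp: boxn_def forall_2 vector_2)

lemma eventually_in_boxn: "\<forall>\<^sub>F n in sequentially. k \<in> boxn n"
  unfolding eventually_sequentially
proof (intro exI allI impI)
  fix n assume "nat (\<bar>k $ 1\<bar> + \<bar>k $ 2\<bar>) \<le> n"
  then show "k \<in> boxn n" by (auto simp: boxn_iff forall_2)
qed

text \<open>\<open>L_l2\<close> speaks of the net of finite sets, whereas \<open>L2_fourier\<close>
  asks for a sequence; growing boxes provide one.\<close>

lemma filterlim_boxn: "filterlim boxn (finite_subsets_at_top UNIV) sequentially"
  unfolding filterlim_finite_subsets_at_top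
proof (intro allI impI)
  fix X :: "(int ^ 2) set" assume X: "finite X \<and> X \<subseteq> UNIV"
  then have "\<forall>\<^sub>F n in sequentially. \<forall>k\<in>X. k \<in> boxn n"
    by (intro eventually_ball_finite) (auto intro: eventually_in_boxn)
  then show "\<forall>\<^sub>F n in sequentially. finite (boxn n) \<and> X \<subseteq> boxn n \<and> boxn n \<subseteq> UNIV"
    by eventually_elim (auto simp: finite_boxn)
qed

lemma l2norm_tail:
  assumes "l2norm a < \<infinity>"
  shows "(\<lambda>n. l2norm (\<lambda>k. if k \<in> boxn n then 0 else a k)) \<longlonglongrightarrow> 0"
proof -
  have "(\<lambda>n. \<integral>\<^sup>+k. ennreal ((cmod (if k \<in> boxn n then 0 else a k))\<^sup>2) \<partial>count_space UNIV) \<longlonglongrightarrow> (\<integral>\<^sup>+k. 0 \<partial>count_space (UNIV :: (int ^ 2) set))"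
  proof (rule nn_integral_dominated_convergence[where w = "\<lambda>k. ennreal ((cmod (a k))\<^sup>2)"])
    show "(\<integral>\<^sup>+k. ennreal ((cmod (a k))\<^sup>2) \<partial>count_space UNIV) < \<infinity>" using assms by (simp add: l2norm_def)
    show "AE k in count_space UNIV. (\<lambda>n. ennreal ((cmod (if k \<in> boxn n then 0 else a k))\<^sup>2)) \<longlonglongrightarrow> 0"
    proof (rule AE_I2, rule tendsto_eventually)
      fix k show "\<forall>\<^sub>F n in sequentially. ennreal ((cmod (if k \<in> boxn n then 0 else a k))\<^sup>2) = 0"
        using eventually_in_boxn[of k] by eventually_elim simp
    qed
  qed auto
  then show ?thesis by (simp add: l2norm_def)
qed

subsection \<open>Periodization\<close>

lemma integral_inverse_square_finite: "(\<integral>\<^sup>+t. ennreal (1 / (1 + t\<^sup>2)) \<partial>lborel) < \<infinity>"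
proof -
  have "integrable lborel (\<lambda>t::real. 1 / (1 + t\<^sup>2))"
    using integrable_inverse_1_plus_square by (simp add: set_integrable_def einterval_def divide_inverse)
  then show ?thesis by (simp add: integrable_iff_bounded)
qed

text \<open>A bound for 1 / (1 + t^2) on the cell from 2 pi l to 2 pi (l + 1). The numerator 2 is
  dictated by l = -1, whose cell reaches up to 0.\<close>

definition qdecay :: "int \<Rightarrow> real" where "qdecay l = 2 / (1 + (of_int l)\<^sup>2)"

lemma qdecay_nonneg: "0 \<le> qdecay l"
  by (simp add: qdecay_def add_nonneg_nonneg)

text \<open>The lattice sum is turned into an integral by \<open>nn_integral_vfloor\<close>; on a
  unit cell \<open>qdecay\<close> is at most 6 / (1 + t^2), and 900 = 25 * 6 * 6.\<close>

lemma qdecay_sum: "(\<integral>\<^sup>+l. ennreal (25 * (qdecay (l $ 1) * qdecay (l $ 2))) \<partial>count_space (UNIV :: (int ^ 2) set)) < \<infinity>"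
proof -
  let ?I = "(\<integral>\<^sup>+t. ennreal (1 / (1 + t\<^sup>2)) \<partial>lborel)"
  have q: "qdecay \<lfloor>t\<rfloor> \<le> 6 / (1 + t\<^sup>2)" for t
  proof -
    have "\<bar>t\<bar> \<le> \<bar>of_int \<lfloor>t\<rfloor>\<bar> + 1" by linarith
    then have "t\<^sup>2 \<le> (\<bar>of_int \<lfloor>t\<rfloor>\<bar> + 1)\<^sup>2" by (simp add: abs_le_square_iff[symmetric])
    also have "\<dots> \<le> 2 * (of_int \<lfloor>t\<rfloor>)\<^sup>2 + 2"
      using zero_le_power2[of "\<bar>real_of_int \<lfloor>t\<rfloor>\<bar> - 1"] by (simp add: power2_sum power2_diff)
    finally have "t\<^sup>2 \<le> 2 * (of_int \<lfloor>t\<rfloor>)\<^sup>2 + 2" .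
    moreover have "0 \<le> (real_of_int \<lfloor>t\<rfloor>)\<^sup>2" by simp
    ultimately have "1 + t\<^sup>2 \<le> 3 + 3 * (of_int \<lfloor>t\<rfloor>)\<^sup>2" by linarith
    then show ?thesis by (simp add: qdecay_def field_simps add_pos_nonneg)
  qed
  have "(\<integral>\<^sup>+l. ennreal (25 * (qdecay (l $ 1) * qdecay (l $ 2))) \<partial>count_space (UNIV :: (int ^ 2) set))
     = (\<integral>\<^sup>+x. ennreal (25 * (qdecay (vfloor x $ 1) * qdecay (vfloor x $ 2))) \<partial>lborel)"
    by (rule nn_integral_vfloor[symmetric])
  also have "\<dots> \<le> (\<integral>\<^sup>+x. ennreal (25 * (6 / (1 + (x $ 1)\<^sup>2) * (6 / (1 + (x $ 2)\<^sup>2)))) \<partial>(lborel :: (real ^ 2) measure))"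
    by (intro nn_integral_mono ennreal_leI mult_left_mono mult_mono)
       (auto simp: vfloor_def q qdecay_nonneg add_nonneg_nonneg)
  also have "\<dots> = (\<integral>\<^sup>+a. \<integral>\<^sup>+b. ennreal 900 * (ennreal (1 / (1 + a\<^sup>2)) * ennreal (1 / (1 + b\<^sup>2))) \<partial>lborel \<partial>lborel)"
  proof -
    have "25 * (6 / (1 + a\<^sup>2) * (6 / (1 + b\<^sup>2))) = 900 * (1 / (1 + a\<^sup>2) * (1 / (1 + b\<^sup>2)))" for a b :: real by simp
    then have "ennreal (25 * (6 / (1 + a\<^sup>2) * (6 / (1 + b\<^sup>2)))) = ennreal 900 * (ennreal (1 / (1 + a\<^sup>2)) * ennreal (1 / (1 + b\<^sup>2)))" for a b :: real
      using ennreal_mult[of 900 "1 / (1 + a\<^sup>2) * (1 / (1 + b\<^sup>2))"] ennreal_mult[of "1 / (1 + a\<^sup>2)" "1 / (1 + b\<^sup>2)"]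
      by (simp only:) (simp add: add_nonneg_nonneg)
    then show ?thesis by (subst nn_integral_vec2) (auto simp: vector_2 simp del: times_divide_eq_right times_divide_eq_left)
  qed
  also have "\<dots> = ennreal 900 * (?I * ?I)"
    by (simp add: nn_integral_cmult nn_integral_multc)
  also have "\<dots> < \<infinity>" using integral_inverse_square_finite by (simp add: ennreal_mult_less_top)
  finally show ?thesis .
qed

lemma qdecay_cell:
  assumes "\<lfloor>t / (2 * pi)\<rfloor> = l"
  shows "1 / (1 + t\<^sup>2) \<le> qdecay l"
proof -
  have t: "of_int l \<le> t / (2 * pi)" "t / (2 * pi) < of_int l + 1" using assms by (simp_all add: floor_eq_iff)
  have p: "2 * pi \<ge> 2" using pi_ge_two by simp
  have "1 + (of_int l)\<^sup>2 \<le> 2 * (1 + t\<^sup>2)"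
  proof (cases "l \<ge> 0")
    case True
    have "of_int l * (2 * pi) \<le> t" using t(1) by (simp add: field_simps)
    moreover have "of_int l * 1 \<le> of_int l * (2 * pi)" using True p by (intro mult_left_mono) auto
    ultimately have "\<bar>real_of_int l\<bar> \<le> \<bar>t\<bar>" using True by simp
    then have "(real_of_int l)\<^sup>2 \<le> t\<^sup>2" by (simp only: abs_le_square_iff)
    moreover have "0 \<le> t\<^sup>2" by simp
    ultimately have "1 + (real_of_int l)\<^sup>2 \<le> 2 + 2 * t\<^sup>2" by linarith
    then show ?thesis by simp
  next
    case False
    define m where "m = real_of_int (- l)"
    have m: "m \<ge> 1" using False by (simp add: m_def)
    have "t < (of_int l + 1) * (2 * pi)" using t(2) by (simp add: field_simps)
    then have "(m - 1) * (2 * pi) \<le> - t" by (simp add: m_def algebra_simps)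
    moreover have "(m - 1) * 2 \<le> (m - 1) * (2 * pi)" using m p by (intro mult_left_mono) auto
    ultimately have "\<bar>2 * (m - 1)\<bar> \<le> \<bar>t\<bar>" using m by simp
    then have "(2 * (m - 1))\<^sup>2 \<le> t\<^sup>2" by (simp only: abs_le_square_iff)
    \<comment> \<open>The difference of the two sides is (7 m - 9) (m - 1), which is negative
      between 1 and 9 / 7; integrality of \<open>m\<close> is essential.\<close>
    moreover have "1 + m\<^sup>2 \<le> 2 * (1 + (2 * (m - 1))\<^sup>2)"
    proof (cases "m = 1")
      case False
      then have "- l \<noteq> 1" by (auto simp: m_def)
      then have "- l \<ge> 2" using \<open>\<not> l \<ge> 0\<close> by linarith
      then have "m \<ge> 2" by (simp add: m_def)
      then have "0 \<le> (7 * m - 9) * (m - 1)" by (intro mult_nonneg_nonneg) auto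
      then show ?thesis by (simp add: power2_eq_square algebra_simps)
    qed simp
    moreover have "(of_int l)\<^sup>2 = m\<^sup>2" by (simp add: m_def)
    ultimately show ?thesis by simp
  qed
  moreover have "1 + (of_int l :: real)\<^sup>2 > 0" "1 + t\<^sup>2 > 0" by (simp_all add: add_pos_nonneg)
  ultimately show ?thesis by (simp add: qdecay_def field_simps)
qed

lemma nn_integral_shift2:
  fixes c :: "real ^ 2"
  assumes [measurable]: "f \<in> borel_measurable borel"
  shows "(\<integral>\<^sup>+x. f (x + c) \<partial>lborel) = (\<integral>\<^sup>+x. f x \<partial>lborel)"
proof -
  have "(\<integral>\<^sup>+x. f x \<partial>lborel) = (\<integral>\<^sup>+x. f x \<partial>distr lborel borel ((+) c))" by (simp add: lborel_distr_plus)
  also have "\<dots> = (\<integral>\<^sup>+x. f (x + c) \<partial>lborel)" by (subst nn_integral_distr) (auto simp: add.commute)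
  finally show ?thesis by simp
qed

text \<open>The plane is cut into translates of the period square. On each the squared transform has
  an explicit bound, summable over the lattice, while the integral of \<open>g\<close> is at most
  the one over the closed period square.\<close>

lemma nn_integral_fourier_bspl_periodic:
  obtains C where "C < \<infinity>" and
    "\<And>g. g \<in> borel_measurable borel \<Longrightarrow> (\<And>u l. g (u + (2 * pi) *\<^sub>R real_vec l) = g u) \<Longrightarrow>
      (\<integral>\<^sup>+u. g u * ennreal ((cmod (fourier (\<lambda>x. of_real (bspl x)) u))\<^sup>2) \<partial>lborel)
        \<le> C * (\<integral>\<^sup>+u\<in>cbox 0 (\<chi> j. 2 * pi). g u \<partial>lborel)"
proof
  let ?C = "(\<integral>\<^sup>+l. ennreal (25 * (qdecay (l $ 1) * qdecay (l $ 2))) \<partial>count_space (UNIV :: (int ^ 2) set))"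
  show "?C < \<infinity>" by (rule qdecay_sum)
  fix g :: "real ^ 2 \<Rightarrow> ennreal"
  assume g [measurable]: "g \<in> borel_measurable borel" and per: "\<And>u l. g (u + (2 * pi) *\<^sub>R real_vec l) = g u"
  let ?d = "\<lambda>l :: int ^ 2. ennreal (25 * (qdecay (l $ 1) * qdecay (l $ 2)))"
  let ?c = "\<lambda>u. vfloor ((1 / (2 * pi)) *\<^sub>R u)"
  let ?J = "\<integral>\<^sup>+u\<in>cbox 0 (\<chi> j. 2 * pi). g u \<partial>lborel"
  have c_meas [measurable]: "?c \<in> borel \<rightarrow>\<^sub>M count_space UNIV"
    by (rule measurable_compose[OF _ measurable_vfloor]) simp
  have ind [measurable]: "(\<lambda>u. indicator {l} (?c u) :: ennreal) \<in> borel_measurable borel" for l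
    by (rule measurable_compose[OF c_meas]) simp
  have cell: "(\<integral>\<^sup>+u. g u * indicator {l} (?c u) \<partial>lborel) \<le> ?J" for l
  proof -
    have "?c (u + (2 * pi) *\<^sub>R real_vec l) = ?c u + l" for u
      by (simp add: vfloor_def real_vec_def vec_eq_iff distrib_left)
    then have "(\<integral>\<^sup>+u. g u * indicator {l} (?c u) \<partial>lborel) = (\<integral>\<^sup>+u. g u * indicator {l} (?c u + l) \<partial>lborel)"
      by (subst nn_integral_shift2[where c = "(2 * pi) *\<^sub>R real_vec l", symmetric]) (simp_all add: per)
    also have "\<dots> \<le> ?J"
    proof (intro nn_integral_mono mult_left_mono)
      show "indicator {l} (?c u + l) \<le> (indicator (cbox 0 (\<chi> j. 2 * pi)) u :: ennreal)" for u
      proof (cases "?c u = 0")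
        case True
        then have "0 \<le> u $ j / (2 * pi) \<and> u $ j / (2 * pi) < 1" for j
          by (simp add: vfloor_def vec_eq_iff floor_eq_iff)
        then have "u \<in> cbox 0 (\<chi> j. 2 * pi)"
          by (auto simp: mem_box_cart pos_le_divide_eq pos_divide_less_eq less_imp_le)
        then show ?thesis by (simp add: indicator_def)
      qed (simp add: indicator_def)
    qed simp
    finally show ?thesis .
  qed
  have "(\<integral>\<^sup>+u. g u * ennreal ((cmod (fourier (\<lambda>x. of_real (bspl x)) u))\<^sup>2) \<partial>lborel)
     \<le> (\<integral>\<^sup>+u. g u * ?d (?c u) \<partial>lborel)"
  proof (intro nn_integral_mono mult_left_mono ennreal_leI)
    fix u :: "real ^ 2"
    have "(cmod (fourier (\<lambda>x. of_real (bspl x)) u))\<^sup>2 \<le> 25 * (1 / (1 + (u $ 1)\<^sup>2) * (1 / (1 + (u $ 2)\<^sup>2)))"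
      using fourier_bspl_decay[of u] by simp
    also have "\<dots> \<le> 25 * (qdecay (?c u $ 1) * qdecay (?c u $ 2))"
      by (intro mult_left_mono mult_mono qdecay_cell)
         (auto simp: vfloor_def qdecay_nonneg add_nonneg_nonneg)
    finally show "(cmod (fourier (\<lambda>x. of_real (bspl x)) u))\<^sup>2 \<le> 25 * (qdecay (?c u $ 1) * qdecay (?c u $ 2))" .
  qed simp
  also have "\<dots> = (\<integral>\<^sup>+u. \<integral>\<^sup>+l. ?d l * (g u * indicator {l} (?c u)) \<partial>count_space UNIV \<partial>lborel)"
  proof (intro nn_integral_cong)
    fix u :: "real ^ 2"
    have "(\<integral>\<^sup>+l. ?d l * (g u * indicator {l} (?c u)) \<partial>count_space UNIV)
       = (\<integral>\<^sup>+l. (?d l * g u) * indicator {?c u} l \<partial>count_space UNIV)"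
      by (intro nn_integral_cong) (auto simp: indicator_def)
    then show "g u * ?d (?c u) = (\<integral>\<^sup>+l. ?d l * (g u * indicator {l} (?c u)) \<partial>count_space UNIV)"
      by (subst (asm) nn_integral_indicator_singleton) (auto simp: mult.commute)
  qed
  also have "\<dots> = (\<integral>\<^sup>+l. \<integral>\<^sup>+u. ?d l * (g u * indicator {l} (?c u)) \<partial>lborel \<partial>count_space UNIV)"
    by (rule nn_integral_count_space_nn_integral[OF countableI_type]) measurable
  also have "\<dots> = (\<integral>\<^sup>+l. ?d l * (\<integral>\<^sup>+u. g u * indicator {l} (?c u) \<partial>lborel) \<partial>count_space UNIV)"
    by (intro nn_integral_cong nn_integral_cmult) measurable
  also have "\<dots> \<le> (\<integral>\<^sup>+l. ?d l * ?J \<partial>count_space UNIV)"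
    by (intro nn_integral_mono mult_left_mono cell) simp
  also have "\<dots> = ?C * ?J" by (rule nn_integral_multc) simp
  finally show "(\<integral>\<^sup>+u. g u * ennreal ((cmod (fourier (\<lambda>x. of_real (bspl x)) u))\<^sup>2) \<partial>lborel) \<le> ?C * ?J" .
qed

section \<open>Functions with a mask as spline series\<close>

abbreviation bhat :: "real ^ 2 \<Rightarrow> complex" where "bhat \<equiv> fourier (\<lambda>x. complex_of_real (bspl x))"

lemma bhat_measurable [measurable]: "bhat \<in> borel_measurable borel"
  by (rule fourier_measurable) measurable

lemma fourier_box_spline: "is_box_spline Xi \<phi> \<Longrightarrow> fourier \<phi> = bhat"
  by (rule ext) (rule box_spline_fourier)

lemma exp_mi_periodic: "exp_mi (u + (2 * pi) *\<^sub>R real_vec l) = exp_mi u"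
proof -
  have "expn (2 * pi * of_int n) = 1" for n
    using cis_multiple_2pi[of "- real_of_int n"] by (simp add: cis_conv_exp mult.assoc)
  then have "expn (t + 2 * pi * of_int n) = expn t" for t n
    unfolding expn_add by simp
  then show ?thesis by (simp add: exp_mi_def real_vec_def vec_eq_iff)
qed

lemma measurable_trig_sum [measurable]:
  "(\<lambda>u. \<Sum>k\<in>K. a k * zpow (exp_mi (u :: real ^ 2)) k) \<in> borel_measurable borel"
  unfolding zpow_exp_mi by measurable

lemma measurable_leval_exp_mi [measurable]: "(\<lambda>u. leval P (exp_mi (u :: real ^ 2))) \<in> borel_measurable borel"
  unfolding leval_def by measurable

text \<open>This carries mean square convergence of masks on the torus over to convergence of the
  transforms on the plane.\<close>

lemma L2_normsq_times_bhat:
  obtains C where "C < \<infinity>" and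
    "\<And>G. (\<lambda>u. G (exp_mi u)) \<in> borel_measurable borel \<Longrightarrow>
      L2_normsq (\<lambda>u. G (exp_mi u) * bhat u) \<le> C * (\<integral>\<^sup>+u\<in>cbox 0 (\<chi> j. 2 * pi). ennreal ((cmod (G (exp_mi u)))\<^sup>2) \<partial>lborel)"
proof -
  obtain C where C: "C < \<infinity>" and le: "\<And>g. g \<in> borel_measurable borel \<Longrightarrow> (\<And>u l. g (u + (2 * pi) *\<^sub>R real_vec l) = g u) \<Longrightarrow>
      (\<integral>\<^sup>+u. g u * ennreal ((cmod (bhat u))\<^sup>2) \<partial>lborel) \<le> C * (\<integral>\<^sup>+u\<in>cbox 0 (\<chi> j. 2 * pi). g u \<partial>lborel)"
    by (rule nn_integral_fourier_bspl_periodic) blast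
  show ?thesis
  proof (rule that[OF C])
    fix G :: "complex ^ 2 \<Rightarrow> complex"
    assume [measurable]: "(\<lambda>u. G (exp_mi u)) \<in> borel_measurable borel"
    have "L2_normsq (\<lambda>u. G (exp_mi u) * bhat u) = (\<integral>\<^sup>+u. ennreal ((cmod (G (exp_mi u)))\<^sup>2) * ennreal ((cmod (bhat u))\<^sup>2) \<partial>lborel)"
      by (simp add: L2_normsq_def norm_mult power_mult_distrib ennreal_mult)
    also have "\<dots> \<le> C * (\<integral>\<^sup>+u\<in>cbox 0 (\<chi> j. 2 * pi). ennreal ((cmod (G (exp_mi u)))\<^sup>2) \<partial>lborel)"
      by (rule le) (simp_all add: exp_mi_periodic)
    finally show "L2_normsq (\<lambda>u. G (exp_mi u) * bhat u) \<le> \<dots>" .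
  qed
qed

lemma spl_coef_integrable: "integrable lborel (spl (coef P))"
proof -
  have "integrable lborel (\<lambda>x. \<Sum>k\<in>Poly_Mapping.keys P. coef P k * of_real (bspl (x - real_vec k)))"
    by (intro Bochner_Integration.integrable_sum integrable_mult_right fourier_shift(1)[OF integrable_bspl])
  then show ?thesis by (simp add: spl_coef[abs_def])
qed

lemma fourier_spl_coef: "fourier (spl (coef P)) u = leval P (exp_mi u) * bhat u"
  unfolding spl_coef[abs_def] sum_coef_fourier leval_def ..

lemma leval_bhat_L2: "(\<lambda>u. leval P (exp_mi u) * bhat u) \<in> L2"
proof -
  obtain C where C: "C < \<infinity>" and le: "\<And>G. (\<lambda>u. G (exp_mi u)) \<in> borel_measurable borel \<Longrightarrow>
      L2_normsq (\<lambda>u. G (exp_mi u) * bhat u) \<le> C * (\<integral>\<^sup>+u\<in>cbox 0 (\<chi> j. 2 * pi). ennreal ((cmod (G (exp_mi u)))\<^sup>2) \<partial>lborel)"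
    by (rule L2_normsq_times_bhat) blast
  have "(\<integral>\<^sup>+u\<in>cbox 0 (\<chi> j. 2 * pi). ennreal ((cmod (leval P (exp_mi u)))\<^sup>2) \<partial>lborel)
      \<le> (\<integral>\<^sup>+u\<in>cbox 0 (\<chi> j. 2 * pi). ennreal ((lnorm P)\<^sup>2) \<partial>(lborel :: (real ^ 2) measure))"
    by (intro nn_integral_mono mult_right_mono ennreal_leI power_mono norm_leval_le[OF exp_mi_torus]) auto
  also have "\<dots> = ennreal ((lnorm P)\<^sup>2) * emeasure lborel (cbox 0 (\<chi> j. 2 * pi) :: (real ^ 2) set)"
    by (simp add: nn_integral_cmult_indicator)
  also have "\<dots> < \<infinity>" using emeasure_lborel_cbox_finite[of "0 :: real ^ 2" "\<chi> j. 2 * pi"]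
    by (simp add: ennreal_mult_less_top del: power_0_left)
  finally have "C * (\<integral>\<^sup>+u\<in>cbox 0 (\<chi> j. 2 * pi). ennreal ((cmod (leval P (exp_mi u)))\<^sup>2) \<partial>lborel) < \<infinity>"
    using C by (simp add: ennreal_mult_less_top)
  then show ?thesis unfolding L2_iff_normsq using le_less_trans[OF le[of "leval P"]] by simp
qed

lemma L2_fourier_spl_coef: "L2_fourier (spl (coef P)) (\<lambda>u. leval P (exp_mi u) * bhat u)"
  unfolding L2_fourier_def
proof (intro conjI exI[of _ "\<lambda>_. spl (coef P)"] allI)
  show "spl (coef P) \<in> L2" "spl (coef P) \<in> L2" by (rule spl_L2[OF l2norm_coef_finite])+
qed (auto simp: leval_bhat_L2 spl_coef_integrable fourier_spl_coef L2_normsq_def)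

lemma L2_fourier_cong_AE:
  assumes f: "L2_fourier f g" and eq: "AE x in lborel. f x = f' x" and m: "f' \<in> borel_measurable borel"
  shows "L2_fourier f' g"
proof -
  have n: "L2_normsq (\<lambda>x. h x - f x) = L2_normsq (\<lambda>x. h x - f' x)" for h
    using eq by (intro L2_normsq_cong_AE) auto
  have "L2_normsq f' = L2_normsq f" using eq by (intro L2_normsq_cong_AE) auto
  then show ?thesis using f m unfolding L2_fourier_def n by (simp add: L2_iff_normsq)
qed

lemma leval_L_l2: "leval (P :: 2 laurent) \<in> L_l2"
  unfolding L_l2_def
proof (intro CollectI conjI exI[of _ "coef P"])
  show "(\<lambda>u. leval P (exp_mi u)) \<in> borel_measurable lborel" by simp
  show "(\<lambda>k. (cmod (coef P k))\<^sup>2) summable_on UNIV"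
    by (rule summable_on_cong_neutral[of UNIV "Poly_Mapping.keys P", THEN iffD1, OF _ _ _ summable_on_finite])
       (auto simp: in_keys_iff)
  show "((\<lambda>K. \<integral>\<^sup>+u\<in>cbox 0 (\<chi> j. 2 * pi). ennreal ((cmod (leval P (exp_mi u) - (\<Sum>k\<in>K. coef P k * zpow (exp_mi u) k)))\<^sup>2) \<partial>lborel)
           \<longlongrightarrow> 0) (finite_subsets_at_top UNIV)"
  proof (rule tendsto_eventually)
    have "\<forall>\<^sub>F K in finite_subsets_at_top UNIV. finite K \<and> Poly_Mapping.keys P \<subseteq> K"
      unfolding eventually_finite_subsets_at_top by (rule exI[of _ "Poly_Mapping.keys P"]) auto
    then show "\<forall>\<^sub>F K in finite_subsets_at_top UNIV. (\<integral>\<^sup>+u\<in>cbox 0 (\<chi> j. 2 * pi). ennreal ((cmod (leval P (exp_mi u) - (\<Sum>k\<in>K. coef P k * zpow (exp_mi u) k)))\<^sup>2) \<partial>lborel) = 0"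
    proof (eventually_elim)
      case (elim K)
      then have "leval P (exp_mi u) = (\<Sum>k\<in>K. coef P k * zpow (exp_mi u) k)" for u :: "real ^ 2"
        by (intro leval_superset) auto
      then show ?case by simp
    qed
  qed
qed

lemma has_mask_leval_iff:
  assumes \<phi>: "is_box_spline Xi \<phi>"
  shows "has_mask \<phi> f (leval P) \<longleftrightarrow> f \<in> borel_measurable borel \<and> (AE x in lborel. f x = spl (coef P) x)"
proof
  assume "has_mask \<phi> f (leval P)"
  then have f: "L2_fourier f (\<lambda>u. leval P (exp_mi u) * bhat u)"
    by (simp add: has_mask_def fourier_box_spline[OF \<phi>])
  then show "f \<in> borel_measurable borel \<and> (AE x in lborel. f x = spl (coef P) x)"
    using L2_fourier_inject[OF f L2_fourier_spl_coef] by (auto simp: L2_fourier_def L2_measurable)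
next
  assume f: "f \<in> borel_measurable borel \<and> (AE x in lborel. f x = spl (coef P) x)"
  then have "AE x in lborel. spl (coef P) x = f x" by auto
  then show "has_mask \<phi> f (leval P)"
    using L2_fourier_cong_AE[OF L2_fourier_spl_coef] f
    by (simp add: has_mask_def fourier_box_spline[OF \<phi>] leval_L_l2)
qed

text \<open>Truncations to boxes converge on both sides: to \<open>spl a\<close> by the bounded
  overlap of the translates, and on the Fourier side by periodization. Hence \<open>spl a\<close>
  and \<open>f\<close> have the same transform.\<close>

theorem has_mask_AE_spl:
  assumes \<phi>: "is_box_spline Xi \<phi>" and f: "has_mask \<phi> f F"
  shows "\<exists>a. l2norm a < \<infinity> \<and> (AE x in lborel. f x = spl a x)"
proof -
  from f have ff: "L2_fourier f (\<lambda>u. F (exp_mi u) * bhat u)" and F: "F \<in> L_l2"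
    by (auto simp: has_mask_def fourier_box_spline[OF \<phi>])
  from F obtain a where [measurable]: "(\<lambda>u. F (exp_mi u)) \<in> borel_measurable borel"
    and a: "(\<lambda>k. (cmod (a k))\<^sup>2) summable_on UNIV"
    and lim: "((\<lambda>K. \<integral>\<^sup>+u\<in>cbox 0 (\<chi> j. 2 * pi). ennreal ((cmod (F (exp_mi u) - (\<Sum>k\<in>K. a k * zpow (exp_mi u) k)))\<^sup>2) \<partial>lborel)
           \<longlongrightarrow> 0) (finite_subsets_at_top UNIV)"
    by (auto simp: L_l2_def)
  have fin: "l2norm a < \<infinity>" by (rule l2norm_summable[OF a])
  define an where "an = (\<lambda>n k. if k \<in> boxn n then a k else 0)"
  have tail: "(\<lambda>k. an n k - a k) = (\<lambda>k. - (if k \<in> boxn n then 0 else a k))" for n by (auto simp: an_def)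
  have an_fin: "l2norm (an n) < \<infinity>" for n
    by (subst l2norm_finite[OF finite_boxn]) (auto simp: an_def)
  have spl_an: "spl (an n) = (\<lambda>x. \<Sum>k\<in>boxn n. a k * of_real (bspl (x - real_vec k)))" for n
    by (rule ext, subst spl_eq[OF finite_boxn[of n]]) (auto simp: an_def)
  have "L2_fourier (spl a) (\<lambda>u. F (exp_mi u) * bhat u)"
    unfolding L2_fourier_def
  proof (intro conjI exI[of _ "\<lambda>n. spl (an n)"] allI)
    show "spl a \<in> L2" "\<And>n. spl (an n) \<in> L2" using fin an_fin by (auto intro: spl_L2)
    show "(\<lambda>u. F (exp_mi u) * bhat u) \<in> L2" using ff by (simp add: L2_fourier_def)
    show "integrable lborel (spl (an n))" for n
      unfolding spl_an
      by (intro Bochner_Integration.integrable_sum integrable_mult_right fourier_shift(1)[OF integrable_bspl])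
    have "(\<lambda>n. 81 * l2norm (\<lambda>k. if k \<in> boxn n then 0 else a k)) \<longlonglongrightarrow> 81 * 0"
      by (intro tendsto_mult_ennreal tendsto_const l2norm_tail fin) auto
    then have "(\<lambda>n. 81 * l2norm (\<lambda>k. if k \<in> boxn n then 0 else a k)) \<longlonglongrightarrow> 0" by simp
    moreover have "L2_normsq (\<lambda>x. spl (an n) x - spl a x) \<le> 81 * l2norm (\<lambda>k. if k \<in> boxn n then 0 else a k)" for n
    proof -
      have "L2_normsq (\<lambda>x. spl (an n) x - spl a x) \<le> 81 * l2norm (\<lambda>k. an n k - a k)"
        using L2_normsq_spl_le[of "\<lambda>k. an n k - a k"] by (simp add: spl_diff[abs_def])
      then show ?thesis unfolding tail by (simp add: l2norm_def)
    qed
    ultimately show "(\<lambda>n. L2_normsq (\<lambda>x. spl (an n) x - spl a x)) \<longlonglongrightarrow> 0"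
      by (rule ennreal_tendsto_0_le[rotated])
    obtain C where C: "C < \<infinity>" and le: "\<And>G. (\<lambda>u. G (exp_mi u)) \<in> borel_measurable borel \<Longrightarrow>
        L2_normsq (\<lambda>u. G (exp_mi u) * bhat u) \<le> C * (\<integral>\<^sup>+u\<in>cbox 0 (\<chi> j. 2 * pi). ennreal ((cmod (G (exp_mi u)))\<^sup>2) \<partial>lborel)"
      by (rule L2_normsq_times_bhat) blast
    let ?I = "\<lambda>n. \<integral>\<^sup>+u\<in>cbox 0 (\<chi> j. 2 * pi). ennreal ((cmod (F (exp_mi u) - (\<Sum>k\<in>boxn n. a k * zpow (exp_mi u) k)))\<^sup>2) \<partial>lborel"
    have "?I \<longlonglongrightarrow> 0" by (rule filterlim_compose[OF lim filterlim_boxn])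
    then have "(\<lambda>n. C * ?I n) \<longlonglongrightarrow> C * 0"
      using C by (intro tendsto_mult_ennreal tendsto_const) auto
    then have "(\<lambda>n. C * ?I n) \<longlonglongrightarrow> 0" by simp
    moreover have "L2_normsq (\<lambda>u. fourier (spl (an n)) u - F (exp_mi u) * bhat u) \<le> C * ?I n" for n
    proof -
      have "L2_normsq (\<lambda>u. fourier (spl (an n)) u - F (exp_mi u) * bhat u)
          = L2_normsq (\<lambda>u. - ((\<lambda>\<zeta>. F \<zeta> - (\<Sum>k\<in>boxn n. a k * zpow \<zeta> k)) (exp_mi u) * bhat u))"
        unfolding spl_an sum_coef_fourier by (simp add: algebra_simps)
      also have "\<dots> \<le> C * ?I n"
        unfolding L2_normsq_minus by (rule le) measurable
      finally show ?thesis .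
    qed
    ultimately show "(\<lambda>n. L2_normsq (\<lambda>u. fourier (spl (an n)) u - F (exp_mi u) * bhat u)) \<longlonglongrightarrow> 0"
      by (rule ennreal_tendsto_0_le[rotated])
  qed
  from L2_fourier_inject[OF ff this] fin show ?thesis by blast
qed

subsection \<open>Dilation\<close>

lemma L2_normsq_half:
  fixes k :: "real ^ 2 \<Rightarrow> complex"
  assumes [measurable]: "k \<in> borel_measurable borel"
  shows "L2_normsq (\<lambda>x. (1 / 4) * k ((1 / 2) *\<^sub>R x)) \<le> L2_normsq k"
proof -
  have "L2_normsq (\<lambda>x. (1 / 4) * k ((1 / 2) *\<^sub>R x)) = 4 * (\<integral>\<^sup>+x. ennreal ((cmod ((1 / 4) * k x))\<^sup>2) \<partial>lborel)"
  proof -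
    have "(\<lambda>x. ennreal ((cmod ((1 / 4) * k ((1 / 2) *\<^sub>R x)))\<^sup>2)) \<in> borel_measurable borel" by measurable
    from nn_integral_scale2[OF this] show ?thesis by (simp add: L2_normsq_def)
  qed
  also have "\<dots> = (\<integral>\<^sup>+x. 4 * ennreal ((cmod ((1 / 4) * k x))\<^sup>2) \<partial>lborel)"
    by (rule nn_integral_cmult[symmetric]) measurable
  also have "\<dots> \<le> L2_normsq k"
    unfolding L2_normsq_def
  proof (intro nn_integral_mono)
    fix x
    have "4 * ennreal ((cmod ((1 / 4) * k x))\<^sup>2) = ennreal (4 * (cmod ((1 / 4) * k x))\<^sup>2)"
      by (subst ennreal_mult) auto
    also have "\<dots> \<le> ennreal ((cmod (k x))\<^sup>2)"
      by (intro ennreal_leI) (simp add: norm_mult power_mult_distrib power_divide norm_divide)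
    finally show "4 * ennreal ((cmod ((1 / 4) * k x))\<^sup>2) \<le> ennreal ((cmod (k x))\<^sup>2)" .
  qed
  finally show ?thesis .
qed

lemma L2_normsq_double:
  fixes k :: "real ^ 2 \<Rightarrow> complex"
  assumes [measurable]: "k \<in> borel_measurable borel"
  shows "L2_normsq (\<lambda>x. k (2 *\<^sub>R x)) \<le> L2_normsq k"
proof -
  have "L2_normsq k = 4 * L2_normsq (\<lambda>x. k (2 *\<^sub>R x))"
  proof -
    have "(\<lambda>x. ennreal ((cmod (k x))\<^sup>2)) \<in> borel_measurable borel" by measurable
    from nn_integral_scale2[OF this] show ?thesis by (simp add: L2_normsq_def)
  qed
  moreover have "1 * L2_normsq (\<lambda>x. k (2 *\<^sub>R x)) \<le> 4 * L2_normsq (\<lambda>x. k (2 *\<^sub>R x))"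
    by (rule mult_right_mono) auto
  ultimately show ?thesis by simp
qed

lemma L2_half:
  fixes k :: "real ^ 2 \<Rightarrow> complex"
  shows "k \<in> L2 \<Longrightarrow> (\<lambda>x. (1 / 4) * k ((1 / 2) *\<^sub>R x)) \<in> L2"
  unfolding L2_iff_normsq using le_less_trans[OF L2_normsq_half[of k]] by (auto intro!: borel_measurable_times)

text \<open>In two dimensions, passing from the transform at \<open>u\<close> to the one at
  \<open>2 u\<close> means replacing g(x) by g(x / 2) / 4; the approximating sequence is dilated
  along.\<close>

lemma L2_fourier_half:
  fixes g g' :: "real ^ 2 \<Rightarrow> complex"
  assumes "L2_fourier g g'"
  shows "L2_fourier (\<lambda>x. (1 / 4) * g ((1 / 2) *\<^sub>R x)) (\<lambda>u. g' (2 *\<^sub>R u))"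
proof -
  from assms obtain h where g: "g \<in> L2" "g' \<in> L2"
    and h: "\<And>n. integrable lborel (h n)" "\<And>n. h n \<in> L2"
      "(\<lambda>n. L2_normsq (\<lambda>x. h n x - g x)) \<longlonglongrightarrow> 0" "(\<lambda>n. L2_normsq (\<lambda>u. fourier (h n) u - g' u)) \<longlonglongrightarrow> 0"
    by (auto simp: L2_fourier_def)
  have [measurable]: "g \<in> borel_measurable borel" "g' \<in> borel_measurable borel" "\<And>n. h n \<in> borel_measurable borel"
    by (rule L2_measurable[OF g(1)], rule L2_measurable[OF g(2)], rule L2_measurable[OF h(2)])
  have [measurable]: "fourier (h n) \<in> borel_measurable borel" for n
    by (rule fourier_measurable) measurable
  have fh: "fourier (\<lambda>x. (1 / 4) * h n ((1 / 2) *\<^sub>R x)) u = fourier (h n) (2 *\<^sub>R u)" for n u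
  proof -
    have "fourier (\<lambda>x. \<Sum>i\<in>{()}. (1 / 4) * h n ((1 / 2) *\<^sub>R x)) u = (\<Sum>i\<in>{()}. (1 / 4) * fourier (\<lambda>x. h n ((1 / 2) *\<^sub>R x)) u)"
      by (rule fourier_sum) (rule fourier_half(1)[OF h(1)])
    then show ?thesis by (simp add: fourier_half(2)[OF h(1)])
  qed
  show ?thesis
    unfolding L2_fourier_def
  proof (intro conjI exI[of _ "\<lambda>n x. (1 / 4) * h n ((1 / 2) *\<^sub>R x)"] allI L2_half g h)
    show "(\<lambda>u. g' (2 *\<^sub>R u)) \<in> L2"
      using g(2) le_less_trans[OF L2_normsq_double[of g']] by (simp add: L2_iff_normsq)
    show "integrable lborel (\<lambda>x. (1 / 4) * h n ((1 / 2) *\<^sub>R x))" for n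
      by (intro integrable_mult_right fourier_half(1) h)
    show "(\<lambda>n. L2_normsq (\<lambda>x. (1 / 4) * h n ((1 / 2) *\<^sub>R x) - (1 / 4) * g ((1 / 2) *\<^sub>R x))) \<longlonglongrightarrow> 0"
    proof (rule ennreal_tendsto_0_le[OF _ h(3)])
      show "L2_normsq (\<lambda>x. (1 / 4) * h n ((1 / 2) *\<^sub>R x) - (1 / 4) * g ((1 / 2) *\<^sub>R x)) \<le> L2_normsq (\<lambda>x. h n x - g x)" for n
        using L2_normsq_half[of "\<lambda>x. h n x - g x"] by (simp add: right_diff_distrib diff_divide_distrib)
    qed
    show "(\<lambda>n. L2_normsq (\<lambda>u. fourier (\<lambda>x. (1 / 4) * h n ((1 / 2) *\<^sub>R x)) u - g' (2 *\<^sub>R u))) \<longlonglongrightarrow> 0"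
      unfolding fh
    proof (rule ennreal_tendsto_0_le[OF _ h(4)])
      show "L2_normsq (\<lambda>u. fourier (h n) (2 *\<^sub>R u) - g' (2 *\<^sub>R u)) \<le> L2_normsq (\<lambda>u. fourier (h n) u - g' u)" for n
        using L2_normsq_double[of "\<lambda>u. fourier (h n) u - g' u"] by simp
    qed
  qed
qed

lemma AE_lborel_half:
  assumes "AE x in (lborel :: (real ^ 2) measure). P x"
  shows "AE x in lborel. P ((1 / 2) *\<^sub>R x)"
proof -
  have l: "(lborel :: (real ^ 2) measure) = density (distr lborel borel (\<lambda>x. (1 / 2) *\<^sub>R x)) (\<lambda>_. ennreal (1 / 4))"
    using lborel_affine[of "1 / 2" "0 :: real ^ 2"] by (simp add: DIM_cart power_divide)
  have "AE x in density (distr lborel borel (\<lambda>x. (1 / 2) *\<^sub>R x)) (\<lambda>_. ennreal (1 / 4)). P x"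
    by (subst l[symmetric]) (rule assms)
  then have "AE x in distr lborel borel (\<lambda>x. (1 / 2) *\<^sub>R x). P x"
    by (subst (asm) AE_density) auto
  from AE_distrD[OF _ this] show ?thesis by simp
qed

lemma Vm1_AE:
  assumes \<phi>: "is_box_spline Xi \<phi>" and f: "f \<in> Vm1 \<phi>"
  shows "\<exists>c. l2norm c < \<infinity> \<and> (AE x in lborel. f x = (1 / 4) * spl c ((1 / 2) *\<^sub>R x))"
proof -
  from f obtain g g' F where g: "has_mask \<phi> g F" and g': "L2_fourier g g'" and fg: "L2_fourier f (\<lambda>u. g' (2 *\<^sub>R u))"
    by (auto simp: Vm1_def V0_def)
  from has_mask_AE_spl[OF \<phi> g] obtain c where c: "l2norm c < \<infinity>" "AE x in lborel. g x = spl c x" by blast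
  have "AE x in lborel. f x = (1 / 4) * g ((1 / 2) *\<^sub>R x)"
    by (rule L2_fourier_inject[OF fg L2_fourier_half[OF g']])
  moreover have "AE x in lborel. g ((1 / 2) *\<^sub>R x) = spl c ((1 / 2) *\<^sub>R x)"
    by (rule AE_lborel_half[OF c(2)])
  ultimately have "AE x in lborel. f x = (1 / 4) * spl c ((1 / 2) *\<^sub>R x)" by eventually_elim simp
  with c(1) show ?thesis by blast
qed

lemma spl_single: "spl (coef (Poly_Mapping.single k 1)) x = of_real (bspl (x - real_vec k))"
  by (simp add: spl_coef)

text \<open>Supplies the test functions: \<open>W0_imp_spl\<close> uses orthogonality to exactly
  these dilated translates.\<close>

lemma Vm1_bspl:
  assumes \<phi>: "is_box_spline Xi \<phi>"
  shows "(\<lambda>x. (1 / 4) * of_real (bspl ((1 / 2) *\<^sub>R x - real_vec k))) \<in> Vm1 \<phi>"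
proof -
  let ?g = "spl (coef (Poly_Mapping.single k 1))"
  have "has_mask \<phi> ?g (leval (Poly_Mapping.single k 1))"
    unfolding has_mask_leval_iff[OF \<phi>] by simp
  then have "?g \<in> V0 \<phi>" by (auto simp: V0_def)
  moreover have "L2_fourier ?g (\<lambda>u. leval (Poly_Mapping.single k 1) (exp_mi u) * bhat u)"
    by (rule L2_fourier_spl_coef)
  moreover from L2_fourier_half[OF this]
  have "L2_fourier (\<lambda>x. (1 / 4) * of_real (bspl ((1 / 2) *\<^sub>R x - real_vec k)))
      (\<lambda>u. leval (Poly_Mapping.single k 1) (exp_mi (2 *\<^sub>R u)) * bhat (2 *\<^sub>R u))"
    by (simp only: spl_single)
  ultimately show ?thesis unfolding Vm1_def by (intro CollectI bexI[of _ ?g] exI[of _ "\<lambda>u. leval (Poly_Mapping.single k 1) (exp_mi u) * bhat u"]) auto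
qed

subsection \<open>The action of Laurent polynomials on sequences\<close>

text \<open>Convolution with the coefficients of \<open>P\<close>. The sum is finite, which makes it
  an action on arbitrary sequences.\<close>

definition act :: "2 laurent \<Rightarrow> (int ^ 2 \<Rightarrow> complex) \<Rightarrow> int ^ 2 \<Rightarrow> complex" where
  "act P b k = (\<Sum>j\<in>Poly_Mapping.keys P. coef P j * b (k - j))"

lemma act_superset: "finite A \<Longrightarrow> Poly_Mapping.keys P \<subseteq> A \<Longrightarrow> act P b k = (\<Sum>j\<in>A. coef P j * b (k - j))"
  unfolding act_def by (rule sum.mono_neutral_left) (auto simp: in_keys_iff)

lemma act_single: "act (Poly_Mapping.single j c) b k = c * b (k - j)"
  by (cases "c = 0") (auto simp: act_def)

lemma act_add_left: "act (P + Q) b k = act P b k + act Q b k"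
proof -
  let ?A = "Poly_Mapping.keys P \<union> Poly_Mapping.keys Q"
  have "act (P + Q) b k = (\<Sum>j\<in>?A. coef (P + Q) j * b (k - j))"
    using Poly_Mapping.keys_add[of P Q] by (intro act_superset) auto
  also have "\<dots> = act P b k + act Q b k"
    by (subst (1 2) act_superset[where A = ?A]) (auto simp: lookup_add distrib_right sum.distrib)
  finally show ?thesis .
qed

lemma act_uminus_left: "act (- P) b k = - act P b k"
  using act_add_left[of P "- P" b k] by (simp add: act_def add_eq_0_iff)

lemma act_diff_left: "act (P - Q) b k = act P b k - act Q b k"
  using act_add_left[of P "- Q" b k] by (simp add: act_uminus_left)

lemma act_sum_left: "act (\<Sum>i\<in>I. P i) b k = (\<Sum>i\<in>I. act (P i) b k)"
  by (induction I rule: infinite_finite_induct) (auto simp: act_add_left act_def[of 0])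

lemma act_one: "act 1 b = b"
  using act_single[of 0 1 b] by (auto simp: fun_eq_iff)

lemma act_uminus: "act P (\<lambda>k. - a k) k = - act P a k"
  by (simp add: act_def sum_negf)

lemma act_sum: "act P (\<lambda>k. \<Sum>i\<in>I. a i k) k = (\<Sum>i\<in>I. act P (a i) k)"
  unfolding act_def sum_distrib_left by (rule sum.swap)

lemma act_mult: "act (P * Q) b = act P (act Q b)"
proof (rule ext, induction P rule: laurent_induct)
  case (single j c k)
  show ?case
    by (induction Q arbitrary: k rule: laurent_induct)
       (auto simp: mult_single act_single distrib_left act_add_left diff_diff_eq)
qed (simp add: distrib_right act_add_left)

lemma act_coef: "act P (coef Q) = coef (P * Q)"
proof (rule ext, induction P rule: laurent_induct)
  case (single j c k)
  show ?case
    by (induction Q arbitrary: k rule: laurent_induct)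
       (auto simp: mult_single act_single distrib_left lookup_add lookup_single when_def algebra_simps)
qed (simp add: distrib_right act_add_left lookup_add)

text \<open>Young's inequality for an l_1 and an l_2 sequence: Cauchy-Schwarz with each modulus of a
  coefficient split into two square roots.\<close>

lemma l2norm_act_le: "l2norm (act P b) \<le> ennreal ((lnorm P)\<^sup>2) * l2norm b"
proof -
  let ?p = "\<lambda>j. cmod (coef P j)"
  have pt: "(cmod (act P b k))\<^sup>2 \<le> lnorm P * (\<Sum>j\<in>Poly_Mapping.keys P. ?p j * (cmod (b (k - j)))\<^sup>2)" for k
  proof -
    have "cmod (act P b k) \<le> (\<Sum>j\<in>Poly_Mapping.keys P. sqrt (?p j) * (sqrt (?p j) * cmod (b (k - j))))"
      unfolding act_def by (rule order_trans[OF norm_sum]) (simp add: norm_mult mult.assoc[symmetric])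
    then have "(cmod (act P b k))\<^sup>2 \<le> (\<Sum>j\<in>Poly_Mapping.keys P. sqrt (?p j) * (sqrt (?p j) * cmod (b (k - j))))\<^sup>2"
      by (intro power_mono) auto
    also have "\<dots> \<le> (\<Sum>j\<in>Poly_Mapping.keys P. (sqrt (?p j))\<^sup>2) * (\<Sum>j\<in>Poly_Mapping.keys P. (sqrt (?p j) * cmod (b (k - j)))\<^sup>2)"
      by (rule Cauchy_Schwarz_ineq_sum)
    finally show ?thesis by (simp add: lnorm_def power_mult_distrib)
  qed
  have "l2norm (act P b) \<le> (\<integral>\<^sup>+k. ennreal (lnorm P) * (\<Sum>j\<in>Poly_Mapping.keys P. ennreal (?p j) * ennreal ((cmod (b (k - j)))\<^sup>2)) \<partial>count_space UNIV)"
    unfolding l2norm_def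
  proof (intro nn_integral_mono)
    fix k
    have "ennreal ((cmod (act P b k))\<^sup>2) \<le> ennreal (lnorm P * (\<Sum>j\<in>Poly_Mapping.keys P. ?p j * (cmod (b (k - j)))\<^sup>2))"
      by (rule ennreal_leI[OF pt])
    also have "\<dots> = ennreal (lnorm P) * (\<Sum>j\<in>Poly_Mapping.keys P. ennreal (?p j) * ennreal ((cmod (b (k - j)))\<^sup>2))"
      by (subst ennreal_mult) (auto simp: lnorm_nonneg sum_nonneg ennreal_mult[symmetric])
    finally show "ennreal ((cmod (act P b k))\<^sup>2) \<le> \<dots>" .
  qed
  also have "\<dots> = ennreal (lnorm P) * (\<Sum>j\<in>Poly_Mapping.keys P. ennreal (?p j) * l2norm (\<lambda>k. b (k - j)))"
    by (simp add: nn_integral_cmult nn_integral_sum l2norm_def del: sum_ennreal)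
  also have "\<dots> = ennreal (lnorm P) * (ennreal (lnorm P) * l2norm b)"
    unfolding l2norm_shift sum_distrib_right[symmetric] lnorm_def by simp
  also have "\<dots> = ennreal ((lnorm P)\<^sup>2) * l2norm b"
    by (simp add: power2_eq_square ennreal_mult lnorm_nonneg mult.assoc)
  finally show ?thesis .
qed

subsection \<open>Inner products\<close>

lemma bspl_shift_L2: "(\<lambda>x. complex_of_real (bspl (x - real_vec m))) \<in> L2"
  using spl_L2[OF l2norm_coef_finite, of "Poly_Mapping.single m 1"] by (simp add: spl_single[abs_def])

lemma bspl_product_zero:
  assumes "m - j \<notin> boxn 3"
  shows "bspl (x - real_vec j) * bspl (x - real_vec m) = 0"
proof (rule ccontr)
  assume "bspl (x - real_vec j) * bspl (x - real_vec m) \<noteq> 0"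
  then have j: "vfloor x - j \<in> box3" and m: "vfloor x - m \<in> box3"
    using bspl_translate_nonzero[of x j] bspl_translate_nonzero[of x m] by auto
  have "\<bar>(m - j) $ i\<bar> \<le> 3" for i
    using j m unfolding box3_iff by (auto dest!: spec[of _ i])
  then show False using assms by (simp add: boxn_iff)
qed

lemma integral_bspl_product:
  "integrable lborel (\<lambda>x. complex_of_real (bspl (x - real_vec j)) * of_real (bspl (x - real_vec m)))"
  "(\<integral>x. complex_of_real (bspl (x - real_vec j)) * of_real (bspl (x - real_vec m)) \<partial>lborel) = coef Phi_poly (m - j)"
proof -
  show i: "integrable lborel (\<lambda>x. complex_of_real (bspl (x - real_vec j)) * of_real (bspl (x - real_vec m)))"
    by (rule L2_mult_integrable[OF bspl_shift_L2 bspl_shift_L2])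
  let ?k = "\<lambda>x. complex_of_real (bspl x * bspl (x - real_vec (m - j)))"
  have e: "complex_of_real (bspl (x - real_vec j)) * of_real (bspl (x - real_vec m)) = ?k (x - real_vec j)" for x
    by (simp add: real_vec_diff)
  have m1: "?k \<in> borel_measurable borel" by measurable
  have "(\<integral>x. ?k x \<partial>distr lborel borel ((+) (- real_vec j))) = (\<integral>x. ?k (- real_vec j + x) \<partial>lborel)"
    by (rule integral_distr) (use m1 in auto)
  then have "(\<integral>x. ?k (x - real_vec j) \<partial>lborel) = (\<integral>x. ?k x \<partial>lborel)"
    unfolding lborel_distr_plus by simp
  also have "\<dots> = of_real (bcorr (real_vec (m - j)))"
    unfolding bcorr_def by (rule integral_complex_of_real)
  finally show "(\<integral>x. complex_of_real (bspl (x - real_vec j)) * of_real (bspl (x - real_vec m)) \<partial>lborel) = coef Phi_poly (m - j)"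
    unfolding e coef_Phi_poly .
qed

text \<open>Only translates overlapping the one at \<open>m\<close> contribute, and their integrals
  are the coefficients of \<open>Phi_poly\<close>.\<close>

lemma inner_spl_bspl: "L2_inner (spl b) (\<lambda>x. of_real (bspl (x - real_vec m))) = act Phi_poly b m"
proof -
  let ?J = "(\<lambda>i. m - i) ` boxn 3"
  have e: "spl b x * cnj (of_real (bspl (x - real_vec m)))
      = (\<Sum>j\<in>?J. b j * (of_real (bspl (x - real_vec j)) * of_real (bspl (x - real_vec m))))" for x
  proof (cases "bspl (x - real_vec m) = 0")
    case False
    have "spl b x = (\<Sum>j\<in>?J. b j * of_real (bspl (x - real_vec j)))"
    proof (rule spl_eq)
      fix k assume k: "k \<notin> ?J"
      have "m - k \<notin> boxn 3"
      proof
        assume "m - k \<in> boxn 3"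
        then have "m - (m - k) \<in> ?J" by blast
        with k show False by simp
      qed
      from bspl_product_zero[OF this, of x] False show "b k * of_real (bspl (x - real_vec k)) = 0" by simp
    qed (simp add: finite_boxn)
    then show ?thesis by (simp add: sum_distrib_right mult.assoc)
  qed simp
  have "L2_inner (spl b) (\<lambda>x. of_real (bspl (x - real_vec m))) = (\<Sum>j\<in>?J. b j * coef Phi_poly (m - j))"
    unfolding L2_inner_def e
    by (subst Bochner_Integration.integral_sum) (simp_all add: integral_bspl_product)
  also have "\<dots> = (\<Sum>i\<in>boxn 3. coef Phi_poly i * b (m - i))"
    by (subst sum.reindex) (auto simp: inj_on_def mult.commute)
  also have "\<dots> = act Phi_poly b m"
  proof (rule act_superset[symmetric, OF finite_boxn])
    show "Poly_Mapping.keys Phi_poly \<subseteq> boxn 3"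
    proof
      fix i assume "i \<in> Poly_Mapping.keys Phi_poly"
      then have "bcorr (real_vec i) \<noteq> 0" by (simp add: in_keys_iff coef_Phi_poly)
      moreover have "bcorr (real_vec i) = 0" if "i \<notin> boxn 3"
      proof -
        have "bspl x * bspl (x - real_vec i) = 0" for x
          using bspl_product_zero[of i 0 x] that by (simp add: real_vec_def zero_vec_def[symmetric])
        then have "(\<lambda>x. bspl x * bspl (x - real_vec i)) = (\<lambda>_. 0)" by (rule ext)
        then show ?thesis by (simp only: bcorr_def integral_zero)
      qed
      ultimately show "i \<in> boxn 3" by blast
    qed
  qed
  finally show ?thesis .
qed

lemma L2_inner_cong_AE:
  assumes "AE x in lborel. f x = f' x" "AE x in lborel. g x = g' x"
    and [measurable]: "f \<in> borel_measurable borel" "f' \<in> borel_measurable borel" "g \<in> borel_measurable borel" "g' \<in> borel_measurable borel"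
  shows "L2_inner f g = L2_inner f' g'"
  unfolding L2_inner_def
proof (rule integral_cong_AE)
  show "AE x in lborel. f x * cnj (g x) = f' x * cnj (g' x)" using assms(1,2) by eventually_elim simp
qed measurable

lemma L2_cnj: "f \<in> L2 \<Longrightarrow> (\<lambda>x. cnj (f x)) \<in> L2"
  unfolding L2_def by (auto intro: measurable_compose[OF _ borel_measurable_cnj])

lemma L2_inner_sum_right:
  assumes "f \<in> L2" "\<And>i. i \<in> I \<Longrightarrow> g i \<in> L2"
  shows "L2_inner f (\<lambda>x. \<Sum>i\<in>I. c i * g i x) = (\<Sum>i\<in>I. cnj (c i) * L2_inner f (g i))"
proof -
  have "f x * cnj (\<Sum>i\<in>I. c i * g i x) = (\<Sum>i\<in>I. cnj (c i) * (f x * cnj (g i x)))" for x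
    by (simp add: sum_distrib_left mult_ac)
  then show ?thesis
    unfolding L2_inner_def using assms
    by (simp add: Bochner_Integration.integral_sum L2_mult_integrable L2_cnj)
qed

lemma bspl_half_refinement:
  "AE x in lborel. (1 / 4) * complex_of_real (bspl ((1 / 2) *\<^sub>R x - real_vec k))
     = (\<Sum>l\<in>Poly_Mapping.keys H. coef H l * of_real (bspl (x - real_vec (k + k + l))))"
  using AE_lborel_shift[OF bspl_refinement, of "real_vec (k + k)"]
proof eventually_elim
  case (elim x)
  have "(1 / 2) *\<^sub>R (x - real_vec (k + k)) = (1 / 2) *\<^sub>R x - real_vec k"
    by (simp add: real_vec_def vec_eq_iff field_simps)
  with elim have "complex_of_real (bspl ((1 / 2) *\<^sub>R x - real_vec k)) = 4 * (\<Sum>l\<in>Poly_Mapping.keys H. coef H l * of_real (bspl (x - real_vec (k + k + l))))"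
    by (simp add: sum_distrib_left real_vec_add diff_diff_eq mult.assoc)
  then show ?case by simp
qed

abbreviation HPhi :: "2 laurent" where "HPhi \<equiv> lconj H * Phi_poly"

text \<open>Correlation with the coefficients of \<open>P\<close>, hence the adjoint of
  \<open>act P\<close>.\<close>

lemma act_lconj: "act (lconj P) y m = (\<Sum>l\<in>Poly_Mapping.keys P. cnj (coef P l) * y (m + l))"
proof (induction P rule: laurent_induct)
  case (single k c)
  have "lconj (0 :: 2 laurent) = 0" using lconj_single[of "0 :: int ^ 2" 0] by simp
  then show ?case by (cases "c = 0") (auto simp: lconj_single act_single act_def[of 0 y m])
next
  case (add f g)
  let ?A = "Poly_Mapping.keys f \<union> Poly_Mapping.keys g"
  have s: "(\<Sum>l\<in>Poly_Mapping.keys P. cnj (coef P l) * y (m + l)) = (\<Sum>l\<in>?A. cnj (coef P l) * y (m + l))"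
    if "Poly_Mapping.keys P \<subseteq> ?A" for P
    using that by (intro sum.mono_neutral_left) (auto simp: in_keys_iff)
  have "act (lconj (f + g)) y m = act (lconj f) y m + act (lconj g) y m" by (simp add: lconj_add act_add_left)
  also have "\<dots> = (\<Sum>l\<in>?A. cnj (coef f l) * y (m + l)) + (\<Sum>l\<in>?A. cnj (coef g l) * y (m + l))"
    unfolding add by (subst (1 2) s) auto
  also have "\<dots> = (\<Sum>l\<in>?A. cnj (coef (f + g) l) * y (m + l))"
    by (simp add: lookup_add distrib_right sum.distrib)
  also have "\<dots> = (\<Sum>l\<in>Poly_Mapping.keys (f + g). cnj (coef (f + g) l) * y (m + l))"
    using Poly_Mapping.keys_add[of f g] by (subst s[of "f + g"]) auto
  finally show ?case .
qed

text \<open>By the refinement equation, pairing with the dilated translate at \<open>k\<close>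
  samples the sequence \<open>act HPhi b\<close> at \<open>2 k\<close>. Orthogonality to
  \<open>Vm1\<close> thus becomes the vanishing of even samples.\<close>

lemma inner_spl_half:
  assumes b: "l2norm b < \<infinity>"
  shows "L2_inner (spl b) (\<lambda>x. (1 / 4) * of_real (bspl ((1 / 2) *\<^sub>R x - real_vec k))) = act HPhi b (k + k)"
proof -
  have "L2_inner (spl b) (\<lambda>x. (1 / 4) * of_real (bspl ((1 / 2) *\<^sub>R x - real_vec k)))
     = L2_inner (spl b) (\<lambda>x. \<Sum>l\<in>Poly_Mapping.keys H. coef H l * of_real (bspl (x - real_vec (k + k + l))))"
    by (rule L2_inner_cong_AE[OF _ bspl_half_refinement]) auto
  also have "\<dots> = (\<Sum>l\<in>Poly_Mapping.keys H. cnj (coef H l) * act Phi_poly b (k + k + l))"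
    by (subst L2_inner_sum_right) (auto intro: spl_L2[OF b] bspl_shift_L2 simp: inner_spl_bspl)
  also have "\<dots> = act HPhi b (k + k)"
    by (simp add: act_mult act_lconj)
  finally show ?thesis .
qed

subsection \<open>The wavelet space\<close>

text \<open>Sampling at even indices without reindexing: zeros are kept elsewhere, so that
  convolution with members of \<open>L_down\<close> commutes with it.\<close>

definition eseq :: "(int ^ 2 \<Rightarrow> complex) \<Rightarrow> int ^ 2 \<Rightarrow> complex" where
  "eseq b k = (if even_vec k then b k else 0)"

lemma even_vec_double: "even_vec (k + k)"
  by (simp add: even_vec_def)

lemma even_vecE: "even_vec m \<Longrightarrow> \<exists>k. m = k + k"
  unfolding even_vec_iff by (auto simp: vec_eq_iff intro!: exI)

theorem W0_imp_spl:
  assumes \<phi>: "is_box_spline Xi \<phi>" and f: "f \<in> W0 \<phi>"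
  shows "\<exists>b. l2norm b < \<infinity> \<and> (AE x in lborel. f x = spl b x) \<and> eseq (act HPhi b) = (\<lambda>_. 0)"
proof -
  from f obtain F where F: "has_mask \<phi> f F" and orth: "\<And>g. g \<in> Vm1 \<phi> \<Longrightarrow> L2_inner f g = 0"
    by (auto simp: W0_def V0_def)
  from has_mask_AE_spl[OF \<phi> F] obtain b where b: "l2norm b < \<infinity>" "AE x in lborel. f x = spl b x" by blast
  have fm: "f \<in> borel_measurable borel" using F by (auto simp: has_mask_def L2_fourier_def L2_measurable)
  have "act HPhi b (k + k) = 0" for k
  proof -
    have "act HPhi b (k + k) = L2_inner (spl b) (\<lambda>x. (1 / 4) * of_real (bspl ((1 / 2) *\<^sub>R x - real_vec k)))"
      by (rule inner_spl_half[OF b(1), symmetric])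
    also have "\<dots> = L2_inner f (\<lambda>x. (1 / 4) * of_real (bspl ((1 / 2) *\<^sub>R x - real_vec k)))"
      using b(2) fm by (intro L2_inner_cong_AE) auto
    also have "\<dots> = 0" by (rule orth[OF Vm1_bspl[OF \<phi>]])
    finally show ?thesis .
  qed
  then have "eseq (act HPhi b) = (\<lambda>_. 0)" by (auto simp: eseq_def fun_eq_iff dest!: even_vecE)
  with b show ?thesis by blast
qed

lemma keys_in_boxn: "\<exists>n. Poly_Mapping.keys P \<subseteq> boxn n"
proof -
  define n where "n = (\<Sum>a\<in>Poly_Mapping.keys P. nat (\<bar>a $ 1\<bar> + \<bar>a $ 2\<bar>))"
  have "a \<in> boxn n" if "a \<in> Poly_Mapping.keys P" for a
  proof -
    have "nat (\<bar>a $ 1\<bar> + \<bar>a $ 2\<bar>) \<le> n" unfolding n_def using that by (intro member_le_sum) auto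
    then show ?thesis by (auto simp: boxn_iff forall_2)
  qed
  then show ?thesis by blast
qed

lemma spl_coef_support:
  assumes n: "Poly_Mapping.keys P \<subseteq> boxn n" and x: "spl (coef P) x \<noteq> 0"
  shows "\<bar>x $ j\<bar> \<le> real n + 3"
proof -
  from x obtain k where k: "k \<in> Poly_Mapping.keys P" "bspl (x - real_vec k) \<noteq> 0"
    unfolding spl_coef by (metis (mono_tags, lifting) mult_eq_0_iff of_real_0 sum.neutral)
  have "\<bar>k $ j\<bar> \<le> int n" using k(1) n by (auto simp: boxn_iff)
  then have "\<bar>real_of_int (k $ j)\<bar> \<le> real n" by linarith
  with bspl_nonzero[OF k(2), of j] show ?thesis by (auto simp: real_vec_def)
qed

text \<open>Orthogonality to every element of \<open>Vm1\<close> is at stake here. The bounded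
  support of \<open>spl (coef P)\<close> reduces each such element to a finite combination of
  dilated translates, without a limit.\<close>

theorem coef_imp_W0:
  assumes \<phi>: "is_box_spline Xi \<phi>" and P: "eseq (coef (HPhi * P)) = (\<lambda>_. 0)"
    and fm: "f \<in> borel_measurable borel" and f: "AE x in lborel. f x = spl (coef P) x"
  shows "f \<in> W0 \<phi>"
proof -
  have "has_mask \<phi> f (leval P)" using has_mask_leval_iff[OF \<phi>] fm f by blast
  then have "f \<in> V0 \<phi>" by (auto simp: V0_def)
  moreover have "L2_inner f g = 0" if g: "g \<in> Vm1 \<phi>" for g
  proof -
    obtain c where c: "l2norm c < \<infinity>" "AE x in lborel. g x = (1 / 4) * spl c ((1 / 2) *\<^sub>R x)"
      using Vm1_AE[OF \<phi> g] by blast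
    have gm: "g \<in> borel_measurable borel" using g by (auto simp: Vm1_def L2_fourier_def L2_measurable)
    obtain n where n: "Poly_Mapping.keys P \<subseteq> boxn n" using keys_in_boxn by blast
    \<comment> \<open>On the support |x_j| <= n + 3, and a nonzero translate requires |x_j / 2 -
      l_j| < 3; hence |l_j| <= n + 6.\<close>
    let ?K = "boxn (n + 6)"
    have e: "spl (coef P) x * cnj ((1 / 4) * spl c ((1 / 2) *\<^sub>R x))
        = spl (coef P) x * cnj (\<Sum>l\<in>?K. c l * ((1 / 4) * of_real (bspl ((1 / 2) *\<^sub>R x - real_vec l))))" for x
    proof (cases "spl (coef P) x = 0")
      case False
      have "spl c ((1 / 2) *\<^sub>R x) = (\<Sum>l\<in>?K. c l * of_real (bspl ((1 / 2) *\<^sub>R x - real_vec l)))"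
      proof (rule spl_eq[OF finite_boxn])
        fix l assume l: "l \<notin> ?K"
        show "c l * of_real (bspl ((1 / 2) *\<^sub>R x - real_vec l)) = 0"
        proof (rule ccontr)
          assume "c l * of_real (bspl ((1 / 2) *\<^sub>R x - real_vec l)) \<noteq> 0"
          then have nz: "bspl ((1 / 2) *\<^sub>R x - real_vec l) \<noteq> 0" by auto
          have "\<bar>l $ j\<bar> \<le> int (n + 6)" for j
            using bspl_nonzero[OF nz, of j] spl_coef_support[OF n False, of j]
            by (auto simp: real_vec_def abs_le_iff)
          with l show False by (simp add: boxn_iff)
        qed
      qed
      then show ?thesis by (simp add: sum_distrib_left mult_ac)
    qed simp
    have m: "(\<lambda>x. (1 / 4) * spl c ((1 / 2) *\<^sub>R x)) \<in> borel_measurable borel" by measurable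
    have "L2_inner f g = L2_inner (spl (coef P)) (\<lambda>x. (1 / 4) * spl c ((1 / 2) *\<^sub>R x))"
      by (rule L2_inner_cong_AE[OF f c(2) fm _ gm m]) measurable
    also have "\<dots> = L2_inner (spl (coef P)) (\<lambda>x. \<Sum>l\<in>?K. c l * ((1 / 4) * of_real (bspl ((1 / 2) *\<^sub>R x - real_vec l))))"
      unfolding L2_inner_def e ..
    also have "\<dots> = (\<Sum>l\<in>?K. cnj (c l) * act HPhi (coef P) (l + l))"
    proof (subst L2_inner_sum_right)
      show "spl (coef P) \<in> L2" by (rule spl_L2[OF l2norm_coef_finite])
      show "(\<lambda>x. (1 / 4) * of_real (bspl ((1 / 2) *\<^sub>R x - real_vec l))) \<in> L2" for l
        by (rule L2_half[OF bspl_shift_L2])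
    qed (simp only: inner_spl_half[OF l2norm_coef_finite])
    also have "\<dots> = 0"
    proof (rule sum.neutral, rule ballI)
      fix l
      have "act HPhi (coef P) (l + l) = eseq (coef (HPhi * P)) (l + l)"
        unfolding act_coef by (simp only: eseq_def even_vec_double if_True)
      then show "cnj (c l) * act HPhi (coef P) (l + l) = 0" by (simp add: P)
    qed
    finally show ?thesis .
  qed
  ultimately show ?thesis by (simp add: W0_def)
qed

section \<open>Polyphase components of sequences\<close>

text \<open>The counterpart of \<open>polyphase\<close> for sequences: the coefficients of the
  component at \<open>s\<close>, placed at even indices.\<close>

definition phase :: "int ^ 2 \<Rightarrow> (int ^ 2 \<Rightarrow> complex) \<Rightarrow> int ^ 2 \<Rightarrow> complex" where
  "phase s b k = (if even_vec k then b (k + s) else 0)"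

lemma even_vec_diff: "even_vec j \<Longrightarrow> even_vec (k - j) \<longleftrightarrow> even_vec k"
  by (auto simp: even_vec_def)

lemma even_vec_add: "even_vec j \<Longrightarrow> even_vec (j + k) \<longleftrightarrow> even_vec k"
  by (auto simp: even_vec_def)

lemma even_vec_E01_diff: "s \<in> E01 \<Longrightarrow> t \<in> E01 \<Longrightarrow> even_vec (s - t) \<longleftrightarrow> s = t"
  unfolding E01_2 by (auto simp: even_vec_def vector_2 vec2_eq_iff)

lemma sum_phase: "(\<Sum>s\<in>E01. phase s b (k - s)) = b k"
proof -
  consider "even (k $ 1)" "even (k $ 2)" | "even (k $ 1)" "odd (k $ 2)" | "odd (k $ 1)" "even (k $ 2)" | "odd (k $ 1)" "odd (k $ 2)"
    by blast
  then show ?thesis unfolding sum_E01_2 phase_def by cases (simp_all add: even_vec_def vector_2)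
qed

lemma L_down_keys_even:
  fixes P :: "2 laurent"
  assumes "P \<in> L_down" "j \<in> Poly_Mapping.keys P"
  shows "even_vec j"
proof -
  obtain Q where P: "P = (\<Sum>k\<in>Poly_Mapping.keys Q. Poly_Mapping.single (\<chi> j. 2 * k $ j) (coef Q k))"
    using assms(1) by (auto simp: L_down_def lsquare_def)
  have "(\<Sum>k\<in>Poly_Mapping.keys Q. coef (Poly_Mapping.single (\<chi> j. 2 * k $ j) (coef Q k)) j) \<noteq> 0"
    using assms(2) unfolding P by (simp only: in_keys_iff lookup_sum) simp
  then obtain k where "coef (Poly_Mapping.single (\<chi> j. 2 * k $ j) (coef Q k)) j \<noteq> 0"
    by (rule sum.not_neutral_contains_not_neutral)
  then have "j = (\<chi> j. 2 * k $ j)" by (auto simp: lookup_single when_def split: if_splits)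
  then show ?thesis unfolding even_vec_iff by blast
qed

lemma act_phase: "P \<in> L_down \<Longrightarrow> act P (phase s b) = phase s (act P b)"
proof (rule ext)
  fix k assume P: "P \<in> L_down"
  have "act P (phase s b) k = (\<Sum>j\<in>Poly_Mapping.keys P. coef P j * (if even_vec k then b (k + s - j) else 0))"
    unfolding act_def phase_def
    by (intro sum.cong refl) (simp add: even_vec_diff[OF L_down_keys_even[OF P]] diff_add_eq)
  then show "act P (phase s b) k = phase s (act P b) k" by (simp add: act_def phase_def)
qed

lemma eseq_eq_phase: "eseq b = phase 0 b"
  by (rule ext) (simp add: eseq_def phase_def)

lemma act_eseq: "P \<in> L_down \<Longrightarrow> act P (eseq b) = eseq (act P b)"
  by (simp add: eseq_eq_phase act_phase)

lemma l2norm_eseq_le: "l2norm (eseq b) \<le> l2norm b"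
  by (rule l2norm_mono) (simp add: eseq_def)

lemma l2norm_phase_le: "l2norm (phase s b) \<le> l2norm b"
proof -
  have "l2norm (phase s b) \<le> l2norm (\<lambda>k. b (k - (- s)))" by (rule l2norm_mono) (simp add: phase_def)
  then show ?thesis unfolding l2norm_shift .
qed

lemma l2norm_uminus: "l2norm (\<lambda>k. - a k) = l2norm a"
  by (simp add: l2norm_def)

lemma l2norm_sum_le: "l2norm (\<lambda>k. \<Sum>i\<in>I. a i k) \<le> of_nat (card I) * (\<Sum>i\<in>I. l2norm (a i))"
proof -
  have "l2norm (\<lambda>k. \<Sum>i\<in>I. a i k) \<le> (\<integral>\<^sup>+k. of_nat (card I) * (\<Sum>i\<in>I. ennreal ((cmod (a i k))\<^sup>2)) \<partial>count_space UNIV)"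
    unfolding l2norm_def
  proof (intro nn_integral_mono)
    fix k
    have "ennreal ((cmod (\<Sum>i\<in>I. a i k))\<^sup>2) \<le> ennreal (real (card I) * (\<Sum>i\<in>I. (cmod (a i k))\<^sup>2))"
      by (intro ennreal_leI norm_sum_squared_le)
    also have "\<dots> = of_nat (card I) * (\<Sum>i\<in>I. ennreal ((cmod (a i k))\<^sup>2))"
      by (simp add: ennreal_mult sum_nonneg ennreal_of_nat_eq_real_of_nat)
    finally show "ennreal ((cmod (\<Sum>i\<in>I. a i k))\<^sup>2) \<le> \<dots>" .
  qed
  also have "\<dots> = of_nat (card I) * (\<Sum>i\<in>I. l2norm (a i))"
    by (simp add: nn_integral_cmult nn_integral_sum l2norm_def del: sum_ennreal)
  finally show ?thesis .
qed

lemma card_E01: "card (E01 :: (int ^ 2) set) = 4" and card_E01_nonzero: "card ((E01 :: (int ^ 2) set) - {0}) = 3"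
  unfolding E01_2_nonzero unfolding E01_2 by (simp_all add: vec2_eq_iff)

section \<open>The wavelet space in terms of polyphase components\<close>

text \<open>The coefficient form of \<open>w_decomposition\<close>, for use with
  \<open>act\<close>.\<close>

lemma HPhi_decomposition:
  "Poly_Mapping.single 0 (2 ^ 5 * 10080) * HPhi = (\<Sum>s\<in>E01. w s * Poly_Mapping.single (- s) 1)"
proof (rule laurent_eqI)
  fix \<zeta> :: "complex ^ 2" assume z: "\<zeta> \<in> torus"
  show "leval (Poly_Mapping.single 0 (2 ^ 5 * 10080) * HPhi) \<zeta> = leval (\<Sum>s\<in>E01. w s * Poly_Mapping.single (- s) 1) \<zeta>"
    unfolding leval_sum leval_mult[OF z] leval_lconj[OF z] leval_single zpow_0
    using w_decomposition_sum[OF z] by (simp add: mult.assoc)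
qed

text \<open>At even indices the sum is a constant multiple of \<open>act HPhi b\<close>; at all
  others each term is 0.\<close>

lemma sum_w_phase_eq_0:
  assumes "eseq (act HPhi b) = (\<lambda>_. 0)"
  shows "(\<Sum>s\<in>E01. act (w s) (phase s b) k) = 0"
proof (cases "even_vec k")
  case True
  have "act (w s) (phase s b) k = act (w s * Poly_Mapping.single (- s) 1) b k" for s
  proof -
    have "act (Poly_Mapping.single (- s) 1) b = (\<lambda>k. b (k + s))" by (rule ext) (simp add: act_single)
    moreover have "act (w s) (\<lambda>k. b (k + s)) k = act (w s) b (k + s)" by (simp add: act_def diff_add_eq)
    ultimately show ?thesis using True by (simp add: act_phase[OF w_L_down] act_mult phase_def)
  qed
  then have "(\<Sum>s\<in>E01. act (w s) (phase s b) k) = act (\<Sum>s\<in>E01. w s * Poly_Mapping.single (- s) 1) b k"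
    by (simp add: act_sum_left)
  also have "\<dots> = 2 ^ 5 * 10080 * act HPhi b k"
    unfolding HPhi_decomposition[symmetric] act_mult[of "Poly_Mapping.single 0 _"] act_single by simp
  also have "act HPhi b k = 0" using fun_cong[OF assms, of k] True by (simp add: eseq_def)
  finally show ?thesis by simp
qed (simp add: act_phase[OF w_L_down] phase_def)

lemma coef_flip_poly: "coef (flip_poly s P) k = coef P k * zpow (flip s (\<chi> j. 1)) k"
  unfolding flip_poly_def lookup_sum lookup_single
  by (auto simp: when_def in_keys_iff sum.delta split: if_splits)

text \<open>Summing a polynomial over the sign changes multiplies its even coefficients by 4, and
  for this product the sum is the vanishing bracket.\<close>

lemma eseq_HPhi_Hs:
  assumes s: "s \<in> E01 - {0}"
  shows "eseq (coef (HPhi * Hs s)) = (\<lambda>_. 0)"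
proof (rule ext)
  fix k
  let ?T = "HPhi * Hs s"
  have "(\<Sum>t\<in>E01. flip_poly t ?T) = 0"
  proof (rule laurent_eqI)
    fix \<zeta> :: "complex ^ 2" assume z: "\<zeta> \<in> torus"
    show "leval (\<Sum>t\<in>E01. flip_poly t ?T) \<zeta> = leval 0 \<zeta>"
      unfolding leval_sum leval_flip_poly leval_mult[OF flip_torus[OF z]] leval_lconj[OF flip_torus[OF z]] leval_zero
      using bracket_H_Hs_zero[OF s z] by (simp add: mult_ac)
  qed
  then have "(\<Sum>t\<in>E01. coef (flip_poly t ?T) k) = 0" by (simp only: lookup_sum[symmetric]) simp
  then have "coef ?T k * (\<Sum>t\<in>E01. zpow (flip t (\<chi> j. 1)) k) = 0"
    unfolding coef_flip_poly sum_distrib_left .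
  then have "even_vec k \<Longrightarrow> coef ?T k = 0"
    unfolding sum_zpow_flip by (simp add: zpow_def)
  then show "eseq (coef ?T) k = 0" by (simp add: eseq_def)
qed

lemma act_single_coef:
  fixes P :: "2 laurent"
  shows "coef (Poly_Mapping.single j c * P) k = c * coef P (k - j)"
  using fun_cong[OF act_coef[of "Poly_Mapping.single j c" P], of k] by (simp only: act_single)

text \<open>Shifts by even vectors commute with \<open>eseq\<close>, so the translates inherit the
  criterion of \<open>coef_imp_W0\<close>.\<close>

lemma translate_Hs_W0:
  assumes \<phi>: "is_box_spline Xi \<phi>" and s: "s \<in> E01 - {0}"
    and fm: "f \<in> borel_measurable borel" and f: "AE x in lborel. f x = spl (coef (Hs s)) x"
  shows "(\<lambda>x. f (x - 2 *\<^sub>R real_vec k)) \<in> W0 \<phi>"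
proof (rule coef_imp_W0[OF \<phi>])
  have two: "2 *\<^sub>R real_vec k = real_vec (k + k)" by (simp add: real_vec_def vec_eq_iff)
  have "HPhi * (Poly_Mapping.single (k + k) 1 * Hs s) = Poly_Mapping.single (k + k) 1 * (HPhi * Hs s)"
    by (simp only: mult_ac)
  then have "eseq (coef (HPhi * (Poly_Mapping.single (k + k) 1 * Hs s))) m = 0" for m
    using fun_cong[OF eseq_HPhi_Hs[OF s], of "m - (k + k)"]
    by (simp only: eseq_def act_single_coef even_vec_diff[OF even_vec_double] mult_1)
  then show "eseq (coef (HPhi * (Poly_Mapping.single (k + k) 1 * Hs s))) = (\<lambda>_. 0)" by (rule ext)
  show "(\<lambda>x. f (x - 2 *\<^sub>R real_vec k)) \<in> borel_measurable borel" using fm by measurable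
  show "AE x in lborel. f (x - 2 *\<^sub>R real_vec k) = spl (coef (Poly_Mapping.single (k + k) 1 * Hs s)) x"
    using AE_lborel_shift[OF f, of "real_vec (k + k)"] unfolding two
    by eventually_elim (simp add: spl_shift act_single_coef[abs_def])
qed

section \<open>Norm equivalence\<close>

text \<open>Split \<open>b\<close> into \<open>act (1 - Q * P) b\<close> and
  \<open>act Q (act P b)\<close>. The first part contributes at most half of \<open>l2norm b\<close>
  and is absorbed on the left, which requires \<open>l2norm b\<close> to be finite.\<close>

lemma l2norm_act_lower:
  fixes P :: "2 laurent"
  assumes "\<And>\<zeta>. \<zeta> \<in> torus \<Longrightarrow> leval P \<zeta> \<noteq> 0"
  shows "\<exists>K>0. \<forall>b. l2norm b < \<infinity> \<longrightarrow> l2norm b \<le> ennreal K * l2norm (act P b)"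
proof -
  obtain Q where Q: "lnorm (1 - Q * P) < 1 / 2"
    by (rule laurent_approx_inverse[of P "1 / 2"]) (use assms in auto)
  define L where "L = (lnorm Q)\<^sup>2"
  have L: "L \<ge> 0" by (simp add: L_def)
  \<comment> \<open>Absorption leaves X / 2 <= 2 L Y, that is X <= 4 L Y; the added 1 keeps the
    constant positive.\<close>
  have "l2norm b \<le> ennreal (4 * L + 1) * l2norm (act P b)" if b: "l2norm b < \<infinity>" for b
  proof -
    have fin: "l2norm (act P b) < \<infinity>"
      using le_less_trans[OF l2norm_act_le[of P b]] b by (simp add: ennreal_mult_less_top)
    obtain X where X: "X \<ge> 0" "l2norm b = ennreal X" using b by (cases "l2norm b") auto
    obtain Y where Y: "Y \<ge> 0" "l2norm (act P b) = ennreal Y" using fin by (cases "l2norm (act P b)") auto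
    have "b = (\<lambda>k. act (1 - Q * P) b k + act Q (act P b) k)"
      by (rule ext) (simp add: act_diff_left act_mult act_one)
    then have "l2norm b \<le> 2 * l2norm (act (1 - Q * P) b) + 2 * l2norm (act Q (act P b))"
      by (subst (1) \<open>b = _\<close>) (rule l2norm_add_le)
    also have "\<dots> \<le> 2 * (ennreal ((lnorm (1 - Q * P))\<^sup>2) * l2norm b) + 2 * (ennreal L * l2norm (act P b))"
      unfolding L_def by (intro add_mono mult_left_mono l2norm_act_le) auto
    also have "\<dots> \<le> 2 * (ennreal (1 / 4) * l2norm b) + 2 * (ennreal L * l2norm (act P b))"
    proof (intro add_mono mult_left_mono mult_right_mono ennreal_leI)
      have "(lnorm (1 - Q * P))\<^sup>2 \<le> (1 / 2)\<^sup>2" by (intro power_mono) (use Q lnorm_nonneg in auto)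
      then show "(lnorm (1 - Q * P))\<^sup>2 \<le> 1 / 4" by (simp add: power2_eq_square)
    qed auto
    also have "\<dots> = ennreal (2 * (1 / 4 * X) + 2 * (L * Y))"
    proof -
      have "ennreal (2 * (1 / 4 * X)) = ennreal 2 * ennreal (1 / 4 * X)"
        by (rule ennreal_mult) (use X(1) in auto)
      also have "ennreal (1 / 4 * X) = ennreal (1 / 4) * ennreal X"
        by (rule ennreal_mult) (use X(1) in auto)
      finally have "2 * (ennreal (1 / 4) * ennreal X) = ennreal (2 * (1 / 4 * X))" by (simp only: ennreal_numeral)
      moreover have "2 * (ennreal L * ennreal Y) = ennreal (2 * (L * Y))"
        using Y(1) L by (simp add: ennreal_mult)
      ultimately show ?thesis using X Y L by simp
    qed
    finally have "X \<le> 2 * (1 / 4 * X) + 2 * (L * Y)" using X Y L by (simp add: ennreal_le_iff del: ennreal_plus)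
    then have "X \<le> (4 * L + 1) * Y" using Y(1) by (simp add: algebra_simps)
    then have "ennreal X \<le> ennreal ((4 * L + 1) * Y)" by (rule ennreal_leI)
    also have "\<dots> = ennreal (4 * L + 1) * ennreal Y" by (rule ennreal_mult) (use Y L in auto)
    finally show ?thesis unfolding X(2) Y(2) .
  qed
  then show ?thesis using L by (intro exI[of _ "4 * L + 1"]) auto
qed

text \<open>Pair the series with the one whose coefficients are \<open>\<Phi> * B\<close> and use Cauchy-Schwarz: this avoids Plancherel.\<close>
lemma L2_normsq_spl_ge: "l2norm (act Phi_poly (coef B)) \<le> 81 * L2_normsq (spl (coef B))"
proof -
  let ?q = "coef (Phi_poly * B)"
  let ?K = "Poly_Mapping.keys (Phi_poly * B)"
  define Q where "Q = (\<Sum>m\<in>?K. (cmod (?q m))\<^sup>2)"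
  have Q0: "Q \<ge> 0" by (simp add: Q_def sum_nonneg)
  have q: "l2norm ?q = ennreal Q"
    unfolding Q_def by (rule l2norm_finite) (auto simp: in_keys_iff)
  have "L2_inner (spl (coef B)) (spl ?q) = L2_inner (spl (coef B)) (\<lambda>x. \<Sum>m\<in>?K. ?q m * of_real (bspl (x - real_vec m)))"
    by (simp add: spl_coef[abs_def])
  also have "\<dots> = (\<Sum>m\<in>?K. cnj (?q m) * act Phi_poly (coef B) m)"
    by (subst L2_inner_sum_right) (auto intro: spl_L2 l2norm_coef_finite bspl_shift_L2 simp: inner_spl_bspl)
  also have "\<dots> = of_real Q"
    unfolding act_coef Q_def of_real_sum by (intro sum.cong refl) (subst complex_norm_square, rule mult.commute)
  finally have inner: "L2_inner (spl (coef B)) (spl ?q) = of_real Q" .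
  have "ennreal Q = ennreal (cmod (L2_inner (spl (coef B)) (spl ?q)))" using Q0 by (simp add: inner)
  also have "\<dots> \<le> (\<integral>\<^sup>+x. ennreal (cmod (spl (coef B) x * cnj (spl ?q x))) \<partial>lborel)"
    unfolding L2_inner_def
    by (intro integral_norm_bound_ennreal L2_mult_integrable L2_cnj spl_L2 l2norm_coef_finite)
  finally have "(ennreal Q)\<^sup>2 \<le> (\<integral>\<^sup>+x. ennreal (cmod (spl (coef B) x * cnj (spl ?q x))) \<partial>lborel)\<^sup>2"
    by (intro power_mono) auto
  also have "\<dots> \<le> L2_normsq (spl (coef B)) * L2_normsq (\<lambda>x. cnj (spl ?q x))"
    by (intro nn_integral_mult_le_L2 measurable_compose[OF _ borel_measurable_cnj]) measurable
  also have "\<dots> \<le> L2_normsq (spl (coef B)) * (81 * ennreal Q)"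
    using L2_normsq_spl_le[of ?q] q by (intro mult_left_mono) (simp_all add: L2_normsq_def)
  finally have le: "(ennreal Q)\<^sup>2 \<le> L2_normsq (spl (coef B)) * (81 * ennreal Q)" .
  have "L2_normsq (spl (coef B)) < \<infinity>" using spl_L2[OF l2norm_coef_finite, of B] by (simp add: L2_iff_normsq)
  then obtain X where X: "X \<ge> 0" "L2_normsq (spl (coef B)) = ennreal X" by (cases "L2_normsq (spl (coef B))") auto
  have e81: "81 * ennreal r = ennreal (81 * r)" if "r \<ge> 0" for r
    using that by (simp add: ennreal_mult)
  have "Q\<^sup>2 \<le> X * (81 * Q)"
    using le X Q0 by (simp add: e81 ennreal_mult[symmetric] ennreal_power ennreal_le_iff)
  then have "Q * Q \<le> (81 * X) * Q" by (simp add: power2_eq_square mult_ac)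
  then have "Q \<le> 81 * X" using Q0 X(1) by (cases "Q = 0") (auto dest: mult_right_le_imp_le)
  then show ?thesis unfolding act_coef q X(2) using X(1) by (simp add: e81 ennreal_leI)
qed

section \<open>Finite combinations of the wavelets\<close>

text \<open>Packs the coefficients of a finite combination of translates by \<open>2 k\<close> into
  a polynomial in the squared variables.\<close>

definition even_poly :: "(int ^ 2) set \<Rightarrow> (int ^ 2 \<Rightarrow> complex) \<Rightarrow> 2 laurent" where
  "even_poly A c = (\<Sum>k\<in>A. Poly_Mapping.single (k + k) (c k))"

lemma double_inj: "k + k = l + l \<longleftrightarrow> k = (l :: int ^ 2)"
  by (auto simp: vec_eq_iff)

lemma coef_even_poly: "finite A \<Longrightarrow> coef (even_poly A c) (k + k) = (if k \<in> A then c k else 0)"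
  unfolding even_poly_def lookup_sum lookup_single when_def double_inj by (simp add: sum.delta)

lemma eseq_even_poly: "eseq (coef (even_poly A c)) = coef (even_poly A c)"
proof (rule ext)
  fix m
  have "coef (even_poly A c) m = 0" if "\<not> even_vec m"
    unfolding even_poly_def lookup_sum lookup_single when_def using that even_vec_double by (intro sum.neutral) auto
  then show "eseq (coef (even_poly A c)) m = coef (even_poly A c) m" by (simp add: eseq_def)
qed

lemma l2norm_even_poly:
  assumes A: "finite A"
  shows "l2norm (coef (even_poly A c)) = ennreal (\<Sum>k\<in>A. (cmod (c k))\<^sup>2)"
proof -
  have "l2norm (coef (even_poly A c)) = ennreal (\<Sum>m\<in>(\<lambda>k. k + k) ` A. (cmod (coef (even_poly A c) m))\<^sup>2)"
  proof (rule l2norm_finite)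
    fix m assume "m \<notin> (\<lambda>k. k + k) ` A"
    then show "coef (even_poly A c) m = 0"
      unfolding even_poly_def lookup_sum lookup_single when_def by (intro sum.neutral) auto
  qed (use A in simp)
  also have "(\<Sum>m\<in>(\<lambda>k. k + k) ` A. (cmod (coef (even_poly A c) m))\<^sup>2) = (\<Sum>k\<in>A. (cmod (c k))\<^sup>2)"
  proof (subst sum.reindex)
    show "inj_on (\<lambda>k. k + k) A" by (rule inj_onI) (simp only: double_inj)
    show "(\<Sum>k\<in>A. ((\<lambda>m. (cmod (coef (even_poly A c) m))\<^sup>2) \<circ> (\<lambda>k. k + k)) k) = (\<Sum>k\<in>A. (cmod (c k))\<^sup>2)"
      by (rule sum.cong[OF refl]) (simp only: o_def coef_even_poly[OF A] if_True)
  qed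
  finally show ?thesis .
qed

definition wpoly :: "(int ^ 2 \<Rightarrow> 2 laurent) \<Rightarrow> 2 laurent" where
  "wpoly C = (\<Sum>s\<in>E01 - {0}. Hs s * C s)"

lemma coef_wpoly: "coef (wpoly C) = (\<lambda>k. \<Sum>s\<in>E01 - {0}. act (Hs s) (coef (C s)) k)"
  unfolding wpoly_def lookup_sum act_coef ..

lemma act_Hs: "s \<in> E01 - {0} \<Longrightarrow> act (Hs s) b k = act (w s) b k - act w00 b (k - s)"
proof -
  assume s: "s \<in> E01 - {0}"
  have "act (w00 * Poly_Mapping.single s 1) b k = act w00 b (k - s)"
    unfolding mult.commute[of w00] act_mult act_single by simp
  then show ?thesis by (simp add: Hs_eq[OF s] act_diff_left)
qed

lemma l2norm_wpoly_seq_le: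
  "l2norm (\<lambda>k. \<Sum>s\<in>E01 - {0}. act (Hs s) (g s) k) \<le> ennreal (3 * (\<Sum>s\<in>E01 - {0}. (lnorm (Hs s))\<^sup>2)) * (\<Sum>s\<in>E01 - {0}. l2norm (g s))"
proof -
  let ?S = "E01 - {0 :: int ^ 2}"
  let ?M = "\<Sum>s\<in>?S. (lnorm (Hs s))\<^sup>2"
  have fin: "finite ?S" by (simp add: finite_E01)
  have "l2norm (\<lambda>k. \<Sum>s\<in>?S. act (Hs s) (g s) k) \<le> 3 * (\<Sum>s\<in>?S. l2norm (act (Hs s) (g s)))"
    using l2norm_sum_le[where I = ?S and a = "\<lambda>s. act (Hs s) (g s)"] by (simp add: card_E01_nonzero)
  also have "\<dots> \<le> 3 * (\<Sum>s\<in>?S. ennreal ?M * l2norm (g s))"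
  proof (intro mult_left_mono sum_mono)
    fix s assume s: "s \<in> ?S"
    have "l2norm (act (Hs s) (g s)) \<le> ennreal ((lnorm (Hs s))\<^sup>2) * l2norm (g s)" by (rule l2norm_act_le)
    also have "\<dots> \<le> ennreal ?M * l2norm (g s)"
      by (intro mult_right_mono ennreal_leI member_le_sum[OF s _ fin]) auto
    finally show "l2norm (act (Hs s) (g s)) \<le> ennreal ?M * l2norm (g s)" .
  qed auto
  also have "\<dots> = ennreal (3 * ?M) * (\<Sum>s\<in>?S. l2norm (g s))"
    by (simp add: ennreal_mult sum_nonneg sum_distrib_left[symmetric] mult.assoc)
  finally show ?thesis .
qed

text \<open>Parity separates the summands: at indices congruent to \<open>s\<close> modulo 2 only
  the part -w00 \<zeta>^s of \<open>Hs s\<close> is visible. The coefficients of \<open>C s\<close>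
  can then be recovered by inverting \<open>w00\<close>.\<close>

lemma phase_wpoly:
  assumes s: "s \<in> E01 - {0}" and C: "\<And>t. eseq (coef (C t)) = coef (C t)"
  shows "phase s (coef (wpoly C)) = (\<lambda>k. - act w00 (coef (C s)) k)"
proof (rule ext)
  fix k
  have even_w: "act P (coef (C t)) m = 0" if "P \<in> L_down" "\<not> even_vec m" for P t m
    using fun_cong[OF act_eseq[OF that(1), of "coef (C t)"], of m] that(2) by (simp add: C eseq_def)
  show "phase s (coef (wpoly C)) k = - act w00 (coef (C s)) k"
  proof (cases "even_vec k")
    case True
    have ks: "even_vec (k + (s - t)) \<longleftrightarrow> s = t" if "t \<in> E01" for t
      using even_vec_add[OF True, of "s - t"] even_vec_E01_diff[of s t] s that by auto
    have s0: "\<not> even_vec (k + s)" using ks[OF zero_in_E01] s by auto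
    have t: "act (Hs t) (coef (C t)) (k + s) = (if t = s then - act w00 (coef (C s)) k else 0)" if "t \<in> E01 - {0}" for t
      using that ks[of t] even_w[OF w_L_down s0, of t] even_w[OF w00_L_down, of "k + (s - t)" t]
      by (auto simp: act_Hs add_diff_eq[symmetric])
    have "phase s (coef (wpoly C)) k = (\<Sum>t\<in>E01 - {0}. act (Hs t) (coef (C t)) (k + s))"
      using True by (simp add: phase_def coef_wpoly)
    also have "\<dots> = (\<Sum>t\<in>E01 - {0}. if t = s then - act w00 (coef (C s)) k else 0)"
      by (intro sum.cong refl t)
    also have "\<dots> = - act w00 (coef (C s)) k" using s by (simp add: finite_E01)
    finally show ?thesis .
  qed (simp add: phase_def even_w[OF w00_L_down])
qed

text \<open>The lower bound leads from the function to \<open>wpoly C\<close>, by the invertibility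
  of \<open>Phi_poly\<close>, and on to each \<open>C s\<close>, by that of \<open>w00\<close>. The
  upper bound combines the boundedness of \<open>spl\<close> and of
  \<open>act (Hs s)\<close>.\<close>

lemma wpoly_bounds:
  obtains A B where "A > 0" "B > 0"
    "\<And>C. (\<And>t. eseq (coef (C t)) = coef (C t)) \<Longrightarrow>
        (\<Sum>s\<in>E01 - {0}. l2norm (coef (C s))) \<le> ennreal A * L2_normsq (spl (coef (wpoly C)))"
    "\<And>C. L2_normsq (spl (coef (wpoly C))) \<le> ennreal B * (\<Sum>s\<in>E01 - {0}. l2norm (coef (C s)))"
proof -
  let ?S = "E01 - {0 :: int ^ 2}"
  obtain K1 where K1: "K1 > 0" "\<And>b. l2norm b < \<infinity> \<Longrightarrow> l2norm b \<le> ennreal K1 * l2norm (act w00 b)"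
    using l2norm_act_lower[OF leval_w00_nonzero] by blast
  obtain K2 where K2: "K2 > 0" "\<And>B. l2norm (coef B) \<le> ennreal K2 * L2_normsq (spl (coef B))"
  proof -
    have "leval Phi_poly \<zeta> \<noteq> 0" if "\<zeta> \<in> torus" for \<zeta> using leval_Phi_poly_pos[OF that] by auto
    then obtain K where K: "K > 0" "\<And>b. l2norm b < \<infinity> \<Longrightarrow> l2norm b \<le> ennreal K * l2norm (act Phi_poly b)"
      using l2norm_act_lower by blast
    have "l2norm (coef B) \<le> ennreal (K * 81) * L2_normsq (spl (coef B))" for B
    proof -
      have "l2norm (coef B) \<le> ennreal K * l2norm (act Phi_poly (coef B))" by (rule K(2)[OF l2norm_coef_finite])
      also have "\<dots> \<le> ennreal K * (81 * L2_normsq (spl (coef B)))" by (intro mult_left_mono L2_normsq_spl_ge) auto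
      also have "\<dots> = ennreal (K * 81) * L2_normsq (spl (coef B))" using K(1) by (simp add: ennreal_mult mult.assoc)
      finally show ?thesis .
    qed
    with K(1) show thesis by (intro that[of "K * 81"]) auto
  qed
  let ?B = "81 * (3 * (\<Sum>s\<in>?S. (lnorm (Hs s))\<^sup>2)) + 1"
  have M: "(\<Sum>s\<in>?S. (lnorm (Hs s))\<^sup>2) \<ge> 0" by (simp add: sum_nonneg)
  show thesis
  \<comment> \<open>Each of the three nonzero vertices costs K1 * K2.\<close>
  proof (rule that[of "3 * (K1 * K2)" ?B])
    show "3 * (K1 * K2) > 0" using K1 K2 by simp
    show "?B > 0" using M by (intro add_nonneg_pos mult_nonneg_nonneg) auto
    fix C :: "int ^ 2 \<Rightarrow> 2 laurent"
    let ?X = "L2_normsq (spl (coef (wpoly C)))"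
    show "(\<Sum>s\<in>?S. l2norm (coef (C s))) \<le> ennreal (3 * (K1 * K2)) * ?X"
      if C: "\<And>t. eseq (coef (C t)) = coef (C t)"
    proof -
      have "l2norm (coef (C s)) \<le> ennreal K1 * (ennreal K2 * ?X)" if s: "s \<in> ?S" for s
      proof -
        have "l2norm (act w00 (coef (C s))) = l2norm (phase s (coef (wpoly C)))"
          by (simp add: phase_wpoly[where C = C, OF s C] l2norm_uminus)
        also have "\<dots> \<le> l2norm (coef (wpoly C))" by (rule l2norm_phase_le)
        also have "\<dots> \<le> ennreal K2 * ?X" by (rule K2(2))
        finally have "ennreal K1 * l2norm (act w00 (coef (C s))) \<le> ennreal K1 * (ennreal K2 * ?X)"
          by (rule mult_left_mono) auto
        then show ?thesis by (rule order_trans[OF K1(2)[OF l2norm_coef_finite]])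
      qed
      then have "(\<Sum>s\<in>?S. l2norm (coef (C s))) \<le> (\<Sum>s\<in>?S. ennreal K1 * (ennreal K2 * ?X))"
        by (rule sum_mono)
      also have "\<dots> = ennreal (3 * (K1 * K2)) * ?X"
        using K1(1) K2(1) by (simp add: card_E01_nonzero ennreal_mult mult_ac)
      finally show ?thesis .
    qed
    have "?X \<le> 81 * l2norm (coef (wpoly C))" by (rule L2_normsq_spl_le)
    also have "\<dots> \<le> 81 * (ennreal (3 * (\<Sum>s\<in>?S. (lnorm (Hs s))\<^sup>2)) * (\<Sum>s\<in>?S. l2norm (coef (C s))))"
      unfolding coef_wpoly by (intro mult_left_mono l2norm_wpoly_seq_le) auto
    also have "\<dots> = ennreal (81 * (3 * (\<Sum>s\<in>?S. (lnorm (Hs s))\<^sup>2))) * (\<Sum>s\<in>?S. l2norm (coef (C s)))"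
      using M by (simp add: ennreal_mult mult.assoc)
    also have "\<dots> \<le> ennreal ?B * (\<Sum>s\<in>?S. l2norm (coef (C s)))"
      by (intro mult_right_mono ennreal_leI) auto
    finally show "?X \<le> ennreal ?B * (\<Sum>s\<in>?S. l2norm (coef (C s)))" .
  qed
qed

text \<open>Translation by \<open>2 k\<close> multiplies the mask by the monomial of exponent
  \<open>k + k\<close>, so a finite combination has as its mask the \<open>wpoly\<close> of the
  packed coefficients.\<close>

lemma wavelet_combination_AE:
  assumes \<psi>: "\<And>s. s \<in> E01 - {0} \<Longrightarrow> AE x in lborel. \<psi> s x = spl (coef (Hs s)) x"
    and J: "finite J" "J \<subseteq> (E01 - {0}) \<times> UNIV"
  shows "AE x in lborel. (\<Sum>j\<in>J. c j * (\<lambda>(s, k) x. \<psi> s (x - 2 *\<^sub>R real_vec k)) j x)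
    = spl (coef (wpoly (\<lambda>s. even_poly {k. (s, k) \<in> J} (\<lambda>k. c (s, k))))) x"
proof -
  have two: "2 *\<^sub>R real_vec k = real_vec (k + k)" for k :: "int ^ 2" by (simp add: real_vec_def vec_eq_iff)
  have 1: "\<forall>j\<in>J. AE x in lborel. c j * (\<lambda>(s, k) x. \<psi> s (x - 2 *\<^sub>R real_vec k)) j x
      = spl (\<lambda>m. c j * coef (Hs (fst j)) (m - (snd j + snd j))) x"
  proof
    fix j assume j: "j \<in> J"
    then have "fst j \<in> E01 - {0}" using J(2) by auto
    from AE_lborel_shift[OF \<psi>[OF this], of "real_vec (snd j + snd j)"]
    show "AE x in lborel. c j * (\<lambda>(s, k) x. \<psi> s (x - 2 *\<^sub>R real_vec k)) j x
      = spl (\<lambda>m. c j * coef (Hs (fst j)) (m - (snd j + snd j))) x"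
      by eventually_elim (simp add: case_prod_beta two spl_shift spl_cmult)
  qed
  have Js: "finite {k. (s, k) \<in> J}" for s
    by (rule finite_subset[of _ "snd ` J"]) (use J(1) in \<open>auto intro: rev_image_eqI\<close>)
  have JS: "J = Sigma (E01 - {0}) (\<lambda>s. {k. (s, k) \<in> J})" using J(2) by auto
  have B: "coef (wpoly (\<lambda>s. even_poly {k. (s, k) \<in> J} (\<lambda>k. c (s, k)))) m
     = (\<Sum>j\<in>J. c j * coef (Hs (fst j)) (m - (snd j + snd j)))" for m
  proof -
    have "coef (wpoly (\<lambda>s. even_poly {k. (s, k) \<in> J} (\<lambda>k. c (s, k)))) m
      = (\<Sum>s\<in>E01 - {0}. \<Sum>k\<in>{k. (s, k) \<in> J}. c (s, k) * coef (Hs s) (m - (k + k)))"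
      unfolding wpoly_def even_poly_def sum_distrib_left lookup_sum mult.commute[of "Hs _"] act_single_coef ..
    also have "\<dots> = (\<Sum>(s, k)\<in>Sigma (E01 - {0}) (\<lambda>s. {k. (s, k) \<in> J}). c (s, k) * coef (Hs s) (m - (k + k)))"
      by (rule sum.Sigma) (auto simp: finite_E01 Js)
    also have "\<dots> = (\<Sum>j\<in>J. c j * coef (Hs (fst j)) (m - (snd j + snd j)))"
      unfolding JS[symmetric] by (simp add: case_prod_beta)
    finally show ?thesis .
  qed
  have "AE x in lborel. \<forall>j\<in>J. c j * (\<lambda>(s, k) x. \<psi> s (x - 2 *\<^sub>R real_vec k)) j x
      = spl (\<lambda>m. c j * coef (Hs (fst j)) (m - (snd j + snd j))) x"
    using 1 by (simp add: AE_finite_all[OF J(1)])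
  then show ?thesis
  proof eventually_elim
    case (elim x)
    have "spl (coef (wpoly (\<lambda>s. even_poly {k. (s, k) \<in> J} (\<lambda>k. c (s, k))))) x
        = (\<Sum>j\<in>J. spl (\<lambda>m. c j * coef (Hs (fst j)) (m - (snd j + snd j))) x)"
      unfolding B[abs_def] by (rule spl_sum)
    also have "\<dots> = (\<Sum>j\<in>J. c j * (\<lambda>(s, k) x. \<psi> s (x - 2 *\<^sub>R real_vec k)) j x)"
      by (rule sum.cong[OF refl]) (rule elim[rule_format, symmetric])
    finally show ?case ..
  qed
qed

section \<open>Density of the wavelets\<close>

text \<open>Comparing components at \<open>s \<noteq> 0\<close>, exact coefficients would be \<open>g s = - (1 / w00) * phase s b\<close>; the
  orthogonality relation \<open>b\<close> then makes the component at \<open>0\<close> agree automatically.\<close>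
lemma wavelet_residual:
  assumes b: "\<And>k. (\<Sum>s\<in>E01. act (w s) (phase s b) k) = 0"
    and g: "\<And>s. g s = eseq (\<lambda>k. - act v (phase s b) k)"
  shows "b k - (\<Sum>s\<in>E01 - {0}. act (Hs s) (g s) k) = (\<Sum>s\<in>E01. eseq (act (1 - v * w00) (phase s b)) (k - s))"
proof -
  let ?S = "E01 - {0 :: int ^ 2}"
  have actg: "act P (g s) = (\<lambda>k. - eseq (act v (act P (phase s b))) k)" if "P \<in> L_down" for P s
  proof -
    have "act P (g s) = eseq (act P (\<lambda>k. - act v (phase s b) k))" unfolding g by (rule act_eseq[OF that])
    then show ?thesis
      by (simp add: fun_eq_iff eseq_def act_uminus act_mult[symmetric] mult.commute)
  qed
  have w0: "act w00 (phase 0 b) k = - (\<Sum>s\<in>?S. act (w s) (phase s b) k)" for k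
    using b[of k] unfolding sum_E01_split w_0 by (simp add: eq_neg_iff_add_eq_0)
  have "(\<Sum>s\<in>?S. act (w s) (g s) k) = - eseq (act v (\<lambda>k. \<Sum>s\<in>?S. act (w s) (phase s b) k)) k"
    by (simp add: actg[OF w_L_down] eseq_def act_sum sum_negf)
  also have "\<dots> = eseq (act v (act w00 (phase 0 b))) k"
    by (simp add: w0[abs_def] act_uminus eseq_def)
  finally have 1: "(\<Sum>s\<in>?S. act (w s) (g s) k) = eseq (act v (act w00 (phase 0 b))) k" .
  have "(\<Sum>s\<in>?S. act (Hs s) (g s) k) = (\<Sum>s\<in>?S. act (w s) (g s) k) + (\<Sum>s\<in>?S. eseq (act v (act w00 (phase s b))) (k - s))"
    unfolding sum.distrib[symmetric]
    by (intro sum.cong refl) (simp add: act_Hs actg[OF w00_L_down])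
  also have "\<dots> = (\<Sum>s\<in>E01. eseq (act v (act w00 (phase s b))) (k - s))"
    unfolding 1 sum_E01_split by simp
  finally have 2: "(\<Sum>s\<in>?S. act (Hs s) (g s) k) = (\<Sum>s\<in>E01. eseq (act v (act w00 (phase s b))) (k - s))" .
  have "eseq (act (1 - v * w00) (phase s b)) m = phase s b m - eseq (act v (act w00 (phase s b))) m" for s m
    by (simp add: eseq_def act_diff_left act_one act_mult phase_def)
  then show ?thesis unfolding 2 by (simp add: sum_subtractf sum_phase)
qed

text \<open>16 = 4 * 4: there are four summands, and squaring a sum of four terms costs another
  factor 4.\<close>

lemma l2norm_residual_le:
  "l2norm (\<lambda>k. \<Sum>s\<in>E01. eseq (act R (phase s b)) (k - s)) \<le> ennreal (16 * (lnorm R)\<^sup>2) * l2norm b"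
proof -
  let ?E = "E01 :: (int ^ 2) set"
  have "l2norm (\<lambda>k. \<Sum>s\<in>?E. eseq (act R (phase s b)) (k - s)) \<le> 4 * (\<Sum>s\<in>?E. l2norm (\<lambda>k. eseq (act R (phase s b)) (k - s)))"
    using l2norm_sum_le[where I = ?E and a = "\<lambda>s k. eseq (act R (phase s b)) (k - s)"] by (simp add: card_E01)
  also have "\<dots> \<le> 4 * (\<Sum>s\<in>?E. ennreal ((lnorm R)\<^sup>2) * l2norm b)"
  proof (intro mult_left_mono sum_mono)
    fix s
    have "l2norm (\<lambda>k. eseq (act R (phase s b)) (k - s)) = l2norm (eseq (act R (phase s b)))" by (rule l2norm_shift)
    also have "\<dots> \<le> l2norm (act R (phase s b))" by (rule l2norm_eseq_le)
    also have "\<dots> \<le> ennreal ((lnorm R)\<^sup>2) * l2norm (phase s b)" by (rule l2norm_act_le)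
    also have "\<dots> \<le> ennreal ((lnorm R)\<^sup>2) * l2norm b" by (intro mult_left_mono l2norm_phase_le) auto
    finally show "l2norm (\<lambda>k. eseq (act R (phase s b)) (k - s)) \<le> ennreal ((lnorm R)\<^sup>2) * l2norm b" .
  qed auto
  also have "\<dots> = ennreal (16 * (lnorm R)\<^sup>2) * l2norm b"
    by (simp add: card_E01 ennreal_mult mult.assoc[symmetric])
  finally show ?thesis .
qed

text \<open>Truncation to a large box; as \<open>g\<close> lives on even indices, the truncated
  sequence is that of an \<open>even_poly\<close>.\<close>

lemma eseq_approx_even_poly:
  assumes g: "l2norm g < \<infinity>" "eseq g = g" and \<epsilon>: "\<epsilon> > 0"
  shows "\<exists>A c. finite A \<and> l2norm (\<lambda>k. g k - coef (even_poly A c) k) < ennreal \<epsilon>"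
proof -
  have "\<forall>\<^sub>F n in sequentially. l2norm (\<lambda>k. if k \<in> boxn n then 0 else g k) < ennreal \<epsilon>"
    using order_tendstoD(2)[OF l2norm_tail[OF g(1)], of "ennreal \<epsilon>"] \<epsilon> by simp
  then obtain n where n: "l2norm (\<lambda>k. if k \<in> boxn n then 0 else g k) < ennreal \<epsilon>"
    by (auto simp: eventually_sequentially)
  let ?A = "{k. k + k \<in> boxn n}"
  have "inj (\<lambda>k :: int ^ 2. k + k)" by (rule injI) (simp only: double_inj)
  from finite_vimageI[OF finite_boxn this] have A: "finite ?A" by (simp only: vimage_def)
  have "g m - coef (even_poly ?A (\<lambda>k. g (k + k))) m = (if m \<in> boxn n then 0 else g m)" for m
  proof (cases "even_vec m")
    case True
    then obtain k where "m = k + k" using even_vecE by blast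
    then show ?thesis by (simp only: coef_even_poly[OF A]) simp
  next
    case False
    then have "g m = 0" "coef (even_poly ?A (\<lambda>k. g (k + k))) m = 0"
      using fun_cong[OF g(2), of m] fun_cong[OF eseq_even_poly[of ?A "\<lambda>k. g (k + k)"], of m] by (auto simp: eseq_def)
    then show ?thesis by simp
  qed
  with n A show ?thesis by (intro exI[of _ ?A] exI[of _ "\<lambda>k. g (k + k)"]) simp
qed

text \<open>Two errors are made: \<open>w00\<close> is inverted only approximately, and the
  resulting coefficients are truncated to finite support. Each may use up a quarter of \<epsilon>,
  because \<open>l2norm_add_le\<close> doubles both.\<close>

lemma wavelet_dense:
  assumes b: "l2norm b < \<infinity>" "eseq (act HPhi b) = (\<lambda>_. 0)" and \<epsilon>: "\<epsilon> > 0"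
  shows "\<exists>A c. (\<forall>s. finite (A s)) \<and> l2norm (\<lambda>k. b k - coef (wpoly (\<lambda>s. even_poly (A s) (c s))) k) < ennreal \<epsilon>"
proof -
  let ?S = "E01 - {0 :: int ^ 2}"
  obtain X where X: "X \<ge> 0" "l2norm b = ennreal X" using b(1) by (cases "l2norm b") auto
  \<comment> \<open>Chosen so that 16 \<delta>^2 X equals \<epsilon> / 4 times X / (X + 1).\<close>
  define \<delta> where "\<delta> = sqrt (\<epsilon> / (4 * (16 * (X + 1))))"
  have \<delta>: "\<delta> > 0" "16 * \<delta>\<^sup>2 * X < \<epsilon> / 4" using \<epsilon> X by (auto simp: \<delta>_def field_simps)
  obtain v where v: "lnorm (1 - v * w00) < \<delta>"
    by (rule laurent_approx_inverse[of w00 \<delta>]) (use leval_w00_nonzero \<delta> in auto)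
  define g where "g = (\<lambda>s. eseq (\<lambda>k. - act v (phase s b) k))"
  have gfin: "l2norm (g s) < \<infinity>" for s
  proof -
    have "l2norm (g s) \<le> l2norm (\<lambda>k. - act v (phase s b) k)" unfolding g_def by (rule l2norm_eseq_le)
    also have "\<dots> \<le> ennreal ((lnorm v)\<^sup>2) * l2norm (phase s b)" unfolding l2norm_uminus by (rule l2norm_act_le)
    also have "\<dots> \<le> ennreal ((lnorm v)\<^sup>2) * l2norm b" by (intro mult_left_mono l2norm_phase_le) auto
    also have "\<dots> < \<infinity>" using b(1) by (simp add: ennreal_mult_less_top)
    finally show ?thesis .
  qed
  have geven: "eseq (g s) = g s" for s by (simp add: g_def eseq_def fun_eq_iff)
  define M where "M = 3 * (\<Sum>s\<in>?S. (lnorm (Hs s))\<^sup>2)"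
  have M: "M \<ge> 0" by (simp add: M_def sum_nonneg)
  \<comment> \<open>Likewise 3 M \<eta> equals \<epsilon> / 4 times M / (M + 1), the 3 counting the
    nonzero vertices.\<close>
  define \<eta> where "\<eta> = \<epsilon> / (4 * (3 * (M + 1)))"
  have \<eta>: "\<eta> > 0" "M * (3 * \<eta>) < \<epsilon> / 4" using \<epsilon> M by (auto simp: \<eta>_def field_simps)
  have "\<forall>s. \<exists>A c. finite A \<and> l2norm (\<lambda>k. g s k - coef (even_poly A c) k) < ennreal \<eta>"
    by (intro allI eseq_approx_even_poly gfin geven \<eta>)
  then obtain A c where A: "\<And>s. finite (A s)" and c: "\<And>s. l2norm (\<lambda>k. g s k - coef (even_poly (A s) (c s)) k) < ennreal \<eta>"
    by metis
  let ?d = "\<lambda>s k. g s k - coef (even_poly (A s) (c s)) k"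
  let ?r = "\<lambda>k. \<Sum>s\<in>E01. eseq (act (1 - v * w00) (phase s b)) (k - s)"
  have res: "b k - (\<Sum>s\<in>?S. act (Hs s) (g s) k) = ?r k" for k
    by (rule wavelet_residual[OF sum_w_phase_eq_0[OF b(2)]]) (simp add: g_def)
  have split: "b k - coef (wpoly (\<lambda>s. even_poly (A s) (c s))) k = ?r k + (\<Sum>s\<in>?S. act (Hs s) (?d s) k)" for k
  proof -
    have "act (Hs s) (?d s) k = act (Hs s) (g s) k - act (Hs s) (coef (even_poly (A s) (c s))) k" for s
      by (simp add: act_def right_diff_distrib sum_subtractf)
    then show ?thesis unfolding res[symmetric] coef_wpoly by (simp add: sum_subtractf)
  qed
  have "l2norm (\<lambda>k. b k - coef (wpoly (\<lambda>s. even_poly (A s) (c s))) k)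
      \<le> 2 * l2norm ?r + 2 * l2norm (\<lambda>k. \<Sum>s\<in>?S. act (Hs s) (?d s) k)"
    unfolding split by (rule l2norm_add_le)
  also have "\<dots> \<le> 2 * ennreal (\<epsilon> / 4) + 2 * ennreal (M * (3 * \<eta>))"
  proof (intro add_mono mult_left_mono)
    have "l2norm ?r \<le> ennreal (16 * (lnorm (1 - v * w00))\<^sup>2) * ennreal X"
      unfolding X(2)[symmetric] by (rule l2norm_residual_le)
    also have "\<dots> = ennreal (16 * (lnorm (1 - v * w00))\<^sup>2 * X)" using X by (simp add: ennreal_mult)
    also have "\<dots> \<le> ennreal (\<epsilon> / 4)"
    proof (rule ennreal_leI)
      have "(lnorm (1 - v * w00))\<^sup>2 \<le> \<delta>\<^sup>2" by (intro power_mono) (use v lnorm_nonneg in auto)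
      then have "16 * (lnorm (1 - v * w00))\<^sup>2 * X \<le> 16 * \<delta>\<^sup>2 * X" by (intro mult_right_mono) (use X in auto)
      then show "16 * (lnorm (1 - v * w00))\<^sup>2 * X \<le> \<epsilon> / 4" using \<delta> by linarith
    qed
    finally show "l2norm ?r \<le> ennreal (\<epsilon> / 4)" .
    have "l2norm (\<lambda>k. \<Sum>s\<in>?S. act (Hs s) (?d s) k) \<le> ennreal M * (\<Sum>s\<in>?S. l2norm (?d s))"
      unfolding M_def by (rule l2norm_wpoly_seq_le)
    also have "\<dots> \<le> ennreal M * (\<Sum>s\<in>?S. ennreal \<eta>)"
      by (intro mult_left_mono sum_mono order.strict_implies_order[OF c]) auto
    also have "\<dots> = ennreal (M * (3 * \<eta>))" using M \<eta> by (simp add: card_E01_nonzero ennreal_mult)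
    finally show "l2norm (\<lambda>k. \<Sum>s\<in>?S. act (Hs s) (?d s) k) \<le> ennreal (M * (3 * \<eta>))" .
  qed auto
  also have "\<dots> = ennreal (\<epsilon> / 2 + 2 * (M * (3 * \<eta>)))"
  proof -
    have e2: "2 * ennreal r = ennreal (2 * r)" if "r \<ge> 0" for r using that by (simp add: ennreal_mult)
    have "0 \<le> M * (3 * \<eta>)" using M \<eta> by simp
    then show ?thesis using \<epsilon> by (simp add: e2 ennreal_plus[symmetric] del: ennreal_plus)
  qed
  also have "\<dots> < ennreal \<epsilon>" using \<eta> \<epsilon> by (intro ennreal_lessI) auto
  finally show ?thesis using A by blast
qed

section \<open>Prewavelets\<close>

context
  fixes \<phi> :: "real ^ 2 \<Rightarrow> complex" and \<psi> :: "int ^ 2 \<Rightarrow> real ^ 2 \<Rightarrow> complex"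
  assumes \<phi>: "is_box_spline Xi \<phi>"
    and mask: "\<And>s. s \<in> E01 - {0} \<Longrightarrow> has_mask \<phi> (\<psi> s) (leval (Hs s))"
begin

lemma \<psi>_measurable: "s \<in> E01 - {0} \<Longrightarrow> \<psi> s \<in> borel_measurable borel"
  and \<psi>_AE: "s \<in> E01 - {0} \<Longrightarrow> AE x in lborel. \<psi> s x = spl (coef (Hs s)) x"
  using mask by (auto simp: has_mask_leval_iff[OF \<phi>])

lemma \<psi>_compactly_supported:
  assumes s: "s \<in> E01 - {0}"
  shows "compactly_supported (\<psi> s)"
proof -
  obtain n where n: "Poly_Mapping.keys (Hs s) \<subseteq> boxn n" using keys_in_boxn by blast
  let ?K = "cbox (\<chi> j. - (real n + 3)) (\<chi> j. real n + 3) :: (real ^ 2) set"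
  have K: "x \<in> ?K" if "spl (coef (Hs s)) x \<noteq> 0" for x
    unfolding mem_box_cart
  proof
    fix j show "(\<chi> j. - (real n + 3)) $ j \<le> x $ j \<and> x $ j \<le> (\<chi> j. real n + 3) $ j"
      using spl_coef_support[OF n that, of j] by auto
  qed
  have "AE x in lborel. x \<notin> ?K \<longrightarrow> \<psi> s x = 0"
    using \<psi>_AE[OF s] by eventually_elim (use K in auto)
  then show ?thesis unfolding compactly_supported_def by (intro exI[of _ ?K] conjI compact_cbox)
qed

lemma \<psi>_translate_W0: "s \<in> E01 - {0} \<Longrightarrow> (\<lambda>x. \<psi> s (x - 2 *\<^sub>R real_vec k)) \<in> W0 \<phi>"
  by (rule translate_Hs_W0[OF \<phi> _ \<psi>_measurable \<psi>_AE])

lemma L2_normsq_combination: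
  assumes "finite J" "J \<subseteq> (E01 - {0}) \<times> UNIV"
  shows "L2_normsq (\<lambda>x. \<Sum>j\<in>J. c j * (\<lambda>(s, k) x. \<psi> s (x - 2 *\<^sub>R real_vec k)) j x)
    = L2_normsq (spl (coef (wpoly (\<lambda>s. even_poly {k. (s, k) \<in> J} (\<lambda>k. c (s, k))))))"
  by (rule L2_normsq_cong_AE[OF wavelet_combination_AE[OF \<psi>_AE assms]])

lemma sum_l2norm_even_poly:
  fixes c :: "(int ^ 2) \<times> (int ^ 2) \<Rightarrow> complex"
  assumes J: "finite J" "J \<subseteq> (E01 - {0}) \<times> UNIV"
  shows "(\<Sum>s\<in>E01 - {0}. l2norm (coef (even_poly {k. (s, k) \<in> J} (\<lambda>k. c (s, k))))) = ennreal (\<Sum>j\<in>J. (cmod (c j))\<^sup>2)"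
proof -
  have Js: "finite {k. (s, k) \<in> J}" for s
    by (rule finite_subset[of _ "snd ` J"]) (use J(1) in \<open>auto intro: rev_image_eqI\<close>)
  have JS: "Sigma (E01 - {0}) (\<lambda>s. {k. (s, k) \<in> J}) = J" using J(2) by auto
  have "(\<Sum>s\<in>E01 - {0}. l2norm (coef (even_poly {k. (s, k) \<in> J} (\<lambda>k. c (s, k)))))
      = ennreal (\<Sum>s\<in>E01 - {0}. \<Sum>k\<in>{k. (s, k) \<in> J}. (cmod (c (s, k)))\<^sup>2)"
    unfolding l2norm_even_poly[OF Js] by (rule sum_ennreal) (simp add: sum_nonneg)
  also have "(\<Sum>s\<in>E01 - {0}. \<Sum>k\<in>{k. (s, k) \<in> J}. (cmod (c (s, k)))\<^sup>2) = (\<Sum>(s, k)\<in>J. (cmod (c (s, k)))\<^sup>2)"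
    by (subst sum.Sigma) (auto simp: finite_E01 Js JS)
  finally show ?thesis by (simp add: case_prod_beta)
qed

theorem \<psi>_prewavelets: "prewavelets \<phi> (E01 - {0}) \<psi>"
  unfolding prewavelets_def riesz_basis_def
proof (intro conjI ballI allI impI)
  let ?S = "E01 - {0 :: int ^ 2}"
  let ?g = "\<lambda>(s, k) x. \<psi> s (x - 2 *\<^sub>R real_vec k)"
  show "finite ?S" by (simp add: finite_E01)
  show "\<psi> s \<in> W0 \<phi>" if "s \<in> ?S" for s
    using \<psi>_translate_W0[OF that, of 0] by (simp add: real_vec_def zero_vec_def[symmetric])
  show "?g j \<in> W0 \<phi>" if "j \<in> ?S \<times> UNIV" for j
    using that \<psi>_translate_W0 by auto
next
  fix f and \<epsilon> :: real
  assume f: "f \<in> W0 \<phi>" and \<epsilon>: "\<epsilon> > 0"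
  let ?S = "E01 - {0 :: int ^ 2}"
  let ?g = "\<lambda>(s, k) x. \<psi> s (x - 2 *\<^sub>R real_vec k)"
  obtain b where b: "l2norm b < \<infinity>" "AE x in lborel. f x = spl b x" "eseq (act HPhi b) = (\<lambda>_. 0)"
    using W0_imp_spl[OF \<phi> f] by blast
  \<comment> \<open>\<open>L2_normsq_spl_le\<close> multiplies the error of the sequences by
    81.\<close>
  have "\<epsilon> / 81 > 0" using \<epsilon> by simp
  from wavelet_dense[OF b(1,3) this] obtain A c where A: "\<And>s. finite (A s)"
    and c: "l2norm (\<lambda>k. b k - coef (wpoly (\<lambda>s. even_poly (A s) (c s))) k) < ennreal (\<epsilon> / 81)" by blast
  let ?J = "Sigma ?S A"
  let ?W = "wpoly (\<lambda>s. even_poly (A s) (c s))"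
  have J: "finite ?J" "?J \<subseteq> ?S \<times> UNIV" using A by (auto simp: finite_E01)
  have W: "wpoly (\<lambda>s. even_poly {k. (s, k) \<in> ?J} (\<lambda>k. case_prod c (s, k))) = ?W"
    unfolding wpoly_def by (intro sum.cong refl) auto
  have comb: "AE x in lborel. (\<Sum>j\<in>?J. case_prod c j * ?g j x) = spl (coef ?W) x"
    using wavelet_combination_AE[OF \<psi>_AE J, of "case_prod c"] unfolding W .
  have "AE x in lborel. f x - (\<Sum>j\<in>?J. case_prod c j * ?g j x) = spl b x - spl (coef ?W) x"
    using b(2) comb by eventually_elim simp
  then have "L2_normsq (\<lambda>x. f x - (\<Sum>j\<in>?J. case_prod c j * ?g j x)) = L2_normsq (spl (\<lambda>k. b k - coef ?W k))"
    unfolding spl_diff[abs_def] by (rule L2_normsq_cong_AE)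
  also have "\<dots> \<le> 81 * l2norm (\<lambda>k. b k - coef ?W k)" by (rule L2_normsq_spl_le)
  also have "\<dots> < 81 * ennreal (\<epsilon> / 81)"
    using c by (intro ennreal_mult_strict_left_mono) auto
  also have "\<dots> = ennreal (81 * (\<epsilon> / 81))" using \<epsilon> by (subst ennreal_mult) auto
  finally show "\<exists>J c. finite J \<and> J \<subseteq> ?S \<times> UNIV \<and> L2_normsq (\<lambda>x. f x - (\<Sum>j\<in>J. c j * ?g j x)) < ennreal \<epsilon>"
    using J by (intro exI[of _ ?J] exI[of _ "case_prod c"]) simp
next
  let ?S = "E01 - {0 :: int ^ 2}"
  let ?g = "\<lambda>(s, k) x. \<psi> s (x - 2 *\<^sub>R real_vec k)"
  obtain A B where AB: "A > 0" "B > 0"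
    and lo: "\<And>C. (\<And>t. eseq (coef (C t)) = coef (C t)) \<Longrightarrow> (\<Sum>s\<in>?S. l2norm (coef (C s))) \<le> ennreal A * L2_normsq (spl (coef (wpoly C)))"
    and up: "\<And>C. L2_normsq (spl (coef (wpoly C))) \<le> ennreal B * (\<Sum>s\<in>?S. l2norm (coef (C s)))"
    by (rule wpoly_bounds) blast
  show "\<exists>A B. 0 < A \<and> 0 < B \<and> (\<forall>J c. finite J \<and> J \<subseteq> ?S \<times> UNIV \<longrightarrow>
      ennreal (A * (\<Sum>j\<in>J. (cmod (c j))\<^sup>2)) \<le> L2_normsq (\<lambda>x. \<Sum>j\<in>J. c j * ?g j x) \<and>
      L2_normsq (\<lambda>x. \<Sum>j\<in>J. c j * ?g j x) \<le> ennreal (B * (\<Sum>j\<in>J. (cmod (c j))\<^sup>2)))"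
  \<comment> \<open>\<open>wpoly_bounds\<close> bounds the coefficients by the function, so the
    lower Riesz bound is the reciprocal of \<open>A\<close>.\<close>
  proof (rule exI[of _ "1 / A"], rule exI[of _ B], intro conjI allI impI)
    fix J :: "((int ^ 2) \<times> (int ^ 2)) set" and c
    assume J: "finite J \<and> J \<subseteq> ?S \<times> UNIV"
    let ?N = "\<Sum>j\<in>J. (cmod (c j))\<^sup>2"
    let ?C = "\<lambda>s. even_poly {k. (s, k) \<in> J} (\<lambda>k. c (s, k))"
    note X = L2_normsq_combination[of J c] and N = sum_l2norm_even_poly[of J c]
    have N0: "?N \<ge> 0" by (simp add: sum_nonneg)
    have "ennreal (1 / A * ?N) = ennreal (1 / A) * ennreal ?N" using AB N0 by (intro ennreal_mult) auto
    also have "\<dots> \<le> ennreal (1 / A) * (ennreal A * L2_normsq (spl (coef (wpoly ?C))))"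
      using lo[of ?C] J by (intro mult_left_mono) (auto simp: N eseq_even_poly)
    also have "\<dots> = L2_normsq (spl (coef (wpoly ?C)))"
      using AB by (simp add: mult.assoc[symmetric] ennreal_mult[symmetric])
    finally show "ennreal (1 / A * ?N) \<le> L2_normsq (\<lambda>x. \<Sum>j\<in>J. c j * ?g j x)"
      using J by (simp only: X)
    have "L2_normsq (spl (coef (wpoly ?C))) \<le> ennreal B * ennreal ?N"
      using up[of ?C] J by (simp only: N)
    then show "L2_normsq (\<lambda>x. \<Sum>j\<in>J. c j * ?g j x) \<le> ennreal (B * ?N)"
      using J AB N0 by (simp only: X ennreal_mult[OF less_imp_le])
  qed (use AB in auto)
qed

end

text \<open>\<open>Phi_poly\<close> is real on the torus, so this bracket is the conjugate of the
  sum in \<open>bracket_H_Hs_zero\<close>, where the arguments stand in the opposite order.\<close>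

lemma bracket_Phi_zero:
  assumes \<phi>: "is_box_spline Xi \<phi>" and s: "s \<in> E01 - {0}" and z: "\<zeta> \<in> torus"
  shows "bracket (Phi \<phi>) (leval H) (leval (Hs s)) \<zeta> = 0"
proof -
  have real: "cnj (leval Phi_poly (flip t \<zeta>)) = leval Phi_poly (flip t \<zeta>)" for t
    using leval_Phi_poly_pos[OF flip_torus[OF z], of t] by auto
  have "bracket (Phi \<phi>) (leval H) (leval (Hs s)) \<zeta>
      = cnj (\<Sum>t\<in>E01. leval Phi_poly (flip t \<zeta>) * leval (Hs s) (flip t \<zeta>) * cnj (leval H (flip t \<zeta>)))"
    unfolding bracket_def Phi_box_spline[OF \<phi>] cnj_sum complex_cnj_mult complex_cnj_cnj real
    by (intro sum.cong refl) (simp only: mult_ac)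
  then show ?thesis by (simp add: bracket_H_Hs_zero[OF s z])
qed

lemma lconj_H_Phi:
  assumes \<phi>: "is_box_spline Xi \<phi>" and z: "\<zeta> \<in> torus"
  shows "leval (lconj (mon (2 ^ 5 * 10080) 0 0 * H)) \<zeta> * Phi \<phi> \<zeta>
     = leval (w00 + w10 * mon 1 (-1) 0 + w01 * mon 1 0 (-1) + w11 * mon 1 (-1) (-1)) \<zeta>"
proof -
  have inv: "inverse (\<zeta> $ j) = cnj (\<zeta> $ j)" for j
    using cnj_torus[OF z, of j] by (rule inverse_unique)
  show ?thesis
    unfolding leval_lconj[OF z] Phi_box_spline[OF \<phi>] leval_add leval_mult[OF z] leval_mon
    using w_decomposition[OF z] by (simp add: power_int_minus inv)
qed

theorem mainTheorem7:
  fixes \<phi> :: "real ^ 2 \<Rightarrow> complex"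
  assumes \<phi>: "is_box_spline Xi \<phi>"
  shows
    "H = mon (1 / 2 ^ 5) 0 0 * (1 + mon 1 1 0) ^ 2 * (1 + mon 1 0 1) ^ 2 * (1 + mon 1 1 1)
     \<and> (\<forall>\<zeta>\<in>torus. Phi \<phi> \<zeta> = leval Phi_poly \<zeta>)
     \<and> w00 \<in> L_down \<and> w10 \<in> L_down \<and> w01 \<in> L_down \<and> w11 \<in> L_down
     \<and> (\<forall>\<zeta>\<in>torus. leval (lconj (mon (2 ^ 5 * 10080) 0 0 * H)) \<zeta> * Phi \<phi> \<zeta>
            = leval (w00 + w10 * mon 1 (-1) 0 + w01 * mon 1 0 (-1) + w11 * mon 1 (-1) (-1)) \<zeta>)
     \<and> module_basis_on torus L_down_l1 L_l1 E01 (\<lambda>s. leval (Hs s))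
     \<and> (\<forall>s\<in>E01 - {0}. \<forall>\<zeta>\<in>torus. bracket (Phi \<phi>) (leval H) (leval (Hs s)) \<zeta> = 0)
     \<and> (\<exists>\<psi>. \<forall>s\<in>E01 - {0}. has_mask \<phi> (\<psi> s) (leval (Hs s)))
     \<and> (\<forall>\<psi>. (\<forall>s\<in>E01 - {0}. has_mask \<phi> (\<psi> s) (leval (Hs s))) \<longrightarrow>
            (\<forall>s\<in>E01 - {0}. compactly_supported (\<psi> s)) \<and> prewavelets \<phi> (E01 - {0}) \<psi>)
     \<and> H01 = lswap H10
     \<and> card (Poly_Mapping.keys H10) = 29
     \<and> card (Poly_Mapping.keys H01) = 29
     \<and> card (Poly_Mapping.keys H11) = 28
     \<and> card (Poly_Mapping.keys H10) + card (Poly_Mapping.keys H01)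
         + card (Poly_Mapping.keys H11) = 86"
proof (intro conjI ballI allI impI)
  show "\<exists>\<psi>. \<forall>s\<in>E01 - {0}. has_mask \<phi> (\<psi> s) (leval (Hs s))"
    by (rule exI[of _ "\<lambda>s. spl (coef (Hs s))"]) (simp add: has_mask_leval_iff[OF \<phi>])
  show "card (Poly_Mapping.keys H10) + card (Poly_Mapping.keys H01) + card (Poly_Mapping.keys H11) = 86"
    by (simp add: card_H10 card_H01 card_H11)
qed (rule H_eq Phi_box_spline[OF \<phi>] w00_L_down w10_L_down w01_L_down w11_L_down lconj_H_Phi[OF \<phi>] module_basis_Hs
      bracket_Phi_zero[OF \<phi>] \<psi>_compactly_supported[OF \<phi>] \<psi>_prewavelets[OF \<phi>] H01_eq_lswap
      card_H10 card_H01 card_H11; (assumption | blast)?)+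

end
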